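(* Let $\sigma$ be a functional signature and $\mathcal C\subseteq\mathrm{Fun}(\sigma)$ a class with bounded expansion. One can compute for every first-order formula $\phi(y\bar x)$ with signature $\sigma$ a set $\Omega$ of conjunctive clauses with free variables $\bar x$ and signature $\rho\supseteq\sigma$ such that: there exists a class $\mathcal C'\subseteq\mathrm{Fun}(\rho)$ with bounded expansion such that for every $\vec G\in\mathcal C$ one can compute in time $O(\|\vec G\|)$ an expansion $\vec G'\in\mathcal C'$ of $\vec G$ and functions $c_{\omega,i}\colon V(\vec G)\to\mathbb Z$ for $\omega\in\Omega$ and $i\in\{1,\dots,|\bar x|\}$ with $c_{\omega,i}(v)=O(|\vec G|)$, such that for every $\bar u\in V(\vec G)^{|\bar x|}$ there exists exactly one $\omega\in\Omega$ with $\vec G'\models\omega(\bar u)$, and for this $\omega$ $$[[\#y\,\phi(y\bar u)]]^{\vec G}=\sum_{i=1}^{|\bar x|}c_{\omega,i}(u_i).$$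
   Context: A functional signature $\sigma$ is a finite signature of unary function symbols and unary predicate symbols, with function symbols $\mathrm{fsig}(\sigma)$ including a special symbol $f_{\mathrm{id}}$ interpreted as identity. A functional representation with signature $\sigma$ is a finite $\sigma$-structure $\vec G$ with universe $V(\vec G)$; its underlying directed graph has an arc $uv$ iff $f^{\vec G}(v)=u$ for some $f\in\mathrm{fsig}(\sigma)$. $\mathrm{Fun}(\sigma)$ is the class of all such structures; $\mathcal C\subseteq\mathrm{Fun}(\sigma)$ has bounded expansion if the underlying undirected graphs form a class of bounded expansion (Nešetřil–Ossona de Mendez). $|\vec G|=|V(\vec G)|$ and $\|\vec G\|=|V(\vec G)|\cdot|\sigma|$. An expansion is a structure over a larger signature with the same universe and the same interpretation of the old symbols. $\bar x=x_1\dots x_k$ is a nonempty tuple of variables, $\bar u=u_1\dots u_k$; $[[\#y\,\phi(y\bar u)]]^{\vec G}$ is the number of $v\in V(\vec G)$ with $\vec G\models\phi(v\bar u)$.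
   Formalization: The set Ω is computed from φ with oracle access to a function g bounding the expansion of the class C (plain computability follows when g is computable); without this, "one can compute Ω" fails for classes with no computable expansion bound. *)

theory Defs
  imports Complex_Main "HOL-Library.Nat_Bijection"
begin

section \<open>Graph classes of bounded expansion\<close>

record 'v ugraph =
  verts :: "'v set"
  edges :: "'v set set"

definition adj_in :: "'v ugraph \<Rightarrow> 'v set \<Rightarrow> ('v \<times> 'v) set" where
  "adj_in G B = {(a, b). a \<in> B \<and> b \<in> B \<and> {a, b} \<in> edges G}"

definition radius_le :: "nat \<Rightarrow> 'v ugraph \<Rightarrow> 'v set \<Rightarrow> bool" where
  "radius_le r G B \<longleftrightarrow> (\<exists>x\<in>B. \<forall>v\<in>B. \<exists>i\<le>r. (x, v) \<in> adj_in G B ^^ i)"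

text \<open>A depth-r minor arises by contracting pairwise disjoint connected subgraphs of radius at
  most r and then taking a subgraph. Its vertices are represented by the contracted sets
  themselves, which loses nothing up to isomorphism.\<close>

definition shallow_minor :: "nat \<Rightarrow> 'v ugraph \<Rightarrow> 'v set ugraph \<Rightarrow> bool" where
  "shallow_minor r G H \<longleftrightarrow>
     (\<forall>B\<in>verts H. B \<subseteq> verts G \<and> radius_le r G B) \<and>
     (\<forall>A\<in>verts H. \<forall>B\<in>verts H. A \<noteq> B \<longrightarrow> A \<inter> B = {}) \<and>
     edges H \<subseteq> {{A, B} | A B. A \<in> verts H \<and> B \<in> verts H \<and> A \<noteq> B \<and>
                              (\<exists>a\<in>A. \<exists>b\<in>B. {a, b} \<in> edges G)}"

text \<open>\<open>f r\<close> bounds the greatest reduced average density of rank r, i.e. the maximum of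
  |E(H)| / |V(H)| over all depth-r minors H, uniformly over the class. (Integral bounds suffice:
  any real bound can be rounded up.)\<close>

definition expansion_bound :: "(nat \<Rightarrow> nat) \<Rightarrow> 'v ugraph set \<Rightarrow> bool" where
  "expansion_bound f \<G> \<longleftrightarrow>
     (\<forall>r. \<forall>G\<in>\<G>. \<forall>H. shallow_minor r G H \<longrightarrow> card (edges H) \<le> f r * card (verts H))"

definition bounded_expansion :: "'v ugraph set \<Rightarrow> bool" where
  "bounded_expansion \<G> \<longleftrightarrow> (\<exists>f. expansion_bound f \<G>)"


section \<open>Functional representations\<close>

text \<open>Symbols are named by natural numbers; function and predicate symbols are separate
  name spaces.\<close>

record signature =
  fsig :: "nat set"
  psig :: "nat set"

definition f_id :: nat where
  "f_id = 0"

definition functional_signature :: "signature \<Rightarrow> bool" where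
  "functional_signature \<sigma> \<longleftrightarrow> finite (fsig \<sigma>) \<and> finite (psig \<sigma>) \<and> f_id \<in> fsig \<sigma>"

definition sig_size :: "signature \<Rightarrow> nat" where
  "sig_size \<sigma> = card (fsig \<sigma>) + card (psig \<sigma>)"

definition sub_signature :: "signature \<Rightarrow> signature \<Rightarrow> bool" where
  "sub_signature \<sigma> \<rho> \<longleftrightarrow> fsig \<sigma> \<subseteq> fsig \<rho> \<and> psig \<sigma> \<subseteq> psig \<rho>"

text \<open>The interpretation of symbols outside the signature, and of functions outside the universe,
  is irrelevant throughout.\<close>

record 'v struc =
  univ :: "'v set"
  fint :: "nat \<Rightarrow> 'v \<Rightarrow> 'v"
  pint :: "nat \<Rightarrow> 'v set"

definition Fun :: "signature \<Rightarrow> 'v struc set" where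
  "Fun \<sigma> = {G. finite (univ G) \<and> univ G \<noteq> {} \<and>
              (\<forall>f\<in>fsig \<sigma>. \<forall>v\<in>univ G. fint G f v \<in> univ G) \<and>
              (\<forall>v\<in>univ G. fint G f_id v = v) \<and>
              (\<forall>p\<in>psig \<sigma>. pint G p \<subseteq> univ G)}"

definition struc_size :: "signature \<Rightarrow> 'v struc \<Rightarrow> nat" where
  "struc_size \<sigma> G = card (univ G) * sig_size \<sigma>"

definition arcs :: "signature \<Rightarrow> 'v struc \<Rightarrow> ('v \<times> 'v) set" where
  "arcs \<sigma> G = {(u, v). u \<in> univ G \<and> v \<in> univ G \<and> (\<exists>f\<in>fsig \<sigma>. fint G f v = u)}"

definition underlying :: "signature \<Rightarrow> 'v struc \<Rightarrow> 'v ugraph" where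
  "underlying \<sigma> G =
     \<lparr>verts = univ G, edges = {{u, v} | u v. (u, v) \<in> arcs \<sigma> G \<and> u \<noteq> v}\<rparr>"

definition expansion_of :: "signature \<Rightarrow> 'v struc \<Rightarrow> 'v struc \<Rightarrow> bool" where
  "expansion_of \<sigma> G G' \<longleftrightarrow>
     univ G' = univ G \<and>
     (\<forall>f\<in>fsig \<sigma>. \<forall>v\<in>univ G. fint G' f v = fint G f v) \<and>
     (\<forall>p\<in>psig \<sigma>. pint G' p = pint G p)"


section \<open>First-order logic\<close>

datatype trm = Var nat | App nat trm

datatype form = Eq trm trm | Pred nat trm | Neg form | And form form | Ex nat form

primrec trm_var :: "trm \<Rightarrow> nat" where
  "trm_var (Var x) = x"
| "trm_var (App f t) = trm_var t"

primrec trm_funs :: "trm \<Rightarrow> nat set" where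
  "trm_funs (Var x) = {}"
| "trm_funs (App f t) = insert f (trm_funs t)"

primrec free_vars :: "form \<Rightarrow> nat set" where
  "free_vars (Eq s t) = {trm_var s, trm_var t}"
| "free_vars (Pred p t) = {trm_var t}"
| "free_vars (Neg \<phi>) = free_vars \<phi>"
| "free_vars (And \<phi> \<psi>) = free_vars \<phi> \<union> free_vars \<psi>"
| "free_vars (Ex x \<phi>) = free_vars \<phi> - {x}"

primrec has_signature :: "signature \<Rightarrow> form \<Rightarrow> bool" where
  "has_signature \<sigma> (Eq s t) \<longleftrightarrow> trm_funs s \<subseteq> fsig \<sigma> \<and> trm_funs t \<subseteq> fsig \<sigma>"
| "has_signature \<sigma> (Pred p t) \<longleftrightarrow> p \<in> psig \<sigma> \<and> trm_funs t \<subseteq> fsig \<sigma>"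
| "has_signature \<sigma> (Neg \<phi>) \<longleftrightarrow> has_signature \<sigma> \<phi>"
| "has_signature \<sigma> (And \<phi> \<psi>) \<longleftrightarrow> has_signature \<sigma> \<phi> \<and> has_signature \<sigma> \<psi>"
| "has_signature \<sigma> (Ex x \<phi>) \<longleftrightarrow> has_signature \<sigma> \<phi>"

inductive literal :: "form \<Rightarrow> bool" where
  "literal (Eq s t)"
| "literal (Pred p t)"
| "literal (Neg (Eq s t))"
| "literal (Neg (Pred p t))"

inductive conjunctive_clause :: "form \<Rightarrow> bool" where
  "literal \<phi> \<Longrightarrow> conjunctive_clause \<phi>"
| "conjunctive_clause \<phi> \<Longrightarrow> conjunctive_clause \<psi> \<Longrightarrow> conjunctive_clause (And \<phi> \<psi>)"

primrec trm_val :: "'v struc \<Rightarrow> (nat \<Rightarrow> 'v) \<Rightarrow> trm \<Rightarrow> 'v" where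
  "trm_val G \<beta> (Var x) = \<beta> x"
| "trm_val G \<beta> (App f t) = fint G f (trm_val G \<beta> t)"

primrec sat :: "'v struc \<Rightarrow> (nat \<Rightarrow> 'v) \<Rightarrow> form \<Rightarrow> bool" where
  "sat G \<beta> (Eq s t) \<longleftrightarrow> trm_val G \<beta> s = trm_val G \<beta> t"
| "sat G \<beta> (Pred p t) \<longleftrightarrow> trm_val G \<beta> t \<in> pint G p"
| "sat G \<beta> (Neg \<phi>) \<longleftrightarrow> \<not> sat G \<beta> \<phi>"
| "sat G \<beta> (And \<phi> \<psi>) \<longleftrightarrow> sat G \<beta> \<phi> \<and> sat G \<beta> \<psi>"
| "sat G \<beta> (Ex x \<phi>) \<longleftrightarrow> (\<exists>v\<in>univ G. sat G (\<beta>(x := v)) \<phi>)"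

text \<open>The assignment of a tuple of elements to a tuple of distinct variables; its value at any
  other variable is unspecified and never used.\<close>

definition assign :: "nat list \<Rightarrow> 'v list \<Rightarrow> nat \<Rightarrow> 'v" where
  "assign xs us = (\<lambda>z. the (map_of (zip xs us) z))"

definition count :: "'v struc \<Rightarrow> form \<Rightarrow> nat \<Rightarrow> nat list \<Rightarrow> 'v list \<Rightarrow> nat" where
  "count G \<phi> y xs us = card {v \<in> univ G. sat G (assign (y # xs) (v # us)) \<phi>}"


section \<open>Goedel numbers\<close>

primrec trm_code :: "trm \<Rightarrow> nat" where
  "trm_code (Var x) = prod_encode (0, x)"
| "trm_code (App f t) = prod_encode (1, prod_encode (f, trm_code t))"

primrec form_code :: "form \<Rightarrow> nat" where
  "form_code (Eq s t) = prod_encode (0, prod_encode (trm_code s, trm_code t))"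
| "form_code (Pred p t) = prod_encode (1, prod_encode (p, trm_code t))"
| "form_code (Neg \<phi>) = prod_encode (2, form_code \<phi>)"
| "form_code (And \<phi> \<psi>) = prod_encode (3, prod_encode (form_code \<phi>, form_code \<psi>))"
| "form_code (Ex x \<phi>) = prod_encode (4, prod_encode (x, form_code \<phi>))"

definition sig_code :: "signature \<Rightarrow> nat" where
  "sig_code \<sigma> = prod_encode (set_encode (fsig \<sigma>), set_encode (psig \<sigma>))"

definition query_code :: "form \<Rightarrow> nat \<Rightarrow> nat list \<Rightarrow> nat" where
  "query_code \<phi> y xs = prod_encode (form_code \<phi>, list_encode (y # xs))"

definition clauses_code :: "signature \<Rightarrow> form list \<Rightarrow> nat" where
  "clauses_code \<rho> \<Omega> = prod_encode (sig_code \<rho>, list_encode (map form_code \<Omega>))"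


section \<open>Random access machines\<close>

text \<open>A configuration consists of a program counter, the contents of the registers, and the
  contents of the addressable memory. The machine stops when the program counter leaves the
  program. \<open>Query\<close> asks an oracle \<open>h\<close>.
  Negative addresses are read as 0.\<close>

datatype instr =
    Const nat int
  | Add nat nat nat
  | Sub nat nat nat
  | Load nat nat
  | Store nat nat
  | Jump_pos nat nat
  | Query nat nat

type_synonym config = "nat \<times> (nat \<Rightarrow> int) \<times> (nat \<Rightarrow> int)"

fun exec :: "(nat \<Rightarrow> nat) \<Rightarrow> instr \<Rightarrow> config \<Rightarrow> config" where
  "exec h (Const i k) (pc, R, M) = (pc + 1, R(i := k), M)"
| "exec h (Add i j k) (pc, R, M) = (pc + 1, R(i := R j + R k), M)"
| "exec h (Sub i j k) (pc, R, M) = (pc + 1, R(i := R j - R k), M)"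
| "exec h (Load i j) (pc, R, M) = (pc + 1, R(i := M (nat (R j))), M)"
| "exec h (Store i j) (pc, R, M) = (pc + 1, R, M(nat (R i) := R j))"
| "exec h (Jump_pos i l) (pc, R, M) = (if R i > 0 then l else pc + 1, R, M)"
| "exec h (Query i j) (pc, R, M) = (pc + 1, R(i := int (h (nat (R j)))), M)"

definition halted :: "instr list \<Rightarrow> config \<Rightarrow> bool" where
  "halted P c \<longleftrightarrow> length P \<le> fst c"

definition step :: "(nat \<Rightarrow> nat) \<Rightarrow> instr list \<Rightarrow> config \<Rightarrow> config" where
  "step h P c = (if halted P c then c else exec h (P ! fst c) c)"

definition run :: "(nat \<Rightarrow> nat) \<Rightarrow> instr list \<Rightarrow> nat \<Rightarrow> config \<Rightarrow> config" where
  "run h P t = step h P ^^ t"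

text \<open>Computability on natural numbers relative to an oracle: started with \<open>m\<close> in register 0 and
  everything else zero, the machine stops with \<open>m'\<close> in register 0. An algorithm for a class of bounded expansion knows
  the class through a bound on its expansion, which is its oracle; a computable bound makes the
  oracle dispensable.\<close>

definition computes :: "(nat \<Rightarrow> nat) \<Rightarrow> instr list \<Rightarrow> nat \<Rightarrow> nat \<Rightarrow> bool" where
  "computes h P m m' \<longleftrightarrow>
     (\<exists>t. case run h P t (0, (\<lambda>_. 0)(0 := int m), \<lambda>_. 0) of
            (pc, R, M) \<Rightarrow> halted P (pc, R, M) \<and> R 0 = int m')"

text \<open>Finite structures are presented to a machine as tables. An enumeration \<open>e\<close> maps the universe
  \<open>V\<close> onto \<open>{..<n}\<close>, n = |V|; table number j (a function on \<open>V\<close>) occupies the memory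
  cells j * n, ..., j * n + n - 1.\<close>

definition tables :: "'v set \<Rightarrow> ('v \<Rightarrow> nat) \<Rightarrow> ('v \<Rightarrow> int) list \<Rightarrow> nat \<Rightarrow> int" where
  "tables V e ts = (\<lambda>a. if a < length ts * card V
                        then (ts ! (a div card V)) (inv_into V e (a mod card V)) else 0)"

definition struc_tables :: "signature \<Rightarrow> ('v \<Rightarrow> nat) \<Rightarrow> 'v struc \<Rightarrow> ('v \<Rightarrow> int) list" where
  "struc_tables \<sigma> e G =
     map (\<lambda>f v. int (e (fint G f v))) (sorted_list_of_set (fsig \<sigma>)) @
     map (\<lambda>p v. of_bool (v \<in> pint G p)) (sorted_list_of_set (psig \<sigma>))"

text \<open>Started with n in register 0 and the tables \<open>ins\<close> in memory, the machine stops within \<open>T\<close>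
  steps with the tables \<open>outs\<close> at the beginning of its memory. It does not use its oracle. To make
  unit cost realistic, no register and no memory cell may ever exceed \<open>W\<close> in absolute value.\<close>

definition computes_tables ::
  "instr list \<Rightarrow> nat \<Rightarrow> nat \<Rightarrow> 'v set \<Rightarrow> ('v \<Rightarrow> nat) \<Rightarrow>
   ('v \<Rightarrow> int) list \<Rightarrow> ('v \<Rightarrow> int) list \<Rightarrow> bool" where
  "computes_tables P T W V e ins outs \<longleftrightarrow>
     (let conf = (\<lambda>t. run (\<lambda>_. 0) P t (0, (\<lambda>_. 0)(0 := int (card V)), tables V e ins)) in
      \<exists>t\<le>T. halted P (conf t) \<and>
        (\<forall>s\<le>t. case conf s of (pc, R, M) \<Rightarrow>
           \<forall>a. \<bar>R a\<bar> \<le> int W \<and> \<bar>M a\<bar> \<le> int W) \<and>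
        (\<forall>a < length outs * card V. snd (snd (conf t)) a = tables V e outs a))"

end

theory Submission imports Defs begin

text \<open>A class of bounded expansion stays one when boundedly many functions are added each of which moves a
  vertex along boundedly many arcs of the old structure: a shallow minor of the new graph is a congested
  shallow minor of the old one. Orienting the underlying graphs with bounded outdegree supplies such
  functions, among them a bounded set of functions that recovers every value \<open>f v\<close> from the value
  \<open>a v\<close> of a single hub \<open>a\<close>. Functions choosing witnesses are indexed by a hub, by the isomorphism type
  of the witness over one variable and by a bounded branch that excludes unwanted coincidences; they
  eliminate an existential quantifier, so after finitely many rounds truth of \<open>\<phi>\<close> depends only on the
  equalities and predicates among the values of the functions of the family at the free variables.

  To count the \<open>y\<close> with \<open>\<phi>(y, u)\<close>, split according to the type of \<open>y\<close> and the set of coincidences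
  \<open>f y = h u\<^sub>i\<close>. By Moebius inversion it suffices to prescribe a set of coincidences to hold, without
  excluding others. A hub then turns these conditions into a single one \<open>a y = h u\<^sub>i\<close> and a condition
  on \<open>u\<close> alone, so the number is a function of one \<open>u\<^sub>i\<close>, computed in linear time. The clauses list all
  sign patterns of the atoms over a signature whose size is bounded by an explicit function of the
  expansion bound, which makes them computable.\<close>

section \<open>Shallow minors\<close>

text \<open>Only the signature and the clauses have to be computed from \<phi> and the expansion
  bound; the linear-time program, the expanded class and the coefficients merely have to exist. So
  of the family of functions built for \<phi> nothing is computed but an upper bound for its size, a
  tower of exponentials whose height is linear in the Goedel number of the query. Quantifier-free
  formulas are replaced by a semantic notion: \<open>qf\<close> says that truth depends on the
  atomic pattern alone, across all structures of the class, and the coefficients are read off one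
  representative per pattern. The obstacle in eliminating a quantifier is that a witness has to be a
  unary function of one available value, yet must avoid coincidences with the values at all free
  variables. A branch records only which functions must differ from earlier witnesses, so it is a
  finite index that mentions no variable. Since everything must run in linear time with small
  numbers, orientations come from an amortised online algorithm, written as a loop over
  tables.\<close>

definition grad_le :: "nat => nat => 'v ugraph => bool" where
  "grad_le R D G \<longleftrightarrow> (\<forall>H. shallow_minor R G H --> card (edges H) \<le> D * card (verts H))"

lemma relpow_subset:
  fixes A B :: "('a \<times> 'a) set"
  shows "(a, b) \<in> A ^^ k ==> A \<subseteq> B ==> (a, b) \<in> B ^^ k"
  by (induction k arbitrary: b) auto

lemma doubletonsE:
  assumes "E \<subseteq> {{A, B} | A B. P A B}" "e \<in> E"
  obtains A B where "e = {A, B}" "P A B"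
  using assms by blast

lemma grad_le_mono:
  assumes "grad_le R D G" "r \<le> R" "D \<le> D'"
  shows "grad_le r D' G"
  unfolding grad_le_def
proof (intro allI impI)
  fix H assume "shallow_minor r G H"
  moreover have "radius_le r G B ==> radius_le R G B" for B
    unfolding radius_le_def using assms(2) by (meson order_trans)
  ultimately have "shallow_minor R G H" by (simp add: shallow_minor_def)
  then have "card (edges H) \<le> D * card (verts H)" using assms(1) by (simp add: grad_le_def)
  also have "\<dots> \<le> D' * card (verts H)" using assms(3) by simp
  finally show "card (edges H) \<le> D' * card (verts H)" .
qed

lemma grad_le_subgraph:
  assumes "grad_le R D G" "verts H = verts G" "edges H \<subseteq> edges G"
  shows "grad_le R D H"
  unfolding grad_le_def
proof (intro allI impI)
  fix M assume M: "shallow_minor R H M"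
  have "adj_in H B \<subseteq> adj_in G B" for B using assms(3) by (auto simp: adj_in_def)
  then have "radius_le R H B ==> radius_le R G B" for B
    unfolding radius_le_def using relpow_subset by meson
  moreover have "{{A, B} | A B. A \<in> verts M \<and> B \<in> verts M \<and> A \<noteq> B \<and> (\<exists>a\<in>A. \<exists>b\<in>B. {a, b} \<in> edges H)}
      \<subseteq> {{A, B} | A B. A \<in> verts M \<and> B \<in> verts M \<and> A \<noteq> B \<and> (\<exists>a\<in>A. \<exists>b\<in>B. {a, b} \<in> edges G)}"
    using assms(3) by blast
  ultimately have "shallow_minor R G M" using M assms(2)
    unfolding shallow_minor_def by (metis (no_types, lifting) order_trans)
  then show "card (edges M) \<le> D * card (verts M)" using assms(1) by (simp add: grad_le_def)
qed

text \<open>Branch sets avoiding z form a minor of \<open>G\<close> itself. By disjointness at most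
  one branch set contains z, and it meets at most one edge per vertex of the minor, which costs the
  additional 1. The lemma pays for \<open>bp\<close>, the function with a constant value.\<close>

lemma grad_le_apex:
  assumes "grad_le R D G" "finite (verts G)" "verts G' = verts G"
    and "edges G' \<subseteq> edges G \<union> {{z, v} | v. v \<in> verts G}"
  shows "grad_le R (D + 1) G'"
  unfolding grad_le_def
proof (intro allI impI)
  fix M assume M: "shallow_minor R G' M"
  define M' where "M' = \<lparr>verts = {B \<in> verts M. z \<notin> B},
     edges = {e \<in> edges M. \<forall>B\<in>e. z \<notin> B}\<rparr>"
  have finM: "finite (verts M)"
    by (rule finite_subset[of _ "Pow (verts G)"])
       (use M assms(2,3) in \<open>auto simp: shallow_minor_def\<close>)
  have E: "edges M \<subseteq> {{A, B} | A B. A \<in> verts M \<and> B \<in> verts M \<and> A \<noteq> B \<and>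
       (\<exists>a\<in>A. \<exists>b\<in>B. {a, b} \<in> edges G')}" using M by (simp add: shallow_minor_def)
  have new_edge: "e \<in> edges G" if "e \<in> edges G'" "z \<notin> e" for e
    using subsetD[OF assms(4) that(1)] that(2) by auto
  have adj: "adj_in G' B \<subseteq> adj_in G B" if "z \<notin> B" for B
    using new_edge that by (auto simp: adj_in_def)
  have rad: "radius_le R G B" if "B \<in> verts M'" for B
  proof -
    have "z \<notin> B" "radius_le R G' B" using that M by (auto simp: M'_def shallow_minor_def)
    then show ?thesis unfolding radius_le_def using relpow_subset adj by meson
  qed
  have EM': "edges M' \<subseteq> {{A, B} | A B. A \<in> verts M' \<and> B \<in> verts M' \<and> A \<noteq> B \<and>
       (\<exists>a\<in>A. \<exists>b\<in>B. {a, b} \<in> edges G)}"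
  proof
    fix e assume "e \<in> edges M'"
    then have e: "e \<in> edges M" "\<forall>B\<in>e. z \<notin> B" by (auto simp: M'_def)
    from doubletonsE[OF E e(1)] obtain A B where "e = {A, B}" and
      "A \<in> verts M \<and> B \<in> verts M \<and> A \<noteq> B \<and> (\<exists>a\<in>A. \<exists>b\<in>B. {a, b} \<in> edges G')" .
    then obtain a b where AB: "e = {A, B}" "A \<in> verts M" "B \<in> verts M" "A \<noteq> B"
      "a \<in> A" "b \<in> B" "{a, b} \<in> edges G'" by blast
    have "z \<notin> A" "z \<notin> B" using e AB by auto
    have "{a, b} \<in> edges G" by (rule new_edge) (use AB \<open>z \<notin> A\<close> \<open>z \<notin> B\<close> in auto)
    with AB \<open>z \<notin> A\<close> \<open>z \<notin> B\<close> show "e \<in> {{A, B} | A B. A \<in> verts M' \<and> B \<in> verts M' \<and> A \<noteq> B \<and>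
       (\<exists>a\<in>A. \<exists>b\<in>B. {a, b} \<in> edges G)}" by (auto simp: M'_def)
  qed
  have "shallow_minor R G M'" unfolding shallow_minor_def
    using rad EM' M assms(3) by (auto simp: M'_def shallow_minor_def)
  then have c1: "card (edges M') \<le> D * card (verts M')" using assms(1) by (simp add: grad_le_def)
  have "card (verts M') \<le> card (verts M)" using finM by (auto simp: M'_def intro: card_mono)
  with c1 have c2: "card (edges M') \<le> D * card (verts M)"
    by (meson mult_le_mono2 order_trans)
  \<comment> \<open>If no branch set contains z, the value of \<open>THE\<close> is arbitrary, but
    then every edge lies in \<open>edges M'\<close> already.\<close>
  have "edges M \<subseteq> edges M' \<union> (\<lambda>A. {THE B. B \<in> verts M \<and> z \<in> B, A}) ` verts M"
  proof
    fix e assume e: "e \<in> edges M"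
    from doubletonsE[OF E e] obtain A B where AB: "e = {A, B}" "A \<in> verts M" "B \<in> verts M" by metis
    have uniq: "(THE B. B \<in> verts M \<and> z \<in> B) = C" if "C \<in> verts M" "z \<in> C" for C
    proof (rule the_equality)
      fix B assume "B \<in> verts M \<and> z \<in> B"
      then show "B = C" using M that unfolding shallow_minor_def by (metis disjoint_iff)
    qed (use that in blast)
    show "e \<in> edges M' \<union> (\<lambda>A. {THE B. B \<in> verts M \<and> z \<in> B, A}) ` verts M"
    proof (cases "z \<in> A \<or> z \<in> B")
      case True
      then show ?thesis
      proof
        assume "z \<in> A" then have "e = {THE B. B \<in> verts M \<and> z \<in> B, B}" using uniq AB by auto
        then show ?thesis using AB by blast
      next
        assume "z \<in> B" then have "e = {THE B. B \<in> verts M \<and> z \<in> B, A}" using uniq AB by auto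
        then show ?thesis using AB by blast
      qed
    next
      case False then show ?thesis using e AB by (auto simp: M'_def)
    qed
  qed
  moreover have "finite (edges M')"
    by (rule finite_subset[of _ "Pow (verts M)"]) (use EM' finM in \<open>auto simp: M'_def\<close>)
  ultimately have "card (edges M) \<le> card (edges M') + card (verts M)"
    by (meson card_Un_le card_image_le card_mono finM finite_UnI finite_imageI add_mono le_refl order_trans)
  with c2 show "card (edges M) \<le> (D + 1) * card (verts M)" by simp
qed

text \<open>An expectation without probabilities: if w takes uniformly random values below m, the
  constraint e holds with probability \<open>1 / m ^ card (S e)\<close>, and some w does at least as
  well as the average. Multiplying by \<open>m ^ s\<close> keeps everything in the natural numbers.
  Values are fixed vertex by vertex, as in the method of conditional expectations.\<close>

lemma partial_assignment_average:
  fixes S :: "'e => 'v set" and con :: "'e => 'v => nat"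
  assumes "finite V" "finite E" "m > 0"
    and "\<And>e. e \<in> E ==> S e \<subseteq> V \<and> card (S e) \<le> s \<and> (\<forall>v\<in>S e. con e v < m)"
  shows "\<exists>w. (\<Sum>e\<in>E. m ^ (s - card (S e))) \<le> m ^ s * card {e \<in> E. \<forall>v\<in>S e. w v = con e v}"
  using assms(1,2,4)
proof (induction V arbitrary: E S rule: finite_induct)
  case empty
  then have "\<And>e. e \<in> E ==> S e = {}" by blast
  then have "{e \<in> E. \<forall>v\<in>S e. w v = con e v} = E" for w by auto
  then show ?case using \<open>\<And>e. e \<in> E ==> S e = {}\<close> by simp
next
  case (insert v V)
  define S' where "S' e = S e - {v}" for e
  \<comment> \<open>\<open>X l\<close> is the weight that remains once v gets the value l:
    constraints that demand another value at v are dropped, and those that demand l lose one vertex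
    and gain a factor m. The total over l is m times the old weight, so some l does not decrease
    it.\<close>
  define X where "X l = (\<Sum>e | e \<in> E \<and> (v \<notin> S e \<or> con e v = l). m ^ (s - card (S' e)))" for l
  have fS: "finite (S e)" if "e \<in> E" for e
    using insert.prems(2)[OF that] insert.hyps(1) finite_subset by blast
  have "(\<Sum>l<m. X l) = (\<Sum>l<m. \<Sum>e\<in>E. if v \<notin> S e \<or> con e v = l then m ^ (s - card (S' e)) else 0)"
    unfolding X_def using insert.prems(1) by (simp add: sum.If_cases Int_def)
  also have "\<dots> = (\<Sum>e\<in>E. \<Sum>l<m. if v \<notin> S e \<or> con e v = l then m ^ (s - card (S' e)) else 0)"
    by (rule sum.swap)
  also have "\<dots> = (\<Sum>e\<in>E. m * m ^ (s - card (S e)))"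
  proof (rule sum.cong)
    fix e assume e: "e \<in> E"
    show "(\<Sum>l<m. if v \<notin> S e \<or> con e v = l then m ^ (s - card (S' e)) else 0)
        = m * m ^ (s - card (S e))"
    proof (cases "v \<in> S e")
      case True
      have "card (S e) = Suc (card (S' e))" using fS[OF e] True
        unfolding S'_def by (metis card_Suc_Diff1)
      moreover have "card (S e) \<le> s" using insert.prems(2)[OF e] by blast
      ultimately have "s - card (S' e) = Suc (s - card (S e))" by simp
      moreover have "con e v < m" using insert.prems(2)[OF e] True by blast
      ultimately show ?thesis using True by (simp add: sum.delta')
    next
      case False then show ?thesis by (simp add: S'_def)
    qed
  qed simp
  also have "\<dots> = m * (\<Sum>e\<in>E. m ^ (s - card (S e)))" by (simp add: sum_distrib_left)
  finally have tot: "(\<Sum>l<m. X l) = m * (\<Sum>e\<in>E. m ^ (s - card (S e)))" .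
  have "\<exists>l<m. (\<Sum>e\<in>E. m ^ (s - card (S e))) \<le> X l"
  proof (rule ccontr)
    assume "\<not> ?thesis"
    then have "(\<Sum>l<m. X l) < (\<Sum>l<m. (\<Sum>e\<in>E. m ^ (s - card (S e))))"
      using \<open>m > 0\<close> by (intro sum_strict_mono) (auto simp: not_le)
    with tot show False by simp
  qed
  then obtain l where l: "l < m" "(\<Sum>e\<in>E. m ^ (s - card (S e))) \<le> X l" by blast
  define E' where "E' = {e \<in> E. v \<notin> S e \<or> con e v = l}"
  have "\<exists>w. (\<Sum>e\<in>E'. m ^ (s - card (S' e)))
      \<le> m ^ s * card {e \<in> E'. \<forall>u\<in>S' e. w u = con e u}"
  proof (rule insert.IH)
    show "finite E'" using insert.prems(1) by (simp add: E'_def)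
    fix e assume "e \<in> E'"
    then have e: "e \<in> E" by (simp add: E'_def)
    have "card (S' e) \<le> card (S e)" using fS[OF e] by (simp add: S'_def card_mono)
    then show "S' e \<subseteq> V \<and> card (S' e) \<le> s \<and> (\<forall>v\<in>S' e. con e v < m)"
      using insert.prems(2)[OF e] by (auto simp: S'_def)
  qed
  then obtain w where w: "(\<Sum>e\<in>E'. m ^ (s - card (S' e)))
      \<le> m ^ s * card {e \<in> E'. \<forall>u\<in>S' e. w u = con e u}" by blast
  have "card {e \<in> E'. \<forall>u\<in>S' e. w u = con e u} \<le> card {e \<in> E. \<forall>u\<in>S e. (w(v := l)) u = con e u}"
    using insert.prems(1) by (intro card_mono) (auto simp: E'_def S'_def)
  then have "X l \<le> m ^ s * card {e \<in> E. \<forall>u\<in>S e. (w(v := l)) u = con e u}"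
    using w unfolding X_def E'_def by (meson le_trans mult_le_mono2)
  with l(2) show ?case by (meson le_trans)
qed

text \<open>The radius is defined through powers of \<open>adj_in\<close>; lists of vertices are
  needed to cut a path at the first vertex that it shares with another one.\<close>

definition walk :: "'v ugraph => 'v list => bool" where
  "walk G = successively (\<lambda>a b. {a, b} \<in> edges G)"

lemma walk_append: "walk G (xs @ ys) \<longleftrightarrow> walk G xs \<and> walk G ys \<and>
   (xs = [] \<or> ys = [] \<or> {last xs, hd ys} \<in> edges G)"
  by (simp add: walk_def successively_append_iff)

lemma relpow_walk:
  "(x, v) \<in> adj_in G B ^^ k ==> x \<in> B ==>
   \<exists>p. walk G p \<and> set p \<subseteq> B \<and> length p = Suc k \<and> hd p = x \<and> last p = v"
proof (induction k arbitrary: v)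
  case 0 then show ?case by (intro exI[of _ "[x]"]) (auto simp: walk_def)
next
  case (Suc k)
  then obtain u where u: "(x, u) \<in> adj_in G B ^^ k" "(u, v) \<in> adj_in G B" by auto
  then obtain p where p: "walk G p" "set p \<subseteq> B" "length p = Suc k" "hd p = x" "last p = u"
    using Suc by blast
  have "walk G (p @ [v])" using p u(2) by (auto simp: walk_append adj_in_def) (simp add: walk_def)
  then show ?case using p u(2) by (intro exI[of _ "p @ [v]"]) (cases p, auto simp: adj_in_def)
qed

lemma walk_relpow:
  "walk G p ==> set p \<subseteq> B ==> i < length p ==> (hd p, p ! i) \<in> adj_in G B ^^ i"
proof (induction i)
  case 0 then show ?case by (simp add: hd_conv_nth)
next
  case (Suc i)
  then have "{p ! i, p ! Suc i} \<in> edges G" unfolding walk_def successively_conv_nth by blast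
  moreover have "p ! i \<in> B" "p ! Suc i \<in> B" using Suc.prems by (auto simp: subset_iff)
  ultimately have "(p ! i, p ! Suc i) \<in> adj_in G B" by (simp add: adj_in_def)
  then show ?case using Suc by auto
qed

text \<open>Assigning every vertex to one of the at most \<open>m\<close> branch sets containing it makes the
  branch sets disjoint. An edge of the congested minor survives if the at most \<open>2 * R + 2\<close>
  vertices of a path joining its two centres are assigned correctly.\<close>

lemma congested_minor_sparse:
  fixes B :: "'i => 'v set" and num :: "'i => 'v => nat"
  assumes gr: "grad_le R D G" and finV: "finite (verts G)" and finI: "finite I" and m: "m > 0"
    and B: "\<And>i. i \<in> I ==> B i \<subseteq> verts G \<and> x i \<in> B i \<and>
       (\<forall>v\<in>B i. \<exists>k\<le>R. (x i, v) \<in> adj_in G (B i) ^^ k)"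
    and num: "\<And>i v. i \<in> I ==> v \<in> B i ==> num i v < m"
    and numinj: "\<And>i j v. i \<in> I ==> j \<in> I ==> i \<noteq> j ==> v \<in> B i ==> v \<in> B j ==> num i v \<noteq> num j v"
    and E: "E \<subseteq> {{i, j} | i j. i \<in> I \<and> j \<in> I \<and> i \<noteq> j \<and>
       (\<exists>a\<in>B i. \<exists>b\<in>B j. a = b \<or> {a, b} \<in> edges G)}"
  shows "card E \<le> (m ^ (2 * R + 2) * D + m) * card I"
proof -
  have finE: "finite E"
    by (rule finite_subset[of _ "Pow I"]) (use E finI in auto)
  \<comment> \<open>Two branch sets with a common centre cannot both keep it, so the edges between
    them are counted separately: a vertex is the centre of at most m sets, because
    \<open>num\<close> separates the sets containing it.\<close>
  define E0 where "E0 = {e \<in> E. \<exists>i j. e = {i, j} \<and> i \<in> I \<and> j \<in> I \<and> x i = x j}"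
  define E1 where "E1 = E - E0"
  have "E0 \<subseteq> (\<Union>i\<in>I. (\<lambda>j. {i, j}) ` {j \<in> I. x j = x i})"
    unfolding E0_def by fastforce
  then have "card E0 \<le> card (\<Union>i\<in>I. (\<lambda>j. {i, j}) ` {j \<in> I. x j = x i})"
    using finI by (intro card_mono) auto
  also have "\<dots> \<le> (\<Sum>i\<in>I. card ((\<lambda>j. {i, j}) ` {j \<in> I. x j = x i}))"
    using finI by (rule card_UN_le)
  also have "\<dots> \<le> (\<Sum>i\<in>I. m)"
  proof (rule sum_mono)
    fix i assume i: "i \<in> I"
    have "inj_on (\<lambda>j. num j (x i)) {j \<in> I. x j = x i}"
      using B numinj by (intro inj_onI) (metis (mono_tags, lifting) mem_Collect_eq)
    moreover have "(\<lambda>j. num j (x i)) ` {j \<in> I. x j = x i} \<subseteq> {..<m}"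
    proof -
      have "num j (x i) < m" if "j \<in> I" "x j = x i" for j using B[OF that(1)] num[OF that(1)] that(2) by metis
      then show ?thesis by auto
    qed
    ultimately have "card {j \<in> I. x j = x i} \<le> m" using card_inj_on_le[of _ _ "{..<m}"] by simp
    then show "card ((\<lambda>j. {i, j}) ` {j \<in> I. x j = x i}) \<le> m"
      using card_image_le[of "{j \<in> I. x j = x i}" "\<lambda>j. {i, j}"] finI by simp
  qed
  finally have c0: "card E0 \<le> m * card I" by (simp add: mult.commute)
  \<comment> \<open>\<open>seg i P\<close> describes the vertex set of a short walk that starts at
    the centre of \<open>B i\<close> and stays inside; owning all of P is enough to keep P connected
    to the centre.\<close>
  define seg where "seg i P \<longleftrightarrow> (\<exists>p. walk G p \<and> p \<noteq> [] \<and> set p = P \<and> set p \<subseteq> B i \<and>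
      length p \<le> R + 1 \<and> hd p = x i)" for i P
  \<comment> \<open>Walks from the two centres to the ends of the edge may meet. Cutting the second
    at its first vertex u on the first, and the first at u, leaves two disjoint adjacent pieces. If
    u is the second centre, then u itself is one piece and the part of the first walk before u is
    the other; distinct centres make that part nonempty.\<close>
  have split: "\<exists>P Q. seg i P \<and> seg j Q \<and> P \<inter> Q = {} \<and> (\<exists>p\<in>P. \<exists>q\<in>Q. {p, q} \<in> edges G)"
    if ij: "i \<in> I" "j \<in> I" "x i \<noteq> x j" "a \<in> B i" "b \<in> B j" "a = b \<or> {a, b} \<in> edges G" for i j a b
  proof -
    have "\<exists>p. walk G p \<and> set p \<subseteq> B i \<and> length p \<le> R + 1 \<and> p \<noteq> [] \<and> hd p = x i \<and> last p = a"
      if ia: "i \<in> I" "a \<in> B i" for i a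
    proof -
      obtain k where "k \<le> R" "(x i, a) \<in> adj_in G (B i) ^^ k" using B[OF ia(1)] ia(2) by blast
      then show ?thesis using relpow_walk[of "x i" a k G "B i"] B[OF ia(1)] by fastforce
    qed
    then obtain p q where p: "walk G p" "set p \<subseteq> B i" "length p \<le> R + 1" "p \<noteq> []" "hd p = x i" "last p = a"
      and q: "walk G q" "set q \<subseteq> B j" "length q \<le> R + 1" "q \<noteq> []" "hd q = x j" "last q = b"
      using ij by metis
    show ?thesis
    proof (cases "set p \<inter> set q = {}")
      case True
      moreover have "a \<in> set p" "b \<in> set q" using p q by auto
      ultimately have "{a, b} \<in> edges G" using ij(6) by blast
      then show ?thesis using True p q \<open>a \<in> set p\<close> \<open>b \<in> set q\<close> unfolding seg_def by blast
    next
      case False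
      then have "\<exists>u\<in>set q. u \<in> set p" by blast
      then obtain q1 u q2 where q12: "q = q1 @ u # q2" "u \<in> set p" "\<forall>u'\<in>set q1. u' \<notin> set p"
        using split_list_first_prop[of q "\<lambda>u. u \<in> set p"] by blast
      obtain p1 p2 where p12: "p = p1 @ u # p2" "u \<notin> set p1" using split_list_first[OF q12(2)] by blast
      have w: "walk G (p1 @ [u])" "walk G p1" using p(1) p12(1)
        by (auto simp: walk_def successively_append_iff successively_Cons)
      show ?thesis
      proof (cases "q1 = []")
        case False
        have "walk G q1" "{last q1, u} \<in> edges G" using q(1) q12(1) False by (auto simp: walk_append)
        moreover have "hd q1 = x j" using q(5) q12(1) False by simp
        ultimately have "seg j (set q1)" using q q12 False unfolding seg_def by (intro exI[of _ q1]) auto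
        moreover have "seg i (set (p1 @ [u]))" using p p12 w unfolding seg_def
          by (intro exI[of _ "p1 @ [u]"]) (auto simp: hd_append)
        moreover have "set (p1 @ [u]) \<inter> set q1 = {}" using q12 p12 by auto
        moreover have "{u, last q1} \<in> edges G" using \<open>{last q1, u} \<in> edges G\<close> by (simp add: insert_commute)
        ultimately show ?thesis using False
          by (intro exI[of _ "set (p1 @ [u])"] exI[of _ "set q1"]) fastforce
      next
        case True
        then have u: "u = x j" using q(5) q12(1) by simp
        then have "p1 \<noteq> []" using p(5) p12(1) ij(3) by auto
        moreover have "{last p1, u} \<in> edges G" using w(1) \<open>p1 \<noteq> []\<close> by (auto simp: walk_append)
        moreover have "seg i (set p1)" using p p12 w \<open>p1 \<noteq> []\<close> unfolding seg_def
          by (intro exI[of _ "p1"]) (auto simp: hd_append)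
        moreover have "seg j {u}" using q u B[OF ij(2)] unfolding seg_def
          by (intro exI[of _ "[u]"]) (auto simp: walk_def)
        ultimately show ?thesis using p12(2)
          by (intro exI[of _ "set p1"] exI[of _ "{u}"]) fastforce
      qed
    qed
  qed
  have "\<exists>i j P Q. e = {i, j} \<and> i \<in> I \<and> j \<in> I \<and> i \<noteq> j \<and> seg i P \<and> seg j Q \<and> P \<inter> Q = {} \<and>
      (\<exists>p\<in>P. \<exists>q\<in>Q. {p, q} \<in> edges G)" if "e \<in> E1" for e
  proof -
    have "e \<in> E" using that by (simp add: E1_def)
    from doubletonsE[OF E this] obtain i j where "e = {i, j}" and
      "i \<in> I \<and> j \<in> I \<and> i \<noteq> j \<and> (\<exists>a\<in>B i. \<exists>b\<in>B j. a = b \<or> {a, b} \<in> edges G)" .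
    then obtain a b where e: "e = {i, j}" "i \<in> I" "j \<in> I" "i \<noteq> j" "a \<in> B i" "b \<in> B j"
      "a = b \<or> {a, b} \<in> edges G" by blast
    then have "x i \<noteq> x j" using that unfolding E1_def E0_def by blast
    from split[OF e(2,3) this e(5-7)] e(1-4) show ?thesis by metis
  qed
  then obtain ei ej P Q where sp: "\<And>e. e \<in> E1 ==> e = {ei e, ej e} \<and> ei e \<in> I \<and> ej e \<in> I \<and> ei e \<noteq> ej e
      \<and> seg (ei e) (P e) \<and> seg (ej e) (Q e) \<and> P e \<inter> Q e = {} \<and> (\<exists>p\<in>P e. \<exists>q\<in>Q e. {p, q} \<in> edges G)"
    by metis
  \<comment> \<open>The value that a vertex of the two pieces must receive so that the edge e
    survives.\<close>
  define con where "con e v = (if v \<in> P e then num (ei e) v else num (ej e) v)" for e v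
  have segB: "P \<subseteq> B i \<and> card P \<le> R + 1 \<and> x i \<in> P \<and> finite P" if "seg i P" for i P
  proof -
    obtain p where p: "set p = P" "length p \<le> R + 1" "hd p = x i" "p \<noteq> []" "set p \<subseteq> B i"
      using \<open>seg i P\<close> unfolding seg_def by blast
    then show ?thesis using card_length[of p] hd_in_set[of p] by auto
  qed
  have finE1: "finite E1" using finE by (simp add: E1_def)
  have "\<exists>w. (\<Sum>e\<in>E1. m ^ (2 * R + 2 - card (P e \<union> Q e))) \<le>
     m ^ (2 * R + 2) * card {e \<in> E1. \<forall>v\<in>P e \<union> Q e. w v = con e v}"
  proof (rule partial_assignment_average[OF finV finE1 m])
    fix e assume e: "e \<in> E1"
    note s = sp[OF e]
    have "card (P e \<union> Q e) \<le> 2 * R + 2"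
      using card_Un_le[of "P e" "Q e"] segB[of "ei e" "P e"] segB[of "ej e" "Q e"] s by linarith
    moreover have "P e \<union> Q e \<subseteq> verts G" using s segB B by (meson Un_least subset_trans)
    moreover have "con e v < m" if "v \<in> P e \<union> Q e" for v
    proof (cases "v \<in> P e")
      case True
      then show ?thesis using s segB[of "ei e" "P e"] num by (auto simp: con_def)
    next
      case False
      then show ?thesis using that s segB[of "ej e" "Q e"] num by (auto simp: con_def)
    qed
    ultimately show "P e \<union> Q e \<subseteq> verts G \<and> card (P e \<union> Q e) \<le> 2 * R + 2 \<and>
      (\<forall>v\<in>P e \<union> Q e. con e v < m)" by blast
  qed
  then obtain w where w: "(\<Sum>e\<in>E1. m ^ (2 * R + 2 - card (P e \<union> Q e))) \<le>
     m ^ (2 * R + 2) * card {e \<in> E1. \<forall>v\<in>P e \<union> Q e. w v = con e v}" by blast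
  define E2 where "E2 = {e \<in> E1. \<forall>v\<in>P e \<union> Q e. w v = con e v}"
  have "card E1 \<le> (\<Sum>e\<in>E1. m ^ (2 * R + 2 - card (P e \<union> Q e)))"
    using m by (subst card_eq_sum) (intro sum_mono, simp)
  with w have c1: "card E1 \<le> m ^ (2 * R + 2) * card E2" by (simp add: E2_def)
  \<comment> \<open>The disjoint branch sets: everything reachable from the centre along a segment
    assigned to i throughout. If the centre itself is lost, \<open>B' i\<close> is empty, hence the
    restriction to \<open>I'\<close>.\<close>
  define B' where "B' i = \<Union>{P. seg i P \<and> (\<forall>u\<in>P. w u = num i u)}" for i
  define I' where "I' = {i \<in> I. w (x i) = num i (x i)}"
  have xB': "x i \<in> B' i" if "i \<in> I'" for i
  proof -
    have "seg i {x i}" using that B unfolding seg_def I'_def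
      by (intro exI[of _ "[x i]"]) (auto simp: walk_def)
    then show ?thesis using that unfolding B'_def I'_def by blast
  qed
  have B'B: "B' i \<subseteq> B i" for i using segB unfolding B'_def by blast
  have own: "w v = num i v" if "v \<in> B' i" for i v using that unfolding B'_def by blast
  have disj: "B' i \<inter> B' j = {}" if "i \<in> I'" "j \<in> I'" "i \<noteq> j" for i j
  proof -
    have "i \<in> I" "j \<in> I" using that by (auto simp: I'_def)
    then have "v \<notin> B' j" if "v \<in> B' i" for v
      using numinj[of i j v] own[of v i] own[of v j] B'B[of i] B'B[of j] that \<open>i \<noteq> j\<close> by fastforce
    then show ?thesis by blast
  qed
  have injB': "inj_on B' I'" using disj xB' by (intro inj_onI) (metis disjoint_iff)
  have rad: "radius_le R G (B' i)" if "i \<in> I'" for i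
    unfolding radius_le_def
  proof (intro bexI[OF _ xB'[OF that]] ballI)
    fix v assume "v \<in> B' i"
    then obtain P where P: "seg i P" "\<forall>u\<in>P. w u = num i u" "v \<in> P" unfolding B'_def by blast
    then obtain p where p: "walk G p" "set p = P" "length p \<le> R + 1" "hd p = x i" unfolding seg_def by blast
    then obtain k where k: "k < length p" "v = p ! k" using P(3) by (metis in_set_conv_nth)
    have "set p \<subseteq> B' i" using P p unfolding B'_def by blast
    from walk_relpow[OF p(1) this k(1)] show "\<exists>k\<le>R. (x i, v) \<in> adj_in G (B' i) ^^ k"
      using k p(3,4) by (intro exI[of _ k]) auto
  qed
  define H where "H = \<lparr>verts = B' ` I', edges = (\<lambda>e. B' ` e) ` E2\<rparr>"
  have E2: "\<exists>i\<in>I'. \<exists>j\<in>I'. i \<noteq> j \<and> e = {i, j} \<and> (\<exists>a\<in>B' i. \<exists>b\<in>B' j. {a, b} \<in> edges G)"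
    if "e \<in> E2" for e
  proof -
    have e: "e \<in> E1" and ow: "\<And>v. v \<in> P e \<union> Q e ==> w v = con e v" using that by (auto simp: E2_def)
    note s = sp[OF e]
    have "w v = num (ei e) v" if "v \<in> P e" for v using ow[of v] that by (simp add: con_def)
    moreover have "w v = num (ej e) v" if "v \<in> Q e" for v
      using ow[of v] that s by (auto simp: con_def split: if_splits)
    ultimately have "P e \<subseteq> B' (ei e)" "Q e \<subseteq> B' (ej e)" using s unfolding B'_def by blast+
    moreover have "ei e \<in> I'" "ej e \<in> I'" using s segB own calculation unfolding I'_def by blast+
    ultimately show ?thesis using s by blast
  qed
  have "shallow_minor R G H" unfolding shallow_minor_def
  proof (intro conjI ballI impI)
    fix C assume "C \<in> verts H"
    then show "C \<subseteq> verts G" "radius_le R G C"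
      using rad B'B B unfolding H_def I'_def by fastforce+
  next
    fix C D assume "C \<in> verts H" "D \<in> verts H" "C \<noteq> D"
    then show "C \<inter> D = {}" using disj unfolding H_def by fastforce
  next
    show "edges H \<subseteq> {{A, B} | A B. A \<in> verts H \<and> B \<in> verts H \<and> A \<noteq> B \<and>
                              (\<exists>a\<in>A. \<exists>b\<in>B. {a, b} \<in> edges G)}"
    proof
      fix E assume "E \<in> edges H"
      then obtain e where "e \<in> E2" "E = B' ` e" by (auto simp: H_def)
      then obtain i j a b where ij: "i \<in> I'" "j \<in> I'" "i \<noteq> j" "e = {i, j}" "a \<in> B' i" "b \<in> B' j"
        "{a, b} \<in> edges G" using E2 by blast
      have "B' i \<noteq> B' j" using ij injB' by (meson inj_onD)
      then show "E \<in> {{A, B} | A B. A \<in> verts H \<and> B \<in> verts H \<and> A \<noteq> B \<and>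
                              (\<exists>a\<in>A. \<exists>b\<in>B. {a, b} \<in> edges G)}"
        using ij \<open>E = B' ` e\<close> by (auto simp: H_def)
    qed
  qed
  then have "card (edges H) \<le> D * card (verts H)" using gr by (simp add: grad_le_def)
  moreover have "card (edges H) = card E2"
  proof -
    have "E2 \<subseteq> Pow I'" using E2 by blast
    then have "inj_on (\<lambda>e. B' ` e) E2"
      using inj_on_image_Pow[OF injB'] by (rule inj_on_subset[rotated])
    then show ?thesis by (simp add: H_def card_image)
  qed
  moreover have "card (verts H) \<le> card I"
  proof -
    have "card (verts H) \<le> card I'" using finI by (simp add: H_def I'_def card_image_le)
    also have "\<dots> \<le> card I" using finI by (auto simp: I'_def intro: card_mono)
    finally show ?thesis .
  qed
  ultimately have "card E2 \<le> D * card I" by (metis le_trans mult_le_mono2)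
  with c1 have "card E1 \<le> m ^ (2 * R + 2) * (D * card I)" by (meson le_trans mult_le_mono2)
  moreover have "card E \<le> card E0 + card E1"
    using card_Un_le[of E0 E1] by (simp add: E1_def E0_def Un_absorb1)
  ultimately show ?thesis using c0 by (simp add: algebra_simps)
qed

section \<open>Shallow minors after adding arcs near the old ones\<close>

definition fun_graph :: "'v set => ('v => 'v) set => 'v ugraph" where
  "fun_graph V F = \<lparr>verts = V, edges = {{f v, v} | f v. f \<in> F \<and> v \<in> V \<and> f v \<noteq> v}\<rparr>"

text \<open>A new edge joins \<open>f c\<close> to c or to a neighbour of c, so it becomes a path
  through c once each branch set S is enlarged to \<open>B S\<close>, the vertices that some
  function sends into S. A vertex lies in at most \<open>length fs\<close> enlarged sets, since S is
  determined by the index of a function sending the vertex into it. Radius r grows to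
  \<open>2 * r + 1\<close>: twice r for the detours, and one for the last step to a preimage. With
  congestion \<open>length fs\<close> this radius gives the exponent
  \<open>4 * r + 4\<close>.\<close>

lemma augmentation_sparse:
  fixes fs :: "('v => 'v) list"
  assumes gr: "grad_le (2 * r + 1) D (fun_graph V (set fs))" and fin: "finite V"
    and idf: "\<exists>f\<in>set fs. \<forall>v\<in>V. f v = v"
    and clV: "\<And>f v. f \<in> set fs ==> v \<in> V ==> f v \<in> V"
    and VH: "verts H = V"
    and H: "edges H \<subseteq> {{f c, w} | f c w. f \<in> set fs \<and> c \<in> V \<and> w \<in> V \<and>
               (w = c \<or> (\<exists>g\<in>set fs. g c = w \<or> g w = c))}"
  shows "grad_le r (length fs ^ (4 * r + 4) * D + length fs) H"
  unfolding grad_le_def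
proof (intro allI impI)
  fix M assume M: "shallow_minor r H M"
  let ?G = "fun_graph V (set fs)"
  define B where "B S = {c \<in> V. \<exists>a<length fs. (fs ! a) c \<in> S}" for S
  define num where "num S c = (LEAST a. a < length fs \<and> (fs ! a) c \<in> S)" for S c
  have SV: "S \<subseteq> V" if "S \<in> verts M" for S using M that VH by (auto simp: shallow_minor_def)
  have "\<exists>x\<in>S. \<forall>v\<in>S. \<exists>i\<le>r. (x, v) \<in> adj_in H S ^^ i" if "S \<in> verts M" for S
    using M that by (auto simp: shallow_minor_def radius_le_def)
  then obtain x where x: "\<And>S. S \<in> verts M ==> x S \<in> S \<and> (\<forall>v\<in>S. \<exists>i\<le>r. (x S, v) \<in> adj_in H S ^^ i)"
    by metis
  have Bmem: "c \<in> B S \<longleftrightarrow> c \<in> V \<and> (\<exists>f\<in>set fs. f c \<in> S)" for c S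
    unfolding B_def by (auto simp: in_set_conv_nth Bex_def)
  have SB: "S \<subseteq> B S" if "S \<in> verts M" for S
  proof
    fix c assume c: "c \<in> S"
    then have "c \<in> V" using SV that by blast
    moreover obtain f where "f \<in> set fs" "f c = c" using idf \<open>c \<in> V\<close> by blast
    ultimately show "c \<in> B S" using c unfolding Bmem by metis
  qed
  have Gedge: "{f v, v} \<in> edges ?G \<and> {v, f v} \<in> edges ?G" if "f \<in> set fs" "v \<in> V" "f v \<noteq> v" for f v
    using that unfolding fun_graph_def by (auto simp: insert_commute)
  have stp: "\<exists>k\<le>1. (a, b) \<in> adj_in ?G (B S) ^^ k"
    if "a \<in> B S" "b \<in> B S" "a = b \<or> (\<exists>g\<in>set fs. g a = b \<or> g b = a)" for a b S
  proof (cases "a = b")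
    case True then show ?thesis by (intro exI[of _ 0]) auto
  next
    case False
    then have "{a, b} \<in> edges ?G" using that Gedge Bmem by metis
    then show ?thesis using that by (intro exI[of _ 1]) (auto simp: adj_in_def)
  qed
  have Hedge: "\<exists>f c w. e = {f c, w} \<and> f \<in> set fs \<and> c \<in> V \<and> w \<in> V \<and>
      (w = c \<or> (\<exists>g\<in>set fs. g c = w \<or> g w = c))" if "e \<in> edges H" for e
    using subsetD[OF H that] by simp
  \<comment> \<open>The middle vertex c belongs to the enlarged set because \<open>f c\<close> lies
    in S, so the detour does not leave \<open>B S\<close>.\<close>
  have two: "\<exists>k\<le>2. (a, b) \<in> adj_in ?G (B S) ^^ k"
    if S: "S \<in> verts M" and ab: "(a, b) \<in> adj_in H S" for a b S
  proof -
    have "a \<in> S" "b \<in> S" "{a, b} \<in> edges H" using ab by (auto simp: adj_in_def)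
    from Hedge[OF this(3)] obtain f c w where fc: "{a, b} = {f c, w}" "f \<in> set fs" "c \<in> V" "w \<in> V"
       "w = c \<or> (\<exists>g\<in>set fs. g c = w \<or> g w = c)" by metis
    have "f c \<in> S" "w \<in> S"
      using fc(1) \<open>a \<in> S\<close> \<open>b \<in> S\<close> unfolding doubleton_eq_iff by blast+
    have inB: "f c \<in> B S" "w \<in> B S" "c \<in> B S"
      using SB[OF S] \<open>f c \<in> S\<close> \<open>w \<in> S\<close> fc Bmem by blast+
    from stp[OF inB(1,3)] stp[OF inB(3,2)] obtain k l where
      kl: "k \<le> 1" "(f c, c) \<in> adj_in ?G (B S) ^^ k" "l \<le> 1" "(c, w) \<in> adj_in ?G (B S) ^^ l" using fc by blast
    from stp[OF inB(3,1)] stp[OF inB(2,3)] obtain k' l' where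
      kl': "k' \<le> 1" "(c, f c) \<in> adj_in ?G (B S) ^^ k'" "l' \<le> 1" "(w, c) \<in> adj_in ?G (B S) ^^ l'" using fc by blast
    have "(f c, w) \<in> adj_in ?G (B S) ^^ (k + l)" "(w, f c) \<in> adj_in ?G (B S) ^^ (l' + k')"
      using kl kl' by (auto simp: relpow_add)
    moreover have "k + l \<le> 2" "l' + k' \<le> 2" using kl kl' by auto
    ultimately show ?thesis using fc(1) unfolding doubleton_eq_iff by metis
  qed
  have multi: "(a, b) \<in> adj_in H S ^^ i ==> \<exists>k\<le>2 * i. (a, b) \<in> adj_in ?G (B S) ^^ k"
    if S: "S \<in> verts M" for a b S i
  proof (induction i arbitrary: b)
    case 0 then show ?case by auto
  next
    case (Suc i)
    then obtain c where "(a, c) \<in> adj_in H S ^^ i" "(c, b) \<in> adj_in H S" by auto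
    then obtain k l where "k \<le> 2 * i" "(a, c) \<in> adj_in ?G (B S) ^^ k" "l \<le> 2" "(c, b) \<in> adj_in ?G (B S) ^^ l"
      using Suc.IH two[OF S] by blast
    then show ?case by (intro exI[of _ "k + l"]) (auto simp: relpow_add)
  qed
  have num: "num S c < length fs \<and> (fs ! num S c) c \<in> S" if "c \<in> B S" for S c
    using that LeastI_ex[of "\<lambda>a. a < length fs \<and> (fs ! a) c \<in> S"] by (auto simp: num_def B_def)
  have m0: "length fs > 0" using idf by (cases fs) auto
  have "card (edges M) \<le> (length fs ^ (2 * (2 * r + 1) + 2) * D + length fs) * card (verts M)"
  proof (rule congested_minor_sparse[of _ _ ?G _ _ B x num])
    show "grad_le (2 * r + 1) D ?G" by (rule gr)
    show "finite (verts ?G)" using fin by (simp add: fun_graph_def)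
    show "finite (verts M)" by (rule finite_subset[of _ "Pow V"]) (use SV fin in auto)
    show "length fs > 0" by (rule m0)
    fix S assume S: "S \<in> verts M"
    show "B S \<subseteq> verts ?G \<and> x S \<in> B S \<and> (\<forall>v\<in>B S. \<exists>k\<le>2 * r + 1. (x S, v) \<in> adj_in ?G (B S) ^^ k)"
    proof (intro conjI ballI)
      show "B S \<subseteq> verts ?G" by (auto simp: B_def fun_graph_def)
      show "x S \<in> B S" using x[OF S] SB[OF S] by blast
      fix v assume v: "v \<in> B S"
      then obtain f where f: "f \<in> set fs" "f v \<in> S" using Bmem by blast
      then obtain i where "i \<le> r" "(x S, f v) \<in> adj_in H S ^^ i" using x[OF S] by blast
      then obtain k where k: "k \<le> 2 * r" "(x S, f v) \<in> adj_in ?G (B S) ^^ k" using multi[OF S]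
        by (meson le_trans mult_le_mono2)
      obtain l where "l \<le> 1" "(f v, v) \<in> adj_in ?G (B S) ^^ l"
        using stp[of "f v" S v] f v SB[OF S] by blast
      with k show "\<exists>k\<le>2 * r + 1. (x S, v) \<in> adj_in ?G (B S) ^^ k"
        by (intro exI[of _ "k + l"]) (auto simp: relpow_add)
    qed
  next
    fix S c assume "S \<in> verts M" "c \<in> B S"
    then show "num S c < length fs" using num by blast
  next
    fix S T c assume ST: "S \<in> verts M" "T \<in> verts M" "S \<noteq> T" "c \<in> B S" "c \<in> B T"
    have "S \<inter> T = {}" using M ST by (auto simp: shallow_minor_def)
    then show "num S c \<noteq> num T c" using ST num by (metis disjoint_iff)
  next
    show "edges M \<subseteq> {{i, j} | i j. i \<in> verts M \<and> j \<in> verts M \<and> i \<noteq> j \<and>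
       (\<exists>a\<in>B i. \<exists>b\<in>B j. a = b \<or> {a, b} \<in> edges ?G)}"
    proof
      fix e assume "e \<in> edges M"
      from doubletonsE[OF conjunct2[OF conjunct2[OF M[unfolded shallow_minor_def]]] this]
      obtain S T where "e = {S, T}" and
        "S \<in> verts M \<and> T \<in> verts M \<and> S \<noteq> T \<and> (\<exists>a\<in>S. \<exists>b\<in>T. {a, b} \<in> edges H)" .
      then obtain a b where e: "e = {S, T}" "S \<in> verts M" "T \<in> verts M" "S \<noteq> T" "a \<in> S" "b \<in> T"
        "{a, b} \<in> edges H" by blast
      from Hedge[OF e(7)] obtain f c w where fc: "{a, b} = {f c, w}" "f \<in> set fs" "c \<in> V" "w \<in> V"
        "w = c \<or> (\<exists>g\<in>set fs. g c = w \<or> g w = c)" by metis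
      \<comment> \<open>The edge between S and T is traced back to the pair c, w: c belongs to the
        enlargement of the set containing \<open>f c\<close>, and w lies in the other set.\<close>
      have cw: "c = w \<or> {c, w} \<in> edges ?G \<and> {w, c} \<in> edges ?G" using fc Gedge by metis
      show "e \<in> {{i, j} | i j. i \<in> verts M \<and> j \<in> verts M \<and> i \<noteq> j \<and>
         (\<exists>a\<in>B i. \<exists>b\<in>B j. a = b \<or> {a, b} \<in> edges ?G)}"
      proof (cases "f c \<in> S")
        case True
        then have "w = b \<and> a = f c \<or> w = a \<and> b = f c" using fc(1) unfolding doubleton_eq_iff by blast
        moreover have "S \<inter> T = {}" using M e by (auto simp: shallow_minor_def)
        ultimately have "w = b" using True e by auto
        then have "w \<in> B T" "c \<in> B S" using e SB True fc Bmem by blast+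
        then show ?thesis using e cw by blast
      next
        case False
        then have "w = a \<and> b = f c" using fc(1) e(5) unfolding doubleton_eq_iff by blast
        then have "w \<in> B S" "c \<in> B T" using e SB fc Bmem by blast+
        then show ?thesis using e cw by blast
      qed
    qed
  qed
  then show "card (edges M) \<le> (length fs ^ (4 * r + 4) * D + length fs) * card (verts M)"
    by (simp add: algebra_simps numeral_eq_Suc)
qed

section \<open>While programs for the machine\<close>

type_synonym st = "(nat => int) \<times> (nat => int)"

datatype com = Bas instr | Seq com com (infixr \<open>;;\<close> 60) | If nat com com | While nat com

fun no_jump :: "instr => bool" where
  "no_jump (Jump_pos _ _) = False" | "no_jump _ = True"

text \<open>Big-step semantics with the exact number of steps of the compiled code. Provided that I
  holds initially, it holds at every state on the way, which serves to bound all registers and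
  cells. The added 1 and 3 count a test alone and a test together with an unconditional jump, which
  takes two instructions.\<close>

inductive bs :: "(nat => nat) => (st => bool) => com => st => nat => st => bool"
  for h I where
  Bas: "no_jump i ==> I (snd (exec h i (0, s))) ==> bs h I (Bas i) s 1 (snd (exec h i (0, s)))"
| Seq: "bs h I c1 s t1 s1 ==> bs h I c2 s1 t2 s2 ==> bs h I (c1 ;; c2) s (t1 + t2) s2"
| IfT: "R r > 0 ==> bs h I c1 (R, M) t s' ==> bs h I (If r c1 c2) (R, M) (t + 1) s'"
| IfF: "\<not> R r > 0 ==> bs h I c2 (R, M) t (R', M') ==> I (R'(1 := 1), M') ==>
        bs h I (If r c1 c2) (R, M) (t + 3) (R'(1 := 1), M')"
| WhF: "\<not> R r > 0 ==> I (R(1 := 1), M) ==> bs h I (While r c) (R, M) 3 (R(1 := 1), M)"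
| WhT: "R r > 0 ==> bs h I c (R, M) t (R', M') ==> I (R'(1 := 1), M') ==>
        bs h I (While r c) (R'(1 := 1), M') t' s2 ==> bs h I (While r c) (R, M) (t + t' + 3) s2"

primrec clen :: "com => nat" where
  "clen (Bas i) = 1"
| "clen (c1 ;; c2) = clen c1 + clen c2"
| "clen (If r c1 c2) = clen c1 + clen c2 + 3"
| "clen (While r c) = clen c + 5"

text \<open>Register 1 is scratch: the compiled code jumps unconditionally by setting it to 1.\<close>

primrec compile :: "nat => com => instr list" where
  "compile a (Bas i) = [i]"
| "compile a (c1 ;; c2) = compile a c1 @ compile (a + clen c1) c2"
| "compile a (If r c1 c2) = [Jump_pos r (a + 3 + clen c2)] @ compile (a + 1) c2 @
     [Const 1 1, Jump_pos 1 (a + 3 + clen c2 + clen c1)] @ compile (a + 3 + clen c2) c1"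
| "compile a (While r c) = [Jump_pos r (a + 3), Const 1 1, Jump_pos 1 (a + 5 + clen c)] @
     compile (a + 3) c @ [Const 1 1, Jump_pos 1 a]"

lemma length_comp: "length (compile a c) = clen c"
  by (induction c arbitrary: a) auto

definition code_at :: "instr list => nat => instr list => bool" where
  "code_at P a xs \<longleftrightarrow> (\<forall>i<length xs. a + i < length P \<and> P ! (a + i) = xs ! i)"

lemma code_at_append: "code_at P a (xs @ ys) \<longleftrightarrow> code_at P a xs \<and> code_at P (a + length xs) ys"
proof
  assume A: "code_at P a (xs @ ys)"
  have "a + length xs + i < length P \<and> P ! (a + length xs + i) = ys ! i" if "i < length ys" for i
    using A that unfolding code_at_def by (auto dest: spec[of _ "length xs + i"] simp: add.assoc)
  moreover have "a + i < length P \<and> P ! (a + i) = xs ! i" if "i < length xs" for i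
    using A that unfolding code_at_def by (auto dest: spec[of _ i] simp: nth_append)
  ultimately show "code_at P a xs \<and> code_at P (a + length xs) ys" by (simp add: code_at_def)
next
  assume A: "code_at P a xs \<and> code_at P (a + length xs) ys"
  show "code_at P a (xs @ ys)" unfolding code_at_def
  proof (intro allI impI)
    fix i assume "i < length (xs @ ys)"
    then show "a + i < length P \<and> P ! (a + i) = (xs @ ys) ! i"
      using A unfolding code_at_def
      by (cases "i < length xs") (auto simp: nth_append dest: spec[of _ "i - length xs"])
  qed
qed

lemma code_at_Cons: "code_at P a (x # xs) \<longleftrightarrow> a < length P \<and> P ! a = x \<and> code_at P (a + 1) xs"
  using code_at_append[of P a "[x]" xs] by (simp add: code_at_def)

definition reach :: "instr list => (nat => nat) => (st => bool) => config => nat => config => bool" where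
  "reach P h I c t c' \<longleftrightarrow> run h P t c = c' \<and> (\<forall>k\<le>t. I (snd (run h P k c)))"

lemma run_add: "run h P (s + t) c = run h P t (run h P s c)"
  unfolding run_def by (metis add.commute comp_apply funpow_add)

lemma reach_trans: "reach P h I c t c' ==> reach P h I c' t' c'' ==> reach P h I c (t + t') c''"
  unfolding reach_def
proof (intro conjI allI impI)
  assume a: "run h P t c = c' \<and> (\<forall>k\<le>t. I (snd (run h P k c)))"
    "run h P t' c' = c'' \<and> (\<forall>k\<le>t'. I (snd (run h P k c')))"
  show "run h P (t + t') c = c''" using a by (simp add: run_add)
  fix k assume k: "k \<le> t + t'"
  show "I (snd (run h P k c))"
  proof (cases "k \<le> t")
    case True then show ?thesis using a by simp
  next
    case False
    then have "run h P k c = run h P (k - t) c'" using a run_add[of h P t "k - t" c] by simp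
    then show ?thesis using a k False by simp
  qed
qed

lemma reach_step:
  "fst c < length P ==> I (snd c) ==> exec h (P ! fst c) c = c' ==> I (snd c') ==> reach P h I c 1 c'"
  by (auto simp: reach_def run_def step_def halted_def le_Suc_eq)

lemma exec_no_jump: "no_jump i ==> exec h i (a, s) = (a + 1, snd (exec h i (0, s)))"
  by (cases i; cases s) auto

text \<open>The claim is about any program P that contains the compiled code at address a, since the
  pieces of a compound command sit at different places of one program and jump targets are
  absolute.\<close>

lemma comp_correct:
  "bs h I c s t s' ==> I s ==> code_at P a (compile a c) ==>
   reach P h I (a, s) t (a + clen c, s') \<and> I s'"
proof (induction arbitrary: a rule: bs.induct)
  case (Bas i s)
  have "reach P h I (a, s) 1 (a + 1, snd (exec h i (0, s)))"
    by (rule reach_step) (use Bas exec_no_jump[OF Bas.hyps(1), of h a s] in \<open>auto simp: code_at_Cons\<close>)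
  then show ?case using Bas by simp
next
  case (Seq c1 s t1 s1 c2 t2 s2)
  then have "reach P h I (a, s) t1 (a + clen c1, s1) \<and> I s1"
    "reach P h I (a + clen c1, s1) t2 (a + clen c1 + clen c2, s2) \<and> I s2"
    by (auto simp: code_at_append length_comp)
  then show ?case using reach_trans by (metis add.assoc clen.simps(2))
next
  case (IfT R r c1 M t s' c2)
  have "reach P h I (a, R, M) 1 (a + 3 + clen c2, R, M)"
    by (rule reach_step) (use IfT in \<open>auto simp: code_at_Cons\<close>)
  moreover have "reach P h I (a + 3 + clen c2, R, M) t (a + 3 + clen c2 + clen c1, s') \<and> I s'"
    by (rule IfT.IH) (use IfT.prems in \<open>auto simp: code_at_append code_at_Cons length_comp algebra_simps numeral_eq_Suc\<close>)
  ultimately have "reach P h I (a, R, M) (1 + t) (a + 3 + clen c2 + clen c1, s') \<and> I s'"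
    using reach_trans by metis
  then show ?case by (simp add: algebra_simps)
next
  case (IfF R r c2 M t R' M' c1)
  have c: "a < length P" "P ! a = Jump_pos r (a + 3 + clen c2)" "code_at P (a + 1) (compile (a + 1) c2)"
    "a + 1 + clen c2 < length P" "P ! (a + 1 + clen c2) = Const 1 1"
    "a + 2 + clen c2 < length P" "P ! (a + 2 + clen c2) = Jump_pos 1 (a + 3 + clen c2 + clen c1)"
    using IfF.prems by (auto simp: code_at_append code_at_Cons length_comp algebra_simps)
  have "reach P h I (a, R, M) 1 (a + 1, R, M)"
    by (rule reach_step) (use IfF c in auto)
  moreover have r2: "reach P h I (a + 1, R, M) t (a + 1 + clen c2, R', M') \<and> I (R', M')"
    by (rule IfF.IH) (use IfF.prems c in auto)
  moreover have "reach P h I (a + 1 + clen c2, R', M') 1 (a + 2 + clen c2, R'(1 := 1), M')"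
    by (rule reach_step) (use IfF r2 c in auto)
  moreover have "reach P h I (a + 2 + clen c2, R'(1 := 1), M') 1 (a + 3 + clen c2 + clen c1, R'(1 := 1), M')"
    by (rule reach_step) (use IfF c in auto)
  ultimately have "reach P h I (a, R, M) (1 + t + 1 + 1) (a + 3 + clen c2 + clen c1, R'(1 := 1), M')"
    using reach_trans by metis
  then show ?case using IfF.hyps(3) by (simp add: algebra_simps numeral_eq_Suc)
next
  case (WhF R r M c)
  have c: "a < length P" "P ! a = Jump_pos r (a + 3)" "a + 1 < length P" "P ! (a + 1) = Const 1 1"
    "a + 2 < length P" "P ! (a + 2) = Jump_pos 1 (a + 5 + clen c)"
    using WhF.prems by (auto simp: code_at_append code_at_Cons)
  have "reach P h I (a, R, M) 1 (a + 1, R, M)"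
    by (rule reach_step) (use WhF c in auto)
  moreover have "reach P h I (a + 1, R, M) 1 (a + 2, R(1 := 1), M)"
    by (rule reach_step) (use WhF c in auto)
  moreover have "reach P h I (a + 2, R(1 := 1), M) 1 (a + 5 + clen c, R(1 := 1), M)"
    by (rule reach_step) (use WhF c in auto)
  ultimately have "reach P h I (a, R, M) (1 + 1 + 1) (a + 5 + clen c, R(1 := 1), M)"
    using reach_trans by metis
  then show ?case using WhF by (simp add: algebra_simps numeral_eq_Suc)
next
  case (WhT R r c M t R' M' t' s2)
  have c: "a < length P" "P ! a = Jump_pos r (a + 3)" "code_at P (a + 3) (compile (a + 3) c)"
    "a + 3 + clen c < length P" "P ! (a + 3 + clen c) = Const 1 1"
    "a + 4 + clen c < length P" "P ! (a + 4 + clen c) = Jump_pos 1 a"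
    using WhT.prems by (auto simp: code_at_append code_at_Cons length_comp algebra_simps numeral_eq_Suc)
  have "reach P h I (a, R, M) 1 (a + 3, R, M)"
    by (rule reach_step) (use WhT c in auto)
  moreover have r2: "reach P h I (a + 3, R, M) t (a + 3 + clen c, R', M') \<and> I (R', M')"
    by (rule WhT.IH(1)) (use WhT.prems c in auto)
  moreover have "reach P h I (a + 3 + clen c, R', M') 1 (a + 4 + clen c, R'(1 := 1), M')"
    by (rule reach_step) (use WhT r2 c in auto)
  moreover have "reach P h I (a + 4 + clen c, R'(1 := 1), M') 1 (a, R'(1 := 1), M')"
    by (rule reach_step) (use WhT c in auto)
  moreover have r3: "reach P h I (a, R'(1 := 1), M') t' (a + clen (While r c), s2) \<and> I s2"
    by (rule WhT.IH(2)) (use WhT in auto)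
  ultimately have "reach P h I (a, R, M) (1 + t + 1 + 1 + t') (a + clen (While r c), s2)"
    using reach_trans by metis
  then show ?case using r3 by (simp add: algebra_simps numeral_eq_Suc)
qed

lemma compile_correct:
  assumes "bs h I c s t s'" "I s"
  shows "run h (compile 0 c) t (0, s) = (length (compile 0 c), s') \<and> (\<forall>k\<le>t. I (snd (run h (compile 0 c) k (0, s))))"
proof -
  have "code_at (compile 0 c) 0 (compile 0 c)" by (simp add: code_at_def)
  from comp_correct[OF assms this] show ?thesis by (simp add: reach_def length_comp)
qed

section \<open>Primitive recursive functions are computable\<close>

definition ex :: "(nat => nat) => com => st => st => bool" where
  "ex h c s s' \<longleftrightarrow> (\<exists>t. bs h (\<lambda>_. True) c s t s')"

lemma ex_Bas: "no_jump i ==> snd (exec h i (0, s)) = s' ==> ex h (Bas i) s s'"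
  unfolding ex_def using bs.Bas[of i "\<lambda>_. True" h s] by auto

lemma ex_Seq: "ex h c1 s s1 ==> ex h c2 s1 s2 ==> ex h (c1 ;; c2) s s2"
  unfolding ex_def using bs.Seq by blast

lemma ex_If:
  "(R r > 0 ==> ex h c1 (R, M) (R', M')) ==>
   (\<not> R r > 0 ==> \<exists>R''. ex h c2 (R, M) (R'', M') \<and> R' = R''(1 := 1)) ==> ex h (If r c1 c2) (R, M) (R', M')"
  unfolding ex_def using bs.IfT[of R r h "\<lambda>_. True"] bs.IfF[of R r h "\<lambda>_. True"] by metis

definition mv :: "nat => nat => com" where
  "mv i j = Bas (Const 1 0) ;; Bas (Add i j 1)"

lemma ex_mv: "j \<noteq> 1 ==> ex h (mv i j) (R, M) (R(1 := 0, i := R j), M)"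
  unfolding mv_def by (rule ex_Seq, rule ex_Bas, simp, simp, rule ex_Bas, simp, simp)

definition Rep :: "nat => com => com" where
  "Rep r c = While r (c ;; Bas (Const 1 1) ;; Bas (Sub r r 1))"

text \<open>The index j of the invariant counts finished rounds, while register r counts down; the
  body may read r but has to preserve it. Stability under writing register 1 is required because the
  loop itself overwrites it.\<close>

lemma ex_Rep:
  assumes r: "r \<noteq> 1"
    and body: "\<And>j R M. j < k ==> Inv j R M ==> R r = int (k - j) ==>
       \<exists>R' M'. ex h c (R, M) (R', M') \<and> R' r = R r \<and> Inv (Suc j) (R'(1 := 1, r := int (k - Suc j))) M'"
    and "Inv 0 R M" "R r = int k"
    and stable: "\<And>j R M. Inv j R M ==> Inv j (R(1 := 1)) M"
  shows "\<exists>R' M'. ex h (Rep r c) (R, M) (R', M') \<and> Inv k R' M' \<and> R' r = 0"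
proof -
  have "j \<le> k ==> Inv j R M ==> R r = int (k - j) ==>
     \<exists>R' M'. ex h (Rep r c) (R, M) (R', M') \<and> Inv k R' M' \<and> R' r = 0" for j R M
  proof (induction "k - j" arbitrary: j R M)
    case 0
    then have "ex h (Rep r c) (R, M) (R(1 := 1), M)" unfolding Rep_def ex_def
      by (intro exI[of _ 3] bs.WhF) auto
    then show ?case using 0 r stable by fastforce
  next
    case (Suc d)
    then have "j < k" by simp
    with Suc body obtain R' M' where b: "ex h c (R, M) (R', M')" "R' r = R r"
      "Inv (Suc j) (R'(1 := 1, r := int (k - Suc j))) M'" by meson
    let ?R = "R'(1 := 1, r := int (k - Suc j))"
    have "ex h (c ;; Bas (Const 1 1) ;; Bas (Sub r r 1)) (R, M) (?R, M')"
      by (rule ex_Seq[OF b(1)], rule ex_Seq, rule ex_Bas, simp, simp, rule ex_Bas)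
        (use r b(2) Suc.prems \<open>j < k\<close> in auto)
    then obtain t where t: "bs h (\<lambda>_. True) (c ;; Bas (Const 1 1) ;; Bas (Sub r r 1)) (R, M) t (?R, M')"
      unfolding ex_def by blast
    have "?R(1 := 1) = ?R" using r by auto
    moreover obtain R2 M2 where e: "ex h (Rep r c) (?R, M') (R2, M2)" "Inv k R2 M2" "R2 r = 0"
    proof -
      have "d = k - Suc j" "?R r = int (k - Suc j)" "Suc j \<le> k" using Suc.hyps(2) \<open>j < k\<close> by auto
      from Suc.hyps(1)[OF this(1,3) b(3) this(2)] show ?thesis using that by blast
    qed
    moreover obtain t' where "bs h (\<lambda>_. True) (Rep r c) (?R, M') t' (R2, M2)" using e(1) unfolding ex_def by blast
    moreover have "R r > 0" using Suc.prems \<open>j < k\<close> by simp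
    ultimately have "bs h (\<lambda>_. True) (Rep r c) (R, M) (t + t' + 3) (R2, M2)"
      unfolding Rep_def by (intro bs.WhT[OF _ t]) auto
    then show ?case using e unfolding ex_def by blast
  qed
  from this[of 0] assms show ?thesis by simp
qed

text \<open>Argument and result share register d, and everything below d except the scratch register
  1 survives. Values that are still needed can thus be stacked below the base of the next
  program.\<close>

definition realizes :: "(nat => nat) => (nat => nat) => com => nat => bool" where
  "realizes h f c d \<longleftrightarrow> (\<forall>R M x. R d = int x -->
     (\<exists>R'. ex h c (R, M) (R', M) \<and> R' d = int (f x) \<and> (\<forall>i<d. i \<noteq> 1 --> R' i = R i)))"

text \<open>Being realisable at every base register makes these functions closed under composition
  and iteration. Registers 0 and 1 are no bases: the former carries input and output of the whole
  program, the latter is scratch.\<close>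

definition prec :: "(nat => nat) => (nat => nat) => bool" where
  "prec h f \<longleftrightarrow> (\<forall>d\<ge>2. \<exists>c. realizes h f c d)"

lemma realizesD:
  "realizes h f c d ==> R d = int x ==>
     \<exists>R'. ex h c (R, M) (R', M) \<and> R' d = int (f x) \<and> (\<forall>i<d. i \<noteq> 1 --> R' i = R i)"
  by (simp add: realizes_def)

lemma prec_id: "prec h (\<lambda>x. x)"
  unfolding prec_def realizes_def using ex_mv by (intro allI impI exI[of _ "mv 1 0"]) (fastforce simp: ex_mv)

lemma prec_const: "prec h (\<lambda>x. k)"
  unfolding prec_def realizes_def
proof (intro allI impI)
  fix d :: nat assume "2 \<le> d"
  have "ex h (Bas (Const d (int k))) (R, M) (R(d := int k), M)" for R M by (rule ex_Bas) auto
  then show "\<exists>c. \<forall>R M x. R d = int x -->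
     (\<exists>R'. ex h c (R, M) (R', M) \<and> R' d = int k \<and> (\<forall>i<d. i \<noteq> 1 --> R' i = R i))"
    by (intro exI[of _ "Bas (Const d (int k))"]) fastforce
qed

lemma prec_oracle: "prec h h"
  unfolding prec_def realizes_def
proof (intro allI impI)
  fix d :: nat assume "2 \<le> d"
  have "ex h (Bas (Query d d)) (R, M) (R(d := int (h (nat (R d)))), M)" for R M by (rule ex_Bas) auto
  then show "\<exists>c. \<forall>R M x. R d = int x -->
     (\<exists>R'. ex h c (R, M) (R', M) \<and> R' d = int (h x) \<and> (\<forall>i<d. i \<noteq> 1 --> R' i = R i))"
    by (intro exI[of _ "Bas (Query d d)"]) fastforce
qed

lemma prec_comp:
  assumes "prec h f" "prec h g" shows "prec h (\<lambda>x. f (g x))"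
  unfolding prec_def
proof (intro allI impI)
  fix d :: nat assume "2 \<le> d"
  then obtain c1 c2 where c: "realizes h f c1 d" "realizes h g c2 d" using assms unfolding prec_def by blast
  have "realizes h (\<lambda>x. f (g x)) (c2 ;; c1) d" unfolding realizes_def
  proof (intro allI impI)
    fix R M x assume "R d = int x"
    from realizesD[OF c(2), of R, OF this] obtain R1 where r1: "ex h c2 (R, M) (R1, M)" "R1 d = int (g x)"
      "\<forall>i<d. i \<noteq> 1 --> R1 i = R i" by blast
    from realizesD[OF c(1), of R1, OF this(2)] obtain R2 where "ex h c1 (R1, M) (R2, M)" "R2 d = int (f (g x))"
      "\<forall>i<d. i \<noteq> 1 --> R2 i = R1 i" by blast
    with r1 show "\<exists>R'. ex h (c2 ;; c1) (R, M) (R', M) \<and> R' d = int (f (g x)) \<and> (\<forall>i<d. i \<noteq> 1 --> R' i = R i)"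
      by (intro exI[of _ R2]) (auto intro: ex_Seq)
  qed
  then show "\<exists>c. realizes h (\<lambda>x. f (g x)) c d" by blast
qed

lemma prec_binary:
  assumes "prec h f" "prec h g"
    and c: "\<And>d. d \<ge> 2 ==> \<exists>c. \<forall>R M x y. R d = int x --> R (d + 1) = int y -->
     (\<exists>R'. ex h c (R, M) (R', M) \<and> R' d = int (b x y) \<and> (\<forall>i<d. i \<noteq> 1 --> R' i = R i))"
  shows "prec h (\<lambda>x. b (f x) (g x))"
  unfolding prec_def
proof (intro allI impI)
  fix d :: nat assume d: "2 \<le> d"
  then obtain c1 c2 where cc: "realizes h f c1 (d + 1)" "realizes h g c2 (d + 2)"
    using assms unfolding prec_def by (meson trans_le_add1)
  have "d + 2 = d + 1 + 1" by simp
  then obtain c3 where c3: "\<forall>R M x y. R (d + 1) = int x --> R (d + 2) = int y -->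
     (\<exists>R'. ex h c3 (R, M) (R', M) \<and> R' (d + 1) = int (b x y) \<and> (\<forall>i<d + 1. i \<noteq> 1 --> R' i = R i))"
    using c[of "d + 1"] d by (metis trans_le_add1)
  have "realizes h (\<lambda>x. b (f x) (g x)) (mv (d + 1) d ;; c1 ;; mv (d + 2) d ;; c2 ;; c3 ;; mv d (d + 1)) d"
    unfolding realizes_def
  proof (intro allI impI)
    fix R M x assume x: "R d = int x"
    define R0 where "R0 = R(1 := 0, d + 1 := R d)"
    have e0: "ex h (mv (d + 1) d) (R, M) (R0, M)" unfolding R0_def by (rule ex_mv) (use d in simp)
    have "R0 (d + 1) = int x" using x by (simp add: R0_def)
    from realizesD[OF cc(1), of R0, OF this] obtain R1 where r1: "ex h c1 (R0, M) (R1, M)" "R1 (d + 1) = int (f x)"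
      "\<forall>i<d + 1. i \<noteq> 1 --> R1 i = R0 i" by blast
    define R2 where "R2 = R1(1 := 0, d + 2 := R1 d)"
    have e2: "ex h (mv (d + 2) d) (R1, M) (R2, M)" unfolding R2_def by (rule ex_mv) (use d in simp)
    have "R2 (d + 2) = int x" using x r1(3) d by (simp add: R2_def R0_def)
    from realizesD[OF cc(2), of R2, OF this] obtain R3 where r3: "ex h c2 (R2, M) (R3, M)" "R3 (d + 2) = int (g x)"
      "\<forall>i<d + 2. i \<noteq> 1 --> R3 i = R2 i" by blast
    have "R3 (d + 1) = int (f x)" using r3(3) r1(2) d by (simp add: R2_def)
    from c3[rule_format, OF this r3(2)] obtain R4 where r4: "ex h c3 (R3, M) (R4, M)" "R4 (d + 1) = int (b (f x) (g x))"
      "\<forall>i<d + 1. i \<noteq> 1 --> R4 i = R3 i" by blast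
    define R5 where "R5 = R4(1 := 0, d := R4 (d + 1))"
    have e5: "ex h (mv d (d + 1)) (R4, M) (R5, M)" unfolding R5_def by (rule ex_mv) (use d in simp)
    have "R5 d = int (b (f x) (g x))" using r4 by (simp add: R5_def)
    moreover have "\<forall>i<d. i \<noteq> 1 --> R5 i = R i" using r4(3) r3(3) r1(3) by (simp add: R5_def R2_def R0_def)
    moreover have "ex h (mv (d + 1) d ;; c1 ;; mv (d + 2) d ;; c2 ;; c3 ;; mv d (d + 1)) (R, M) (R5, M)"
      using e0 r1(1) e2 r3(1) r4(1) e5 by (blast intro: ex_Seq)
    ultimately show "\<exists>R'. ex h (mv (d + 1) d ;; c1 ;; mv (d + 2) d ;; c2 ;; c3 ;; mv d (d + 1)) (R, M) (R', M) \<and>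
      R' d = int (b (f x) (g x)) \<and> (\<forall>i<d. i \<noteq> 1 --> R' i = R i)" by blast
  qed
  then show "\<exists>c. realizes h (\<lambda>x. b (f x) (g x)) c d" by blast
qed

lemma prec_add: "prec h f ==> prec h g ==> prec h (\<lambda>x. f x + g x)"
proof (erule prec_binary[where b = "(+)"], assumption)
  fix d :: nat assume "d \<ge> 2"
  have "ex h (Bas (Add d d (d + 1))) (R, M) (R(d := R d + R (d + 1)), M)" for R M by (rule ex_Bas) auto
  then show "\<exists>c. \<forall>R M x y. R d = int x --> R (d + 1) = int y -->
     (\<exists>R'. ex h c (R, M) (R', M) \<and> R' d = int (x + y) \<and> (\<forall>i<d. i \<noteq> 1 --> R' i = R i))"
    by (intro exI[of _ "Bas (Add d d (d + 1))"]) fastforce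
qed

lemma prec_diff: "prec h f ==> prec h g ==> prec h (\<lambda>x. f x - g x)"
proof (erule prec_binary[where b = "(-)"], assumption)
  fix d :: nat assume d: "d \<ge> 2"
  let ?c = "Bas (Sub d d (d + 1)) ;; If d (Bas (Const 1 0)) (Bas (Const d 0))"
  have "\<exists>R'. ex h ?c (R, M) (R', M) \<and> R' d = int (x - y) \<and> (\<forall>i<d. i \<noteq> 1 --> R' i = R i)"
    if "R d = int x" "R (d + 1) = int y" for R M x y
  proof -
    let ?R = "R(d := R d - R (d + 1))"
    define R' where "R' = (if x > y then ?R(1 := 0) else ?R(d := 0, 1 := 1))"
    have "ex h ?c (R, M) (R', M)"
    proof (rule ex_Seq)
      show "ex h (Bas (Sub d d (d + 1))) (R, M) (?R, M)" by (rule ex_Bas) auto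
      show "ex h (If d (Bas (Const 1 0)) (Bas (Const d 0))) (?R, M) (R', M)"
      proof (rule ex_If)
        assume "?R d > 0"
        then have "R' = ?R(1 := 0)" using that by (auto simp: R'_def)
        moreover have "ex h (Bas (Const 1 0)) (?R, M) (?R(1 := 0), M)" by (rule ex_Bas) auto
        ultimately show "ex h (Bas (Const 1 0)) (?R, M) (R', M)" by metis
      next
        assume "\<not> ?R d > 0"
        moreover have "ex h (Bas (Const d 0)) (?R, M) (?R(d := 0), M)" by (rule ex_Bas) auto
        ultimately show "\<exists>R''. ex h (Bas (Const d 0)) (?R, M) (R'', M) \<and> R' = R''(1 := 1)"
          using that by (auto simp: R'_def)
      qed
    qed
    then show ?thesis using d that by (intro exI[of _ R']) (auto simp: R'_def)
  qed
  then show "\<exists>c. \<forall>R M x y. R d = int x --> R (d + 1) = int y -->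
     (\<exists>R'. ex h c (R, M) (R', M) \<and> R' d = int (x - y) \<and> (\<forall>i<d. i \<noteq> 1 --> R' i = R i))" by blast
qed

text \<open>The Cantor code of (x, y) is \<open>triangle (x + y) + x\<close>, so the program adds
  the numbers x + y, ..., 1 to x; the loop counter itself is the summand.\<close>

lemma prec_pair: "prec h f ==> prec h g ==> prec h (\<lambda>x. prod_encode (f x, g x))"
proof (erule prec_binary[where b = "\<lambda>x y. prod_encode (x, y)"], assumption)
  fix d :: nat assume d: "d \<ge> 2"
  let ?c = "Bas (Add (d + 2) d (d + 1)) ;; Rep (d + 2) (Bas (Add d d (d + 2)))"
  have "\<exists>R'. ex h ?c (R, M) (R', M) \<and> R' d = int (prod_encode (x, y)) \<and> (\<forall>i<d. i \<noteq> 1 --> R' i = R i)"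
    if xy: "R d = int x" "R (d + 1) = int y" for R M x y
  proof -
    let ?R = "R(d + 2 := R d + R (d + 1))"
    define Inv where "Inv j R' M' \<longleftrightarrow> R' d = int (x + (triangle (x + y) - triangle (x + y - j))) \<and>
       (\<forall>i<d. i \<noteq> 1 --> R' i = R i) \<and> M' = M" for j R' M'
    have "\<exists>R' M'. ex h (Rep (d + 2) (Bas (Add d d (d + 2)))) (?R, M) (R', M') \<and> Inv (x + y) R' M' \<and> R' (d + 2) = 0"
    proof (rule ex_Rep)
      fix j R1 M1 assume j: "j < x + y" "Inv j R1 M1" "R1 (d + 2) = int (x + y - j)"
      have "ex h (Bas (Add d d (d + 2))) (R1, M1) (R1(d := R1 d + R1 (d + 2)), M1)" by (rule ex_Bas) auto
      moreover have "Inv (Suc j) ((R1(d := R1 d + R1 (d + 2)))(1 := 1, d + 2 := int (x + y - Suc j))) M1"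
      proof -
        obtain e where e: "x + y - j = Suc e" using j by (metis Suc_diff_Suc)
        then have e': "x + y - Suc j = e" by simp
        have "triangle (Suc e) \<le> triangle (x + y)"
          using e unfolding triangle_def by (intro div_le_mono mult_le_mono) auto
        then show ?thesis using j d e e' unfolding Inv_def by (auto simp: triangle_Suc)
      qed
      ultimately show "\<exists>R' M'. ex h (Bas (Add d d (d + 2))) (R1, M1) (R', M') \<and> R' (d + 2) = R1 (d + 2) \<and>
            Inv (Suc j) (R'(1 := 1, d + 2 := int (x + y - Suc j))) M'" by fastforce
    next
      show "Inv j (R1(1 := 1)) M1" if "Inv j R1 M1" for j R1 M1 using that d by (auto simp: Inv_def)
    qed (use xy d in \<open>auto simp: Inv_def\<close>)
    then obtain R' M' where "ex h (Rep (d + 2) (Bas (Add d d (d + 2)))) (?R, M) (R', M')" "Inv (x + y) R' M'" by blast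
    moreover have "ex h (Bas (Add (d + 2) d (d + 1))) (R, M) (?R, M)" by (rule ex_Bas) auto
    ultimately show ?thesis
      by (intro exI[of _ R']) (auto simp: Inv_def prod_encode_def intro: ex_Seq)
  qed
  then show "\<exists>c. \<forall>R M x y. R d = int x --> R (d + 1) = int y -->
     (\<exists>R'. ex h c (R, M) (R', M) \<and> R' d = int (prod_encode (x, y)) \<and> (\<forall>i<d. i \<noteq> 1 --> R' i = R i))" by blast
qed

abbreviation pfst :: "nat => nat" where "pfst x \<equiv> fst (prod_decode x)"
abbreviation psnd :: "nat => nat" where "psnd x \<equiv> snd (prod_decode x)"

text \<open>The successor along the diagonals of the Cantor enumeration. It allows decoding x by x
  steps from (0, 0), without roots or division.\<close>

lemma prod_encode_Suc: "Suc (prod_encode (a, Suc b)) = prod_encode (Suc a, b)"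
  "Suc (prod_encode (a, 0)) = prod_encode (0, Suc a)"
  by (auto simp: prod_encode_def triangle_Suc)

lemma decode_program:
  assumes d: "d \<ge> 2"
  shows "\<exists>c. \<forall>R M x. R d = int x --> (\<exists>R'. ex h c (R, M) (R', M) \<and> R' (d + 1) = int (pfst x) \<and>
     R' (d + 2) = int (psnd x) \<and> (\<forall>i<d. i \<noteq> 1 --> R' i = R i))"
proof -
  let ?T = "Bas (Const 1 1) ;; Bas (Add (d + 1) (d + 1) 1) ;; Bas (Sub (d + 2) (d + 2) 1)"
  let ?F = "Bas (Const 1 1) ;; Bas (Add (d + 2) (d + 1) 1) ;; Bas (Const (d + 1) 0)"
  let ?b = "If (d + 2) ?T ?F"
  let ?c = "Bas (Const (d + 1) 0) ;; Bas (Const (d + 2) 0) ;; Rep d ?b"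
  have "\<exists>R'. ex h ?c (R, M) (R', M) \<and> R' (d + 1) = int (pfst x) \<and>
     R' (d + 2) = int (psnd x) \<and> (\<forall>i<d. i \<noteq> 1 --> R' i = R i)" if x: "R d = int x" for R M x
  proof -
    let ?R = "R(d + 1 := 0, d + 2 := 0)"
    define Inv where "Inv j R' M' \<longleftrightarrow> (\<exists>a b. R' (d + 1) = int a \<and> R' (d + 2) = int b \<and> prod_encode (a, b) = j) \<and>
       (\<forall>i<d. i \<noteq> 1 --> R' i = R i) \<and> M' = M" for j R' M'
    have "\<exists>R' M'. ex h (Rep d ?b) (?R, M) (R', M') \<and> Inv x R' M' \<and> R' d = 0"
    proof (rule ex_Rep)
      fix j R1 M1 assume j: "j < x" "Inv j R1 M1" "R1 d = int (x - j)"
      then obtain a b where ab: "R1 (d + 1) = int a" "R1 (d + 2) = int b" "prod_encode (a, b) = j"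
        unfolding Inv_def by blast
      let ?R1 = "R1(1 := 1, d + 1 := R1 (d + 1) + 1, d + 2 := R1 (d + 2) - 1)"
      let ?R2 = "R1(1 := 1, d + 2 := R1 (d + 1) + 1, d + 1 := 0)"
      have t: "ex h ?T (R1, M1) (?R1, M1)"
        by (rule ex_Seq, rule ex_Bas, simp, simp, rule ex_Seq, rule ex_Bas, simp, simp, rule ex_Bas)
          (use d in auto)
      have f: "ex h ?F (R1, M1) (?R2, M1)"
        by (rule ex_Seq, rule ex_Bas, simp, simp, rule ex_Seq, rule ex_Bas, simp, simp, rule ex_Bas)
          (use d in auto)
      have "\<exists>R'. ex h ?b (R1, M1) (R', M1) \<and> R' d = R1 d \<and> Inv (Suc j) (R'(1 := 1, d := int (x - Suc j))) M1"
      proof (cases b)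
        case 0
        have "?R2 = ?R2(1 := 1)" using d by auto
        then have "ex h ?b (R1, M1) (?R2, M1)" using f ab 0 by (intro ex_If) auto
        moreover have "Inv (Suc j) (?R2(1 := 1, d := int (x - Suc j))) M1" unfolding Inv_def
          using ab 0 j(2) d prod_encode_Suc by (intro conjI exI[of _ "0::nat"] exI[of _ "Suc a"]) (auto simp: Inv_def)
        ultimately show ?thesis using d by (intro exI[of _ ?R2]) auto
      next
        case (Suc b')
        then have "ex h ?b (R1, M1) (?R1, M1)" using t ab by (intro ex_If) auto
        moreover have "Inv (Suc j) (?R1(1 := 1, d := int (x - Suc j))) M1" unfolding Inv_def
          using ab Suc j(2) d prod_encode_Suc by (intro conjI exI[of _ "Suc a"] exI[of _ b']) (auto simp: Inv_def)
        ultimately show ?thesis using d by (intro exI[of _ ?R1]) auto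
      qed
      then show "\<exists>R' M'. ex h ?b (R1, M1) (R', M') \<and> R' d = R1 d \<and>
            Inv (Suc j) (R'(1 := 1, d := int (x - Suc j))) M'" by blast
    next
      show "Inv j (R1(1 := 1)) M1" if "Inv j R1 M1" for j R1 M1 using that d by (auto simp: Inv_def)
      show "Inv 0 ?R M" unfolding Inv_def
        by (intro conjI exI[of _ "0::nat"]) (auto simp: prod_encode_def triangle_def)
    qed (use x d in auto)
    then obtain R' M' where R': "ex h (Rep d ?b) (?R, M) (R', M')" "Inv x R' M'" by blast
    have "ex h (Bas (Const (d + 1) 0)) (R, M) (R(d + 1 := 0), M)" by (rule ex_Bas) auto
    moreover have "ex h (Bas (Const (d + 2) 0)) (R(d + 1 := 0), M) (?R, M)" by (rule ex_Bas) auto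
    ultimately have "ex h ?c (R, M) (R', M')" using R'(1) by (blast intro: ex_Seq)
    moreover obtain a b where "R' (d + 1) = int a" "R' (d + 2) = int b" "prod_encode (a, b) = x"
      using R'(2) unfolding Inv_def by blast
    moreover have "prod_decode x = (a, b)" using calculation by auto
    ultimately show ?thesis using R'(2) unfolding Inv_def by (intro exI[of _ R']) auto
  qed
  then show ?thesis by blast
qed

lemma prec_pfst_psnd: "prec h pfst" "prec h psnd"
proof -
  have "\<exists>c. realizes h f c d" if fe: "2 \<le> d" "f = pfst \<and> e = 1 \<or> f = psnd \<and> e = 2" for f d and e :: nat
  proof -
    obtain c where c: "\<forall>R M x. R d = int x --> (\<exists>R'. ex h c (R, M) (R', M) \<and> R' (d + 1) = int (pfst x) \<and>
     R' (d + 2) = int (psnd x) \<and> (\<forall>i<d. i \<noteq> 1 --> R' i = R i))" using decode_program[OF fe(1)] by blast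
    have "realizes h f (c ;; mv d (d + e)) d" unfolding realizes_def
    proof (intro allI impI)
      fix R M x assume "R d = int x"
      then have "\<exists>R'. ex h c (R, M) (R', M) \<and> R' (d + 1) = int (pfst x) \<and>
        R' (d + 2) = int (psnd x) \<and> (\<forall>i<d. i \<noteq> 1 --> R' i = R i)" using c by blast
      then obtain R' where "ex h c (R, M) (R', M)" "R' (d + 1) = int (pfst x)"
        "R' (d + 2) = int (psnd x)" "\<forall>i<d. i \<noteq> 1 --> R' i = R i" by blast
      moreover have "ex h (mv d (d + e)) (R', M) (R'(1 := 0, d := R' (d + e)), M)"
        by (rule ex_mv) (use fe in auto)
      ultimately have "ex h (c ;; mv d (d + e)) (R, M) (R'(1 := 0, d := R' (d + e)), M)"
        "R' (d + e) = int (f x)" "\<forall>i<d. i \<noteq> 1 --> R' i = R i" using fe by (auto intro: ex_Seq)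
      then show "\<exists>R'. ex h (c ;; mv d (d + e)) (R, M) (R', M) \<and> R' d = int (f x) \<and> (\<forall>i<d. i \<noteq> 1 --> R' i = R i)"
        by (intro exI[of _ "R'(1 := 0, d := R' (d + e))"]) auto
    qed
    then show ?thesis by blast
  qed
  then show "prec h pfst" "prec h psnd" unfolding prec_def by blast+
qed

lemma prec_iterate:
  assumes "prec h f" shows "prec h (\<lambda>x. (f ^^ pfst x) (psnd x))"
  unfolding prec_def
proof (intro allI impI)
  fix d :: nat assume d: "2 \<le> d"
  obtain c where c: "\<forall>R M x. R d = int x --> (\<exists>R'. ex h c (R, M) (R', M) \<and> R' (d + 1) = int (pfst x) \<and>
     R' (d + 2) = int (psnd x) \<and> (\<forall>i<d. i \<noteq> 1 --> R' i = R i))" using decode_program[OF d] by blast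
  obtain cf where cf: "realizes h f cf (d + 2)" using assms d unfolding prec_def by (meson trans_le_add1)
  have "realizes h (\<lambda>x. (f ^^ pfst x) (psnd x)) (c ;; Rep (d + 1) cf ;; mv d (d + 2)) d" unfolding realizes_def
  proof (intro allI impI)
    fix R M x assume "R d = int x"
    then have "\<exists>R'. ex h c (R, M) (R', M) \<and> R' (d + 1) = int (pfst x) \<and>
      R' (d + 2) = int (psnd x) \<and> (\<forall>i<d. i \<noteq> 1 --> R' i = R i)" using c by blast
    then obtain R0 where R0: "ex h c (R, M) (R0, M)" "R0 (d + 1) = int (pfst x)"
      "R0 (d + 2) = int (psnd x)" "\<forall>i<d. i \<noteq> 1 --> R0 i = R i" by blast
    define Inv where "Inv j R' M' \<longleftrightarrow> R' (d + 2) = int ((f ^^ j) (psnd x)) \<and>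
       (\<forall>i<d. i \<noteq> 1 --> R' i = R i) \<and> M' = M" for j R' M'
    have "\<exists>R' M'. ex h (Rep (d + 1) cf) (R0, M) (R', M') \<and> Inv (pfst x) R' M' \<and> R' (d + 1) = 0"
    proof (rule ex_Rep)
      fix j R1 M1 assume j: "j < pfst x" "Inv j R1 M1" "R1 (d + 1) = int (pfst x - j)"
      then have "R1 (d + 2) = int ((f ^^ j) (psnd x))" by (simp add: Inv_def)
      from realizesD[OF cf, of R1, OF this, of M1] obtain R' where "ex h cf (R1, M1) (R', M1)"
        "R' (d + 2) = int (f ((f ^^ j) (psnd x)))" "\<forall>i<d + 2. i \<noteq> 1 --> R' i = R1 i" by blast
      then show "\<exists>R' M'. ex h cf (R1, M1) (R', M') \<and> R' (d + 1) = R1 (d + 1) \<and>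
            Inv (Suc j) (R'(1 := 1, d + 1 := int (pfst x - Suc j))) M'"
        using j(2) d by (intro exI[of _ R'] exI[of _ M1]) (auto simp: Inv_def)
    next
      show "Inv j (R1(1 := 1)) M1" if "Inv j R1 M1" for j R1 M1 using that d by (auto simp: Inv_def)
    qed (use R0 d in \<open>auto simp: Inv_def\<close>)
    then obtain R' where R': "ex h (Rep (d + 1) cf) (R0, M) (R', M)" "Inv (pfst x) R' M"
      unfolding Inv_def by blast
    moreover have "ex h (mv d (d + 2)) (R', M) (R'(1 := 0, d := R' (d + 2)), M)" by (rule ex_mv) (use d in simp)
    ultimately show "\<exists>R'. ex h (c ;; Rep (d + 1) cf ;; mv d (d + 2)) (R, M) (R', M) \<and>
      R' d = int ((f ^^ pfst x) (psnd x)) \<and> (\<forall>i<d. i \<noteq> 1 --> R' i = R i)"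
      using R0(1) by (intro exI[of _ "R'(1 := 0, d := R' (d + 2))"]) (auto simp: Inv_def intro: ex_Seq)
  qed
  then show "\<exists>c. realizes h (\<lambda>x. (f ^^ pfst x) (psnd x)) c d" by blast
qed

lemma prec_computes:
  assumes "prec h f" shows "\<exists>Q. \<forall>m. computes h Q m (f m)"
proof -
  obtain c where c: "realizes h f c 2" using assms unfolding prec_def by blast
  let ?c = "mv 2 0 ;; c ;; mv 0 2"
  have "computes h (compile 0 ?c) m (f m)" for m
  proof -
    define R :: "nat => int" where "R = (\<lambda>_. 0)(0 := int m)"
    let ?R = R and ?M = "\<lambda>_. 0 :: int"
    have 1: "ex h (mv 2 0) (R, ?M) (R(1 := 0, 2 := R 0), ?M)" by (rule ex_mv) simp
    obtain R' where R': "ex h c (R(1 := 0, 2 := R 0), ?M) (R', ?M)" "R' 2 = int (f m)"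
      using realizesD[OF c, of "R(1 := 0, 2 := R 0)" m] by (auto simp: R_def)
    have "ex h (mv 0 2) (R', ?M) (R'(1 := 0, 0 := R' 2), ?M)" by (rule ex_mv) simp
    with 1 R' have "ex h ?c (?R, ?M) (R'(1 := 0, 0 := R' 2), ?M)" by (blast intro: ex_Seq)
    then obtain t where "bs h (\<lambda>_. True) ?c (?R, ?M) t (R'(1 := 0, 0 := R' 2), ?M)" unfolding ex_def by blast
    from compile_correct[OF this] show ?thesis using R'(2)
      unfolding computes_def R_def by (intro exI[of _ t]) (auto simp: halted_def)
  qed
  then show ?thesis by blast
qed

lemma prec_pfst: "prec h f ==> prec h (\<lambda>x. pfst (f x))"
  using prec_comp[OF prec_pfst_psnd(1)] .

lemma prec_psnd: "prec h f ==> prec h (\<lambda>x. psnd (f x))"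
  using prec_comp[OF prec_pfst_psnd(2)] .

lemma prec_Suc: "prec h f ==> prec h (\<lambda>x. Suc (f x))"
  using prec_add[OF _ prec_const[of h 1], of f] by simp

text \<open>The parameter x travels along as the first component of the iterated pair, which reduces
  a step function with a parameter to plain iteration.\<close>

lemma prec_funpow:
  assumes k: "prec h k" and a: "prec h a" and s: "prec h (\<lambda>p. s (pfst p) (psnd p))"
  shows "prec h (\<lambda>x. (s x ^^ k x) (a x))"
proof -
  define f where "f p = prod_encode (pfst p, s (pfst p) (psnd p))" for p
  have "(f ^^ n) (prod_encode (x, b)) = prod_encode (x, (s x ^^ n) b)" for n x b
    by (induction n) (auto simp: f_def)
  then have "psnd ((f ^^ pfst p) (psnd p)) = (s x ^^ k x) (a x)"
    if "p = prod_encode (k x, prod_encode (x, a x))" for p x using that by simp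
  moreover have "prec h (\<lambda>p. psnd ((f ^^ pfst p) (psnd p)))"
    unfolding f_def by (intro prec_psnd prec_iterate prec_pair prec_pfst prec_id s)
  then have "prec h (\<lambda>x. (\<lambda>p. psnd ((f ^^ pfst p) (psnd p))) (prod_encode (k x, prod_encode (x, a x))))"
    by (rule prec_comp) (intro prec_pair k a prec_id)
  ultimately show ?thesis by simp
qed

text \<open>Iterating a constant function 0 times leaves the start value, and any other number of
  times yields the constant.\<close>

lemma prec_if:
  assumes "prec h c" "prec h f" "prec h g"
  shows "prec h (\<lambda>x. if c x = 0 then f x else g x)"
proof -
  have "prec h (\<lambda>x. ((\<lambda>_. g x) ^^ c x) (f x))"
    using prec_funpow[OF assms(1,2), of "\<lambda>x _. g x"] prec_comp[OF assms(3) prec_pfst_psnd(1)] by simp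
  moreover have "((\<lambda>_. g x) ^^ c x) (f x) = (if c x = 0 then f x else g x)" for x
    by (cases "c x") auto
  ultimately show ?thesis by simp
qed

lemma prec_upt_fold:
  assumes k: "prec h k" and a: "prec h a" and f: "prec h (\<lambda>p. f (pfst p) (pfst (psnd p)) (psnd (psnd p)))"
  shows "prec h (\<lambda>x. fold (f x) [0..<k x] (a x))"
proof -
  define s where "s x p = prod_encode (Suc (pfst p), f x (pfst p) (psnd p))" for x p
  have "(s x ^^ n) (prod_encode (0, b)) = prod_encode (n, fold (f x) [0..<n] b)" for x n b
    by (induction n) (auto simp: s_def)
  moreover have "prec h (\<lambda>x. psnd ((s x ^^ k x) (prod_encode (0, a x))))"
  proof (intro prec_psnd prec_funpow k prec_pair prec_const a)
    have "prec h (\<lambda>p. (\<lambda>p. f (pfst p) (pfst (psnd p)) (psnd (psnd p)))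
      (prod_encode (pfst p, prod_encode (pfst (psnd p), psnd (psnd p)))))"
      by (rule prec_comp[OF f]) (intro prec_pair prec_pfst prec_psnd prec_id)
    then show "prec h (\<lambda>p. s (pfst p) (psnd p))" unfolding s_def
      by (intro prec_pair prec_Suc prec_pfst prec_psnd prec_id) simp
  qed
  ultimately show ?thesis by simp
qed

lemma length_le_list_encode: "length xs \<le> list_encode xs"
  by (induction xs) (auto intro: order_trans le_prod_encode_2)

text \<open>The code of a list bounds its length and serves as the number of rounds. The code 0 of
  the empty list is left unchanged by the step function, so surplus rounds do nothing.\<close>

lemma prec_list_fold:
  assumes L: "prec h L" and a: "prec h a" and f: "prec h (\<lambda>p. f (pfst p) (pfst (psnd p)) (psnd (psnd p)))"
  shows "prec h (\<lambda>x. fold (f x) (list_decode (L x)) (a x))"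
proof -
  define s where "s x p = (if pfst p = 0 then p else
     prod_encode (psnd (pfst p - 1), f x (pfst (pfst p - 1)) (psnd p)))" for x p
  have stat: "(s x ^^ n) (prod_encode (0, b)) = prod_encode (0, b)" for n x b
    by (induction n) (auto simp: s_def)
  have s1: "(s x ^^ n) (prod_encode (list_encode xs, b)) = prod_encode (0, fold (f x) xs b)"
    if "length xs \<le> n" for n x xs b using that
  proof (induction xs arbitrary: n b)
    case Nil then show ?case using stat by simp
  next
    case (Cons y ys)
    then obtain n' where n: "n = Suc n'" "length ys \<le> n'" by (cases n) auto
    have "s x (prod_encode (list_encode (y # ys), b)) = prod_encode (list_encode ys, f x y b)"
      by (simp add: s_def)
    then show ?case using Cons.IH n by (simp add: funpow_Suc_right del: funpow.simps)
  qed
  have "(s x ^^ l) (prod_encode (l, b)) = prod_encode (0, fold (f x) (list_decode l) b)" for x l b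
    using s1[OF length_le_list_encode, of "list_decode l" x b] by simp
  moreover have "prec h (\<lambda>x. psnd ((s x ^^ L x) (prod_encode (L x, a x))))"
  proof (intro prec_psnd prec_funpow L prec_pair a)
    have "prec h (\<lambda>p. (\<lambda>p. f (pfst p) (pfst (psnd p)) (psnd (psnd p)))
      (prod_encode (pfst p, prod_encode (pfst (pfst (psnd p) - 1), psnd (psnd p)))))"
      by (rule prec_comp[OF f]) (intro prec_pair prec_pfst prec_psnd prec_id prec_diff prec_const)
    then show "prec h (\<lambda>p. s (pfst p) (psnd p))" unfolding s_def
      by (intro prec_if prec_pair prec_pfst prec_psnd prec_id prec_diff prec_const) simp
  qed
  ultimately show ?thesis by simp
qed

section \<open>Explicit growth bounds, and the clauses on Goedel numbers\<close>

definition tower :: "nat => nat => nat" where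
  "tower k X = ((\<lambda>n. 2 ^ n) ^^ k) X"

text \<open>The rank at which density must be controlled before k rounds in order to control rank 0
  after them. A round makes up to three augmentations, and \<open>8 * r + 7\<close> is the map from
  r to \<open>2 * r + 1\<close> applied three times.\<close>

definition radius :: "nat => nat" where
  "radius k = ((\<lambda>r. 8 * r + 7) ^^ k) 0"

text \<open>One number covers everything: m is the code of the query, the oracle h is asked for the
  density at a rank large enough for all rounds, and a absorbs constants, including the sizes
  belonging to \<sigma>. The height is linear in m because each quantifier and each level of term
  depth costs a bounded number of exponentials.\<close>

definition sig_bound :: "(nat => nat) => nat => nat => nat" where
  "sig_bound h a m = tower (a * (m + 1)) (radius (a * (m + 1)) + h (radius (a * (m + 1))) + m + a)"

lemma prec_mult_const: "prec h f ==> prec h (\<lambda>x. a * f x)"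
proof (induction a)
  case (Suc a) then show ?case using prec_add[of h f "\<lambda>x. a * f x"] by simp
qed (simp add: prec_const)

lemma prec_power2: "prec h f ==> prec h (\<lambda>x. 2 ^ f x)"
proof -
  assume f: "prec h f"
  have "prec h (\<lambda>x. ((\<lambda>a. a + a) ^^ f x) 1)"
    by (intro prec_funpow[where s = "\<lambda>x a. a + a"] f prec_const prec_add prec_psnd prec_id)
  moreover have "((\<lambda>a. a + a) ^^ n) 1 = (2 :: nat) ^ n" for n by (induction n) auto
  ultimately show ?thesis by simp
qed

lemma prec_sig_bound: "prec h (sig_bound h a)"
  unfolding sig_bound_def tower_def radius_def
  by (intro prec_funpow[where s = "\<lambda>x n. 2 ^ n"] prec_funpow[where s = "\<lambda>x r. 8 * r + 7"] prec_add
      prec_mult_const prec_power2 prec_comp[OF prec_oracle] prec_id prec_const prec_psnd)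

text \<open>Written with \<open>fold\<close> because the same loop is available on codes through
  \<open>prec_list_fold\<close>; the order of the clauses does not matter.\<close>

definition ext :: "form => form list => form list" where
  "ext A \<Omega> = fold (\<lambda>c acc. And A c # And (Neg A) c # acc) \<Omega> []"

text \<open>A single number i encodes the pair of function symbols, so all equations for two given
  variables come from one loop below N. In the application N exceeds the code of every pair of
  symbols that is needed.\<close>

definition eq_atom :: "nat => nat => nat => form" where
  "eq_atom x x' i = Eq (App (pfst i) (Var x)) (App (psnd i) (Var x'))"

definition pred_atom :: "nat => nat => form" where
  "pred_atom x i = Pred (pfst i) (App (psnd i) (Var x))"

definition atoms :: "nat => nat list => form list" where
  "atoms N xs = concat (map (\<lambda>x. map (pred_atom x) [0..<N]) xs) @
     concat (map (\<lambda>x. concat (map (\<lambda>x'. map (eq_atom x x') [0..<N]) xs)) xs)"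

text \<open>The trivial equation starts the conjunction because there is no empty conjunctive
  clause.\<close>

definition clauses :: "nat => nat list => form list" where
  "clauses N xs = fold ext (atoms N xs) [Eq (Var (hd xs)) (Var (hd xs))]"

abbreviation ccons :: "nat => nat => nat" where "ccons a l \<equiv> Suc (prod_encode (a, l))"

text \<open>Counterpart of \<open>ext\<close> on Goedel numbers; 2 and 3 are the tags of
  \<open>Neg\<close> and \<open>And\<close>. Like the three definitions after it, it only uses
  operations under which \<open>prec\<close> is closed.\<close>

definition cext :: "nat => nat => nat" where
  "cext A L = fold (\<lambda>c acc. ccons (prod_encode (3, prod_encode (A, c)))
     (ccons (prod_encode (3, prod_encode (prod_encode (2, A), c))) acc)) (list_decode L) 0"

definition ceq_atom :: "nat => nat => nat => nat" where
  "ceq_atom x x' i = prod_encode (0, prod_encode (prod_encode (1, prod_encode (pfst i, prod_encode (0, x))),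
     prod_encode (1, prod_encode (psnd i, prod_encode (0, x')))))"

definition cpred_atom :: "nat => nat => nat" where
  "cpred_atom x i = prod_encode (1, prod_encode (pfst i, prod_encode (1, prod_encode (psnd i, prod_encode (0, x)))))"

definition cclauses :: "nat => nat => nat" where
  "cclauses N l = fold (\<lambda>x. fold (\<lambda>x'. fold (\<lambda>i. cext (ceq_atom x x' i)) [0..<N]) (list_decode l)) (list_decode l)
     (fold (\<lambda>x. fold (\<lambda>i. cext (cpred_atom x i)) [0..<N]) (list_decode l)
       (ccons (prod_encode (0, prod_encode (prod_encode (0, pfst (l - 1)), prod_encode (0, pfst (l - 1))))) 0))"

lemma cext_code: "cext (form_code A) (list_encode (map form_code \<Omega>)) = list_encode (map form_code (ext A \<Omega>))"
proof -
  have "fold (\<lambda>c acc. ccons (prod_encode (3, prod_encode (form_code A, c)))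
     (ccons (prod_encode (3, prod_encode (prod_encode (2, form_code A), c))) acc)) (map form_code \<Omega>)
       (list_encode (map form_code acc)) =
     list_encode (map form_code (fold (\<lambda>c acc. And A c # And (Neg A) c # acc) \<Omega> acc))" for acc
  proof (induction \<Omega> arbitrary: acc)
    case (Cons c \<Omega>)
    from Cons.IH[of "And A c # And (Neg A) c # acc"] show ?case by simp
  qed simp
  from this[of "[]"] show ?thesis by (simp add: cext_def ext_def)
qed

lemma fold_concat: "fold f (concat xss) = fold (fold f) xss"
  by (induction xss) auto

lemma fold_code:
  assumes "\<And>x \<Omega>. x \<in> set xs ==> g x (c \<Omega>) = c (f x \<Omega>)"
  shows "fold g xs (c \<Omega>) = c (fold f xs \<Omega>)"
  using assms by (induction xs arbitrary: \<Omega>) auto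

lemma cclauses_code:
  assumes "xs \<noteq> []"
  shows "cclauses N (list_encode xs) = list_encode (map form_code (clauses N xs))"
proof -
  let ?c = "\<lambda>\<Omega>. list_encode (map form_code \<Omega>)"
  have e: "ceq_atom x x' i = form_code (eq_atom x x' i)" for x x' i by (simp add: ceq_atom_def eq_atom_def)
  have p: "cpred_atom x i = form_code (pred_atom x i)" for x i by (simp add: cpred_atom_def pred_atom_def)
  obtain z zs where xs: "xs = z # zs" using assms by (cases xs) auto
  have b: "ccons (prod_encode (0, prod_encode (prod_encode (0, pfst (list_encode xs - 1)), prod_encode (0, pfst (list_encode xs - 1))))) 0
     = ?c [Eq (Var (hd xs)) (Var (hd xs))]" by (simp add: xs)
  have 1: "fold (\<lambda>x. fold (\<lambda>i. cext (cpred_atom x i)) [0..<N]) xs (?c \<Omega>) =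
     ?c (fold (\<lambda>x. fold (\<lambda>i. ext (pred_atom x i)) [0..<N]) xs \<Omega>)" for \<Omega>
    by (intro fold_code) (simp add: p cext_code)
  have 2: "fold (\<lambda>x. fold (\<lambda>x'. fold (\<lambda>i. cext (ceq_atom x x' i)) [0..<N]) xs) xs (?c \<Omega>) =
     ?c (fold (\<lambda>x. fold (\<lambda>x'. fold (\<lambda>i. ext (eq_atom x x' i)) [0..<N]) xs) xs \<Omega>)" for \<Omega>
    by (intro fold_code) (simp add: e cext_code)
  show ?thesis unfolding cclauses_def clauses_def atoms_def
    by (simp only: list_encode_inverse b 1 2) (simp add: fold_concat fold_map o_def)
qed

text \<open>The formula enters only through the bound N. For the code m of a query,
  \<open>psnd m\<close> is the code of \<open>y # xs\<close>, the successor of a pair, so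
  \<open>psnd (psnd m - 1)\<close> is the code of \<open>xs\<close>.\<close>

lemma prec_query:
  fixes h a defines "N \<equiv> sig_bound h a"
  shows "prec h (\<lambda>m. prod_encode (prod_encode (2 ^ N m - 1, 2 ^ N m - 1), cclauses (N m) (psnd (psnd m - 1))))"
proof -
  have N: "prec h (\<lambda>x. N (f x))" if "prec h f" for f
    unfolding N_def using prec_comp[OF prec_sig_bound that] .
  show ?thesis unfolding cclauses_def cext_def ceq_atom_def cpred_atom_def
    by (intro prec_pair prec_diff prec_power2 N prec_const prec_id prec_list_fold prec_upt_fold prec_psnd
        prec_pfst prec_Suc)
qed

text \<open>The set \<open>{0..<N}\<close> has code \<open>2 ^ N - 1\<close>.\<close>

theorem clauses_computable:
  "\<exists>Q. \<forall>\<phi> y xs. xs \<noteq> [] --> (let N = sig_bound h a (query_code \<phi> y xs) in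
     computes h Q (query_code \<phi> y xs)
       (clauses_code \<lparr>fsig = {0..<N}, psig = {0..<N}\<rparr> (clauses N xs)))"
proof -
  from prec_computes[OF prec_query] obtain Q where Q: "\<And>m. computes h Q m
    (prod_encode (prod_encode (2 ^ sig_bound h a m - 1, 2 ^ sig_bound h a m - 1),
      cclauses (sig_bound h a m) (psnd (psnd m - 1))))" by blast
  have S: "set_encode {0..<N} = 2 ^ N - 1" for N
    by (simp add: set_encode_def sum_power2)
  show ?thesis
  proof (intro exI[of _ Q] allI impI)
    fix \<phi> y and xs :: "nat list" assume "xs \<noteq> []"
    then show "let N = sig_bound h a (query_code \<phi> y xs) in
     computes h Q (query_code \<phi> y xs)
       (clauses_code \<lparr>fsig = {0..<N}, psig = {0..<N}\<rparr> (clauses N xs))"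
      using Q[of "query_code \<phi> y xs"] cclauses_code[of xs]
      by (simp add: Let_def clauses_code_def sig_code_def S query_code_def)
  qed
qed

section \<open>Linear-time programs on tables\<close>

text \<open>A store \<open>(j, a, e, k)\<close> writes the value of \<open>e\<close>, cut off at \<open>k * n\<close>, to cell number \<open>a\<close> of
  table \<open>j\<close>; the cut-off makes a polynomial bound on all values evident. A phase \<open>(K, b)\<close> runs its
  body \<open>b\<close> for all counter values below \<open>K * n\<close>, in decreasing order.\<close>

datatype exp = Cst int | Sz | Ctr | Ld nat exp | Pls exp exp | Mns exp exp | Ifp exp exp exp

type_synonym store = "nat \<times> exp \<times> exp \<times> nat"
type_synonym phase = "nat \<times> store list"

primrec eval :: "nat => int => (nat => int) => exp => int" where
  "eval n i M (Cst k) = k"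
| "eval n i M Sz = int n"
| "eval n i M Ctr = i"
| "eval n i M (Ld j e) = M (nat (int (j * n) + eval n i M e))"
| "eval n i M (Pls e1 e2) = eval n i M e1 + eval n i M e2"
| "eval n i M (Mns e1 e2) = eval n i M e1 - eval n i M e2"
| "eval n i M (Ifp e1 e2 e3) = (if eval n i M e1 > 0 then eval n i M e2 else eval n i M e3)"

definition clamp :: "nat => int => int" where
  "clamp b x = (if \<bar>x\<bar> \<le> int b then x else 0)"

fun exec_store :: "nat => int => store => (nat => int) => (nat => int)" where
  "exec_store n i (j, a, e, k) M = M(nat (int (j * n) + eval n i M a) := clamp (k * n) (eval n i M e))"

definition exec_body :: "nat => int => store list => (nat => int) => (nat => int)" where
  "exec_body n i b = fold (exec_store n i) b"

fun exec_phase :: "nat => phase => (nat => int) => (nat => int)" where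
  "exec_phase n (K, b) = fold (\<lambda>i. exec_body n (int i) b) (rev [0..<K * n])"

definition exec_prog :: "nat => phase list => (nat => int) => (nat => int)" where
  "exec_prog n p = fold (exec_phase n) p"

text \<open>The machine cannot multiply, but k is a constant of the program, so the product with n
  takes a fixed number of additions.\<close>

primrec mulSz :: "nat => exp" where
  "mulSz 0 = Cst 0" | "mulSz (Suc k) = Pls (mulSz k) Sz"

text \<open>The added 1 turns the strict test of \<open>Ifp\<close> into the two non-strict
  comparisons of \<open>clamp\<close>.\<close>

definition clampe :: "nat => exp => exp" where
  "clampe k e = Ifp (Mns (Pls (mulSz k) (Cst 1)) e) (Ifp (Pls (Pls (mulSz k) (Cst 1)) e) e (Cst 0)) (Cst 0)"

lemma eval_mulSz: "eval n i M (mulSz k) = int (k * n)"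
  by (induction k) auto

lemma eval_clampe: "eval n i M (clampe k e) = clamp (k * n) (eval n i M e)"
  by (auto simp: clampe_def clamp_def eval_mulSz)

text \<open>When n, the counter and all cells are bounded by U, \<open>mag e * U\<close> bounds the
  value of e and of its subexpressions. The summand j of a load accounts for the offset
  \<open>j * n\<close> in the address.\<close>

primrec mag :: "exp => nat" where
  "mag (Cst k) = nat \<bar>k\<bar>"
| "mag Sz = 1"
| "mag Ctr = 1"
| "mag (Ld j e) = mag e + j + 1"
| "mag (Pls e1 e2) = mag e1 + mag e2"
| "mag (Mns e1 e2) = mag e1 + mag e2"
| "mag (Ifp e1 e2 e3) = mag e1 + mag e2 + mag e3"

lemma eval_bound:
  assumes "n \<le> U" "\<bar>i\<bar> \<le> int U" "\<And>a. \<bar>M a\<bar> \<le> int U" "1 \<le> U"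
  shows "\<bar>eval n i M e\<bar> \<le> int (mag e * U)"
proof (induction e)
  case (Cst k)
  have "\<bar>k\<bar> * 1 \<le> \<bar>k\<bar> * int U" using assms(4) by (intro mult_left_mono) auto
  then show ?case by simp
next
  case (Ld j e) then show ?case using assms(3)[of "nat (int (j * n) + eval n i M e)"]
    by (auto simp: algebra_simps intro: order_trans)
qed (use assms in \<open>auto simp: algebra_simps\<close>)

section \<open>Compilation of expressions, stores and phases with bounds on time and numbers\<close>

definition bdd :: "nat => st => bool" where
  "bdd W = (\<lambda>(R, M). (\<forall>a. \<bar>R a\<bar> \<le> int W) \<and> (\<forall>a. \<bar>M a\<bar> \<le> int W))"

abbreviation bs0 :: "nat => com => st => nat => st => bool" where
  "bs0 W \<equiv> bs (\<lambda>_. 0) (bdd W)"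

lemma bs_Bas: "no_jump i ==> snd (exec h i (0, s)) = s' ==> I s' ==> bs h I (Bas i) s 1 s'"
  using bs.Bas by metis

primrec addn :: "nat => nat => com" where
  "addn d 0 = Bas (Const 1 0)"
| "addn d (Suc k) = addn d k ;; Bas (Add d d 0)"

lemma addn_correct:
  assumes "bdd W (R, M)" "d > 1" "R 0 = int n" "\<bar>R d\<bar> + int (k * n) \<le> int W"
  shows "\<exists>R'. bs0 W (addn d k) (R, M) (k + 1) (R', M) \<and> R' d = R d + int (k * n) \<and>
     (\<forall>i. i \<noteq> d --> i \<noteq> 1 --> R' i = R i) \<and> bdd W (R', M)"
  using assms(4)
proof (induction k)
  case 0
  have b: "bdd W (R(1 := 0), M)" using assms(1) by (auto simp: bdd_def)
  then have "bs0 W (Bas (Const 1 0)) (R, M) 1 (R(1 := 0), M)"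
    by (intro bs_Bas) auto
  then show ?case using assms(2) b by (intro exI[of _ "R(1 := 0)"]) (auto simp del: fun_upd_apply, auto)
next
  case (Suc k)
  then have "\<bar>R d\<bar> + int (k * n) \<le> int W" by simp
  from Suc.IH[OF this] obtain R' where R': "bs0 W (addn d k) (R, M) (k + 1) (R', M)" "R' d = R d + int (k * n)"
     "\<forall>i. i \<noteq> d --> i \<noteq> 1 --> R' i = R i" "bdd W (R', M)" by blast
  have v: "R' d + R' 0 = R d + int (Suc k * n)" using R' assms by simp
  then have "\<bar>R' d + R' 0\<bar> \<le> int W" using Suc.prems by linarith
  then have b: "bdd W (R'(d := R' d + R' 0), M)" using R'(4) by (auto simp: bdd_def)
  then have "bs0 W (Bas (Add d d 0)) (R', M) 1 (R'(d := R' d + R' 0), M)"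
    by (intro bs_Bas) auto
  from bs.Seq[OF R'(1) this] have "bs0 W (addn d (Suc k)) (R, M) (Suc k + 1) (R'(d := R' d + R' 0), M)" by simp
  moreover have "(R'(d := R' d + R' 0)) d = R d + int (Suc k * n)"
    "\<forall>i. i \<noteq> d --> i \<noteq> 1 --> (R'(d := R' d + R' 0)) i = R i" using R' v by auto
  ultimately show ?case using b by blast
qed

primrec ce :: "nat => exp => com" where
  "ce d (Cst k) = Bas (Const d k)"
| "ce d Sz = mv d 0"
| "ce d Ctr = mv d 2"
| "ce d (Ld j e) = ce d e ;; addn d j ;; Bas (Load d d)"
| "ce d (Pls e1 e2) = ce d e1 ;; ce (d + 1) e2 ;; Bas (Add d d (d + 1))"
| "ce d (Mns e1 e2) = ce d e1 ;; ce (d + 1) e2 ;; Bas (Sub d d (d + 1))"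
| "ce d (Ifp e1 e2 e3) = ce d e1 ;; If d (ce d e2) (ce d e3)"

primrec tim :: "exp => nat" where
  "tim (Cst k) = 1"
| "tim Sz = 2"
| "tim Ctr = 2"
| "tim (Ld j e) = tim e + j + 2"
| "tim (Pls e1 e2) = tim e1 + tim e2 + 1"
| "tim (Mns e1 e2) = tim e1 + tim e2 + 1"
| "tim (Ifp e1 e2 e3) = tim e1 + tim e2 + tim e3 + 3"

text \<open>Two bounds are kept apart: U for the contents of memory, which the cut-off preserves,
  and W for everything in registers, including addresses and intermediate values that are not cut
  off. Registers 0 and 2 hold n and the counter.\<close>

lemma ce_correct:
  assumes "n \<le> U" "\<bar>i\<bar> \<le> int U" "\<And>a. \<bar>M a\<bar> \<le> int U" "1 \<le> U" "U \<le> W"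
    and "d \<ge> 3" "bdd W (R, M)" "R 0 = int n" "R 2 = i" "mag e * U \<le> W"
  shows "\<exists>t R'. bs0 W (ce d e) (R, M) t (R', M) \<and> t \<le> tim e \<and> R' d = eval n i M e \<and>
     (\<forall>k<d. k \<noteq> 1 --> R' k = R k) \<and> bdd W (R', M)"
  using assms(6-10)
proof (induction e arbitrary: d R)
  case (Cst k)
  have "nat \<bar>k\<bar> * 1 \<le> nat \<bar>k\<bar> * U" using assms(4) by (rule mult_le_mono2)
  then have "nat \<bar>k\<bar> \<le> W" using Cst.prems(5) by (metis le_trans mag.simps(1) mult.right_neutral)
  then have "\<bar>k\<bar> \<le> int W" by linarith
  then have "bdd W (R(d := k), M)" using Cst by (auto simp: bdd_def)
  moreover from this have "bs0 W (Bas (Const d k)) (R, M) 1 (R(d := k), M)" by (intro bs_Bas) auto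
  moreover have "(R(d := k)) d = eval n i M (Cst k)" "\<forall>l<d. l \<noteq> 1 --> (R(d := k)) l = R l" "1 \<le> tim (Cst k)"
    by auto
  ultimately show ?case unfolding ce.simps by blast
next
  case Sz
  have b: "bdd W (R(1 := 0), M)" using Sz by (auto simp: bdd_def)
  then have b': "bdd W (R(1 := 0, d := R 0), M)" using Sz by (auto simp: bdd_def split: if_splits) (metis abs_of_nat of_nat_le_iff)
  have "bs0 W (Bas (Const 1 0)) (R, M) 1 (R(1 := 0), M)" by (rule bs_Bas) (use b in auto)
  moreover have "bs0 W (Bas (Add d 0 1)) (R(1 := 0), M) 1 (R(1 := 0, d := R 0), M)"
    by (rule bs_Bas) (use b' in auto)
  ultimately have "bs0 W (mv d 0) (R, M) (1 + 1) (R(1 := 0, d := R 0), M)"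
    unfolding mv_def by (rule bs.Seq)
  moreover have "(R(1 := 0, d := R 0)) d = eval n i M Sz" "1 + 1 \<le> tim Sz"
    "\<forall>l<d. l \<noteq> 1 --> (R(1 := 0, d := R 0)) l = R l" using Sz by auto
  ultimately show ?case using b' unfolding ce.simps by blast
next
  case Ctr
  have b: "bdd W (R(1 := 0), M)" using Ctr by (auto simp: bdd_def)
  then have b': "bdd W (R(1 := 0, d := R 2), M)" using Ctr by (auto simp: bdd_def)
  have "bs0 W (Bas (Const 1 0)) (R, M) 1 (R(1 := 0), M)" by (rule bs_Bas) (use b in auto)
  moreover have "bs0 W (Bas (Add d 2 1)) (R(1 := 0), M) 1 (R(1 := 0, d := R 2), M)"
    by (rule bs_Bas) (use b' in auto)
  ultimately have "bs0 W (mv d 2) (R, M) (1 + 1) (R(1 := 0, d := R 2), M)"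
    unfolding mv_def by (rule bs.Seq)
  moreover have "(R(1 := 0, d := R 2)) d = eval n i M Ctr" "1 + 1 \<le> tim Ctr"
    "\<forall>l<d. l \<noteq> 1 --> (R(1 := 0, d := R 2)) l = R l" using Ctr by auto
  ultimately show ?case using b' unfolding ce.simps by blast
next
  case (Ld j e)
  have m: "mag e * U + j * U \<le> W" using Ld.prems(5) by (simp add: algebra_simps)
  then obtain t R1 where R1: "bs0 W (ce d e) (R, M) t (R1, M)" "t \<le> tim e" "R1 d = eval n i M e"
     "\<forall>k<d. k \<noteq> 1 --> R1 k = R k" "bdd W (R1, M)" using Ld.IH[of d R] Ld.prems by auto
  have "\<bar>R1 d\<bar> \<le> int (mag e * U)" using eval_bound[where M = M, OF assms(1-4)] R1(3) by simp
  moreover have "j * n \<le> j * U" using assms(1) by simp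
  ultimately have "\<bar>R1 d\<bar> + int (j * n) \<le> int W" using m by linarith
  moreover have "R1 0 = int n" using R1(4) Ld.prems by auto
  ultimately obtain R2 where R2: "bs0 W (addn d j) (R1, M) (j + 1) (R2, M)" "R2 d = R1 d + int (j * n)"
     "\<forall>i. i \<noteq> d --> i \<noteq> 1 --> R2 i = R1 i" "bdd W (R2, M)"
    using addn_correct[OF R1(5), of d n j] Ld.prems by auto
  let ?R = "R2(d := M (nat (R2 d)))"
  have b: "bdd W (?R, M)" using R2(4) by (auto simp: bdd_def)
  then have "bs0 W (Bas (Load d d)) (R2, M) 1 (?R, M)" by (intro bs_Bas) auto
  with R1(1) R2(1) have "bs0 W (ce d (Ld j e)) (R, M) (t + ((j + 1) + 1)) (?R, M)"
    unfolding ce.simps by (blast intro: bs.Seq)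
  moreover have "?R d = eval n i M (Ld j e)" using R1(3) R2(2) by (simp add: add.commute)
  moreover have "\<forall>k<d. k \<noteq> 1 --> ?R k = R k" using R1(4) R2(3) by auto
  moreover have "t + ((j + 1) + 1) \<le> tim (Ld j e)" using R1(2) by simp
  ultimately show ?case using b by blast
next
  case (Pls e1 e2)
  have m: "mag e1 * U \<le> W" "mag e2 * U \<le> W"
    using Pls.prems(5) by (auto simp: algebra_simps)
  then obtain t R1 where R1: "bs0 W (ce d e1) (R, M) t (R1, M)" "t \<le> tim e1" "R1 d = eval n i M e1"
     "\<forall>k<d. k \<noteq> 1 --> R1 k = R k" "bdd W (R1, M)" using Pls.IH(1)[of d R] Pls.prems by auto
  then have "R1 0 = int n" "R1 2 = i" using Pls.prems by auto
  then obtain t2 R2 where R2: "bs0 W (ce (d + 1) e2) (R1, M) t2 (R2, M)" "t2 \<le> tim e2" "R2 (d + 1) = eval n i M e2"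
     "\<forall>k<d + 1. k \<noteq> 1 --> R2 k = R1 k" "bdd W (R2, M)" using Pls.IH(2)[of "d + 1" R1] Pls.prems R1(5) m by auto
  let ?R = "R2(d := R2 d + R2 (d + 1))"
  have v: "?R d = eval n i M (Pls e1 e2)" using R1(3) R2(3,4) Pls.prems by auto
  have "\<bar>?R d\<bar> \<le> int W" using eval_bound[where M = M, OF assms(1-4), of "Pls e1 e2"] Pls.prems(5) v by linarith
  then have b: "bdd W (?R, M)" using R2(5) by (auto simp: bdd_def)
  then have "bs0 W (Bas (Add d d (d + 1))) (R2, M) 1 (?R, M)" by (intro bs_Bas) auto
  with R1(1) R2(1) have "bs0 W (ce d (Pls e1 e2)) (R, M) (t + (t2 + 1)) (?R, M)"
    unfolding ce.simps by (blast intro: bs.Seq)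
  moreover have "\<forall>k<d. k \<noteq> 1 --> ?R k = R k" using R1(4) R2(4) by auto
  moreover have "t + (t2 + 1) \<le> tim (Pls e1 e2)" using R1(2) R2(2) by simp
  ultimately show ?case using b v by blast
next
  case (Mns e1 e2)
  have m: "mag e1 * U \<le> W" "mag e2 * U \<le> W"
    using Mns.prems(5) by (auto simp: algebra_simps)
  then obtain t R1 where R1: "bs0 W (ce d e1) (R, M) t (R1, M)" "t \<le> tim e1" "R1 d = eval n i M e1"
     "\<forall>k<d. k \<noteq> 1 --> R1 k = R k" "bdd W (R1, M)" using Mns.IH(1)[of d R] Mns.prems by auto
  then have "R1 0 = int n" "R1 2 = i" using Mns.prems by auto
  then obtain t2 R2 where R2: "bs0 W (ce (d + 1) e2) (R1, M) t2 (R2, M)" "t2 \<le> tim e2" "R2 (d + 1) = eval n i M e2"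
     "\<forall>k<d + 1. k \<noteq> 1 --> R2 k = R1 k" "bdd W (R2, M)" using Mns.IH(2)[of "d + 1" R1] Mns.prems R1(5) m by auto
  let ?R = "R2(d := R2 d - R2 (d + 1))"
  have v: "?R d = eval n i M (Mns e1 e2)" using R1(3) R2(3,4) Mns.prems by auto
  have "\<bar>?R d\<bar> \<le> int W" using eval_bound[where M = M, OF assms(1-4), of "Mns e1 e2"] Mns.prems(5) v by linarith
  then have b: "bdd W (?R, M)" using R2(5) by (auto simp: bdd_def)
  then have "bs0 W (Bas (Sub d d (d + 1))) (R2, M) 1 (?R, M)" by (intro bs_Bas) auto
  with R1(1) R2(1) have "bs0 W (ce d (Mns e1 e2)) (R, M) (t + (t2 + 1)) (?R, M)"
    unfolding ce.simps by (blast intro: bs.Seq)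
  moreover have "\<forall>k<d. k \<noteq> 1 --> ?R k = R k" using R1(4) R2(4) by auto
  moreover have "t + (t2 + 1) \<le> tim (Mns e1 e2)" using R1(2) R2(2) by simp
  ultimately show ?case using b v by blast
next
  case (Ifp e1 e2 e3)
  have m: "mag e1 * U \<le> W" "mag e2 * U \<le> W" "mag e3 * U \<le> W"
    using Ifp.prems(5) by (auto simp: algebra_simps)
  then obtain t R1 where R1: "bs0 W (ce d e1) (R, M) t (R1, M)" "t \<le> tim e1" "R1 d = eval n i M e1"
     "\<forall>k<d. k \<noteq> 1 --> R1 k = R k" "bdd W (R1, M)" using Ifp.IH(1)[of d R] Ifp.prems by auto
  then have r: "R1 0 = int n" "R1 2 = i" using Ifp.prems by auto
  show ?case
  proof (cases "R1 d > 0")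
    case True
    obtain t2 R2 where R2: "bs0 W (ce d e2) (R1, M) t2 (R2, M)" "t2 \<le> tim e2" "R2 d = eval n i M e2"
     "\<forall>k<d. k \<noteq> 1 --> R2 k = R1 k" "bdd W (R2, M)" using Ifp.IH(2)[of d R1] Ifp.prems R1(5) m r by auto
    have "bs0 W (ce d (Ifp e1 e2 e3)) (R, M) (t + (t2 + 1)) (R2, M)"
      using bs.Seq[OF R1(1) bs.IfT[OF True R2(1)]] by simp
    moreover have "t + (t2 + 1) \<le> tim (Ifp e1 e2 e3)" using R1(2) R2(2) by simp
    moreover have "R2 d = eval n i M (Ifp e1 e2 e3)" using True R1(3) R2(3) by simp
    ultimately show ?thesis using R1(4) R2(4,5) by (intro exI[of _ "t + (t2 + 1)"] exI[of _ R2]) auto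
  next
    case False
    obtain t2 R2 where R2: "bs0 W (ce d e3) (R1, M) t2 (R2, M)" "t2 \<le> tim e3" "R2 d = eval n i M e3"
     "\<forall>k<d. k \<noteq> 1 --> R2 k = R1 k" "bdd W (R2, M)" using Ifp.IH(3)[of d R1] Ifp.prems R1(5) m r by auto
    have b: "bdd W (R2(1 := 1), M)" using R2(5) assms(4,5) by (auto simp: bdd_def)
    have "bs0 W (ce d (Ifp e1 e2 e3)) (R, M) (t + (t2 + 3)) (R2(1 := 1), M)"
      using bs.Seq[OF R1(1) bs.IfF[OF False R2(1) b]] by simp
    moreover have "t + (t2 + 3) \<le> tim (Ifp e1 e2 e3)" using R1(2) R2(2) by simp
    moreover have "R2 d = eval n i M (Ifp e1 e2 e3)" using False R1(3) R2(3) by simp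
    moreover have "(R2(1 := 1)) d = R2 d" "\<forall>k<d. k \<noteq> 1 --> (R2(1 := 1)) k = R k"
      using R1(4) R2(4) Ifp.prems(1) by auto
    ultimately show ?thesis using b by metis
  qed
qed

fun cstore :: "store => com" where
  "cstore (j, a, e, k) = ce 3 a ;; addn 3 j ;; ce 4 (clampe k e) ;; Bas (Store 3 4)"

fun tstore :: "store => nat" where
  "tstore (j, a, e, k) = tim a + j + tim (clampe k e) + 2"

fun mstore :: "store => nat" where
  "mstore (j, a, e, k) = mag a + j + mag (clampe k e)"

fun kstore :: "store => nat" where
  "kstore (j, a, e, k) = k"

lemma clamp_bound: "\<bar>clamp b x\<bar> \<le> int b"
  by (auto simp: clamp_def)

lemma cstore_correct:
  assumes "n \<le> U" "\<bar>i\<bar> \<le> int U" "\<And>a. \<bar>M a\<bar> \<le> int U" "1 \<le> U" "U \<le> W"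
    and "bdd W (R, M)" "R 0 = int n" "R 2 = i" "mstore s * U \<le> W" "kstore s * n \<le> U"
  shows "\<exists>t R'. bs0 W (cstore s) (R, M) t (R', exec_store n i s M) \<and> t \<le> tstore s \<and>
     R' 0 = int n \<and> R' 2 = i \<and> bdd W (R', exec_store n i s M) \<and> (\<forall>a. \<bar>exec_store n i s M a\<bar> \<le> int U)"
proof -
  obtain j a e k where s: "s = (j, a, e, k)" by (cases s) auto
  have m: "mag a * U \<le> W" "mag (clampe k e) * U \<le> W" "mag a * U + j * U \<le> W"
    using assms(9) by (auto simp: s algebra_simps)
  obtain t1 R1 where R1: "bs0 W (ce 3 a) (R, M) t1 (R1, M)" "t1 \<le> tim a" "R1 3 = eval n i M a"
     "\<forall>k<3. k \<noteq> 1 --> R1 k = R k" "bdd W (R1, M)"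
    using ce_correct[where M = M, OF assms(1-5), where d = 3 and R = R and e = a] assms(6-8) m by auto
  have "\<bar>R1 3\<bar> \<le> int (mag a * U)" using eval_bound[where M = M, OF assms(1-4)] R1(3) by simp
  moreover have "j * n \<le> j * U" using assms(1) by simp
  ultimately have "\<bar>R1 3\<bar> + int (j * n) \<le> int W" using m by linarith
  moreover have "R1 0 = int n" "R1 2 = i" using R1(4) assms by auto
  ultimately obtain R2 where R2: "bs0 W (addn 3 j) (R1, M) (j + 1) (R2, M)" "R2 3 = R1 3 + int (j * n)"
     "\<forall>i. i \<noteq> 3 --> i \<noteq> 1 --> R2 i = R1 i" "bdd W (R2, M)"
    using addn_correct[OF R1(5), where d = 3 and n = n and k = j] by auto
  have r: "R2 0 = int n" "R2 2 = i" using R2(3) \<open>R1 0 = int n\<close> \<open>R1 2 = i\<close> by auto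
  obtain t3 R3 where R3: "bs0 W (ce 4 (clampe k e)) (R2, M) t3 (R3, M)" "t3 \<le> tim (clampe k e)"
     "R3 4 = eval n i M (clampe k e)" "\<forall>k<4. k \<noteq> 1 --> R3 k = R2 k" "bdd W (R3, M)"
    using ce_correct[where M = M, OF assms(1-5), where d = 4 and R = R2 and e = "clampe k e"] R2(4) r m by auto
  have ad: "R3 3 = int (j * n) + eval n i M a" using R3(4) R2(2) R1(3) by simp
  have M': "exec_store n i s M = M(nat (R3 3) := R3 4)"
    by (simp add: s ad R3(3) eval_clampe)
  have b: "\<bar>exec_store n i s M x\<bar> \<le> int U" for x
  proof -
    have "\<bar>clamp (k * n) (eval n i M e)\<bar> \<le> int (k * n)" by (rule clamp_bound)
    also have "\<dots> \<le> int U" using assms(10) unfolding s kstore.simps by (rule of_nat_mono)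
    finally show ?thesis using assms(3) by (auto simp: s)
  qed
  then have "\<bar>exec_store n i s M x\<bar> \<le> int W" for x using assms(5) by (meson int_ops(1) nat_int_comparison(3) order_trans)
  then have b': "bdd W (R3, exec_store n i s M)" using R3(5) by (auto simp: bdd_def)
  then have "bs0 W (Bas (Store 3 4)) (R3, M) 1 (R3, exec_store n i s M)"
    unfolding M' by (intro bs_Bas) auto
  with R1(1) R2(1) R3(1) have "bs0 W (cstore s) (R, M) (t1 + ((j + 1) + (t3 + 1))) (R3, exec_store n i s M)"
    unfolding s cstore.simps by (blast intro: bs.Seq)
  moreover have "t1 + ((j + 1) + (t3 + 1)) \<le> tstore s" using R1(2) R3(2) by (simp add: s)
  moreover have "R3 0 = int n" "R3 2 = i" using R3(4) r by auto
  ultimately show ?thesis using b b' by blast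
qed

definition cbody :: "store list => com" where
  "cbody b = foldr (\<lambda>s c. cstore s ;; c) b (Bas (Const 1 0))"

lemma cbody_correct:
  assumes "n \<le> U" "\<bar>i\<bar> \<le> int U" "1 \<le> U" "U \<le> W"
    and "\<And>a. \<bar>M a\<bar> \<le> int U" "bdd W (R, M)" "R 0 = int n" "R 2 = i"
    and "\<And>s. s \<in> set b ==> mstore s * U \<le> W \<and> kstore s * n \<le> U"
  shows "\<exists>t R'. bs0 W (cbody b) (R, M) t (R', exec_body n i b M) \<and> t \<le> sum_list (map tstore b) + 1 \<and>
     R' 0 = int n \<and> R' 2 = i \<and> bdd W (R', exec_body n i b M) \<and> (\<forall>a. \<bar>exec_body n i b M a\<bar> \<le> int U)"
  using assms(5-9)
proof (induction b arbitrary: R M)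
  case Nil
  have b: "bdd W (R(1 := 0), M)" using Nil by (auto simp: bdd_def)
  then have "bs0 W (Bas (Const 1 0)) (R, M) 1 (R(1 := 0), M)" by (intro bs_Bas) auto
  moreover have "(R(1 := 0)) 0 = int n" "(R(1 := 0)) 2 = i" using Nil by auto
  ultimately show ?case using b Nil(1) by (auto simp: cbody_def exec_body_def simp del: fun_upd_apply)
next
  case (Cons s b)
  obtain t1 R1 where R1: "bs0 W (cstore s) (R, M) t1 (R1, exec_store n i s M)" "t1 \<le> tstore s"
     "R1 0 = int n" "R1 2 = i" "bdd W (R1, exec_store n i s M)" "\<forall>a. \<bar>exec_store n i s M a\<bar> \<le> int U"
    using cstore_correct[OF assms(1,2) Cons.prems(1) assms(3,4) Cons.prems(2-4), of s] Cons.prems(5) by auto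
  from R1(6) have "\<And>a. \<bar>exec_store n i s M a\<bar> \<le> int U" by blast
  from Cons.IH[OF this R1(5,3,4)] Cons.prems(5) obtain t2 R2 where
    R2: "bs0 W (cbody b) (R1, exec_store n i s M) t2 (R2, exec_body n i b (exec_store n i s M))"
     "t2 \<le> sum_list (map tstore b) + 1" "R2 0 = int n" "R2 2 = i" "bdd W (R2, exec_body n i b (exec_store n i s M))"
     "\<forall>a. \<bar>exec_body n i b (exec_store n i s M) a\<bar> \<le> int U" by auto
  have "bs0 W (cbody (s # b)) (R, M) (t1 + t2) (R2, exec_body n i (s # b) M)"
    using bs.Seq[OF R1(1) R2(1)] by (simp add: cbody_def exec_body_def)
  then show ?case using R1(2) R2(2-6)
    by (intro exI[of _ "t1 + t2"] exI[of _ R2]) (auto simp: exec_body_def)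
qed

fun cphase :: "phase => com" where
  "cphase (K, b) = Bas (Const 2 0) ;; addn 2 K ;; While 2 (Bas (Const 1 1) ;; Bas (Sub 2 2 1) ;; cbody b)"

fun phase_ok :: "nat => nat => nat => phase => bool" where
  "phase_ok n U W (K, b) \<longleftrightarrow> K * n \<le> U \<and> (\<forall>s\<in>set b. mstore s * U \<le> W \<and> kstore s * n \<le> U)"

fun tphase :: "phase => nat" where
  "tphase (K, b) = K * (sum_list (map tstore b) + 6) + K + 5"

lemma cphase_correct:
  assumes n: "n \<le> U" "1 \<le> n" and U: "U \<le> W" and ok: "phase_ok n U W p"
    and M: "\<And>a. \<bar>M a\<bar> \<le> int U" "bdd W (R, M)" "R 0 = int n"
  shows "\<exists>t R'. bs0 W (cphase p) (R, M) t (R', exec_phase n p M) \<and> t \<le> tphase p * n \<and>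
     R' 0 = int n \<and> bdd W (R', exec_phase n p M) \<and> (\<forall>a. \<bar>exec_phase n p M a\<bar> \<le> int U)"
proof -
  obtain K b where p: "p = (K, b)" by (cases p) auto
  have KU: "K * n \<le> U" and bok: "\<And>s. s \<in> set b ==> mstore s * U \<le> W \<and> kstore s * n \<le> U" using ok by (auto simp: p)
  define T where "T = sum_list (map tstore b) + 1"
  have loop: "\<exists>t R'. bs0 W (While 2 (Bas (Const 1 1) ;; Bas (Sub 2 2 1) ;; cbody b)) (R, M) t
      (R', fold (\<lambda>i. exec_body n (int i) b) (rev [0..<m]) M) \<and> t \<le> m * (T + 5) + 3 \<and> R' 0 = int n \<and>
      bdd W (R', fold (\<lambda>i. exec_body n (int i) b) (rev [0..<m]) M) \<and>
      (\<forall>a. \<bar>fold (\<lambda>i. exec_body n (int i) b) (rev [0..<m]) M a\<bar> \<le> int U)"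
    if "m \<le> U" "\<And>a. \<bar>M a\<bar> \<le> int U" "bdd W (R, M)" "R 0 = int n" "R 2 = int m" for m R M
    using that
  proof (induction m arbitrary: R M)
    case 0
    have b: "bdd W (R(1 := 1), M)" using 0 n U by (auto simp: bdd_def)
    have "bs0 W (While 2 (Bas (Const 1 1) ;; Bas (Sub 2 2 1) ;; cbody b)) (R, M) 3 (R(1 := 1), M)"
      by (rule bs.WhF) (use 0 b in auto)
    moreover have "(R(1 := 1)) 0 = int n" using 0 by auto
    ultimately show ?case using b 0(2) by (intro exI[of _ 3] exI[of _ "R(1 := 1)"]) (auto simp del: fun_upd_apply)
  next
    case (Suc m)
    have b1: "bdd W (R(1 := 1), M)" using Suc.prems n U by (auto simp: bdd_def)
    let ?R = "R(1 := 1, 2 := int m)"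
    have b2: "bdd W (?R, M)" using b1 Suc.prems(1) U by (auto simp: bdd_def)
    have e1: "bs0 W (Bas (Const 1 1)) (R, M) 1 (R(1 := 1), M)" by (rule bs_Bas) (use b1 in auto)
    have e2: "bs0 W (Bas (Sub 2 2 1)) (R(1 := 1), M) 1 (?R, M)"
      by (rule bs_Bas) (use b2 Suc.prems(5) in auto)
    obtain t R1 where R1: "bs0 W (cbody b) (?R, M) t (R1, exec_body n (int m) b M)" "t \<le> T"
       "R1 0 = int n" "R1 2 = int m" "bdd W (R1, exec_body n (int m) b M)"
       "\<forall>a. \<bar>exec_body n (int m) b M a\<bar> \<le> int U"
      using cbody_correct[of n U "int m" W M ?R b] n U Suc.prems b2 bok unfolding T_def by auto
    let ?M = "exec_body n (int m) b M"
    have b3: "bdd W (R1(1 := 1), ?M)" using R1(5) n U by (auto simp: bdd_def)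
    from R1(6) have M1: "\<And>a. \<bar>?M a\<bar> \<le> int U" by blast
    have "m \<le> U" using Suc.prems(1) by simp
    moreover have "(R1(1 := 1)) 0 = int n" "(R1(1 := 1)) 2 = int m" using R1(3,4) by auto
    ultimately obtain t' R2 where
      R2: "bs0 W (While 2 (Bas (Const 1 1) ;; Bas (Sub 2 2 1) ;; cbody b)) (R1(1 := 1), ?M) t'
      (R2, fold (\<lambda>i. exec_body n (int i) b) (rev [0..<m]) ?M)" "t' \<le> m * (T + 5) + 3" "R2 0 = int n"
      "bdd W (R2, fold (\<lambda>i. exec_body n (int i) b) (rev [0..<m]) ?M)"
      "\<forall>a. \<bar>fold (\<lambda>i. exec_body n (int i) b) (rev [0..<m]) ?M a\<bar> \<le> int U"
      using Suc.IH[OF _ M1 b3] by blast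
    have "bs0 W (While 2 (Bas (Const 1 1) ;; Bas (Sub 2 2 1) ;; cbody b)) (R, M) ((1 + (1 + t)) + t' + 3)
      (R2, fold (\<lambda>i. exec_body n (int i) b) (rev [0..<m]) ?M)"
      by (rule bs.WhT[OF _ bs.Seq[OF e1 bs.Seq[OF e2 R1(1)]] b3 R2(1)]) (use Suc.prems in auto)
    moreover have "(1 + (1 + t)) + t' + 3 \<le> Suc m * (T + 5) + 3" using R1(2) R2(2) by simp
    ultimately show ?case using R2(3-5) by (intro exI[of _ "(1 + (1 + t)) + t' + 3"] exI[of _ R2]) auto
  qed
  have b0: "bdd W (R(2 := 0), M)" using M by (auto simp: bdd_def)
  have e0: "bs0 W (Bas (Const 2 0)) (R, M) 1 (R(2 := 0), M)" by (rule bs_Bas) (use b0 in auto)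
  obtain R1 where R1: "bs0 W (addn 2 K) (R(2 := 0), M) (K + 1) (R1, M)" "R1 2 = int (K * n)"
     "R1 0 = int n" "bdd W (R1, M)"
    using addn_correct[OF b0, of 2 n K] M(3) KU U of_nat_mono[of "K * n" W, where ?'a = int] by auto
  from loop[OF KU M(1) R1(4,3,2)] obtain t R2 where R2:
    "bs0 W (While 2 (Bas (Const 1 1) ;; Bas (Sub 2 2 1) ;; cbody b)) (R1, M) t (R2, exec_phase n p M)"
    "t \<le> K * n * (T + 5) + 3" "R2 0 = int n" "bdd W (R2, exec_phase n p M)" "\<forall>a. \<bar>exec_phase n p M a\<bar> \<le> int U"
    unfolding p exec_phase.simps by blast
  have "bs0 W (cphase p) (R, M) (1 + ((K + 1) + t)) (R2, exec_phase n p M)"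
    unfolding p cphase.simps by (rule bs.Seq[OF e0 bs.Seq[OF R1(1) R2(1)[unfolded p]]])
  moreover have "1 + ((K + 1) + t) \<le> tphase p * n"
  proof -
    have "1 + ((K + 1) + t) \<le> K * n * (T + 5) + (K + 5)" using R2(2) by simp
    also have "\<dots> \<le> K * n * (T + 5) + (K + 5) * n" using n(2) by simp
    also have "\<dots> = tphase p * n" by (simp add: p T_def algebra_simps)
    finally show ?thesis .
  qed
  ultimately show ?thesis using R2(3-5) by blast
qed

definition cprog :: "phase list => com" where
  "cprog ps = foldr (\<lambda>p c. cphase p ;; c) ps (Bas (Const 1 0))"

lemma cprog_correct:
  assumes n: "n \<le> U" "1 \<le> n" and U: "U \<le> W" and ok: "\<And>p. p \<in> set ps ==> phase_ok n U W p"
    and M: "\<And>a. \<bar>M a\<bar> \<le> int U" "bdd W (R, M)" "R 0 = int n"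
  shows "\<exists>t R'. bs0 W (cprog ps) (R, M) t (R', exec_prog n ps M) \<and> t \<le> sum_list (map tphase ps) * n + 1"
  using ok M
proof (induction ps arbitrary: R M)
  case Nil
  have "bs0 W (Bas (Const 1 0)) (R, M) 1 (R(1 := 0), M)"
    by (intro bs_Bas) (use Nil in \<open>auto simp: bdd_def\<close>)
  then show ?case by (auto simp: cprog_def exec_prog_def)
next
  case (Cons p ps)
  from cphase_correct[OF n U, of p, OF _ Cons.prems(2-4)] Cons.prems(1) obtain t1 R1 where
    R1: "bs0 W (cphase p) (R, M) t1 (R1, exec_phase n p M)" "t1 \<le> tphase p * n"
     "R1 0 = int n" "bdd W (R1, exec_phase n p M)" "\<forall>a. \<bar>exec_phase n p M a\<bar> \<le> int U" by auto
  from R1(5) have "\<And>a. \<bar>exec_phase n p M a\<bar> \<le> int U" by blast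
  from Cons.IH[OF _ this R1(4,3)] Cons.prems(1) obtain t2 R2 where
    R2: "bs0 W (cprog ps) (R1, exec_phase n p M) t2 (R2, exec_prog n ps (exec_phase n p M))"
    "t2 \<le> sum_list (map tphase ps) * n + 1" by auto
  have "bs0 W (cprog (p # ps)) (R, M) (t1 + t2) (R2, exec_prog n (p # ps) M)"
    using bs.Seq[OF R1(1) R2(1)] by (simp add: cprog_def exec_prog_def)
  then show ?case using R1(2) R2(2) by (intro exI[of _ "t1 + t2"] exI[of _ R2]) (auto simp: algebra_simps)
qed

text \<open>All bounds are constants of the program times n: \<open>c0\<close> dominates the numbers
  of rounds and the cut-off factors, which gives the memory bound \<open>c0 * n\<close>;
  \<open>c1\<close> dominates the magnitudes of the expressions, so \<open>c0 * c1 * n\<close>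
  bounds the registers.\<close>

theorem linear_program:
  "\<exists>P c. \<forall>n M. 1 \<le> n --> (\<forall>a. \<bar>M a\<bar> \<le> int n) -->
     (\<exists>t R. t \<le> c * n \<and> run (\<lambda>_. 0) P t (0, (\<lambda>_. 0)(0 := int n), M) = (length P, R, exec_prog n ps M) \<and>
       (\<forall>k\<le>t. bdd (c * n) (snd (run (\<lambda>_. 0) P k (0, (\<lambda>_. 0)(0 := int n), M)))))"
proof -
  define c0 where "c0 = 1 + sum_list (map fst ps) + sum_list (map kstore (concat (map snd ps)))"
  define c1 where "c1 = 1 + sum_list (map mstore (concat (map snd ps)))"
  define c where "c = c0 * c1 + sum_list (map tphase ps) + 1"
  have ok: "phase_ok n (c0 * n) (c * n) p" if p: "p \<in> set ps" for n p
  proof -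
    obtain K b where pp: "p = (K, b)" by (cases p) auto
    have "K \<in> set (map fst ps)" using p pp by force
    then have "K \<le> sum_list (map fst ps)" by (rule member_le_sum_list) simp
    then have "K \<le> c0" by (simp add: c0_def)
    then have "K * n \<le> c0 * n" by simp
    moreover have "mstore s * (c0 * n) \<le> c * n \<and> kstore s * n \<le> c0 * n" if s: "s \<in> set b" for s
    proof -
      have "s \<in> set (concat (map snd ps))" using p pp s by force
      then have "mstore s \<in> set (map mstore (concat (map snd ps)))"
        "kstore s \<in> set (map kstore (concat (map snd ps)))" unfolding set_map by (rule imageI)+
      then have "mstore s \<le> sum_list (map mstore (concat (map snd ps)))"
        "kstore s \<le> sum_list (map kstore (concat (map snd ps)))" by (simp_all only: member_le_sum_list)
      then have m: "mstore s \<le> c1" "kstore s \<le> c0" by (auto simp: c0_def c1_def)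
      have "mstore s * (c0 * n) \<le> c1 * (c0 * n)" using m(1) by (rule mult_right_mono) simp
      also have "\<dots> \<le> c * n" by (simp add: c_def algebra_simps)
      finally show ?thesis using m(2) by simp
    qed
    ultimately show ?thesis by (simp add: pp)
  qed
  show ?thesis
  proof (rule exI[of _ "compile 0 (cprog ps)"], rule exI[of _ c], intro allI impI)
    fix n and M :: "nat => int" assume n: "1 \<le> n" and M: "\<forall>a. \<bar>M a\<bar> \<le> int n"
    define R :: "nat => int" where "R = (\<lambda>_. 0)(0 := int n)"
    have U: "n \<le> c0 * n" "c0 * n \<le> c * n" by (auto simp: c0_def c_def c1_def algebra_simps)
    have M': "\<bar>M a\<bar> \<le> int (c0 * n)" for a using M U(1) by (meson of_nat_mono order_trans)
    have "int n \<le> int (c * n)" "\<And>a. \<bar>M a\<bar> \<le> int (c * n)"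
      using M' U by (meson of_nat_mono order_trans)+
    then have b: "bdd (c * n) (R, M)" unfolding bdd_def R_def by simp
    from cprog_correct[where ps = ps and M = M, OF U(1) n U(2) ok M' b] obtain t R' where
      t: "bs0 (c * n) (cprog ps) (R, M) t (R', exec_prog n ps M)" "t \<le> sum_list (map tphase ps) * n + 1"
      by (auto simp: R_def)
    have "t \<le> c * n" using t(2) n by (auto simp: c_def algebra_simps)
    then show "\<exists>t R. t \<le> c * n \<and> run (\<lambda>_. 0) (compile 0 (cprog ps)) t (0, (\<lambda>_. 0)(0 := int n), M) =
         (length (compile 0 (cprog ps)), R, exec_prog n ps M) \<and>
       (\<forall>k\<le>t. bdd (c * n) (snd (run (\<lambda>_. 0) (compile 0 (cprog ps)) k (0, (\<lambda>_. 0)(0 := int n), M))))"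
      using compile_correct[OF t(1) b] unfolding R_def by blast
  qed
qed

section \<open>Tables on a class of structures\<close>

text \<open>All stores go to table J, while the address depends only on the other tables and the
  value also on the old content of the target cell. The cells of the table therefore evolve
  independently, each by a fold over the counter values that hit it, in decreasing order.\<close>

lemma fold_pass:
  fixes n J k :: nat
  defines "T \<equiv> {J * n..<J * n + n}"
  assumes ev: "\<And>M i. (\<forall>a. a \<notin> T --> M a = M0 a) ==> i < n ==>
     eval n (int i) M ef = int (F i) \<and> F i < n \<and> eval n (int i) M e = G i (M (J * n + F i))"
  shows "exec_phase n (1, [(J, ef, e, k)]) M0 =
    (\<lambda>a. if a \<in> T then fold (\<lambda>i x. if F i = a - J * n then clamp (k * n) (G i x) else x) (rev [0..<n]) (M0 a)
         else M0 a)"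
proof -
  have "fold (\<lambda>i. exec_body n (int i) [(J, ef, e, k)]) is M =
    (\<lambda>a. if a \<in> T then fold (\<lambda>i x. if F i = a - J * n then clamp (k * n) (G i x) else x) is (M a) else M0 a)"
    if "\<forall>a. a \<notin> T --> M a = M0 a" "set is \<subseteq> {..<n}" for "is" M
    using that
  proof (induction "is" arbitrary: M)
    case (Cons i "is")
    then have i: "i < n" by simp
    note e = ev[OF Cons.prems(1) i]
    let ?M = "exec_body n (int i) [(J, ef, e, k)] M"
    have M': "?M = M(J * n + F i := clamp (k * n) (G i (M (J * n + F i))))"
    proof -
      have "nat (int (J * n) + int (F i)) = J * n + F i" by linarith
      then show ?thesis unfolding exec_body_def by (simp only: fold_simps exec_store.simps e)
    qed
    have "\<forall>a. a \<notin> T --> ?M a = M0 a" using Cons.prems(1) e unfolding M' by (auto simp: T_def)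
    from Cons.IH[OF this] Cons.prems(2) have IH: "fold (\<lambda>i. exec_body n (int i) [(J, ef, e, k)]) is ?M =
      (\<lambda>a. if a \<in> T then fold (\<lambda>i x. if F i = a - J * n then clamp (k * n) (G i x) else x) is (?M a) else M0 a)"
      by simp
    have "?M a = (if F i = a - J * n then clamp (k * n) (G i (M a)) else M a)" if "a \<in> T" for a
      using that unfolding M' T_def by auto
    with IH show ?case by (auto simp: fun_eq_iff)
  qed auto
  from this[of M0 "rev [0..<n]"] show ?thesis by (simp add: exec_body_def atLeast0LessThan)
qed

type_synonym 'v inst = "'v struc \<times> ('v => nat)"
type_synonym 'v table = "'v inst => 'v => int"

abbreviation vs :: "'v inst => 'v set" where "vs \<G> \<equiv> univ (fst \<G>)"
abbreviation sz :: "'v inst => nat" where "sz \<G> \<equiv> card (univ (fst \<G>))"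
abbreviation ix :: "'v inst => 'v => nat" where "ix \<G> \<equiv> snd \<G>"
abbreviation vx :: "'v inst => nat => 'v" where "vx \<G> \<equiv> inv_into (univ (fst \<G>)) (snd \<G>)"

definition agree :: "'v inst => 'v table list => (nat => int) => bool" where
  "agree \<G> ts M \<longleftrightarrow> (\<forall>j<length ts. \<forall>i<sz \<G>. M (j * sz \<G> + i) = (ts ! j) \<G> (vx \<G> i))"

text \<open>Memory beyond the tables is zero, so the next table can be accumulated in place without
  being cleared.\<close>

definition rep :: "'v inst => 'v table list => (nat => int) => bool" where
  "rep \<G> ts M \<longleftrightarrow> agree \<G> ts M \<and> (\<forall>a \<ge> length ts * sz \<G>. M a = 0)"

text \<open>The candidate with the least index is chosen, because a loop with decreasing counter
  finds it by mere overwriting.\<close>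

definition pick :: "'v inst => 'v set => 'v => 'v" where
  "pick \<G> A d = (if A = {} then d else vx \<G> (LEAST i. i \<in> ix \<G> ` A))"

definition enc :: "('v inst => 'v => 'v) => 'v table" where
  "enc f = (\<lambda>\<G> v. int (ix \<G> (f \<G> v)))"

locale structure_class =
  fixes \<sigma> :: signature and \<C> :: "'v struc set"
  assumes sig: "functional_signature \<sigma>" and cls: "\<C> \<subseteq> Fun \<sigma>"
begin

definition insts :: "'v inst set" where
  "insts = {(G, e). G \<in> \<C> \<and> bij_betw e (univ G) {..<card (univ G)}}"

lemma insts:
  assumes "\<G> \<in> insts"
  shows "finite (vs \<G>)" "vs \<G> \<noteq> {}" "sz \<G> > 0" "\<And>v. v \<in> vs \<G> ==> ix \<G> v < sz \<G>"
    "\<And>i. i < sz \<G> ==> vx \<G> i \<in> vs \<G>" "\<And>v. v \<in> vs \<G> ==> vx \<G> (ix \<G> v) = v"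
    "\<And>i. i < sz \<G> ==> ix \<G> (vx \<G> i) = i" "inj_on (ix \<G>) (vs \<G>)"
proof -
  have b: "bij_betw (ix \<G>) (vs \<G>) {..<sz \<G>}" and "fst \<G> \<in> \<C>"
    using assms unfolding insts_def by (simp_all add: case_prod_beta)
  moreover from this(2) have "fst \<G> \<in> Fun \<sigma>" using cls by blast
  ultimately show f: "finite (vs \<G>)" "vs \<G> \<noteq> {}" by (auto simp: Fun_def)
  then show "sz \<G> > 0" by (simp add: card_gt_0_iff)
  show "\<And>v. v \<in> vs \<G> ==> ix \<G> v < sz \<G>" using bij_betwE[OF b] by auto
  have im: "ix \<G> ` vs \<G> = {..<sz \<G>}" using b by (simp add: bij_betw_def)
  show "\<And>i. i < sz \<G> ==> vx \<G> i \<in> vs \<G>" using im by (metis inv_into_into lessThan_iff)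
  show "inj_on (ix \<G>) (vs \<G>)" using b by (simp add: bij_betw_def)
  then show "\<And>v. v \<in> vs \<G> ==> vx \<G> (ix \<G> v) = v" by simp
  show "\<And>i. i < sz \<G> ==> ix \<G> (vx \<G> i) = i" using im by (metis f_inv_into_f lessThan_iff)
qed

lemma pick_in: "\<G> \<in> insts ==> A \<subseteq> vs \<G> ==> A \<noteq> {} ==> pick \<G> A d \<in> A"
proof -
  assume a: "\<G> \<in> insts" "A \<subseteq> vs \<G>" "A \<noteq> {}"
  then obtain x where "x \<in> A" by blast
  then have "(LEAST i. i \<in> ix \<G> ` A) \<in> ix \<G> ` A" by (intro LeastI[of "\<lambda>i. i \<in> ix \<G> ` A" "ix \<G> x"]) simp
  then obtain y where "y \<in> A" "(LEAST i. i \<in> ix \<G> ` A) = ix \<G> y" by (elim imageE)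
  then show ?thesis using a insts(6)[OF a(1), of y] by (simp add: pick_def subset_iff)
qed

lemma pick_empty: "pick \<G> {} d = d" by (simp add: pick_def)

definition start :: "'v inst => nat => int" where
  "start \<G> = tables (vs \<G>) (ix \<G>) (struc_tables \<sigma> (ix \<G>) (fst \<G>))"

text \<open>A table is a function of the instance, so one program has to produce it for all
  structures of the class and all enumerations.\<close>

definition Comp :: "'v table list => bool" where
  "Comp ts \<longleftrightarrow> (\<exists>ps. \<forall>\<G>\<in>insts. rep \<G> ts (exec_prog (sz \<G>) ps (start \<G>)))"

text \<open>The program q may overwrite the tables \<open>old\<close> that follow \<open>ts\<close>.
  Tables with index in J get the prescribed content t; every other one is by definition what q
  leaves in memory, so work tables need no description. The last clause still relates them to a run
  of q.\<close>

lemma Comp_ext: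
  assumes "Comp (ts @ old)"
    and q: "\<And>\<G> M. \<G> \<in> insts ==> rep \<G> (ts @ old) M ==>
      (\<forall>a<length ts * sz \<G>. exec_prog (sz \<G>) q M a = M a) \<and>
      (\<forall>a\<ge>(length ts + L) * sz \<G>. exec_prog (sz \<G>) q M a = 0) \<and>
      (\<forall>j\<in>J. \<forall>i<sz \<G>. exec_prog (sz \<G>) q M ((length ts + j) * sz \<G> + i) = t j \<G> (vx \<G> i))"
  shows "\<exists>us. length us = L \<and> Comp (ts @ us) \<and> (\<forall>j<L. j \<in> J --> us ! j = t j) \<and>
    (\<forall>\<G>\<in>insts. \<exists>M. rep \<G> (ts @ old) M \<and> (\<forall>j<L. j \<notin> J --> (\<forall>i<sz \<G>. (us ! j) \<G> (vx \<G> i) =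
       exec_prog (sz \<G>) q M ((length ts + j) * sz \<G> + i))))"
proof -
  obtain ps where ps: "\<And>\<G>. \<G> \<in> insts ==> rep \<G> (ts @ old) (exec_prog (sz \<G>) ps (start \<G>))"
    using assms(1) unfolding Comp_def by blast
  define M where "M \<G> = exec_prog (sz \<G>) q (exec_prog (sz \<G>) ps (start \<G>))" for \<G>
  define us where "us = map (\<lambda>j. if j \<in> J then t j else (\<lambda>\<G> v. M \<G> ((length ts + j) * sz \<G> + ix \<G> v))) [0..<L]"
  have "rep \<G> (ts @ us) (M \<G>)" if \<G>: "\<G> \<in> insts" for \<G>
  proof -
    note q' = q[OF \<G> ps[OF \<G>], folded M_def]
    have "M \<G> (j * sz \<G> + i) = ((ts @ us) ! j) \<G> (vx \<G> i)" if ji: "j < length ts + L" "i < sz \<G>" for j i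
    proof (cases "j < length ts")
      case True
      then have "(j + 1) * sz \<G> \<le> length ts * sz \<G>" by (intro mult_right_mono) auto
      then have "j * sz \<G> + i < length ts * sz \<G>" using ji(2) by simp
      then have "M \<G> (j * sz \<G> + i) = exec_prog (sz \<G>) ps (start \<G>) (j * sz \<G> + i)" using q' by blast
      then show ?thesis using ps[OF \<G>] True ji by (simp add: rep_def agree_def nth_append)
    next
      case False
      then obtain l where l: "j = length ts + l" "l < L" using ji by (metis add_less_cancel_left le_iff_add not_less)
      then show ?thesis using q' ji(2) insts(7)[OF \<G>] by (auto simp: nth_append us_def)
    qed
    then show ?thesis using q' by (auto simp: rep_def agree_def us_def)
  qed
  then have "Comp (ts @ us)" unfolding Comp_def
    by (intro exI[of _ "ps @ q"]) (auto simp: M_def exec_prog_def)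
  moreover have "\<forall>\<G>\<in>insts. \<exists>M. rep \<G> (ts @ old) M \<and> (\<forall>j<L. j \<notin> J --> (\<forall>i<sz \<G>. (us ! j) \<G> (vx \<G> i) =
       exec_prog (sz \<G>) q M ((length ts + j) * sz \<G> + i)))"
  proof
    fix \<G> assume \<G>: "\<G> \<in> insts"
    show "\<exists>M. rep \<G> (ts @ old) M \<and> (\<forall>j<L. j \<notin> J --> (\<forall>i<sz \<G>. (us ! j) \<G> (vx \<G> i) =
       exec_prog (sz \<G>) q M ((length ts + j) * sz \<G> + i)))"
      by (rule exI[of _ "exec_prog (sz \<G>) ps (start \<G>)"])
        (use ps[OF \<G>] insts(7)[OF \<G>] in \<open>auto simp: us_def M_def\<close>)
  qed
  ultimately show ?thesis by (intro exI[of _ us]) (auto simp: us_def)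
qed

section \<open>Tables obtained pointwise, by counting and by picking\<close>

definition lin :: "'v table set => bool" where
  "lin S \<longleftrightarrow> (\<exists>ts. Comp ts \<and> S \<subseteq> set ts)"

lemma lin_mono: "lin S ==> T \<subseteq> S ==> lin T"
  unfolding lin_def by blast

text \<open>Values computable at each vertex by a bounded number of table lookups. A loaded index
  must be in range on the class, and \<open>congr\<close> permits replacing a function by one that
  agrees with it on the instances, since values elsewhere never matter.\<close>

inductive_set pw :: "'v table set => 'v table set" for S where
  tab: "t \<in> S ==> t \<in> pw S"
| const: "(\<lambda>_ _. k) \<in> pw S"
| index: "(\<lambda>\<G> v. int (ix \<G> v)) \<in> pw S"
| load: "t \<in> S ==> f \<in> pw S ==> (\<And>\<G> v. \<G> \<in> insts ==> v \<in> vs \<G> ==> 0 \<le> f \<G> v \<and> f \<G> v < int (sz \<G>)) ==>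
    (\<lambda>\<G> v. t \<G> (vx \<G> (nat (f \<G> v)))) \<in> pw S"
| plus: "f \<in> pw S ==> g \<in> pw S ==> (\<lambda>\<G> v. f \<G> v + g \<G> v) \<in> pw S"
| minus: "f \<in> pw S ==> g \<in> pw S ==> (\<lambda>\<G> v. f \<G> v - g \<G> v) \<in> pw S"
| ifp: "c \<in> pw S ==> f \<in> pw S ==> g \<in> pw S ==> (\<lambda>\<G> v. if c \<G> v > 0 then f \<G> v else g \<G> v) \<in> pw S"
| congr: "f \<in> pw S ==> (\<And>\<G> v. \<G> \<in> insts ==> v \<in> vs \<G> ==> f \<G> v = g \<G> v) ==> g \<in> pw S"

lemma pw_mono: "f \<in> pw S ==> S \<subseteq> T ==> f \<in> pw T"
  by (induction rule: pw.induct) (auto intro: pw.intros pw.congr)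

lemma pw_exp:
  assumes "f \<in> pw S" "S \<subseteq> set ts"
  shows "\<exists>e. \<forall>\<G>\<in>insts. \<forall>M. agree \<G> ts M --> (\<forall>i<sz \<G>. eval (sz \<G>) (int i) M e = f \<G> (vx \<G> i))"
  using assms(1)
proof (induction rule: pw.induct)
  case (tab t)
  then obtain j where "j < length ts" "ts ! j = t" using assms(2) by (meson in_set_conv_nth subsetD)
  then show ?case by (intro exI[of _ "Ld j Ctr"]) (auto simp: agree_def nat_add_distrib nat_mult_distrib)
next
  case (const k) then show ?case by (intro exI[of _ "Cst k"]) auto
next
  case index then show ?case by (intro exI[of _ Ctr]) (auto simp: insts)
next
  case (load t f)
  obtain j where j: "j < length ts" "ts ! j = t" using load(1) assms(2) by (meson in_set_conv_nth subsetD)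
  obtain e where e: "\<And>\<G> M i. \<G> \<in> insts ==> agree \<G> ts M ==> i < sz \<G> ==> eval (sz \<G>) (int i) M e = f \<G> (vx \<G> i)"
    using load.IH by blast
  have "eval (sz \<G>) (int i) M (Ld j e) = t \<G> (vx \<G> (nat (f \<G> (vx \<G> i))))"
    if a: "\<G> \<in> insts" "agree \<G> ts M" "i < sz \<G>" for \<G> M i
  proof -
    have f: "0 \<le> f \<G> (vx \<G> i)" "f \<G> (vx \<G> i) < int (sz \<G>)" using load(3)[OF a(1) insts(5)[OF a(1,3)]] by auto
    then have "nat (int (j * sz \<G>) + f \<G> (vx \<G> i)) = j * sz \<G> + nat (f \<G> (vx \<G> i))"
      by (simp add: nat_add_distrib nat_mult_distrib)
    then show ?thesis using a(2) j f e[OF a] by (auto simp: agree_def)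
  qed
  then show ?case by blast
next
  case (plus f g)
  then obtain e1 e2 where "\<forall>\<G>\<in>insts. \<forall>M. agree \<G> ts M --> (\<forall>i<sz \<G>. eval (sz \<G>) (int i) M e1 = f \<G> (vx \<G> i))"
    "\<forall>\<G>\<in>insts. \<forall>M. agree \<G> ts M --> (\<forall>i<sz \<G>. eval (sz \<G>) (int i) M e2 = g \<G> (vx \<G> i))" by blast
  then show ?case by (intro exI[of _ "Pls e1 e2"]) auto
next
  case (minus f g)
  then obtain e1 e2 where "\<forall>\<G>\<in>insts. \<forall>M. agree \<G> ts M --> (\<forall>i<sz \<G>. eval (sz \<G>) (int i) M e1 = f \<G> (vx \<G> i))"
    "\<forall>\<G>\<in>insts. \<forall>M. agree \<G> ts M --> (\<forall>i<sz \<G>. eval (sz \<G>) (int i) M e2 = g \<G> (vx \<G> i))" by blast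
  then show ?case by (intro exI[of _ "Mns e1 e2"]) auto
next
  case (ifp c f g)
  then obtain e1 e2 e3 where "\<forall>\<G>\<in>insts. \<forall>M. agree \<G> ts M --> (\<forall>i<sz \<G>. eval (sz \<G>) (int i) M e1 = c \<G> (vx \<G> i))"
    "\<forall>\<G>\<in>insts. \<forall>M. agree \<G> ts M --> (\<forall>i<sz \<G>. eval (sz \<G>) (int i) M e2 = f \<G> (vx \<G> i))"
    "\<forall>\<G>\<in>insts. \<forall>M. agree \<G> ts M --> (\<forall>i<sz \<G>. eval (sz \<G>) (int i) M e3 = g \<G> (vx \<G> i))" by blast
  then show ?case by (intro exI[of _ "Ifp e1 e2 e3"]) auto
next
  case (congr f g) then show ?case using insts(5) by metis
qed

text \<open>One pass of stores into a fresh table at position \<open>length ts\<close>: f gives the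
  cell and G the update of its content. The expression for the value is a function e of the one for
  the address, because an update has to read the cell that it writes.\<close>

lemma Comp_pass:
  assumes ts: "Comp ts" "S \<subseteq> set ts" and f: "f \<in> pw S"
    and fV: "\<And>\<G> v. \<G> \<in> insts ==> v \<in> vs \<G> ==> 0 \<le> f \<G> v \<and> f \<G> v < int (sz \<G>)"
    and e: "\<And>\<G> M i ef. \<G> \<in> insts ==> agree \<G> ts M ==> i < sz \<G> ==> eval (sz \<G>) (int i) M ef = f \<G> (vx \<G> i) ==>
       eval (sz \<G>) (int i) M (e ef) = G \<G> i (M (length ts * sz \<G> + nat (f \<G> (vx \<G> i))))"
    and t: "\<And>\<G> z. \<G> \<in> insts ==> z < sz \<G> ==>
       fold (\<lambda>i x. if nat (f \<G> (vx \<G> i)) = z then clamp (k * sz \<G>) (G \<G> i x) else x) (rev [0..<sz \<G>]) 0 = t \<G> (vx \<G> z)"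
  shows "Comp (ts @ [t])"
proof -
  obtain ef where ef: "\<And>\<G> M i. \<G> \<in> insts ==> agree \<G> ts M ==> i < sz \<G> ==> eval (sz \<G>) (int i) M ef = f \<G> (vx \<G> i)"
    using pw_exp[OF f ts(2)] by blast
  let ?q = "[(1, [(length ts, ef, e ef, k)])]"
  have "\<exists>us. length us = 1 \<and> Comp (ts @ us) \<and> (\<forall>j<1. j \<in> {0} --> us ! j = t) \<and>
    (\<forall>\<G>\<in>insts. \<exists>M. rep \<G> (ts @ []) M \<and> (\<forall>j<1. j \<notin> {0} --> (\<forall>i<sz \<G>. (us ! j) \<G> (vx \<G> i) =
       exec_prog (sz \<G>) ?q M ((length ts + j) * sz \<G> + i))))"
  proof (rule Comp_ext[where old = "[]" and q = ?q])
    show "Comp (ts @ [])" using ts(1) by simp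
    fix \<G> M0 assume \<G>: "\<G> \<in> insts" and "rep \<G> (ts @ []) M0"
    then have rep: "rep \<G> ts M0" by simp
    let ?n = "sz \<G>" and ?J = "length ts"
    let ?F = "\<lambda>i. nat (f \<G> (vx \<G> i))"
    have ag: "agree \<G> ts M" if "\<forall>a. a \<notin> {?J * ?n..<?J * ?n + ?n} --> M a = M0 a" for M
      unfolding agree_def
    proof (intro allI impI)
      fix j i assume ji: "j < ?J" "i < ?n"
      then have "(j + 1) * ?n \<le> ?J * ?n" by (intro mult_right_mono) auto
      then have "M (j * ?n + i) = M0 (j * ?n + i)" using that ji by auto
      then show "M (j * ?n + i) = (ts ! j) \<G> (vx \<G> i)" using rep ji by (simp add: rep_def agree_def)
    qed
    have "exec_phase ?n (1, [(?J, ef, e ef, k)]) M0 =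
      (\<lambda>a. if a \<in> {?J * ?n..<?J * ?n + ?n} then
        fold (\<lambda>i x. if ?F i = a - ?J * ?n then clamp (k * ?n) (G \<G> i x) else x) (rev [0..<?n]) (M0 a) else M0 a)"
    proof (rule fold_pass)
      fix M i assume M: "\<forall>a. a \<notin> {?J * ?n..<?J * ?n + ?n} --> M a = M0 a" and i: "i < ?n"
      have "eval ?n (int i) M ef = f \<G> (vx \<G> i)" using ef[OF \<G> ag[OF M] i] .
      then show "eval ?n (int i) M ef = int (?F i) \<and> ?F i < ?n \<and> eval ?n (int i) M (e ef) = G \<G> i (M (?J * ?n + ?F i))"
        using e[OF \<G> ag[OF M] i] fV[OF \<G> insts(5)[OF \<G> i]] by auto
    qed
    then have ex: "exec_prog ?n ?q M0 = (\<lambda>a. if a \<in> {?J * ?n..<?J * ?n + ?n} then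
        fold (\<lambda>i x. if ?F i = a - ?J * ?n then clamp (k * ?n) (G \<G> i x) else x) (rev [0..<?n]) (M0 a) else M0 a)"
      by (simp add: exec_prog_def)
    show "(\<forall>a<?J * ?n. exec_prog ?n ?q M0 a = M0 a) \<and> (\<forall>a\<ge>(?J + 1) * ?n. exec_prog ?n ?q M0 a = 0) \<and>
      (\<forall>j\<in>{0}. \<forall>i<?n. exec_prog ?n ?q M0 ((?J + j) * ?n + i) = t \<G> (vx \<G> i))"
      unfolding ex using rep t[OF \<G>] by (auto simp: rep_def)
  qed
  then obtain us where "length us = 1" "Comp (ts @ us)" "us ! 0 = t" by auto
  then show ?thesis by (cases us) auto
qed

text \<open>The linear bound on f makes the cut-off of the store harmless.\<close>

lemma Comp_pw:
  assumes ts: "Comp ts" "S \<subseteq> set ts" and "f \<in> pw S"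
    and "\<And>\<G> v. \<G> \<in> insts ==> v \<in> vs \<G> ==> \<bar>f \<G> v\<bar> \<le> int (k * sz \<G>)"
  shows "Comp (ts @ [f])"
proof -
  obtain e where e: "\<And>\<G> M i. \<G> \<in> insts ==> agree \<G> ts M ==> i < sz \<G> ==> eval (sz \<G>) (int i) M e = f \<G> (vx \<G> i)"
    using pw_exp[OF assms(3) ts(2)] by blast
  have fold: "fold (\<lambda>i x. if i = z then g i else x) (rev [0..<m]) x = (if z < m then g z else x)"
    for g and z m :: nat and x :: int by (induction m arbitrary: x) (auto simp: less_Suc_eq)
  show ?thesis
  proof (rule Comp_pass[OF ts pw.index, of "\<lambda>_. e" "\<lambda>\<G> i x. f \<G> (vx \<G> i)" k f])
    fix \<G> z assume a: "\<G> \<in> insts" "z < sz \<G>"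
    have "fold (\<lambda>i x. if nat (int (ix \<G> (vx \<G> i))) = z then clamp (k * sz \<G>) (f \<G> (vx \<G> i)) else x) (rev [0..<sz \<G>]) 0
      = fold (\<lambda>i x. if i = z then clamp (k * sz \<G>) (f \<G> (vx \<G> i)) else x) (rev [0..<sz \<G>]) 0"
      by (rule fold_cong) (use insts(7)[OF a(1)] in auto)
    also have "\<dots> = clamp (k * sz \<G>) (f \<G> (vx \<G> z))" using a fold by simp
    also have "\<dots> = f \<G> (vx \<G> z)" using assms(4)[OF a(1) insts(5)[OF a]] by (simp add: clamp_def)
    finally show "fold (\<lambda>i x. if nat (int (ix \<G> (vx \<G> i))) = z then clamp (k * sz \<G>) (f \<G> (vx \<G> i)) else x) (rev [0..<sz \<G>]) 0
       = f \<G> (vx \<G> z)" .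
  qed (use e insts in auto)
qed

lemma lin_pw:
  assumes "lin S" "f \<in> pw S" "\<And>\<G> v. \<G> \<in> insts ==> v \<in> vs \<G> ==> \<bar>f \<G> v\<bar> \<le> int (k * sz \<G>)"
  shows "lin (insert f S)"
proof -
  obtain ts where ts: "Comp ts" "S \<subseteq> set ts" using assms(1) unfolding lin_def by blast
  have "Comp (ts @ [f])" using Comp_pw[OF ts assms(2,3)] .
  then show ?thesis using ts(2) unfolding lin_def by (intro exI[of _ "ts @ [f]"]) auto
qed

lemma lin_pw_set:
  assumes "lin S" "finite F" "\<And>f. f \<in> F ==> f \<in> pw S \<and> (\<forall>\<G>\<in>insts. \<forall>v\<in>vs \<G>. \<bar>f \<G> v\<bar> \<le> int (k * sz \<G>))"
  shows "lin (F \<union> S)"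
  using assms(2,3)
proof (induction F rule: finite_induct)
  case empty then show ?case using assms(1) by simp
next
  case (insert f F)
  then have "lin (F \<union> S)" by blast
  from lin_pw[OF this, of f k] insert.prems[of f] show ?case using pw_mono[of f S "F \<union> S"] by auto
qed

lemma bij_card_index:
  assumes "\<G> \<in> insts"
  shows "card {i. i < sz \<G> \<and> P (vx \<G> i)} = card {y \<in> vs \<G>. P y}"
proof (rule bij_betw_same_card[of "vx \<G>"])
  show "bij_betw (vx \<G>) {i. i < sz \<G> \<and> P (vx \<G> i)} {y \<in> vs \<G>. P y}"
    by (rule bij_betw_byWitness[where f' = "ix \<G>"]) (use insts[OF assms] in auto)
qed

text \<open>A histogram: each y with positive \<open>c\<close> increments the cell of its value. No
  entry exceeds n, so the cut-off factor 1 suffices.\<close>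

lemma lin_count:
  assumes "lin S" "f \<in> pw S" "c \<in> pw S"
    and fV: "\<And>\<G> v. \<G> \<in> insts ==> v \<in> vs \<G> ==> 0 \<le> f \<G> v \<and> f \<G> v < int (sz \<G>)"
  shows "lin (insert (\<lambda>\<G> z. int (card {y \<in> vs \<G>. f \<G> y = int (ix \<G> z) \<and> c \<G> y > 0})) S)"
proof -
  obtain ts where ts: "Comp ts" "S \<subseteq> set ts" using assms(1) unfolding lin_def by blast
  obtain e where e: "\<And>\<G> M i. \<G> \<in> insts ==> agree \<G> ts M ==> i < sz \<G> ==> eval (sz \<G>) (int i) M e = c \<G> (vx \<G> i)"
    using pw_exp[OF assms(3) ts(2)] by blast
  let ?J = "length ts"
  let ?t = "\<lambda>\<G> z. int (card {y \<in> vs \<G>. f \<G> y = int (ix \<G> z) \<and> c \<G> y > 0})"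
  have "Comp (ts @ [?t])"
  proof (rule Comp_pass[OF ts assms(2) fV, of "\<lambda>ef. Ifp e (Pls (Ld ?J ef) (Cst 1)) (Ld ?J ef)"
        "\<lambda>\<G> i x. if c \<G> (vx \<G> i) > 0 then x + 1 else x" 1])
    fix \<G> M i ef assume a: "\<G> \<in> insts" "agree \<G> ts M" "i < sz \<G>" "eval (sz \<G>) (int i) M ef = f \<G> (vx \<G> i)"
    have "nat (int (?J * sz \<G>) + f \<G> (vx \<G> i)) = ?J * sz \<G> + nat (f \<G> (vx \<G> i))"
      using fV[OF a(1) insts(5)[OF a(1,3)]] by (simp add: nat_add_distrib nat_mult_distrib)
    then show "eval (sz \<G>) (int i) M (Ifp e (Pls (Ld ?J ef) (Cst 1)) (Ld ?J ef)) =
       (if c \<G> (vx \<G> i) > 0 then M (?J * sz \<G> + nat (f \<G> (vx \<G> i))) + 1 else M (?J * sz \<G> + nat (f \<G> (vx \<G> i))))"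
      using e[OF a(1-3)] a(4) by simp
  next
    fix \<G> z assume a: "\<G> \<in> insts" "z < sz \<G>"
    let ?P = "\<lambda>i. nat (f \<G> (vx \<G> i)) = z \<and> c \<G> (vx \<G> i) > 0"
    let ?g = "\<lambda>i x. if nat (f \<G> (vx \<G> i)) = z then clamp (1 * sz \<G>) (if c \<G> (vx \<G> i) > 0 then x + 1 else x) else x"
    have "fold ?g (rev [0..<m]) (int x) = int (x + card {i. i < m \<and> ?P i})" if "x + m \<le> sz \<G>" for x m
      using that
    proof (induction m arbitrary: x)
      case (Suc m)
      have s: "{i. i < Suc m \<and> ?P i} = {i. i < m \<and> ?P i} \<union> (if ?P m then {m} else {})"
        by (auto simp: less_Suc_eq)
      have "card {i. i < Suc m \<and> ?P i} = card {i. i < m \<and> ?P i} + (if ?P m then 1 else 0)"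
        unfolding s by (auto simp: card_insert_if)
      moreover have "?g m (int x) = int (x + (if ?P m then 1 else 0))" using Suc.prems by (auto simp: clamp_def)
      moreover have "x + (if ?P m then 1 else 0) + m \<le> sz \<G>" using Suc.prems by auto
      ultimately show ?case using Suc.IH[of "x + (if ?P m then 1 else 0)"] by simp
    qed auto
    from this[of 0 "sz \<G>"] have "fold ?g (rev [0..<sz \<G>]) 0 = int (card {i. i < sz \<G> \<and> ?P i})" by simp
    also have "\<dots> = ?t \<G> (vx \<G> z)"
    proof -
      have "{y \<in> vs \<G>. f \<G> y = int (ix \<G> (vx \<G> z)) \<and> c \<G> y > 0} = {y \<in> vs \<G>. nat (f \<G> y) = z \<and> c \<G> y > 0}"
        using fV[OF a(1)] insts(7)[OF a] by auto
      then show ?thesis using bij_card_index[OF a(1), of "\<lambda>y. nat (f \<G> y) = z \<and> c \<G> y > 0"] by simp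
    qed
    finally show "fold ?g (rev [0..<sz \<G>]) 0 = ?t \<G> (vx \<G> z)" .
  qed auto
  then show ?thesis using ts(2) unfolding lin_def by (intro exI[of _ "ts @ [?t]"]) auto
qed

lemma enc_bound: "\<G> \<in> insts ==> f \<G> v \<in> vs \<G> ==> 0 \<le> enc f \<G> v \<and> enc f \<G> v < int (sz \<G>)"
  using insts(4) by (auto simp: enc_def)

text \<open>Every admissible y overwrites the cell of \<open>f \<G> y\<close> by its own index; the
  counter decreases, so the least index is written last and survives.\<close>

lemma lin_pick:
  assumes "lin S" "enc f \<in> pw S" "c \<in> pw S"
    and fV: "\<And>\<G> v. \<G> \<in> insts ==> v \<in> vs \<G> ==> f \<G> v \<in> vs \<G>"
  shows "lin (insert (enc (\<lambda>\<G> z. pick \<G> {y \<in> vs \<G>. f \<G> y = z \<and> c \<G> y > 0} z)) S)"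
proof -
  obtain ts where ts: "Comp ts" "S \<subseteq> set ts" using assms(1) unfolding lin_def by blast
  obtain e where e: "\<And>\<G> M i. \<G> \<in> insts ==> agree \<G> ts M ==> i < sz \<G> ==> eval (sz \<G>) (int i) M e = c \<G> (vx \<G> i)"
    using pw_exp[OF assms(3) ts(2)] by blast
  let ?J = "length ts"
  define A where "A \<G> z = {y \<in> vs \<G>. f \<G> y = z \<and> c \<G> y > 0}" for \<G> z
  \<comment> \<open>The index is shifted by one, so that the initial 0 of a fresh table means that
    nothing was found.\<close>
  define t where "t \<G> z = (if A \<G> z = {} then 0 else 1 + int (LEAST i. i \<in> ix \<G> ` A \<G> z))" for \<G> z
  have fV': "0 \<le> enc f \<G> v \<and> enc f \<G> v < int (sz \<G>)" if "\<G> \<in> insts" "v \<in> vs \<G>" for \<G> v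
    using enc_bound fV that by blast
  have "Comp (ts @ [t])"
  proof (rule Comp_pass[OF ts assms(2) fV', of "\<lambda>ef. Ifp e (Pls Ctr (Cst 1)) (Ld ?J ef)"
        "\<lambda>\<G> i x. if c \<G> (vx \<G> i) > 0 then int i + 1 else x" 1])
    fix \<G> M i ef assume a: "\<G> \<in> insts" "agree \<G> ts M" "i < sz \<G>" "eval (sz \<G>) (int i) M ef = enc f \<G> (vx \<G> i)"
    have "nat (int (?J * sz \<G>) + enc f \<G> (vx \<G> i)) = ?J * sz \<G> + nat (enc f \<G> (vx \<G> i))"
      using fV'[OF a(1) insts(5)[OF a(1,3)]] by (simp add: nat_add_distrib nat_mult_distrib)
    then show "eval (sz \<G>) (int i) M (Ifp e (Pls Ctr (Cst 1)) (Ld ?J ef)) =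
       (if c \<G> (vx \<G> i) > 0 then int i + 1 else M (?J * sz \<G> + nat (enc f \<G> (vx \<G> i))))"
      using e[OF a(1-3)] a(4) by simp
  next
    fix \<G> z assume a: "\<G> \<in> insts" "z < sz \<G>"
    let ?P = "\<lambda>i. nat (enc f \<G> (vx \<G> i)) = z \<and> c \<G> (vx \<G> i) > 0"
    let ?g = "\<lambda>i x. if nat (enc f \<G> (vx \<G> i)) = z then clamp (1 * sz \<G>) (if c \<G> (vx \<G> i) > 0 then int i + 1 else x) else x"
    have "fold ?g (rev [0..<m]) x = (if \<exists>i<m. ?P i then 1 + int (LEAST i. ?P i) else x)"
      if "m \<le> sz \<G>" "\<bar>x\<bar> \<le> int (sz \<G>)" for x m
      using that
    proof (induction m arbitrary: x)
      case (Suc m)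
      have "?g m x = (if ?P m then int m + 1 else x)" using Suc.prems by (auto simp: clamp_def)
      moreover have "fold ?g (rev [0..<m]) (?g m x) = (if \<exists>i<m. ?P i then 1 + int (LEAST i. ?P i) else ?g m x)"
        by (rule Suc.IH) (use Suc.prems in \<open>auto simp: clamp_def\<close>)
      moreover have "(LEAST i. ?P i) = m" if "\<not> (\<exists>i<m. ?P i)" "?P m"
        by (rule Least_equality) (use that in \<open>auto simp: not_less[symmetric]\<close>)
      ultimately show ?case by (auto simp: less_Suc_eq)
    qed auto
    from this[of "sz \<G>" 0] have r: "fold ?g (rev [0..<sz \<G>]) 0 =
      (if \<exists>i<sz \<G>. ?P i then 1 + int (LEAST i. ?P i) else 0)" by simp
    have A': "i \<in> ix \<G> ` A \<G> (vx \<G> z) \<longleftrightarrow> i < sz \<G> \<and> ?P i" for i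
    proof
      assume "i \<in> ix \<G> ` A \<G> (vx \<G> z)"
      then obtain y where y: "y \<in> vs \<G>" "i = ix \<G> y" "f \<G> y = vx \<G> z" "c \<G> y > 0" by (auto simp: A_def)
      then show "i < sz \<G> \<and> ?P i"
        using insts(4,6)[OF a(1) y(1)] insts(7)[OF a] by (simp add: enc_def)
    next
      assume i: "i < sz \<G> \<and> ?P i"
      have "f \<G> (vx \<G> i) \<in> vs \<G>" using fV a insts(5) i by blast
      then have "f \<G> (vx \<G> i) = vx \<G> z" using i insts(6)[OF a(1)] by (auto simp: enc_def)
      then show "i \<in> ix \<G> ` A \<G> (vx \<G> z)" using i insts(5,7)[OF a(1), of i]
        by (intro image_eqI[of _ _ "vx \<G> i"]) (simp_all add: A_def)
    qed
    have L: "(LEAST i. ?P i) = (LEAST i. i < sz \<G> \<and> ?P i)" if ex: "\<exists>i<sz \<G>. ?P i"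
    proof (rule Least_equality)
      have "(LEAST i. i < sz \<G> \<and> ?P i) < sz \<G> \<and> ?P (LEAST i. i < sz \<G> \<and> ?P i)"
        using ex LeastI_ex[of "\<lambda>i. i < sz \<G> \<and> ?P i"] by blast
      then have l: "(LEAST i. i < sz \<G> \<and> ?P i) < sz \<G>" and "?P (LEAST i. i < sz \<G> \<and> ?P i)" by blast+
      then show "?P (LEAST i. i < sz \<G> \<and> ?P i)" by blast
      fix y assume y: "?P y"
      show "(LEAST i. i < sz \<G> \<and> ?P i) \<le> y"
      proof (cases "y < sz \<G>")
        case True then show ?thesis using y by (intro Least_le) auto
      next
        case False
        then show ?thesis using l by linarith
      qed
    qed
    show "fold ?g (rev [0..<sz \<G>]) 0 = t \<G> (vx \<G> z)"
    proof (cases "\<exists>i<sz \<G>. ?P i")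
      case True
      then have "A \<G> (vx \<G> z) \<noteq> {}" using A' by blast
      moreover have "(LEAST i. i \<in> ix \<G> ` A \<G> (vx \<G> z)) = (LEAST i. ?P i)" unfolding A' using L True by simp
      ultimately show ?thesis unfolding r t_def using True by simp
    next
      case False
      then have "A \<G> (vx \<G> z) = {}" using A' by blast
      then show ?thesis unfolding r t_def using False by simp
    qed
  qed auto
  then have l: "lin (insert t S)" using ts(2) unfolding lin_def by (intro exI[of _ "ts @ [t]"]) auto
  let ?w = "\<lambda>\<G> z. pick \<G> (A \<G> z) z"
  have "(\<lambda>\<G> v. if t \<G> v > 0 then t \<G> v - 1 else int (ix \<G> v)) \<in> pw (insert t S)"
    by (intro pw.ifp pw.minus pw.const pw.index pw.tab) auto
  then have w: "enc ?w \<in> pw (insert t S)"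
  proof (rule pw.congr)
    fix \<G> z assume a: "\<G> \<in> insts" "z \<in> vs \<G>"
    show "(if t \<G> z > 0 then t \<G> z - 1 else int (ix \<G> z)) = enc ?w \<G> z"
    proof (cases "A \<G> z = {}")
      case True then show ?thesis by (simp add: t_def enc_def pick_empty)
    next
      case False
      then obtain x where "x \<in> A \<G> z" by blast
      then have "(LEAST i. i \<in> ix \<G> ` A \<G> z) \<in> ix \<G> ` A \<G> z"
        by (intro LeastI[of "\<lambda>i. i \<in> ix \<G> ` A \<G> z" "ix \<G> x"]) simp
      then obtain y where "y \<in> A \<G> z" "(LEAST i. i \<in> ix \<G> ` A \<G> z) = ix \<G> y" by (elim imageE)
      then show ?thesis using False insts[OF a(1)] by (auto simp: t_def enc_def pick_def A_def)
    qed
  qed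
  have "lin (insert (enc ?w) (insert t S))"
  proof (rule lin_pw[OF l w, of 1])
    fix \<G> v assume a: "\<G> \<in> insts" "v \<in> vs \<G>"
    have "A \<G> v \<subseteq> vs \<G>" by (auto simp: A_def)
    then have "?w \<G> v \<in> vs \<G>" using pick_in[OF a(1), of "A \<G> v" v] a(2)
      by (cases "A \<G> v = {}") (simp add: pick_empty, blast)
    then show "\<bar>enc ?w \<G> v\<bar> \<le> int (1 * sz \<G>)" using enc_bound[OF a(1), of ?w v] by auto
  qed
  then show ?thesis unfolding A_def by (rule lin_mono) auto
qed

end

section \<open>Orientations of bounded outdegree\<close>

text \<open>Depth-0 minors are the subgraphs, up to writing vertices as singletons, so the subgraph
  induced on W has at most \<open>D * card W\<close> edges and hence a vertex of degree at most
  \<open>2 * D\<close>. Orienting its edges outwards and removing it is the usual degeneracy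
  argument.\<close>

lemma orientation_exists:
  assumes g: "grad_le 0 D G" and fin: "finite (verts G)" and W: "W \<subseteq> verts G"
  shows "\<exists>Or. Or \<subseteq> W \<times> W \<and> (\<forall>u\<in>W. card {w. (u, w) \<in> Or} \<le> 2 * D) \<and>
     (\<forall>a\<in>W. \<forall>b\<in>W. a \<noteq> b --> {a, b} \<in> edges G --> (a, b) \<in> Or \<or> (b, a) \<in> Or)"
proof -
  have "finite W" using fin W finite_subset by blast
  then show ?thesis using W
  proof (induction "card W" arbitrary: W)
    case 0 then show ?case by auto
  next
    case (Suc k)
    define E where "E = {(a, b). a \<in> W \<and> b \<in> W \<and> a \<noteq> b \<and> {a, b} \<in> edges G}"
    define H where "H = \<lparr>verts = (\<lambda>v. {v}) ` W, edges = (\<lambda>(a, b). {{a}, {b}}) ` E\<rparr>"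
    have finE: "finite E" by (rule finite_subset[of _ "W \<times> W"]) (use Suc.prems in \<open>auto simp: E_def\<close>)
    have "shallow_minor 0 G H" unfolding shallow_minor_def
    proof (intro conjI ballI impI)
      fix B assume "B \<in> verts H"
      then obtain v where v: "B = {v}" "v \<in> W" by (auto simp: H_def)
      then show "B \<subseteq> verts G" using Suc.prems by auto
      show "radius_le 0 G B" using v by (auto simp: radius_le_def)
    next
      fix A B assume "A \<in> verts H" "B \<in> verts H" "A \<noteq> B"
      then show "A \<inter> B = {}" by (auto simp: H_def)
    next
      show "edges H \<subseteq> {{A, B} |A B. A \<in> verts H \<and> B \<in> verts H \<and> A \<noteq> B \<and> (\<exists>a\<in>A. \<exists>b\<in>B. {a, b} \<in> edges G)}"
      proof
        fix e assume "e \<in> edges H"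
        then obtain a b where "(a, b) \<in> E" "e = {{a}, {b}}" by (auto simp: H_def)
        then show "e \<in> {{A, B} |A B. A \<in> verts H \<and> B \<in> verts H \<and> A \<noteq> B \<and> (\<exists>a\<in>A. \<exists>b\<in>B. {a, b} \<in> edges G)}"
          by (intro CollectI exI[of _ "{a}"] exI[of _ "{b}"]) (auto simp: H_def E_def)
      qed
    qed
    then have "card (edges H) \<le> D * card (verts H)" using g by (simp add: grad_le_def)
    also have "card (verts H) = card W" by (simp add: H_def card_image)
    finally have c: "card (edges H) \<le> D * card W" .
    have EU: "E \<subseteq> (\<Union>e\<in>edges H. {(a, b). e = {{a}, {b}}})" by (auto simp: H_def)
    have fe: "finite {(a, b). e = {{a}, {b}}} \<and> card {(a, b). e = {{a}, {b}}} \<le> 2" if "e \<in> edges H" for e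
    proof -
      obtain a b where e: "e = {{a}, {b}}" using \<open>e \<in> edges H\<close> by (auto simp: H_def)
      have "{(a, b). e = {{a}, {b}}} \<subseteq> {(a, b), (b, a)}" unfolding e doubleton_eq_iff by auto
      moreover have "card {(a, b), (b, a)} \<le> 2" using card_insert_le_m1[of 2 "{(b, a)}" "(a, b)"] by simp
      ultimately show ?thesis by (meson card_mono finite.emptyI finite_insert finite_subset le_trans)
    qed
    have "finite (edges H)" using finE by (simp add: H_def)
    then have "card E \<le> card (\<Union>e\<in>edges H. {(a, b). e = {{a}, {b}}})"
      using fe by (intro card_mono[OF _ EU] finite_UN_I) auto
    also have "\<dots> \<le> (\<Sum>e\<in>edges H. card {(a, b). e = {{a}, {b}}})"
      using \<open>finite (edges H)\<close> by (rule card_UN_le)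
    also have "\<dots> \<le> card (edges H) * 2" using sum_mono[of "edges H" "\<lambda>e. card {(a, b). e = {{a}, {b}}}" "\<lambda>_. 2"] fe by simp
    finally have cE: "card E \<le> 2 * D * card W" using c by simp
    have "\<exists>v\<in>W. card {w. (v, w) \<in> E} \<le> 2 * D"
    proof (rule ccontr)
      assume "\<not> ?thesis"
      then have "(\<Sum>v\<in>W. 2 * D) < (\<Sum>v\<in>W. card {w. (v, w) \<in> E})"
        using Suc by (intro sum_strict_mono) (auto simp: not_le)
      also have "\<dots> = card (SIGMA v:W. {w. (v, w) \<in> E})"
      proof (rule card_SigmaI[symmetric])
        show "\<forall>a\<in>W. finite {w. (a, w) \<in> E}"
          using Suc.prems(1) by (auto intro!: finite_subset[of _ W] simp: E_def)
      qed (use Suc.prems in auto)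
      also have "(SIGMA v:W. {w. (v, w) \<in> E}) = E" by (auto simp: E_def)
      finally show False using cE by (simp add: mult.commute)
    qed
    then obtain v where v: "v \<in> W" "card {w. (v, w) \<in> E} \<le> 2 * D" by blast
    have k: "k = card (W - {v})" and f: "finite (W - {v})" "W - {v} \<subseteq> verts G"
      using Suc.hyps(2) v Suc.prems by auto
    from Suc.hyps(1)[OF k f] obtain Or where Or: "Or \<subseteq> (W - {v}) \<times> (W - {v})"
      "\<forall>u\<in>W - {v}. card {w. (u, w) \<in> Or} \<le> 2 * D"
      "\<forall>a\<in>W - {v}. \<forall>b\<in>W - {v}. a \<noteq> b --> {a, b} \<in> edges G --> (a, b) \<in> Or \<or> (b, a) \<in> Or"
      by (elim exE conjE)
    let ?O = "Or \<union> {(v, w) | w. (v, w) \<in> E}"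
    have "card {w. (u, w) \<in> ?O} \<le> 2 * D" if "u \<in> W" for u
    proof (cases "u = v")
      case True
      then have "{w. (u, w) \<in> ?O} = {w. (v, w) \<in> E}" using Or(1) by auto
      then show ?thesis using v by simp
    next
      case False
      then have "{w. (u, w) \<in> ?O} = {w. (u, w) \<in> Or}" by auto
      then show ?thesis using Or(2) False that by simp
    qed
    moreover have "(a, b) \<in> ?O \<or> (b, a) \<in> ?O" if ab: "a \<in> W" "b \<in> W" "a \<noteq> b" "{a, b} \<in> edges G" for a b
    proof -
      have "{b, a} \<in> edges G" using ab(4) by (simp add: insert_commute)
      then show ?thesis using ab Or(3) by (cases "a = v"; cases "b = v") (auto simp: E_def)
    qed
    moreover have "?O \<subseteq> W \<times> W" using Or(1) by (auto simp: E_def)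
    ultimately show ?case by (intro exI[of _ ?O]) blast
  qed
qed

section \<open>Online orientation and its amortised analysis\<close>

type_synonym ostate = "(nat => nat list) \<times> (nat \<times> nat) list"

text \<open>Online orientation. The queue contains arcs to be inserted into the out-lists; when the
  out-list of a vertex overflows, all its arcs are reversed and queued again.\<close>

fun ostep :: "nat => nat \<times> nat => ostate => ostate" where
  "ostep d (u, w) (out, q) = (if u = w \<or> w \<in> set (out u) then (out, q)
     else if length (out u) < d then (out(u := out u @ [w]), q)
     else (out(u := [w]), q @ map (\<lambda>x. (x, u)) (out u)))"

text \<open>Reading past the end of the queue gives the self-loop (0, 0), which \<open>ostep\<close>
  ignores, so surplus steps are idle.\<close>

definition entry :: "nat => (nat \<times> nat) list => nat \<times> nat" where
  "entry c q = (if c < length q then q ! c else (0, 0))"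

primrec orun :: "nat => (nat \<times> nat) list => nat => ostate" where
  "orun d q 0 = (\<lambda>_. [], q)"
| "orun d q (Suc c) = ostep d (entry c (snd (orun d q c))) (orun d q c)"

text \<open>The potential: arcs in out-lists or in the queue that disagree with a fixed orientation
  \<open>Or\<close> of outdegree at most \<delta>. The algorithm does not know \<open>Or\<close>; it
  occurs only in the analysis.\<close>

definition obad :: "(nat \<times> nat) set => nat => (nat => nat list) => (nat \<times> nat) list => nat" where
  "obad Or n out q = (\<Sum>u<n. length (filter (\<lambda>w. (u, w) \<notin> Or) (out u))) + length (filter (\<lambda>a. a \<notin> Or) q)"

text \<open>The last conjunct is the amortised bound. It keeps \<open>length q\<close> below
  \<open>(2 * \<delta> + 2) * length q0\<close>, so after that many steps the queue is exhausted
  and, by the third conjunct, every edge of \<open>q0\<close> sits in an out-list. Arcs are never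
  invented: each is an arc of \<open>q0\<close> or the reverse of one.\<close>

definition oinv :: "(nat \<times> nat) set => nat => nat => (nat \<times> nat) list => nat => ostate => bool" where
  "oinv Or n \<delta> q0 c = (\<lambda>(out, q).
     (\<forall>u. distinct (out u) \<and> length (out u) \<le> 2 * \<delta> + 1 \<and> (\<forall>w\<in>set (out u). u \<noteq> w \<and> (u, w) \<in> set q0 \<union> (set q0)\<inverse>)) \<and>
     (\<forall>(a, b)\<in>set q. (a, b) \<in> set q0 \<union> (set q0)\<inverse>) \<and>
     (\<forall>(a, b)\<in>set q0. a \<noteq> b --> b \<in> set (out a) \<or> a \<in> set (out b) \<or> (a, b) \<in> set (drop c q) \<or> (b, a) \<in> set (drop c q)) \<and>
     length q + (2 * \<delta> + 1) * obad Or n out (drop c q) \<le> (2 * \<delta> + 2) * length q0)"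

lemma oinvI:
  assumes "\<And>u. distinct (out u) \<and> length (out u) \<le> 2 * \<delta> + 1 \<and> (\<forall>w\<in>set (out u). u \<noteq> w \<and> (u, w) \<in> set q0 \<union> (set q0)\<inverse>)"
    and "\<And>a b. (a, b) \<in> set q ==> (a, b) \<in> set q0 \<union> (set q0)\<inverse>"
    and "\<And>a b. (a, b) \<in> set q0 ==> a \<noteq> b ==>
      b \<in> set (out a) \<or> a \<in> set (out b) \<or> (a, b) \<in> set (drop c q) \<or> (b, a) \<in> set (drop c q)"
    and "length q + (2 * \<delta> + 1) * obad Or n out (drop c q) \<le> (2 * \<delta> + 2) * length q0"
  shows "oinv Or n \<delta> q0 c (out, q)"
  using assms unfolding oinv_def by blast

lemma obad_upd: "u < n ==> obad Or n (out(u := xs)) q + length (filter (\<lambda>w. (u, w) \<notin> Or) (out u)) =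
   obad Or n out q + length (filter (\<lambda>w. (u, w) \<notin> Or) xs)"
proof -
  assume u: "u < n"
  have "(\<Sum>v<n. length (filter (\<lambda>w. (v, w) \<notin> Or) ((out(u := xs)) v))) =
    length (filter (\<lambda>w. (u, w) \<notin> Or) xs) + (\<Sum>v\<in>{..<n} - {u}. length (filter (\<lambda>w. (v, w) \<notin> Or) ((out(u := xs)) v)))"
    using u by (subst sum.remove[of _ u]) auto
  moreover have "(\<Sum>v\<in>{..<n} - {u}. length (filter (\<lambda>w. (v, w) \<notin> Or) ((out(u := xs)) v))) =
    (\<Sum>v\<in>{..<n} - {u}. length (filter (\<lambda>w. (v, w) \<notin> Or) (out v)))" by (rule sum.cong) auto
  moreover have "(\<Sum>v<n. length (filter (\<lambda>w. (v, w) \<notin> Or) (out v))) =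
    length (filter (\<lambda>w. (u, w) \<notin> Or) (out u)) + (\<Sum>v\<in>{..<n} - {u}. length (filter (\<lambda>w. (v, w) \<notin> Or) (out v)))"
    using u by (subst sum.remove[of _ u]) auto
  ultimately show ?thesis by (simp add: obad_def)
qed

lemma obad_append: "obad Or n out (q @ q') = obad Or n out q + length (filter (\<lambda>a. a \<notin> Or) q')"
  by (simp add: obad_def)

lemma obad_Cons: "obad Or n out (a # q) = obad Or n out q + (if a \<notin> Or then 1 else 0)"
  by (simp add: obad_def)

text \<open>Only an overflow is interesting. A full list has \<open>2 * \<delta> + 1\<close> arcs,
  at most \<delta> of them in \<open>Or\<close>. Reversing them all makes the bad ones, at least
  \<open>\<delta> + 1\<close>, good, and at most \<delta> good ones bad. The potential drops, and
  this pays for the \<open>2 * \<delta> + 1\<close> new queue entries.\<close>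

lemma oinv_step:
  assumes Or: "\<And>u. u < n ==> finite {w. (u, w) \<in> Or} \<and> card {w. (u, w) \<in> Or} \<le> \<delta>"
    and cov: "\<And>a b. (a, b) \<in> set q0 ==> a \<noteq> b ==> (a, b) \<in> Or \<or> (b, a) \<in> Or"
    and q0: "set q0 \<subseteq> {..<n} \<times> {..<n}"
    and inv: "oinv Or n \<delta> q0 c (out, q)"
  shows "oinv Or n \<delta> q0 (Suc c) (ostep (2 * \<delta> + 1) (entry c q) (out, q))"
proof (cases "c < length q")
  case False
  then have "ostep (2 * \<delta> + 1) (entry c q) (out, q) = (out, q)" "drop (Suc c) q = drop c q" by (auto simp: entry_def)
  then show ?thesis using inv unfolding oinv_def by simp
next
  case True
  let ?E = "set q0 \<union> (set q0)\<inverse>" and ?d = "2 * \<delta> + 1"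
  obtain u w where uw: "q ! c = (u, w)" by fastforce
  define r where "r = drop (Suc c) q"
  have dr: "drop c q = (u, w) # r" using True uw by (simp add: r_def Cons_nth_drop_Suc[symmetric])
  note i = inv[unfolded oinv_def prod.case]
  have i1: "\<And>u. distinct (out u) \<and> length (out u) \<le> ?d \<and> (\<forall>w\<in>set (out u). u \<noteq> w \<and> (u, w) \<in> ?E)"
    using conjunct1[OF i] by blast
  have i2: "\<And>a b. (a, b) \<in> set q ==> (a, b) \<in> ?E"
    using conjunct1[OF conjunct2[OF i]] by blast
  have i3: "\<And>a b. (a, b) \<in> set q0 ==> a \<noteq> b ==> b \<in> set (out a) \<or> a \<in> set (out b) \<or> (a, b) \<in> set (drop c q) \<or> (b, a) \<in> set (drop c q)"
    using conjunct1[OF conjunct2[OF conjunct2[OF i]]] by fast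
  have i4: "length q + ?d * obad Or n out (drop c q) \<le> (2 * \<delta> + 2) * length q0"
    using conjunct2[OF conjunct2[OF conjunct2[OF i]]] .
  have "(u, w) \<in> set q" using uw True nth_mem by metis
  then have uwE: "(u, w) \<in> ?E" by (rule i2)
  then have un: "u < n" using q0 by auto
  show ?thesis
  proof (cases "u = w \<or> w \<in> set (out u)")
    case skip: True
    then have st: "ostep ?d (entry c q) (out, q) = (out, q)" using True uw by (simp add: entry_def)
    have p: "length q + ?d * obad Or n out r \<le> (2 * \<delta> + 2) * length q0"
    proof -
      have "?d * obad Or n out r \<le> ?d * obad Or n out (drop c q)" by (rule mult_le_mono2) (simp add: dr obad_Cons)
      then show ?thesis using i4 by linarith
    qed
    have i3': "b \<in> set (out a) \<or> a \<in> set (out b) \<or> (a, b) \<in> set r \<or> (b, a) \<in> set r"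
      if "(a, b) \<in> set q0" "a \<noteq> b" for a b using i3[OF that] skip that(2) by (auto simp: dr)
    show ?thesis unfolding st by (rule oinvI[OF i1 i2 i3'[unfolded r_def] p[unfolded r_def]])
  next
    case ins: False
    show ?thesis
    proof (cases "length (out u) < ?d")
      case len: True
      then have st: "ostep ?d (entry c q) (out, q) = (out(u := out u @ [w]), q)" using True uw ins by (simp add: entry_def)
      have "obad Or n (out(u := out u @ [w])) r = obad Or n out (drop c q)"
        using obad_upd[OF un, of Or out "out u @ [w]" r] by (simp add: dr obad_Cons)
      then have p: "length q + ?d * obad Or n (out(u := out u @ [w])) r \<le> (2 * \<delta> + 2) * length q0"
        using i4 by simp
      have i3': "b \<in> set ((out(u := out u @ [w])) a) \<or> a \<in> set ((out(u := out u @ [w])) b) \<or> (a, b) \<in> set r \<or> (b, a) \<in> set r"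
        if "(a, b) \<in> set q0" "a \<noteq> b" for a b using i3[OF that] that(2) by (auto simp: dr)
      have i1': "distinct ((out(u := out u @ [w])) v) \<and> length ((out(u := out u @ [w])) v) \<le> ?d \<and>
        (\<forall>x\<in>set ((out(u := out u @ [w])) v). v \<noteq> x \<and> (v, x) \<in> ?E)" for v
        using i1[of v] uwE ins len by (cases "v = u") auto
      show ?thesis unfolding st by (rule oinvI[OF i1' i2 i3'[unfolded r_def] p[unfolded r_def]])
    next
      case full: False
      then have lenu: "length (out u) = ?d" using i1[of u] by simp
      let ?out = "out(u := [w])" and ?q = "q @ map (\<lambda>x. (x, u)) (out u)"
      have st: "ostep ?d (entry c q) (out, q) = (?out, ?q)" using True uw ins full by (simp add: entry_def)
      have dq: "drop (Suc c) ?q = r @ map (\<lambda>x. (x, u)) (out u)" using True by (simp add: r_def)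
      define b where "b = length (filter (\<lambda>x. (u, x) \<notin> Or) (out u))"
      define g where "g = length (filter (\<lambda>x. (u, x) \<in> Or) (out u))"
      have "b + g = ?d" using sum_length_filter_compl[of "\<lambda>x. (u, x) \<notin> Or" "out u"] lenu by (simp add: b_def g_def)
      moreover have "g \<le> \<delta>"
      proof -
        have "g = card (set (filter (\<lambda>x. (u, x) \<in> Or) (out u)))"
          using i1[of u] distinct_card[of "filter (\<lambda>x. (u, x) \<in> Or) (out u)"] by (simp add: g_def)
        also have "\<dots> \<le> card {w. (u, w) \<in> Or}" using Or[OF un] by (intro card_mono) auto
        finally show ?thesis using Or[OF un] by simp
      qed
      ultimately have bg: "\<delta> + 1 \<le> b" by simp
      \<comment> \<open>\<open>Or\<close> contains each edge in some direction, so an arc outside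
        \<open>Or\<close> has its reverse inside; only reversed good arcs can become bad.\<close>
      have flip: "length (filter (\<lambda>a. a \<notin> Or) (map (\<lambda>x. (x, u)) (out u))) \<le> g"
      proof -
        have "(x, u) \<in> Or" if "x \<in> set (out u)" "(u, x) \<notin> Or" for x
        proof -
          have "(u, x) \<in> ?E" "u \<noteq> x" using i1[of u] that(1) by auto
          then show ?thesis using cov[of u x] cov[of x u] that(2) by auto
        qed
        then have "filter (\<lambda>x. (x, u) \<notin> Or) (out u) = filter (\<lambda>x. (u, x) \<in> Or \<and> (x, u) \<notin> Or) (out u)"
          by (intro filter_cong) auto
        also have "\<dots> = filter (\<lambda>x. (x, u) \<notin> Or) (filter (\<lambda>x. (u, x) \<in> Or) (out u))" by (simp add: conj_commute)
        also have "length \<dots> \<le> g" unfolding g_def by (rule length_filter_le)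
        finally show ?thesis by (simp add: filter_map o_def)
      qed
      \<comment> \<open>The arc (u, w) contributes to its list exactly what it contributed to the
        queue.\<close>
      have "obad Or n ?out r + b = obad Or n out r + (if (u, w) \<notin> Or then 1 else 0)"
        using obad_upd[OF un, of Or out "[w]" r] by (simp add: b_def)
      then have "obad Or n ?out (drop (Suc c) ?q) + 1 \<le> obad Or n out (drop c q)"
        using flip bg \<open>g \<le> \<delta>\<close> unfolding dq obad_append dr obad_Cons by linarith
      then have "?d * obad Or n ?out (drop (Suc c) ?q) + ?d \<le> ?d * obad Or n out (drop c q)"
        by (metis mult.right_neutral distrib_left mult_le_mono2)
      moreover have "length ?q = length q + ?d" using lenu by simp
      ultimately have pot: "length ?q + ?d * obad Or n ?out (drop (Suc c) ?q) \<le> (2 * \<delta> + 2) * length q0"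
        using i4 by linarith
      have i3': "b \<in> set (?out a) \<or> a \<in> set (?out b) \<or> (a, b) \<in> set (drop (Suc c) ?q) \<or> (b, a) \<in> set (drop (Suc c) ?q)"
        if "(a, b) \<in> set q0" "a \<noteq> b" for a b using i3[OF that] that(2) unfolding dq dr by auto
      have i1': "distinct (?out v) \<and> length (?out v) \<le> ?d \<and> (\<forall>w\<in>set (?out v). v \<noteq> w \<and> (v, w) \<in> ?E)" for v
        using i1[of v] uwE ins by (cases "v = u") auto
      have i2': "(a, b) \<in> ?E" if "(a, b) \<in> set ?q" for a b
      proof (cases "(a, b) \<in> set q")
        case False
        then have "b = u" "a \<in> set (out u)" using that by auto
        then show ?thesis using i1[of u] by auto
      qed (rule i2)
      show ?thesis unfolding st by (rule oinvI[OF i1' i2' i3' pot])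
    qed
  qed
qed

lemma orun_inv:
  assumes "\<And>u. u < n ==> finite {w. (u, w) \<in> Or} \<and> card {w. (u, w) \<in> Or} \<le> \<delta>"
    and "\<And>a b. (a, b) \<in> set q0 ==> a \<noteq> b ==> (a, b) \<in> Or \<or> (b, a) \<in> Or"
    and "set q0 \<subseteq> {..<n} \<times> {..<n}"
  shows "oinv Or n \<delta> q0 c (orun (2 * \<delta> + 1) q0 c)"
proof (induction c)
  case 0
  have "length (filter (\<lambda>a. a \<notin> Or) q0) \<le> length q0" by simp
  then have "(2 * \<delta> + 1) * length (filter (\<lambda>a. a \<notin> Or) q0) \<le> (2 * \<delta> + 1) * length q0" by (rule mult_le_mono2)
  then have "length q0 + (2 * \<delta> + 1) * obad Or n (\<lambda>_. []) (drop 0 q0) \<le> (2 * \<delta> + 2) * length q0"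
    by (simp add: obad_def)
  then show ?case unfolding orun.simps by (intro oinvI) force+
next
  case (Suc c)
  obtain out q where "orun (2 * \<delta> + 1) q0 c = (out, q)" by fastforce
  then show ?case using oinv_step[OF assms, of c out q] Suc by simp
qed

section \<open>The online orientation as a table program\<close>

definition eqe :: "exp => exp => exp" where
  "eqe a b = Ifp (Mns a b) (Cst 0) (Ifp (Mns b a) (Cst 0) (Cst 1))"

lemma eval_eqe: "eval n i M (eqe a b) = of_bool (eval n i M a = eval n i M b)"
  by (auto simp: eqe_def)

definition sume :: "exp list => exp" where
  "sume es = foldr Pls es (Cst 0)"

lemma eval_sume: "eval n i M (sume es) = (\<Sum>e\<leftarrow>es. eval n i M e)"
  by (induction es) (auto simp: sume_def)

lemma eval_Ld: "eval n i M e = int k ==> eval n i M (Ld t e) = M (t * n + k)"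
  by (simp flip: nat_int_add)

lemma eval_Ld0: "eval n i M (Ld t (Cst 0)) = M (t * n)"
  using eval_Ld[of n i M "Cst 0" 0 t] by simp

declare eval.simps(4) [simp del] eval_Ld0 [simp]

lemma exec_store_eq:
  "eval n i M a = int k ==> eval n i M e = x ==> \<bar>x\<bar> \<le> int (b * n) ==>
   exec_store n i (t, a, e, b) M = M(t * n + k := x)"
  by (simp add: clamp_def flip: nat_int_add)

lemma exec_body_append: "exec_body n i (b1 @ b2) M = exec_body n i b2 (exec_body n i b1 M)"
  by (simp add: exec_body_def)

lemma exec_body_Cons: "exec_body n i (s # b) M = exec_body n i b (exec_store n i s M)"
  by (simp add: exec_body_def)

lemma exec_body_Nil: "exec_body n i [] M = M"
  by (simp add: exec_body_def)

lemma cell_eq: "i < n ==> i' < n ==> t * n + i = t' * n + i' \<longleftrightarrow> t = t' \<and> i = (i' :: nat)"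
  by (metis add.commute div_mult_self1_is_m div_mult_self3 less_nat_zero_code mod_less mod_mult_self3 mult.commute
      div_less add_0 add_cancel_right_left not_less_zero)

text \<open>Memory layout: the T tables from B on hold the sources of the queue entries and the next
  T tables their targets, each block used as one array of \<open>T * n\<close> cells. The d tables
  from J on hold the slots of the out-lists and \<open>LEN\<close> their lengths. Of
  \<open>TAIL\<close>, \<open>ACT\<close> and \<open>FULL\<close> only cell 0 is used.\<close>

locale orient_program =
  fixes n B T d :: nat
  assumes n: "n > 0" and d: "d > 0" and dT: "d \<le> T"
begin

definition "J = B + 2 * T"
definition "LEN = J + d"
definition "TAIL = J + d + 1"
definition "ACT = J + d + 2"
definition "FULL = J + d + 3"

lemma tables_distinct [simp]:
  "LEN \<noteq> TAIL" "LEN \<noteq> ACT" "LEN \<noteq> FULL" "TAIL \<noteq> ACT" "TAIL \<noteq> FULL" "ACT \<noteq> FULL"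
  "TAIL \<noteq> LEN" "ACT \<noteq> LEN" "FULL \<noteq> LEN" "ACT \<noteq> TAIL" "FULL \<noteq> TAIL" "FULL \<noteq> ACT"
  "j < d ==> J + j \<noteq> LEN" "j \<le> d ==> J + j \<noteq> TAIL" "j \<le> d ==> J + j \<noteq> ACT" "j \<le> d ==> J + j \<noteq> FULL"
  "j < d ==> LEN \<noteq> J + j" "j \<le> d ==> TAIL \<noteq> J + j" "j \<le> d ==> ACT \<noteq> J + j" "j \<le> d ==> FULL \<noteq> J + j"
  "J \<le> LEN" "J \<le> TAIL" "J \<le> ACT" "J \<le> FULL" "LEN \<le> TAIL" "LEN \<le> ACT"
  "LEN < J + d + 4" "TAIL < J + d + 4" "ACT < J + d + 4" "FULL < J + d + 4"
  by (auto simp: LEN_def TAIL_def ACT_def FULL_def)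

text \<open>The counter of the phase decreases from \<open>T * n - 1\<close>, so this expression is
  the number of the current step, that is, the position of the entry to be processed.\<close>

definition "cure = Mns (Mns (mulSz T) (Cst 1)) Ctr"
definition "ue = Ld B cure"
definition "we = Ld (B + T) cure"
definition "lene = Ld LEN ue"
definition "acte = Ld ACT (Cst 0)"
definition "fulle = Ld FULL (Cst 0)"
definition "taile = Ld TAIL (Cst 0)"
definition "membe = sume (map (\<lambda>j. Ifp (Mns lene (Cst (int j))) (eqe (Ld (J + j) ue) we) (Cst 0)) [0..<d])"

text \<open>A phase body is a fixed sequence of stores, so the case distinctions of
  \<open>ostep\<close> become two flags: \<open>ACT\<close> says that the arc is inserted,
  \<open>FULL\<close> that its list overflows. Stores that should not happen write an existing value
  back.\<close>

definition b1 :: "store list" where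
  "b1 = [(ACT, Cst 0, Ifp (eqe ue we) (Cst 0) (Ifp membe (Cst 0) (Cst 1)), 1),
         (FULL, Cst 0, Ifp acte (eqe lene (Cst (int d))) (Cst 0), 1)]"

definition push :: "nat => store list" where
  "push j = [(B, Ifp fulle (Pls taile (Cst (int j))) (Cst 0), Ifp fulle (Ld (J + j) ue) (Ld B (Cst 0)), 1),
             (B + T, Ifp fulle (Pls taile (Cst (int j))) (Cst 0), Ifp fulle ue (Ld (B + T) (Cst 0)), 1)]"

definition b3 :: "store list" where
  "b3 = [(TAIL, Cst 0, Pls taile (Ifp fulle (Cst (int d)) (Cst 0)), T),
         (LEN, ue, Ifp fulle (Cst 0) lene, d)]"

definition put :: "nat => store list" where
  "put j = [(J + j, ue, Ifp acte (Ifp (eqe lene (Cst (int j))) we (Ld (J + j) ue)) (Ld (J + j) ue), T)]"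

definition b5 :: "store list" where
  "b5 = [(LEN, ue, Pls lene acte, d)]"

definition obody :: "store list" where
  "obody = b1 @ concat (map push [0..<d]) @ b3 @ concat (map put [0..<d]) @ b5"

definition crep :: "(nat => int) => ostate => bool" where
  "crep M = (\<lambda>(out, Q). length Q \<le> T * n \<and>
     (\<forall>q<T * n. M (B * n + q) = int (fst (entry q Q)) \<and> M ((B + T) * n + q) = int (snd (entry q Q))) \<and>
     M (TAIL * n) = int (length Q) \<and>
     (\<forall>u<n. M (LEN * n + u) = int (length (out u)) \<and> (\<forall>j<length (out u). M ((J + j) * n + u) = int (out u ! j))) \<and>
     (\<forall>j<d. \<forall>u<n. \<bar>M ((J + j) * n + u)\<bar> \<le> int (T * n)))"

definition frame :: "(nat => int) => (nat => int) => bool" where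
  "frame M M' \<longleftrightarrow> (\<forall>a. a < B * n \<or> a \<ge> (J + d + 4) * n --> M' a = M a)"

lemma Jn: "J * n = B * n + 2 * (T * n)" "(B + T) * n = B * n + T * n" by (auto simp: algebra_simps J_def)

lemma cell_J: "t \<ge> J ==> t * n \<ge> B * n + 2 * (T * n)"
  using Jn mult_le_mono1[of J t n] by simp

lemma cell_end: "t < J + d + 4 ==> i < n ==> t * n + i < (J + d + 4) * n"
  using mult_le_mono1[of "t + 1" "J + d + 4" n] by simp

lemma eval_cure: "c < T * n ==> eval n (int (T * n - 1 - c)) M cure = int c"
  by (simp add: cure_def eval_mulSz)

lemma eval_ue: "c < T * n ==> eval n (int (T * n - 1 - c)) M ue = M (B * n + c)"
  unfolding ue_def by (rule eval_Ld[OF eval_cure])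

lemma eval_we: "c < T * n ==> eval n (int (T * n - 1 - c)) M we = M ((B + T) * n + c)"
  unfolding we_def by (rule eval_Ld[OF eval_cure])

text \<open>Symbolic execution store by store. The order matters: a full list is copied to the queue
  before its slots are reused, and its length is reset before the new arc goes to the slot at that
  length.\<close>

lemma obody_correct:
  assumes rep: "crep M (out, Q)" and c: "c < T * n"
    and wf: "\<And>a b. (a, b) \<in> set Q ==> a < n \<and> b < n" "\<And>u. u < n ==> length (out u) \<le> d \<and> set (out u) \<subseteq> {..<n}"
    and len: "length (snd (ostep d (entry c Q) (out, Q))) \<le> T * n"
  shows "crep (exec_body n (int (T * n - 1 - c)) obody M) (ostep d (entry c Q) (out, Q)) \<and>
    frame M (exec_body n (int (T * n - 1 - c)) obody M)"
proof -
  define i where "i = int (T * n - 1 - c)"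
  obtain u w where uw: "entry c Q = (u, w)" by fastforce
  have unwn: "u < n" "w < n"
  proof -
    have "u < n \<and> w < n"
    proof (cases "c < length Q")
      case True
      then have "(u, w) \<in> set Q" using uw nth_mem[of c Q] by (simp add: entry_def)
      then show ?thesis by (rule wf(1))
    next
      case False then show ?thesis using uw n by (simp add: entry_def)
    qed
    then show "u < n" "w < n" by auto
  qed
  have r1: "\<And>q. q < T * n ==> M (B * n + q) = int (fst (entry q Q)) \<and> M ((B + T) * n + q) = int (snd (entry q Q))"
    and r2: "M (TAIL * n) = int (length Q)"
    and r3: "\<And>u. u < n ==> M (LEN * n + u) = int (length (out u))"
    and r4: "\<And>u j. u < n ==> j < length (out u) ==> M ((J + j) * n + u) = int (out u ! j)"
    and r5: "\<And>u j. u < n ==> j < d ==> \<bar>M ((J + j) * n + u)\<bar> \<le> int (T * n)"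
    and r6: "length Q \<le> T * n"
    using rep unfolding crep_def by auto
  define a where "a \<longleftrightarrow> \<not> (u = w \<or> w \<in> set (out u))"
  define b where "b \<longleftrightarrow> a \<and> length (out u) = d"
  have low: "(t * n + x = B * n + q) = False" "(t * n + x = (B + T) * n + q) = False"
    "(B * n + q = t * n + x) = False" "((B + T) * n + q = t * n + x) = False" if "t \<ge> J" "q < T * n" for t x q
  proof -
    have 1: "B * n + 2 * (T * n) \<le> t * n" using that(1) by (rule cell_J)
    have a: "t * n + x \<noteq> B * n + q" using 1 that(2) by linarith
    have b: "t * n + x \<noteq> (B + T) * n + q" unfolding Jn(2) using 1 that(2) by linarith
    show "(t * n + x = B * n + q) = False" "(B * n + q = t * n + x) = False" using a by metis+
    show "(t * n + x = (B + T) * n + q) = False" "((B + T) * n + q = t * n + x) = False" using b by metis+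
  qed
  have uu: "eval n i M' ue = int u" "eval n i M' we = int w"
    if "M' (B * n + c) = M (B * n + c)" "M' ((B + T) * n + c) = M ((B + T) * n + c)" for M'
    using that eval_ue[OF c, of M'] eval_we[OF c, of M'] r1[OF c] uw by (auto simp: i_def)
  have ca: "c < length Q" if a using that uw by (auto simp: a_def entry_def split: if_splits)
  have memb: "(eval n i M membe > 0) = (w \<in> set (out u))"
  proof -
    have l: "eval n i M lene = int (length (out u))" unfolding lene_def
      using eval_Ld[OF uu(1)[OF refl refl], of LEN] r3[OF unwn(1)] by simp
    have e: "eval n i M (Ifp (Mns lene (Cst (int j))) (eqe (Ld (J + j) ue) we) (Cst 0)) =
      of_bool (j < length (out u) \<and> out u ! j = w)" if "j < d" for j
      using eval_Ld[OF uu(1)[OF refl refl], of "J + j"] r4[OF unwn(1), of j] uu(2)[OF refl refl] l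
      by (auto simp: eval_eqe)
    have "eval n i M membe = (\<Sum>j\<leftarrow>[0..<d]. of_bool (j < length (out u) \<and> out u ! j = w))"
      unfolding membe_def eval_sume map_map o_def using e by (intro arg_cong[where f = sum_list] map_cong) auto
    also have "\<dots> = (\<Sum>j<d. of_bool (j < length (out u) \<and> out u ! j = w))"
      by (simp add: sum_list_distinct_conv_sum_set atLeast0LessThan)
    finally have s: "eval n i M membe = (\<Sum>j<d. of_bool (j < length (out u) \<and> out u ! j = w))" .
    show ?thesis
    proof
      assume "eval n i M membe > 0"
      then have *: "(\<Sum>j<d. of_bool (j < length (out u) \<and> out u ! j = w)) \<noteq> (0 :: int)" using s by linarith
      have "\<exists>j<d. j < length (out u) \<and> out u ! j = w"
      proof (rule ccontr)
        assume "\<not> ?thesis"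
        then have "(\<Sum>j<d. of_bool (j < length (out u) \<and> out u ! j = w)) = (0 :: int)" by (intro sum.neutral) auto
        with * show False by simp
      qed
      then show "w \<in> set (out u)" using nth_mem by blast
    next
      assume "w \<in> set (out u)"
      then obtain j where "j < length (out u)" "out u ! j = w" by (auto simp: in_set_conv_nth)
      moreover then have "j < d" using wf(2)[OF unwn(1)] by simp
      ultimately show "eval n i M membe > 0" unfolding s
        by (intro sum_pos2[of _ j]) auto
    qed
  qed
  define M1 where "M1 = M(ACT * n := of_bool a, FULL * n := of_bool b)"
  have e1: "exec_body n i b1 M = M1"
  proof -
    let ?M = "M(ACT * n := of_bool a)"
    have s1: "exec_store n i (ACT, Cst 0, Ifp (eqe ue we) (Cst 0) (Ifp membe (Cst 0) (Cst 1)), 1) M = M(ACT * n + 0 := of_bool a)"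
      by (rule exec_store_eq) (use memb uu[OF refl refl] n in \<open>auto simp: eval_eqe a_def\<close>)
    have q: "?M (B * n + c) = M (B * n + c)" "?M ((B + T) * n + c) = M ((B + T) * n + c)"
      using low(3,4)[of ACT c 0] c by auto
    have l: "eval n i ?M lene = int (length (out u))" unfolding lene_def
      using eval_Ld[OF uu(1)[of ?M, OF q], of LEN] r3[OF unwn(1)] cell_eq[OF unwn(1) n, of LEN ACT]
      by (simp add: fun_upd_other)
    have ac: "eval n i ?M acte = of_bool a" unfolding acte_def using eval_Ld[of n i ?M "Cst 0" 0 ACT] by simp
    have "exec_store n i (FULL, Cst 0, Ifp acte (eqe lene (Cst (int d))) (Cst 0), 1) ?M = ?M(FULL * n + 0 := of_bool b)"
      by (rule exec_store_eq) (use l ac n in \<open>auto simp: eval_eqe b_def\<close>)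
    then show ?thesis using s1 by (simp add: b1_def exec_body_Cons exec_body_Nil M1_def)
  qed
  have J1: "M1 (t * n + x) = M (t * n + x)" if "x < n" "t \<noteq> ACT" "t \<noteq> FULL" for t x
    using cell_eq[OF that(1) n, of t ACT] cell_eq[OF that(1) n, of t FULL] that by (simp add: M1_def)
  have Q1: "M1 (B * n + q) = M (B * n + q)" "M1 ((B + T) * n + q) = M ((B + T) * n + q)" if "q < T * n" for q
    using low(3,4)[of ACT q 0] low(3,4)[of FULL q 0] that by (auto simp: M1_def)
  let ?l = "length Q"
  have tailb: "?l + d \<le> T * n" if b
    using len that by (auto simp: uw b_def a_def)
  \<comment> \<open>Memory after the first m arcs of an overflowing list have been copied to the
    tail of the queue; without overflow nothing has changed.\<close>
  define P where "P m M' x = (if b \<and> (\<exists>j<m. x = B * n + (?l + j)) then int (out u ! (x - B * n - ?l))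
     else if b \<and> (\<exists>j<m. x = (B + T) * n + (?l + j)) then int u else M' x)" for m x and M' :: "nat => int"
  have PJ: "P m M1 (t * n + x) = M1 (t * n + x)" if "t \<ge> J" "m \<le> d" for m t x
  proof -
    have "(t * n + x = B * n + (?l + j)) = False" "(t * n + x = (B + T) * n + (?l + j)) = False" if b "j < m" for j
      using low[of t "?l + j" x] tailb \<open>t \<ge> J\<close> \<open>m \<le> d\<close> that by auto
    then show ?thesis unfolding P_def by auto
  qed
  have Pq: "P m M1 (B * n + q) = M1 (B * n + q)" "P m M1 ((B + T) * n + q) = M1 ((B + T) * n + q)"
    if "m \<le> d" "q < ?l \<or> \<not> b" "q < T * n" for m q
    using that tailb Jn unfolding P_def by auto
  have pushes: "exec_body n i (concat (map push [0..<m])) M1 = P m M1" if "m \<le> d" for m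
    using that
  proof (induction m)
    case 0 then show ?case by (simp add: exec_body_Nil P_def fun_eq_iff)
  next
    case (Suc m)
    let ?M = "P m M1"
    have c': "c < ?l \<or> \<not> b" using ca by (auto simp: b_def)
    have q: "?M (B * n + c) = M (B * n + c)" "?M ((B + T) * n + c) = M ((B + T) * n + c)"
      using Pq[OF _ c' c] Suc.prems Q1[OF c] by auto
    have f: "eval n i ?M fulle = of_bool b" unfolding fulle_def
      using eval_Ld[of n i ?M "Cst 0" 0 FULL] PJ[of FULL m 0] Suc.prems by (simp add: M1_def)
    have t: "eval n i ?M taile = int ?l" unfolding taile_def
      using eval_Ld[of n i ?M "Cst 0" 0 TAIL] PJ[of TAIL m 0] Suc.prems J1[OF n, of TAIL] r2 by simp
    have ee: "exec_body n i (concat (map push [0..<Suc m])) M1 = exec_body n i (push m) ?M"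
      using Suc by (simp add: exec_body_append)
    show ?case
    proof (cases b)
      case False
      have PM: "P m' M1 = M1" for m' using False by (simp add: P_def fun_eq_iff)
      have T0: "0 < T * n" using d dT n by simp
      have v: "M1 (B * n) = int (fst (entry 0 Q))" "M1 ((B + T) * n) = int (snd (entry 0 Q))"
        using Q1[OF T0] r1[OF T0] by auto
      have vn: "fst (entry 0 Q) < n" "snd (entry 0 Q) < n"
        using wf(1)[of "fst (Q ! 0)" "snd (Q ! 0)"] n nth_mem[of 0 Q] by (auto simp: entry_def)
      have "exec_store n i (B, Ifp fulle (Pls taile (Cst (int m))) (Cst 0), Ifp fulle (Ld (J + m) ue) (Ld B (Cst 0)), 1) M1
        = M1(B * n + 0 := M1 (B * n))"
        by (rule exec_store_eq) (use f False v vn in \<open>auto simp: PM\<close>)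
      moreover have "exec_store n i (B + T, Ifp fulle (Pls taile (Cst (int m))) (Cst 0), Ifp fulle ue (Ld (B + T) (Cst 0)), 1) M1
        = M1((B + T) * n + 0 := M1 ((B + T) * n))"
        by (rule exec_store_eq) (use f False v vn in \<open>auto simp: PM nat_mult_distrib nat_add_distrib\<close>)
      ultimately have "exec_body n i (push m) M1 = M1"
        by (simp only: push_def exec_body_Cons exec_body_Nil add_0_right fun_upd_triv)
      then show ?thesis using ee by (simp only: PM)
    next
      case True
      have lu: "length (out u) = d" using True by (simp add: b_def)
      have o: "eval n i ?M (Ld (J + m) ue) = int (out u ! m)"
        using eval_Ld[OF uu(1)[OF q], of "J + m"] PJ[of "J + m" m u] Suc.prems J1[OF unwn(1), of "J + m"]
          r4[OF unwn(1), of m] lu by simp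
      have "out u ! m \<in> set (out u)" using lu Suc.prems by (intro nth_mem) simp
      then have on: "out u ! m < n" using wf(2)[OF unwn(1)] by blast
      have s1: "exec_store n i (B, Ifp fulle (Pls taile (Cst (int m))) (Cst 0), Ifp fulle (Ld (J + m) ue) (Ld B (Cst 0)), 1) ?M
        = ?M(B * n + (?l + m) := int (out u ! m))"
        by (rule exec_store_eq) (use f t o True on in auto)
      let ?M' = "?M(B * n + (?l + m) := int (out u ! m))"
      have lm: "?l + m < T * n" using tailb[OF True] Suc.prems by simp
      have q': "?M' (B * n + c) = M (B * n + c)" "?M' ((B + T) * n + c) = M ((B + T) * n + c)"
        using q c' True Jn lm by auto
      have f': "eval n i ?M' fulle = of_bool b" "eval n i ?M' taile = int ?l"
        using f t low[of FULL "?l + m" 0] low[of TAIL "?l + m" 0] lm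
        unfolding fulle_def taile_def by auto
      have s2: "exec_store n i (B + T, Ifp fulle (Pls taile (Cst (int m))) (Cst 0), Ifp fulle ue (Ld (B + T) (Cst 0)), 1) ?M'
        = ?M'((B + T) * n + (?l + m) := int u)"
        by (rule exec_store_eq) (use f' True uu(1)[OF q'] unwn in \<open>auto simp del: fun_upd_apply\<close>)
      have "?M'((B + T) * n + (?l + m) := int u) = P (Suc m) M1"
        using True Jn lm Suc.prems tailb unfolding P_def by (fastforce simp: less_Suc_eq)
      moreover have "exec_body n i (push m) ?M = ?M'((B + T) * n + (?l + m) := int u)"
        by (simp only: push_def exec_body_Cons exec_body_Nil s1 s2)
      ultimately show ?thesis using ee by simp
    qed
  qed
  define M2 where "M2 = P d M1"
  have e2: "exec_body n i (concat (map push [0..<d])) M1 = M2" using pushes[of d] by (simp add: M2_def)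
  have c': "c < ?l \<or> \<not> b" using ca by (auto simp: b_def)
  have q2: "M2 (B * n + c) = M (B * n + c)" "M2 ((B + T) * n + c) = M ((B + T) * n + c)"
    using Pq[OF _ c' c, of d] Q1[OF c] by (auto simp: M2_def)
  have J2: "M2 (t * n + x) = M (t * n + x)" if "t \<ge> J" "x < n" "t \<noteq> ACT" "t \<noteq> FULL" for t x
    using PJ[OF that(1), of d x] J1[OF that(2-4)] by (simp add: M2_def)
  have A2: "M2 (ACT * n + 0) = of_bool a" "M2 (FULL * n + 0) = of_bool b"
    using PJ[of ACT d 0] PJ[of FULL d 0] n by (auto simp: M2_def M1_def)
  \<comment> \<open>The slot for a new arc: 0 after an overflow, otherwise the old length.\<close>
  define l' where "l' = (if b then 0 else length (out u))"
  define M4 where "M4 = M2(TAIL * n + 0 := int (?l + (if b then d else 0)), LEN * n + u := int l')"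
  have l'd: "l' \<le> d" "a ==> l' < d" using wf(2)[OF unwn(1)] d by (auto simp: l'_def b_def)
  have e3: "exec_body n i b3 M2 = M4"
  proof -
    have f: "eval n i M2 fulle = of_bool b" "eval n i M2 taile = int ?l"
      unfolding fulle_def taile_def using eval_Ld[of n i M2 "Cst 0" 0] A2 J2[of TAIL 0] r2 n by auto
    have s1: "exec_store n i (TAIL, Cst 0, Pls taile (Ifp fulle (Cst (int d)) (Cst 0)), T) M2 =
      M2(TAIL * n + 0 := int (?l + (if b then d else 0)))"
      by (rule exec_store_eq) (use f tailb r6 in \<open>auto simp flip: of_nat_mult of_nat_add\<close>)
    let ?M = "M2(TAIL * n + 0 := int (?l + (if b then d else 0)))"
    have q: "?M (B * n + c) = M (B * n + c)" "?M ((B + T) * n + c) = M ((B + T) * n + c)"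
      using q2 low(3,4)[of TAIL c 0] c by auto
    have l: "eval n i ?M lene = int (length (out u))" unfolding lene_def
      using eval_Ld[OF uu(1)[of ?M, OF q], of LEN] J2[of LEN u] r3[OF unwn(1)] cell_eq[OF unwn(1) n, of LEN TAIL] unwn
      by (simp add: fun_upd_other)
    have f': "eval n i ?M fulle = of_bool b"
      using f(1) cell_eq[OF n n, of FULL TAIL] unfolding fulle_def by simp
    have "\<bar>int l'\<bar> \<le> int (d * n)" using l'd n by (simp flip: of_nat_mult) (metis le_trans mult_le_mono2 nat_mult_1_right Suc_leI One_nat_def)
    then have "exec_store n i (LEN, ue, Ifp fulle (Cst 0) lene, d) ?M = ?M(LEN * n + u := int l')"
      by (intro exec_store_eq uu(1)[OF q]) (use f' l in \<open>auto simp: l'_def\<close>)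
    then show ?thesis using s1 by (simp add: b3_def exec_body_Cons exec_body_Nil M4_def)
  qed
  have J4: "M4 (t * n + x) = (if t = TAIL \<and> x = 0 then int (?l + (if b then d else 0))
      else if t = LEN \<and> x = u then int l' else M2 (t * n + x))" if "x < n" for t x
    using cell_eq[OF that unwn(1), of t LEN] cell_eq[OF that n, of t TAIL] by (auto simp: M4_def)
  have q4: "M4 (B * n + q) = M2 (B * n + q)" "M4 ((B + T) * n + q) = M2 ((B + T) * n + q)" if "q < T * n" for q
    using low(3,4)[of TAIL q 0] low(3,4)[of LEN q u] that by (auto simp: M4_def)
  have uu4: "M4 (B * n + c) = M (B * n + c)" "M4 ((B + T) * n + c) = M ((B + T) * n + c)"
    using q4[OF c] q2 by auto
  \<comment> \<open>Only the copy of \<open>put\<close> with index \<open>l'\<close> changes memory,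
    and only for an active arc.\<close>
  define R where "R m = (if a \<and> l' < m then M4((J + l') * n + u := int w) else M4)" for m
  have puts: "exec_body n i (concat (map put [0..<m])) M4 = R m" if "m \<le> d" for m
    using that
  proof (induction m)
    case 0 then show ?case by (simp add: exec_body_Nil R_def)
  next
    case (Suc m)
    have ee: "exec_body n i (concat (map put [0..<Suc m])) M4 = exec_store n i
       (J + m, ue, Ifp acte (Ifp (eqe lene (Cst (int m))) we (Ld (J + m) ue)) (Ld (J + m) ue), T) (R m)"
    proof -
      have "exec_body n i (concat (map put [0..<Suc m])) M4 = exec_body n i (put m) (exec_body n i (concat (map put [0..<m])) M4)"
        by (simp add: exec_body_append)
      also have "\<dots> = exec_body n i (put m) (R m)" using Suc by simp
      finally show ?thesis by (simp only: put_def exec_body_Cons exec_body_Nil)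
    qed
    have q: "R m (B * n + c) = M (B * n + c)" "R m ((B + T) * n + c) = M ((B + T) * n + c)"
      using uu4 low(3,4)[of "J + l'" c u] c by (auto simp: R_def)
    have Rt: "R m (t * n + x) = M4 (t * n + x)" if "x < n" "t \<noteq> J + l' \<or> x \<noteq> u \<or> m \<le> l'" for t x
      using cell_eq[OF that(1) unwn(1), of t "J + l'"] that(2) by (auto simp: R_def)
    have ac: "eval n i (R m) acte = of_bool a" unfolding acte_def
      using eval_Ld[of n i "R m" "Cst 0" 0 ACT] Rt[OF n, of ACT] l'd J4[OF n, of ACT] A2 by simp
    have l: "eval n i (R m) lene = int l'" unfolding lene_def
      using eval_Ld[OF uu(1)[OF q], of LEN] Rt[OF unwn(1), of LEN] J4[OF unwn(1), of LEN] l'd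
      by (cases "l' = d") (auto simp: R_def)
    have own: "eval n i (R m) (Ld (J + m) ue) = M4 ((J + m) * n + u)"
      using eval_Ld[OF uu(1)[OF q], of "J + m"] Rt[OF unwn(1), of "J + m"] by (cases "m = l'") auto
    have "M4 ((J + m) * n + u) = M ((J + m) * n + u)" using J4[OF unwn(1), of "J + m"] J2[of "J + m" u] Suc.prems unwn by auto
    then have bnd: "\<bar>M4 ((J + m) * n + u)\<bar> \<le> int (T * n)" using r5[OF unwn(1), of m] Suc.prems by simp
    have T0: "n \<le> T * n" using d dT by simp
    have "exec_store n i (J + m, ue, Ifp acte (Ifp (eqe lene (Cst (int m))) we (Ld (J + m) ue)) (Ld (J + m) ue), T) (R m)
      = (R m)((J + m) * n + u := if a \<and> l' = m then int w else M4 ((J + m) * n + u))"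
    proof (rule exec_store_eq[OF uu(1)[OF q]])
      show "eval n i (R m) (Ifp acte (Ifp (eqe lene (Cst (int m))) we (Ld (J + m) ue)) (Ld (J + m) ue)) =
        (if a \<and> l' = m then int w else M4 ((J + m) * n + u))"
        using ac l own uu(2)[OF q] by (simp add: eval_eqe)
      have "w \<le> T * n" using unwn(2) T0 by linarith
      then have "int w \<le> int (T * n)" by (simp only: of_nat_le_iff)
      then show "\<bar>if a \<and> l' = m then int w else M4 ((J + m) * n + u)\<bar> \<le> int (T * n)" using bnd by auto
    qed
    also have "\<dots> = R (Suc m)"
    proof (cases "a \<and> l' = m")
      case True
      then have "R m = M4" "R (Suc m) = M4((J + m) * n + u := int w)" by (auto simp: R_def)
      then show ?thesis using True by simp
    next
      case False
      then have "M4 ((J + m) * n + u) = R m ((J + m) * n + u)" using Rt[OF unwn(1), of "J + m"] by (cases "m = l'") (auto simp: R_def)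
      moreover have "R (Suc m) = R m" using False by (auto simp: R_def less_Suc_eq)
      ultimately show ?thesis using False by (simp only: if_False fun_upd_triv)
    qed
    finally show ?case using ee by simp
  qed
  define M5 where "M5 = R d"
  have e4: "exec_body n i (concat (map put [0..<d])) M4 = M5" using puts[of d] by (simp add: M5_def)
  have M5: "M5 = (if a then M4((J + l') * n + u := int w) else M4)" using l'd by (auto simp: M5_def R_def)
  define M6 where "M6 = M5(LEN * n + u := int (l' + of_bool a))"
  have e5: "exec_body n i b5 M5 = M6"
  proof -
    have q: "M5 (B * n + c) = M (B * n + c)" "M5 ((B + T) * n + c) = M ((B + T) * n + c)"
      using uu4 low(3,4)[of "J + l'" c u] c by (auto simp: M5)
    have t: "M5 (t * n + x) = M4 (t * n + x)" if "x < n" "t \<ge> LEN" for t x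
      using cell_eq[OF that(1) unwn(1), of t "J + l'"] that(2) l'd by (auto simp: M5 LEN_def)
    have ac: "eval n i M5 acte = of_bool a" unfolding acte_def
      using eval_Ld[of n i M5 "Cst 0" 0 ACT] t[OF n, of ACT] J4[OF n, of ACT] A2 by simp
    have l: "eval n i M5 lene = int l'" unfolding lene_def
      using eval_Ld[OF uu(1)[OF q], of LEN] t[OF unwn(1), of LEN] J4[OF unwn(1), of LEN] by simp
    have "l' + of_bool a \<le> d * 1" using l'd by auto
    also have "\<dots> \<le> d * n" using n by (intro mult_le_mono2) simp
    finally have "\<bar>int (l' + of_bool a)\<bar> \<le> int (d * n)" by (simp only: abs_of_nat of_nat_le_iff)
    then have "exec_store n i (LEN, ue, Pls lene acte, d) M5 = M5(LEN * n + u := int (l' + of_bool a))"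
      by (intro exec_store_eq uu(1)[OF q]) (use ac l in auto)
    then show ?thesis by (simp add: b5_def exec_body_Cons exec_body_Nil M6_def)
  qed
  have E: "exec_body n i obody M = M6"
    by (simp add: obody_def exec_body_append e1 e2 e3 e4 e5)
  have J6: "M6 (t * n + x) = (if t = LEN \<and> x = u then int (l' + of_bool a)
      else if a \<and> t = J + l' \<and> x = u then int w else M4 (t * n + x))" if "x < n" for t x
    using cell_eq[OF that unwn(1), of t LEN] cell_eq[OF that unwn(1), of t "J + l'"] by (auto simp: M6_def M5)
  have Q6: "M6 (B * n + q) = M2 (B * n + q)" "M6 ((B + T) * n + q) = M2 ((B + T) * n + q)" if "q < T * n" for q
    using low(3,4)[of _ q] q4[OF that] that by (auto simp: M6_def M5)
  obtain out' Q' where st: "ostep d (entry c Q) (out, Q) = (out', Q')" by fastforce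
  have out'Q': "out' = (if a then out(u := if b then [w] else out u @ [w]) else out)"
    "Q' = (if b then Q @ map (\<lambda>x. (x, u)) (out u) else Q)"
    using st wf(2)[OF unwn(1)] unfolding uw by (auto simp: a_def b_def split: if_splits)
  have "crep M6 (out', Q')" unfolding crep_def prod.case
  proof (intro conjI allI impI)
    show "length Q' \<le> T * n" using len st by simp
    show "M6 (TAIL * n) = int (length Q')"
      using J6[OF n, of TAIL] J4[OF n, of TAIL] l'd by (auto simp: out'Q' b_def)
  next
    fix q assume q: "q < T * n"
    have "M2 (B * n + q) = int (fst (entry q Q')) \<and> M2 ((B + T) * n + q) = int (snd (entry q Q'))"
    proof (cases "b \<and> ?l \<le> q \<and> q < ?l + d")
      case True
      then have "\<exists>j<d. B * n + q = B * n + (?l + j)" "\<exists>j<d. (B + T) * n + q = (B + T) * n + (?l + j)"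
        by (auto intro: exI[of _ "q - ?l"])
      moreover have "\<not> (\<exists>j<d. (B + T) * n + q = B * n + (?l + j))" using Jn tailb True by auto
      moreover have "length (out u) = d" using True by (simp add: b_def)
      ultimately show ?thesis using True by (auto simp: M2_def P_def entry_def out'Q' nth_append)
    next
      case False
      have "M2 (B * n + q) = M1 (B * n + q)" "M2 ((B + T) * n + q) = M1 ((B + T) * n + q)"
        using False Jn tailb q by (auto simp: M2_def P_def)
      moreover have "entry q Q' = entry q Q" using False by (auto simp: entry_def out'Q' nth_append b_def)
      ultimately show ?thesis using Q1[OF q] r1[OF q] by simp
    qed
    then show "M6 (B * n + q) = int (fst (entry q Q'))" "M6 ((B + T) * n + q) = int (snd (entry q Q'))"
      using Q6[OF q] by auto
  next
    fix v assume v: "v < n"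
    show "M6 (LEN * n + v) = int (length (out' v))"
      using J6[OF v, of LEN] J4[OF v, of LEN] J2[of LEN v] r3[OF v] v l'd by (auto simp: out'Q' l'_def b_def)
    fix j assume j: "j < length (out' v)"
    have jd: "j < d"
    proof (cases "v = u")
      case True then show ?thesis using j l'd unfolding out'Q' l'_def b_def by (auto split: if_splits)
    next
      case False then show ?thesis using j wf(2)[OF v] by (auto simp: out'Q' split: if_splits)
    qed
    have old: "M4 ((J + j) * n + v) = M ((J + j) * n + v)" using J4[OF v, of "J + j"] J2[of "J + j" v] v jd by auto
    show "M6 ((J + j) * n + v) = int (out' v ! j)"
    proof (cases "v = u")
      case False
      then show ?thesis using J6[OF v, of "J + j"] old r4[OF v, of j] j by (auto simp: out'Q' split: if_splits)
    next
      case True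
      then show ?thesis using J6[OF v, of "J + j"] old r4[OF v, of j] j jd
        by (auto simp: out'Q' l'_def nth_append b_def split: if_splits)
    qed
  next
    fix j v assume jv: "j < d" "v < n"
    have old: "M4 ((J + j) * n + v) = M ((J + j) * n + v)" using J4[OF jv(2), of "J + j"] J2[of "J + j" v] jv by auto
    have "n \<le> T * n" using d dT by simp
    then have "w \<le> T * n" using unwn(2) by linarith
    then have "int w \<le> int (T * n)" by (simp only: of_nat_le_iff)
    then show "\<bar>M6 ((J + j) * n + v)\<bar> \<le> int (T * n)" using J6[OF jv(2), of "J + j"] old r5[OF jv(2,1)] jv by auto
  qed
  moreover have "frame M M6" unfolding frame_def
  proof (intro allI impI)
    fix x assume x: "x < B * n \<or> (J + d + 4) * n \<le> x"
    have ne: "x \<noteq> t * n + y" if "t \<ge> J" "t < J + d + 4" "y < n" for t y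
      using x cell_J[OF that(1)] cell_end[OF that(2,3)] by auto
    have "x \<noteq> B * n + q" "x \<noteq> (B + T) * n + q" if "q < T * n" for q
    proof -
      have "(J + d + 4) * n = J * n + (d + 4) * n" by (simp add: algebra_simps)
      then have "(J + d + 4) * n \<ge> B * n + 2 * (T * n)" using Jn by simp
      then show "x \<noteq> B * n + q" "x \<noteq> (B + T) * n + q" using x that Jn by auto
    qed
    then have "x \<noteq> B * n + (?l + j)" "x \<noteq> (B + T) * n + (?l + j)" if b "j < d" for j
      using tailb that by auto
    then have "M2 x = M1 x" by (auto simp: M2_def P_def)
    moreover have "M6 x = M2 x" "M1 x = M x" using ne[of LEN u] ne[of "J + l'" u] ne[of TAIL 0] ne[of ACT 0] ne[of FULL 0] unwn n l'd
      by (auto simp: M6_def M5 M4_def M1_def)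
    ultimately show "M6 x = M x" by simp
  qed
  ultimately show ?thesis using E st unfolding i_def by simp
qed

end

lemma rev_upt: "rev [0..<m] = map (\<lambda>c. m - 1 - c) [0..<m]"
  by (rule nth_equalityI) (auto simp: rev_nth)

context orient_program
begin

text \<open>With \<open>d = 2 * \<delta> + 1\<close> the amortised bound
  \<open>(2 * \<delta> + 2) * length q0\<close> is exactly the size \<open>T * n\<close> of the
  queue arrays, so the queue never overruns them and \<open>T * n\<close> steps reach its
  end.\<close>

lemma loop_correct:
  assumes q0: "set q0 \<subseteq> {..<n} \<times> {..<n}" "length q0 * (d + 1) = T * n"
    and Or: "\<And>u. u < n ==> finite {w. (u, w) \<in> Or} \<and> card {w. (u, w) \<in> Or} \<le> \<delta>" "d = 2 * \<delta> + 1"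
    and cov: "\<And>a b. (a, b) \<in> set q0 ==> a \<noteq> b ==> (a, b) \<in> Or \<or> (b, a) \<in> Or"
    and M: "crep M (\<lambda>_. [], q0)"
  shows "crep (exec_phase n (T, obody) M) (orun d q0 (T * n)) \<and> frame M (exec_phase n (T, obody) M)"
proof -
  have "c \<le> T * n ==> crep (fold (\<lambda>i. exec_body n (int i) obody) (map (\<lambda>c. T * n - 1 - c) [0..<c]) M) (orun d q0 c) \<and>
    frame M (fold (\<lambda>i. exec_body n (int i) obody) (map (\<lambda>c. T * n - 1 - c) [0..<c]) M)" for c
  proof (induction c)
    case 0 then show ?case using M by (simp add: frame_def)
  next
    case (Suc c)
    let ?M = "fold (\<lambda>i. exec_body n (int i) obody) (map (\<lambda>c. T * n - 1 - c) [0..<c]) M"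
    obtain out q where oq: "orun d q0 c = (out, q)" by fastforce
    have inv: "oinv Or n \<delta> q0 c (out, q)" using orun_inv[OF Or(1) cov q0(1), of c] oq Or(2) by simp
    have inv': "oinv Or n \<delta> q0 (Suc c) (ostep d (entry c q) (out, q))"
      using orun_inv[OF Or(1) cov q0(1), of "Suc c"] oq Or(2) by simp
    have E: "(a, b) \<in> set q0 \<union> (set q0)\<inverse> ==> a < n \<and> b < n" for a b using q0(1) by auto
    obtain out' q' where oq': "ostep d (entry c q) (out, q) = (out', q')" by fastforce
    have i: "crep ?M (out, q)" "c < T * n" using Suc oq by auto
    have w1: "a < n \<and> b < n" if "(a, b) \<in> set q" for a b
    proof (rule E)
      show "(a, b) \<in> set q0 \<union> (set q0)\<inverse>" using inv that unfolding oinv_def by fast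
    qed
    have w2: "length (out u) \<le> d \<and> set (out u) \<subseteq> {..<n}" if "u < n" for u
    proof -
      have "length (out u) \<le> d" using inv Or(2) unfolding oinv_def by simp
      moreover have "w < n" if "w \<in> set (out u)" for w
      proof -
        have "(u, w) \<in> set q0 \<union> (set q0)\<inverse>" using inv that unfolding oinv_def by fast
        then show ?thesis using E by blast
      qed
      ultimately show ?thesis by auto
    qed
    have "length q' \<le> (2 * \<delta> + 2) * length q0" using inv' unfolding oq' oinv_def prod.case by linarith
    also have "\<dots> = T * n" using q0(2) Or(2) by (simp add: mult.commute)
    finally have l: "length (snd (ostep d (entry c q) (out, q))) \<le> T * n" using oq' by simp
    from obody_correct[OF i w1 w2 l] have "crep (exec_body n (int (T * n - 1 - c)) obody ?M) (orun d q0 (Suc c)) \<and>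
      frame ?M (exec_body n (int (T * n - 1 - c)) obody ?M)" using oq by simp
    then show ?case using Suc by (simp add: frame_def)
  qed
  from this[of "T * n"] show ?thesis by (simp add: rev_upt)
qed

end

section \<open>Functions giving the out-neighbours of an orientation\<close>

context structure_class
begin

lemma Comp_pw_list:
  assumes "Comp ts" "S \<subseteq> set ts"
    and "\<And>f. f \<in> set us ==> f \<in> pw S \<and> (\<forall>\<G>\<in>insts. \<forall>v\<in>vs \<G>. \<bar>f \<G> v\<bar> \<le> int (1 * sz \<G>))"
  shows "Comp (ts @ us)"
  using assms(3)
proof (induction us rule: rev_induct)
  case Nil then show ?case using assms(1) by simp
next
  case (snoc u us)
  have "Comp (ts @ us)" using snoc by simp
  moreover have "S \<subseteq> set (ts @ us)" using assms(2) by auto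
  ultimately have "Comp ((ts @ us) @ [u])" using snoc.prems[of u] by (intro Comp_pw[where k = 1]) auto
  then show ?case by simp
qed

definition vfun :: "('v inst => 'v => 'v) => bool" where
  "vfun f \<longleftrightarrow> (\<forall>\<G>\<in>insts. \<forall>v\<in>vs \<G>. f \<G> v \<in> vs \<G>)"

lemma vfunD: "vfun f ==> \<G> \<in> insts ==> v \<in> vs \<G> ==> f \<G> v \<in> vs \<G>"
  by (auto simp: vfun_def)

lemma vfun_bound: "vfun f ==> \<G> \<in> insts ==> v \<in> vs \<G> ==> \<bar>enc f \<G> v\<bar> \<le> int (1 * sz \<G>)"
  using enc_bound[of \<G> f v] vfunD by fastforce

text \<open>The pairs of \<open>(fs ! c) \<G> y\<close> and \<open>(gs ! c) \<G> y\<close> are the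
  edges to be oriented, given by functions so that the initial queue consists of existing tables.
  The functions \<open>hs\<close> correspond to the slots of the out-lists, and an empty slot gives
  the identity. There are \<open>2 * \<delta> + 1\<close> of them, more than the outdegree \<delta>
  that is assumed to be possible, because the online algorithm needs slack.\<close>

lemma lin_orient:
  fixes fs gs :: "('v inst => 'v => 'v) list"
  assumes S: "lin S" and len: "length gs = length fs" "fs \<noteq> []"
    and fg: "\<And>f. f \<in> set fs \<union> set gs ==> vfun f \<and> enc f \<in> S"
    and Or: "\<And>\<G>. \<G> \<in> insts ==> \<exists>Or \<subseteq> vs \<G> \<times> vs \<G>. (\<forall>u\<in>vs \<G>. card {w. (u, w) \<in> Or} \<le> \<delta>) \<and>
      (\<forall>c<length fs. \<forall>v\<in>vs \<G>. (fs ! c) \<G> v \<noteq> (gs ! c) \<G> v -->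
        ((fs ! c) \<G> v, (gs ! c) \<G> v) \<in> Or \<or> ((gs ! c) \<G> v, (fs ! c) \<G> v) \<in> Or)"
  shows "\<exists>hs. length hs = 2 * \<delta> + 1 \<and> lin (enc ` set hs \<union> S) \<and> (\<forall>h\<in>set hs. vfun h) \<and>
     (\<forall>\<G>\<in>insts. \<forall>h\<in>set hs. \<forall>v\<in>vs \<G>. h \<G> v = v \<or>
        (\<exists>c<length fs. \<exists>y\<in>vs \<G>. (fs ! c) \<G> y = v \<and> (gs ! c) \<G> y = h \<G> v \<or> (gs ! c) \<G> y = v \<and> (fs ! c) \<G> y = h \<G> v)) \<and>
     (\<forall>\<G>\<in>insts. \<forall>c<length fs. \<forall>y\<in>vs \<G>. (fs ! c) \<G> y \<noteq> (gs ! c) \<G> y -->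
        (\<exists>h\<in>set hs. h \<G> ((fs ! c) \<G> y) = (gs ! c) \<G> y \<or> h \<G> ((gs ! c) \<G> y) = (fs ! c) \<G> y))"
proof -
  obtain ts where ts: "Comp ts" "S \<subseteq> set ts" using S unfolding lin_def by blast
  define p where "p = length fs"
  define d where "d = 2 * \<delta> + 1"
  define T where "T = (d + 1) * p"
  define B where "B = length ts"
  have p0: "p > 0" using len by (simp add: p_def)
  \<comment> \<open>Zero tables fill each queue array up to T tables; they represent the default
    entries beyond the queue.\<close>
  define Z :: "'v table list" where "Z = replicate (T - p) (\<lambda>_ _. 0)"
  define old where "old = map enc fs @ Z @ map enc gs @ Z"
  have pT: "p \<le> T" by (simp add: T_def)
  have lold: "length old = 2 * T" using pT len by (simp add: old_def Z_def p_def)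
  have "Comp (ts @ old)"
  proof (rule Comp_pw_list[OF ts])
    fix f assume "f \<in> set old"
    then consider g where "f = enc g" "g \<in> set fs \<union> set gs" | "f = (\<lambda>_ _. 0)"
      by (auto simp: old_def Z_def)
    then show "f \<in> pw S \<and> (\<forall>\<G>\<in>insts. \<forall>v\<in>vs \<G>. \<bar>f \<G> v\<bar> \<le> int (1 * sz \<G>))"
    proof cases
      case 1 then show ?thesis using fg vfun_bound by (auto intro: pw.tab)
    next
      case 2 then show ?thesis by (auto intro: pw.const)
    qed
  qed
  note Cold = this
  define q0 where "q0 \<G> = map (\<lambda>k. (ix \<G> ((fs ! (k div sz \<G>)) \<G> (vx \<G> (k mod sz \<G>))),
     ix \<G> ((gs ! (k div sz \<G>)) \<G> (vx \<G> (k mod sz \<G>))))) [0..<p * sz \<G>]" for \<G>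
  define tail where "tail = B + 2 * T + d + 1"
  define body where "body = orient_program.obody B T d"
  \<comment> \<open>The length of the queue is stored by a phase of its own, whose rounds all do the
    same.\<close>
  define q where "q = [(1, [(tail, Cst 0, mulSz p, p)]), (T, body)]"
  have "(d + 1) * 1 \<le> T" unfolding T_def using p0 by (intro mult_le_mono2) simp
  then have dT: "d > 0" "d \<le> T" by (auto simp: d_def)
  have op: "orient_program (sz \<G>) T d" if "\<G> \<in> insts" for \<G>
    by unfold_locales (use insts(3)[OF that] dT in auto)
  define outs where "outs \<G> = fst (orun d (q0 \<G>) (T * sz \<G>))" for \<G>
  have main: "frame_ok \<and> (\<forall>u<sz \<G>. exec_prog (sz \<G>) q M ((B + (2 * T + d)) * sz \<G> + u) = int (length (outs \<G> u)) \<and>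
      length (outs \<G> u) \<le> d \<and>
      (\<forall>j<length (outs \<G> u). exec_prog (sz \<G>) q M ((B + (2 * T + j)) * sz \<G> + u) = int (outs \<G> u ! j)) \<and>
      (\<forall>w\<in>set (outs \<G> u). (u, w) \<in> set (q0 \<G>) \<union> (set (q0 \<G>))\<inverse>)) \<and>
      (\<forall>(a, b)\<in>set (q0 \<G>). a \<noteq> b --> b \<in> set (outs \<G> a) \<or> a \<in> set (outs \<G> b))"
    if \<G>: "\<G> \<in> insts" and rep: "rep \<G> (ts @ old) M"
      and fo: "frame_ok \<longleftrightarrow> (\<forall>a<B * sz \<G>. exec_prog (sz \<G>) q M a = M a) \<and>
      (\<forall>a\<ge>(B + (2 * T + d + 4)) * sz \<G>. exec_prog (sz \<G>) q M a = 0)" for \<G> M frame_ok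
  proof -
    let ?n = "sz \<G>"
    interpret O: orient_program ?n B T d by (rule op[OF \<G>])
    have n: "?n > 0" using insts(3)[OF \<G>] .
    define M0 where "M0 = M(tail * ?n := int (p * ?n))"
    have st: "exec_body ?n i [(tail, Cst 0, mulSz p, p)] N = N(tail * ?n := int (p * ?n))" for i N
    proof -
      have "exec_store ?n i (tail, Cst 0, mulSz p, p) N = N(tail * ?n + 0 := int (p * ?n))"
        by (rule exec_store_eq) (auto simp: eval_mulSz)
      then show ?thesis by (simp add: exec_body_Cons exec_body_Nil)
    qed
    have "fold (\<lambda>i. exec_body ?n (int i) [(tail, Cst 0, mulSz p, p)]) is N = N(tail * ?n := int (p * ?n))"
      if "is \<noteq> []" for "is" N using that
    proof (induction "is" arbitrary: N)
      case (Cons a "is")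
      show ?case
      proof (cases "is = []")
        case True then show ?thesis by (simp only: fold_simps st)
      next
        case False
        have "exec_body ?n (int a) [(tail, Cst 0, mulSz p, p)] N = N(tail * ?n := int (p * ?n))" by (rule st)
        then show ?thesis using Cons.IH[OF False, of "N(tail * ?n := int (p * ?n))"]
          by (simp only: fold_simps fun_upd_upd)
      qed
    qed simp
    then have ph1: "exec_phase ?n (1, [(tail, Cst 0, mulSz p, p)]) M = M0" using n by (simp add: M0_def)
    have ex: "exec_prog ?n q M = exec_phase ?n (T, O.obody) M0"
      unfolding q_def exec_prog_def body_def fold_simps ph1 ..
    have q0l: "length (q0 \<G>) = p * ?n" by (simp add: q0_def)
    have mem0: "M (t * ?n + x) = ((ts @ old) ! t) \<G> (vx \<G> x)" if "t < B + 2 * T" "x < ?n" for t x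
      using rep that lold unfolding rep_def agree_def B_def by auto
    have zero: "M a = 0" if "a \<ge> (B + 2 * T) * ?n" for a using rep that lold unfolding rep_def B_def by auto
    have q0E: "ent \<in> set (q0 \<G>) \<longleftrightarrow> (\<exists>c<p. \<exists>x<?n. ent = (ix \<G> ((fs ! c) \<G> (vx \<G> x)), ix \<G> ((gs ! c) \<G> (vx \<G> x))))" for ent
    proof
      assume "ent \<in> set (q0 \<G>)"
      then obtain k where k: "k < p * ?n" "ent = (ix \<G> ((fs ! (k div ?n)) \<G> (vx \<G> (k mod ?n))), ix \<G> ((gs ! (k div ?n)) \<G> (vx \<G> (k mod ?n))))"
        by (auto simp: q0_def)
      have "k div ?n < p" using k(1) by (simp add: less_mult_imp_div_less)
      moreover have "k mod ?n < ?n" using n by simp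
      ultimately show "\<exists>c<p. \<exists>x<?n. ent = (ix \<G> ((fs ! c) \<G> (vx \<G> x)), ix \<G> ((gs ! c) \<G> (vx \<G> x)))" using k(2) by blast
    next
      assume "\<exists>c<p. \<exists>x<?n. ent = (ix \<G> ((fs ! c) \<G> (vx \<G> x)), ix \<G> ((gs ! c) \<G> (vx \<G> x)))"
      then obtain c x where cx: "c < p" "x < ?n" "ent = (ix \<G> ((fs ! c) \<G> (vx \<G> x)), ix \<G> ((gs ! c) \<G> (vx \<G> x)))" by blast
      have "(c + 1) * ?n \<le> p * ?n" using cx(1) by (intro mult_right_mono) auto
      then have "c * ?n + x < p * ?n" using cx(2) by simp
      moreover have "(c * ?n + x) div ?n = c" "(c * ?n + x) mod ?n = x" using cx(2) n by auto
      ultimately show "ent \<in> set (q0 \<G>)" unfolding q0_def using cx(3)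
        by (auto intro!: image_eqI[of _ _ "c * ?n + x"])
    qed
    have cr: "O.crep M0 (\<lambda>_. [], q0 \<G>)" unfolding O.crep_def prod.case
    proof (intro conjI allI impI)
      show "length (q0 \<G>) \<le> T * ?n" using pT by (simp add: q0l)
      show "M0 (O.TAIL * ?n) = int (length (q0 \<G>))" by (simp add: M0_def tail_def O.TAIL_def O.J_def q0l)
    next
      fix k assume k: "k < T * ?n"
      define c x where "c = k div ?n" "x = k mod ?n"
      have kx: "k = c * ?n + x" "x < ?n" "c < T" using n k by (auto simp: c_x_def less_mult_imp_div_less)
      have ad: "B * ?n + k = (B + c) * ?n + x" "(B + T) * ?n + k = (B + T + c) * ?n + x"
        using kx(1) by (auto simp: algebra_simps)
      have "tail * ?n \<ge> (B + 2 * T) * ?n" by (rule mult_le_mono1) (simp add: tail_def)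
      moreover have "B * ?n + k < (B + 2 * T) * ?n" "(B + T) * ?n + k < (B + 2 * T) * ?n" using k by (auto simp: algebra_simps)
      ultimately have t: "M0 (B * ?n + k) = M (B * ?n + k)" "M0 ((B + T) * ?n + k) = M ((B + T) * ?n + k)"
        by (auto simp: M0_def)
      have nth1: "(ts @ old) ! (B + c) = (if c < p then enc (fs ! c) else (\<lambda>_ _. 0))"
        using kx(3) pT by (auto simp: B_def old_def nth_append Z_def p_def)
      have "(ts @ old) ! (B + T + c) = old ! (T + c)" by (simp add: B_def nth_append add.assoc)
      also have "\<dots> = (if c < p then enc (gs ! c) else (\<lambda>_ _. 0))"
        using kx(3) pT len by (auto simp: old_def nth_append Z_def p_def)
      finally have nth2: "(ts @ old) ! (B + T + c) = (if c < p then enc (gs ! c) else (\<lambda>_ _. 0))" .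
      have cp: "k < p * ?n \<longleftrightarrow> c < p"
      proof
        assume "k < p * ?n" then show "c < p" by (simp add: c_x_def less_mult_imp_div_less)
      next
        assume "c < p"
        then have "(c + 1) * ?n \<le> p * ?n" by (intro mult_right_mono) auto
        then show "k < p * ?n" using kx by simp
      qed
      have ent: "entry k (q0 \<G>) = (if c < p then (ix \<G> ((fs ! c) \<G> (vx \<G> x)), ix \<G> ((gs ! c) \<G> (vx \<G> x))) else (0, 0))"
        using cp by (auto simp: entry_def q0l q0_def c_x_def)
      show "M0 (B * ?n + k) = int (fst (entry k (q0 \<G>)))"
        unfolding t[unfolded ad] ad ent using mem0[of "B + c" x] kx nth1 by (auto simp: enc_def)
      show "M0 ((B + T) * ?n + k) = int (snd (entry k (q0 \<G>)))"
        unfolding t[unfolded ad] ad ent using mem0[of "B + T + c" x] kx nth2 by (auto simp: enc_def)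
    next
      fix u assume u: "u < ?n"
      have "O.LEN * ?n + u \<noteq> tail * ?n + 0" using cell_eq[OF u n, of O.LEN tail] by (simp add: O.LEN_def O.J_def tail_def)
      moreover have "(B + 2 * T) * ?n \<le> O.LEN * ?n" by (rule mult_le_mono1) (simp add: O.LEN_def O.J_def)
      ultimately show "M0 (O.LEN * ?n + u) = int (length [])"
        using zero[OF trans_le_add1, of "O.LEN * ?n" u] by (simp add: M0_def)
    next
      fix u j assume u: "u < ?n" and j: "j < d"
      have "(O.J + j) * ?n + u \<noteq> tail * ?n + 0" using cell_eq[OF u n, of "O.J + j" tail] j by (simp add: O.J_def tail_def)
      moreover have "(B + 2 * T) * ?n \<le> (O.J + j) * ?n" by (rule mult_le_mono1) (simp add: O.J_def)
      ultimately show "\<bar>M0 ((O.J + j) * ?n + u)\<bar> \<le> int (T * ?n)"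
        using zero[OF trans_le_add1, of "(O.J + j) * ?n" u] by (simp add: M0_def)
    qed simp
    obtain Or' where Or': "Or' \<subseteq> vs \<G> \<times> vs \<G>" "\<And>u. u \<in> vs \<G> ==> card {w. (u, w) \<in> Or'} \<le> \<delta>"
      "\<And>c v. c < p ==> v \<in> vs \<G> ==> (fs ! c) \<G> v \<noteq> (gs ! c) \<G> v ==>
        ((fs ! c) \<G> v, (gs ! c) \<G> v) \<in> Or' \<or> ((gs ! c) \<G> v, (fs ! c) \<G> v) \<in> Or'"
      using Or[OF \<G>] unfolding p_def by blast
    define R where "R = map_prod (ix \<G>) (ix \<G>) ` Or'"
    have R1: "finite {w. (u, w) \<in> R} \<and> card {w. (u, w) \<in> R} \<le> \<delta>" if "u < ?n" for u
    proof -
      have "{w. (u, w) \<in> R} \<subseteq> ix \<G> ` {w. (vx \<G> u, w) \<in> Or'}"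
      proof
        fix w assume "w \<in> {w. (u, w) \<in> R}"
        then obtain a b where ab: "(a, b) \<in> Or'" "u = ix \<G> a" "w = ix \<G> b" by (auto simp: R_def)
        then have "a \<in> vs \<G>" using Or'(1) by auto
        then show "w \<in> ix \<G> ` {w. (vx \<G> u, w) \<in> Or'}" using ab insts(6)[OF \<G>] by auto
      qed
      moreover have f: "finite {w. (vx \<G> u, w) \<in> Or'}"
        by (rule finite_subset[OF _ insts(1)[OF \<G>]]) (use Or'(1) in auto)
      ultimately have "card {w. (u, w) \<in> R} \<le> card (ix \<G> ` {w. (vx \<G> u, w) \<in> Or'})" "finite {w. (u, w) \<in> R}"
        by (auto intro: card_mono finite_subset)
      then show ?thesis using card_image_le[OF f, of "ix \<G>"] Or'(2)[OF insts(5)[OF \<G> that]] by linarith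
    qed
    have R2: "(a, b) \<in> R \<or> (b, a) \<in> R" if "(a, b) \<in> set (q0 \<G>)" "a \<noteq> b" for a b
    proof -
      obtain c x where cx: "c < p" "x < ?n" "a = ix \<G> ((fs ! c) \<G> (vx \<G> x))" "b = ix \<G> ((gs ! c) \<G> (vx \<G> x))"
        using \<open>(a, b) \<in> set (q0 \<G>)\<close> q0E by auto
      then have "(fs ! c) \<G> (vx \<G> x) \<noteq> (gs ! c) \<G> (vx \<G> x)" using \<open>a \<noteq> b\<close> by auto
      from Or'(3)[OF cx(1) insts(5)[OF \<G> cx(2)] this] show ?thesis unfolding R_def cx(3,4) by force
    qed
    have q0n: "set (q0 \<G>) \<subseteq> {..<?n} \<times> {..<?n}"
    proof
      fix ent assume "ent \<in> set (q0 \<G>)"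
      then obtain c x where cx: "c < p" "x < ?n" "ent = (ix \<G> ((fs ! c) \<G> (vx \<G> x)), ix \<G> ((gs ! c) \<G> (vx \<G> x)))"
        using q0E by blast
      have "fs ! c \<in> set fs" "gs ! c \<in> set gs" using cx(1) len by (auto simp: p_def)
      then have "(fs ! c) \<G> (vx \<G> x) \<in> vs \<G>" "(gs ! c) \<G> (vx \<G> x) \<in> vs \<G>"
        using fg vfunD[OF _ \<G> insts(5)[OF \<G> cx(2)]] by blast+
      then show "ent \<in> {..<?n} \<times> {..<?n}" using insts(4)[OF \<G>] cx(3) by auto
    qed
    have lq: "length (q0 \<G>) * (d + 1) = T * ?n" by (simp add: q0l T_def algebra_simps)
    from O.loop_correct[OF q0n lq R1 d_def R2 cr]
    have fin: "O.crep (exec_prog ?n q M) (orun d (q0 \<G>) (T * ?n))" "O.frame M0 (exec_prog ?n q M)" by (auto simp: ex)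
    obtain Q where Q: "orun d (q0 \<G>) (T * ?n) = (outs \<G>, Q)" unfolding outs_def by (metis prod.collapse)
    have inv: "oinv R ?n \<delta> (q0 \<G>) (T * ?n) (outs \<G>, Q)"
      using orun_inv[OF R1 R2 q0n, of "T * ?n"] Q by (simp add: d_def)
    have lQ: "drop (T * ?n) Q = []" using fin(1) unfolding Q O.crep_def by simp
    have c1: "exec_prog ?n q M (O.LEN * ?n + u) = int (length (outs \<G> u)) \<and>
      (\<forall>j<length (outs \<G> u). exec_prog ?n q M ((O.J + j) * ?n + u) = int (outs \<G> u ! j))" if "u < ?n" for u
      using fin(1) that unfolding Q O.crep_def by simp
    have c2: "length (outs \<G> u) \<le> d \<and> (\<forall>w\<in>set (outs \<G> u). (u, w) \<in> set (q0 \<G>) \<union> (set (q0 \<G>))\<inverse>)" for u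
      using conjunct1[OF inv[unfolded oinv_def prod.case]] by (simp add: d_def)
    have c3: "\<forall>(a, b)\<in>set (q0 \<G>). a \<noteq> b --> b \<in> set (outs \<G> a) \<or> a \<in> set (outs \<G> b)"
      using conjunct1[OF conjunct2[OF conjunct2[OF inv[unfolded oinv_def prod.case]]]] unfolding lQ by auto
    have "frame_ok" unfolding fo
    proof (intro conjI allI impI)
      fix a assume a: "a < B * ?n"
      have "B * ?n \<le> tail * ?n" by (rule mult_le_mono1) (simp add: tail_def)
      then have "a \<noteq> tail * ?n" using a by linarith
      then show "exec_prog ?n q M a = M a" using fin(2) a unfolding O.frame_def by (simp add: M0_def)
    next
      fix a assume a: "(B + (2 * T + d + 4)) * ?n \<le> a"
      have "tail * ?n < (B + (2 * T + d + 4)) * ?n" using n by (intro mult_less_mono1) (auto simp: tail_def)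
      then have "M0 a = M a" using a by (auto simp: M0_def)
      moreover have "(B + 2 * T) * ?n \<le> (B + (2 * T + d + 4)) * ?n" by (rule mult_le_mono1) simp
      moreover have J4: "O.J + d + 4 = B + (2 * T + d + 4)" by (simp add: O.J_def)
      moreover have "exec_prog ?n q M a = M0 a" using fin(2) a unfolding O.frame_def J4 by blast
      ultimately show "exec_prog ?n q M a = 0" using zero[of a] a by linarith
    qed
    moreover have "O.LEN = B + (2 * T + d)" "\<And>j. O.J + j = B + (2 * T + j)" by (auto simp: O.LEN_def O.J_def)
    note c1 = c1[unfolded this]
    ultimately show ?thesis using c1 c2 c3 by blast
  qed
  \<comment> \<open>No content is prescribed: what the loop leaves in memory is named afterwards and
    read off through \<open>outs\<close>.\<close>
  have "\<exists>us. length us = 2 * T + d + 4 \<and> Comp (ts @ us) \<and> (\<forall>j<2 * T + d + 4. j \<in> {} --> us ! j = t j) \<and>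
    (\<forall>\<G>\<in>insts. \<exists>M. rep \<G> (ts @ old) M \<and> (\<forall>j<2 * T + d + 4. j \<notin> {} --> (\<forall>i<sz \<G>. (us ! j) \<G> (vx \<G> i) =
       exec_prog (sz \<G>) q M ((length ts + j) * sz \<G> + i))))" for t
    by (rule Comp_ext[OF Cold]) (use main[OF _ _ refl] in \<open>auto simp: B_def\<close>)
  then obtain us where us: "length us = 2 * T + d + 4" "Comp (ts @ us)"
    "\<And>\<G>. \<G> \<in> insts ==> \<exists>M. rep \<G> (ts @ old) M \<and> (\<forall>j<2 * T + d + 4. \<forall>i<sz \<G>. (us ! j) \<G> (vx \<G> i) =
       exec_prog (sz \<G>) q M ((B + j) * sz \<G> + i))" unfolding B_def by (metis empty_iff)
  have R: "(us ! (2 * T + d)) \<G> v = int (length (outs \<G> (ix \<G> v)))"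
    "\<And>j. j < length (outs \<G> (ix \<G> v)) ==> (us ! (2 * T + j)) \<G> v = int (outs \<G> (ix \<G> v) ! j)"
    "length (outs \<G> (ix \<G> v)) \<le> d"
    "\<And>w. w \<in> set (outs \<G> (ix \<G> v)) ==> (ix \<G> v, w) \<in> set (q0 \<G>) \<union> (set (q0 \<G>))\<inverse>"
    if \<G>: "\<G> \<in> insts" and v: "v \<in> vs \<G>" for \<G> v
  proof -
    obtain M where M: "rep \<G> (ts @ old) M" "\<And>j i. j < 2 * T + d + 4 ==> i < sz \<G> ==> (us ! j) \<G> (vx \<G> i) =
       exec_prog (sz \<G>) q M ((B + j) * sz \<G> + i)" using us(3)[OF \<G>] by blast
    note m = main[OF \<G> M(1) refl]
    have x: "ix \<G> v < sz \<G>" "vx \<G> (ix \<G> v) = v" using insts(4,6)[OF \<G> v] by auto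
    from m x(1) have m': "exec_prog (sz \<G>) q M ((B + (2 * T + d)) * sz \<G> + ix \<G> v) = int (length (outs \<G> (ix \<G> v)))"
      "length (outs \<G> (ix \<G> v)) \<le> d"
      "\<And>j. j < length (outs \<G> (ix \<G> v)) ==> exec_prog (sz \<G>) q M ((B + (2 * T + j)) * sz \<G> + ix \<G> v) = int (outs \<G> (ix \<G> v) ! j)"
      "\<And>w. w \<in> set (outs \<G> (ix \<G> v)) ==> (ix \<G> v, w) \<in> set (q0 \<G>) \<union> (set (q0 \<G>))\<inverse>"
      by blast+
    show "(us ! (2 * T + d)) \<G> v = int (length (outs \<G> (ix \<G> v)))" using M(2)[of "2 * T + d" "ix \<G> v"] x m'(1) by simp
    show "length (outs \<G> (ix \<G> v)) \<le> d" by (rule m'(2))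
    show "(us ! (2 * T + j)) \<G> v = int (outs \<G> (ix \<G> v) ! j)" if "j < length (outs \<G> (ix \<G> v))" for j
      using M(2)[of "2 * T + j" "ix \<G> v"] x m'(3)[OF that] m'(2) that by simp
    show "(ix \<G> v, w) \<in> set (q0 \<G>) \<union> (set (q0 \<G>))\<inverse>" if "w \<in> set (outs \<G> (ix \<G> v))" for w
      using m'(4)[OF that] .
  qed
  have R5: "b \<in> set (outs \<G> a) \<or> a \<in> set (outs \<G> b)" if \<G>: "\<G> \<in> insts" and ab: "(a, b) \<in> set (q0 \<G>)" "a \<noteq> b" for \<G> a b
  proof -
    obtain M where "rep \<G> (ts @ old) M" using us(3)[OF \<G>] by blast
    from conjunct2[OF conjunct2[OF main[OF \<G> this refl]]] ab show ?thesis by auto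
  qed
  have q0E: "\<exists>c<p. \<exists>y\<in>vs \<G>. a = ix \<G> ((fs ! c) \<G> y) \<and> b = ix \<G> ((gs ! c) \<G> y) \<and> (fs ! c) \<G> y \<in> vs \<G> \<and> (gs ! c) \<G> y \<in> vs \<G>"
    if \<G>: "\<G> \<in> insts" and ab: "(a, b) \<in> set (q0 \<G>)" for a b \<G>
  proof -
    obtain k where k: "k < p * sz \<G>" "a = ix \<G> ((fs ! (k div sz \<G>)) \<G> (vx \<G> (k mod sz \<G>)))" "b = ix \<G> ((gs ! (k div sz \<G>)) \<G> (vx \<G> (k mod sz \<G>)))"
      using ab by (auto simp: q0_def)
    have kd: "k div sz \<G> < p" using k(1) by (simp add: less_mult_imp_div_less)
    have y: "vx \<G> (k mod sz \<G>) \<in> vs \<G>" using insts(3,5)[OF \<G>] by simp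
    have "fs ! (k div sz \<G>) \<in> set fs" "gs ! (k div sz \<G>) \<in> set gs" using kd len by (auto simp: p_def)
    then show ?thesis using k kd y fg vfunD[OF _ \<G> y] by blast
  qed
  have q0I: "(ix \<G> ((fs ! c) \<G> y), ix \<G> ((gs ! c) \<G> y)) \<in> set (q0 \<G>)" if "\<G> \<in> insts" "c < p" "y \<in> vs \<G>" for \<G> c y
  proof -
    have x: "ix \<G> y < sz \<G>" "vx \<G> (ix \<G> y) = y" using insts(4,6)[OF that(1,3)] by auto
    have "(c + 1) * sz \<G> \<le> p * sz \<G>" using that(2) by (intro mult_right_mono) auto
    then have "c * sz \<G> + ix \<G> y < p * sz \<G>" using x by simp
    moreover have "(c * sz \<G> + ix \<G> y) div sz \<G> = c" "(c * sz \<G> + ix \<G> y) mod sz \<G> = ix \<G> y" using x by auto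
    ultimately show ?thesis unfolding q0_def using x by (auto intro!: image_eqI[of _ _ "c * sz \<G> + ix \<G> y"])
  qed
  define h where "h j \<G> v = (if j < length (outs \<G> (ix \<G> v)) then vx \<G> (outs \<G> (ix \<G> v) ! j) else v)" for j \<G> v
  have adj: "\<exists>c<p. \<exists>y\<in>vs \<G>. ((fs ! c) \<G> y = v \<and> (gs ! c) \<G> y = vx \<G> w \<or> (gs ! c) \<G> y = v \<and> (fs ! c) \<G> y = vx \<G> w)
      \<and> vx \<G> w \<in> vs \<G> \<and> ix \<G> (vx \<G> w) = w"
    if \<G>: "\<G> \<in> insts" and v: "v \<in> vs \<G>" and w: "w \<in> set (outs \<G> (ix \<G> v))" for \<G> v w
  proof -
    consider "(ix \<G> v, w) \<in> set (q0 \<G>)" | "(w, ix \<G> v) \<in> set (q0 \<G>)" using R(4)[OF \<G> v w] by auto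
    then show ?thesis
    proof cases
      case 1
      then obtain c y where c: "c < p" "y \<in> vs \<G>" "ix \<G> v = ix \<G> ((fs ! c) \<G> y)" "w = ix \<G> ((gs ! c) \<G> y)"
        "(fs ! c) \<G> y \<in> vs \<G>" "(gs ! c) \<G> y \<in> vs \<G>" using q0E[OF \<G>] by blast
      then have "(fs ! c) \<G> y = v" "(gs ! c) \<G> y = vx \<G> w" using insts(6)[OF \<G>] v by metis+
      then show ?thesis using c by metis
    next
      case 2
      then obtain c y where c: "c < p" "y \<in> vs \<G>" "w = ix \<G> ((fs ! c) \<G> y)" "ix \<G> v = ix \<G> ((gs ! c) \<G> y)"
        "(fs ! c) \<G> y \<in> vs \<G>" "(gs ! c) \<G> y \<in> vs \<G>" using q0E[OF \<G>] by blast
      then have "(gs ! c) \<G> y = v" "(fs ! c) \<G> y = vx \<G> w" using insts(6)[OF \<G>] v by metis+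
      then show ?thesis using c by metis
    qed
  qed
  have hj: "h j \<G> v \<in> vs \<G> \<and> (h j \<G> v = v \<or> (\<exists>c<p. \<exists>y\<in>vs \<G>. (fs ! c) \<G> y = v \<and> (gs ! c) \<G> y = h j \<G> v \<or> (gs ! c) \<G> y = v \<and> (fs ! c) \<G> y = h j \<G> v))"
    if "\<G> \<in> insts" "v \<in> vs \<G>" for j \<G> v
  proof (cases "j < length (outs \<G> (ix \<G> v))")
    case True
    then have "outs \<G> (ix \<G> v) ! j \<in> set (outs \<G> (ix \<G> v))" by simp
    from adj[OF that this] show ?thesis using True by (auto simp: h_def)
  next
    case False then show ?thesis using that by (simp add: h_def)
  qed
  let ?S = "set (ts @ us)"
  have pwh: "enc (h j) \<in> pw ?S" if "j < d" for j
  proof -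
    have "us ! (2 * T + d) \<in> ?S" "us ! (2 * T + j) \<in> ?S" using us(1) that by auto
    then have "(\<lambda>\<G> v. if (us ! (2 * T + d)) \<G> v - int j > 0 then (us ! (2 * T + j)) \<G> v else int (ix \<G> v)) \<in> pw ?S"
      by (intro pw.ifp pw.minus pw.const pw.index pw.tab)
    then show ?thesis
    proof (rule pw.congr)
      fix \<G> v assume a: "\<G> \<in> insts" "v \<in> vs \<G>"
      show "(if (us ! (2 * T + d)) \<G> v - int j > 0 then (us ! (2 * T + j)) \<G> v else int (ix \<G> v)) = enc (h j) \<G> v"
      proof (cases "j < length (outs \<G> (ix \<G> v))")
        case True
        then have "outs \<G> (ix \<G> v) ! j \<in> set (outs \<G> (ix \<G> v))" by simp
        from adj[OF a this] have "ix \<G> (vx \<G> (outs \<G> (ix \<G> v) ! j)) = outs \<G> (ix \<G> v) ! j" by blast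
        then show ?thesis using True R(1,2)[OF a] by (simp add: enc_def h_def)
      next
        case False then show ?thesis using R(1)[OF a] by (simp add: enc_def h_def)
      qed
    qed
  qed
  let ?hs = "map h [0..<d]"
  have vh: "vfun (h j)" for j using hj unfolding vfun_def by blast
  have "lin ?S" unfolding lin_def using us(2) by blast
  then have "lin (enc ` set ?hs \<union> ?S)"
    by (rule lin_pw_set[where k = 1]) (use pwh vfun_bound[OF vh] in auto)
  then have "lin (enc ` set ?hs \<union> S)" by (rule lin_mono) (use ts(2) in auto)
  moreover have "\<exists>h\<in>set ?hs. h \<G> ((fs ! c) \<G> y) = (gs ! c) \<G> y \<or> h \<G> ((gs ! c) \<G> y) = (fs ! c) \<G> y"
    if a: "\<G> \<in> insts" "c < length fs" "y \<in> vs \<G>" "(fs ! c) \<G> y \<noteq> (gs ! c) \<G> y" for \<G> c y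
  proof -
    have c: "c < p" using a(2) by (simp add: p_def)
    have "fs ! c \<in> set fs" "gs ! c \<in> set gs" using a(2) len by auto
    then have v: "(fs ! c) \<G> y \<in> vs \<G>" "(gs ! c) \<G> y \<in> vs \<G>" using fg vfunD[OF _ a(1,3)] by blast+
    then have "ix \<G> ((fs ! c) \<G> y) \<noteq> ix \<G> ((gs ! c) \<G> y)" using a(4) insts(6)[OF a(1)] by metis
    have hh: "\<exists>h\<in>set ?hs. h \<G> x = z" if xz: "x \<in> vs \<G>" "z \<in> vs \<G>" "ix \<G> z \<in> set (outs \<G> (ix \<G> x))" for x z
    proof -
      obtain j where j: "j < length (outs \<G> (ix \<G> x))" "outs \<G> (ix \<G> x) ! j = ix \<G> z"
        using xz(3) by (auto simp: in_set_conv_nth)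
      then have "h j \<G> x = z" using insts(6)[OF a(1) xz(2)] by (simp add: h_def)
      moreover have "j < d" using j(1) R(3)[OF a(1) xz(1)] by simp
      ultimately show ?thesis by auto
    qed
    from R5[OF a(1) q0I[OF a(1) c a(3)] \<open>ix \<G> ((fs ! c) \<G> y) \<noteq> ix \<G> ((gs ! c) \<G> y)\<close>]
    show ?thesis using hh v by blast
  qed
  moreover have "length ?hs = 2 * \<delta> + 1" by (simp add: d_def)
  moreover have "\<forall>h\<in>set ?hs. vfun h" using vh by auto
  moreover have "\<forall>\<G>\<in>insts. \<forall>h\<in>set ?hs. \<forall>v\<in>vs \<G>. h \<G> v = v \<or>
        (\<exists>c<length fs. \<exists>y\<in>vs \<G>. (fs ! c) \<G> y = v \<and> (gs ! c) \<G> y = h \<G> v \<or> (gs ! c) \<G> y = v \<and> (fs ! c) \<G> y = h \<G> v)"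
    using hj unfolding p_def by auto
  ultimately show ?thesis by (intro exI[of _ ?hs]) blast
qed

end

section \<open>Families of functions\<close>

text \<open>A vertex a of maximum outdegree works: a vertex b not reached within two steps would
  beat a and everything that a beats, and so have larger outdegree.\<close>

lemma tournament_king:
  assumes "finite A" "A \<noteq> {}" and "\<And>a b. a \<in> A ==> b \<in> A ==> a = b \<or> E a b \<or> E b a"
  shows "\<exists>a\<in>A. \<forall>b\<in>A. b = a \<or> E a b \<or> (\<exists>c\<in>A. E a c \<and> E c b)"
proof -
  define deg where "deg a = card {b \<in> A. E a b \<or> b = a}" for a
  have "Max (deg ` A) \<in> deg ` A" using assms(1,2) by (intro Max_in) auto
  then obtain a where "a \<in> A" "deg a = Max (deg ` A)" by auto
  then have a: "a \<in> A" "\<And>b. b \<in> A ==> deg b \<le> deg a" using assms(1) by auto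
  have "b = a \<or> E a b \<or> (\<exists>c\<in>A. E a c \<and> E c b)" if b: "b \<in> A" for b
  proof (rule ccontr)
    assume n: "\<not> ?thesis"
    then have ba: "E b a" using assms(3)[OF a(1) b] by blast
    have "{c \<in> A. E a c \<or> c = a} \<subset> {c \<in> A. E b c \<or> c = b}"
    proof
      show "{c \<in> A. E a c \<or> c = a} \<subseteq> {c \<in> A. E b c \<or> c = b}"
        using n ba assms(3)[OF b] by blast
      show "{c \<in> A. E a c \<or> c = a} \<noteq> {c \<in> A. E b c \<or> c = b}" using n b by blast
    qed
    then have "deg a < deg b" unfolding deg_def using assms(1) by (intro psubset_card_mono) auto
    then show False using a(2)[OF b] by simp
  qed
  then show ?thesis using a(1) by blast
qed

section \<open>Growth below towers of fixed height\<close>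

lemma tower_Suc: "tower (Suc k) X = 2 ^ tower k X" by (simp add: tower_def)
lemma tower_0: "tower 0 X = X" by (simp add: tower_def)

lemma tower_add: "tower (j + k) X = tower j (tower k X)"
  by (simp add: tower_def funpow_add)

lemma tower_mono: "X \<le> Y ==> tower k X \<le> tower k Y"
  by (induction k) (auto simp: tower_0 tower_Suc)

lemma tower_ge: "X \<le> tower k X"
  by (induction k) (auto simp: tower_0 tower_Suc intro: order_trans less_imp_le less_exp)

lemma tower_mono1: "j \<le> k ==> tower j X \<le> tower k X"
  by (metis le_add_diff_inverse2 tower_add tower_ge)

text \<open>This class is closed under the arithmetic of the size bounds, so each round of the
  construction adds only a fixed number to the height of the tower.\<close>

definition elem :: "(nat => nat) => bool" where
  "elem F \<longleftrightarrow> (\<exists>c. \<forall>X. F X \<le> tower c X)"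

lemma elem_id: "elem (\<lambda>X. X)" unfolding elem_def using tower_0 by (metis le_refl)

lemma elem_const: "elem (\<lambda>X. a)"
proof -
  have "a \<le> tower a X" for X
  proof (induction a)
    case (Suc a)
    have "Suc a \<le> 2 ^ a" by (induction a) auto
    also have "\<dots> \<le> tower (Suc a) X" using Suc by (simp add: tower_Suc)
    finally show ?case .
  qed simp
  then show ?thesis unfolding elem_def by blast
qed

lemma elem_binary:
  assumes F: "elem F" and G: "elem G" and H: "\<And>X Y. X \<le> Y ==> H1 X Y \<le> tower k Y" "\<And>X Y. X \<le> Y ==> H1 Y X \<le> tower k Y"
    and mono: "\<And>a b c d. a \<le> c ==> b \<le> d ==> H1 a b \<le> H1 c (d :: nat)"
  shows "elem (\<lambda>X. H1 (F X) (G X))"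
proof -
  obtain a b where ab: "\<And>X. F X \<le> tower a X" "\<And>X. G X \<le> tower b X" using F G unfolding elem_def by metis
  have "H1 (F X) (G X) \<le> tower (k + (a + b)) X" for X
  proof -
    have "F X \<le> tower (a + b) X" using ab(1)[of X] tower_mono1[of a "a + b" X] by simp
    moreover have "G X \<le> tower (a + b) X" using ab(2)[of X] tower_mono1[of b "a + b" X] by simp
    ultimately have "H1 (F X) (G X) \<le> H1 (tower (a + b) X) (tower (a + b) X)" by (rule mono)
    also have "\<dots> \<le> tower k (tower (a + b) X)" by (rule H(1)) simp
    finally show ?thesis by (simp add: tower_add[of k])
  qed
  then show ?thesis unfolding elem_def by blast
qed

lemma le2: "(n :: nat) + n \<le> 2 ^ (2 ^ n)" "n * n \<le> 2 ^ (2 ^ (2 ^ n))"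
proof -
  have a: "n \<le> 2 ^ n" for n :: nat by (simp add: less_imp_le)
  have b: "2 * n \<le> 2 ^ n" if "n \<ge> 1" for n :: nat using that by (induction n rule: nat_induct_at_least) auto
  show s: "n + n \<le> 2 ^ (2 ^ n)"
  proof (cases "n = 0")
    case False
    then have "2 * n \<le> 2 ^ n" using b[of n] by simp
    then show ?thesis using a[of "2 ^ n"] by linarith
  qed simp
  have "n * n \<le> 2 ^ n * 2 ^ n" by (intro mult_le_mono a)
  also have "\<dots> = 2 ^ (n + n)" by (simp add: power_add)
  also have "\<dots> \<le> 2 ^ (2 ^ (2 ^ n))" using s by (intro power_increasing) auto
  finally show "n * n \<le> 2 ^ (2 ^ (2 ^ n))" .
qed

lemma elem_add: "elem F ==> elem G ==> elem (\<lambda>X. F X + G X)"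
proof (rule elem_binary[where k = 2 and ?H1.0 = "(+)"])
  show "X + Y \<le> tower 2 Y" "Y + X \<le> tower 2 Y" if "X \<le> Y" for X Y :: nat
    using that le2(1)[of Y] by (auto simp: numeral_2_eq_2 tower_Suc tower_0)
qed auto

lemma elem_mult: "elem F ==> elem G ==> elem (\<lambda>X. F X * G X)"
proof (rule elem_binary[where k = 3 and ?H1.0 = "(*)"])
  show "X * Y \<le> tower 3 Y" "Y * X \<le> tower 3 Y" if "X \<le> Y" for X Y :: nat
    using order_trans[OF mult_le_mono1[OF that, of Y] le2(2)[of Y]]
    by (simp_all add: numeral_3_eq_3 tower_Suc tower_0 mult.commute)
qed (auto intro: mult_le_mono)

lemma elem_power2: "elem F ==> elem (\<lambda>X. 2 ^ F X)"
  unfolding elem_def by (metis one_le_numeral power_increasing tower_Suc)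

lemma elem_mono: "elem G ==> (\<And>X. F X \<le> G X) ==> elem F"
  unfolding elem_def by (meson order_trans)

lemma elem_power:
  assumes "elem F" "elem G" shows "elem (\<lambda>X. F X ^ G X)"
proof (rule elem_mono)
  show "elem (\<lambda>X. 2 ^ (F X * G X))" using assms by (intro elem_power2 elem_mult)
  fix X
  have "F X ^ G X \<le> (2 ^ F X) ^ G X" by (intro power_mono) (auto simp: less_imp_le)
  then show "F X ^ G X \<le> 2 ^ (F X * G X)" by (simp add: power_mult)
qed

lemmas elem_intros = elem_id elem_const elem_add elem_mult elem_power2 elem_power

section \<open>Families of vertex functions and their augmentation\<close>

type_synonym 'v vfn = "'v inst => 'v => 'v"

definition compose :: "'v vfn => 'v vfn => 'v vfn" where
  "compose f g = (\<lambda>\<G> v. f \<G> (g \<G> v))"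

definition vid :: "'v vfn" where "vid = (\<lambda>\<G> v. v)"
text \<open>A constant function with value the vertex of index 0. Its value at y is also its value
  at every free variable, so the set of functions taking y to a value of the free variables is never
  empty and has a hub.\<close>

definition bp :: "'v vfn" where "bp = (\<lambda>\<G> v. vx \<G> 0)"

definition comps :: "'v vfn list => 'v vfn list => 'v vfn list" where
  "comps fs gs = map (\<lambda>(f, g). compose f g) (List.product fs gs)"

lemma set_comps: "set (comps fs gs) = {compose f g | f g. f \<in> set fs \<and> g \<in> set gs}"
  by (auto simp: comps_def)

lemma length_comps: "length (comps fs gs) = length fs * length gs"
  by (simp add: comps_def)

lemma compose_vid: "compose f vid = f" "compose vid f = f"
  by (simp_all add: compose_def vid_def)

lemma comps_subset1: "vid \<in> set gs ==> set fs \<subseteq> set (comps fs gs)"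
  unfolding set_comps using compose_vid(1) by (metis (mono_tags, lifting) CollectI subsetI)

lemma comps_subset2: "vid \<in> set fs ==> set gs \<subseteq> set (comps fs gs)"
  unfolding set_comps using compose_vid(2) by (metis (mono_tags, lifting) CollectI subsetI)

definition ptab :: "nat => 'v table" where
  "ptab p = (\<lambda>\<G> v. of_bool (v \<in> pint (fst \<G>) p))"

definition fgraph :: "'v vfn list => 'v inst => 'v ugraph" where
  "fgraph fs \<G> = fun_graph (vs \<G>) ((\<lambda>f. f \<G>) ` set fs)"

text \<open>The pairs of vertices that \<open>augmentation_sparse\<close> admits as new
  edges.\<close>

definition near :: "'v vfn list => 'v inst => 'v => 'v => bool" where
  "near fs \<G> a b \<longleftrightarrow> (\<exists>f\<in>set fs. \<exists>c\<in>vs \<G>. f \<G> c = a \<and> (b = c \<or> (\<exists>g\<in>set fs. g \<G> c = b \<or> g \<G> b = c)))"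

definition augm :: "nat => nat => nat => nat" where
  "augm m r D = m ^ (4 * r + 4) * D + m"

lemma augm_mono: "m \<le> m' ==> r \<le> r' ==> D \<le> D' ==> augm m r D \<le> augm m' r' D'"
proof -
  assume a: "m \<le> m'" "r \<le> r'" "D \<le> D'"
  have "m ^ (4 * r + 4) \<le> m' ^ (4 * r' + 4)"
  proof (cases "m = 0")
    case False
    have "m ^ (4 * r + 4) \<le> m ^ (4 * r' + 4)" using a False by (intro power_increasing) auto
    also have "\<dots> \<le> m' ^ (4 * r' + 4)" using a by (intro power_mono) auto
    finally show ?thesis .
  qed (simp add: power_0_left)
  then show ?thesis unfolding augm_def using a by (intro add_mono mult_le_mono) auto
qed

context structure_class
begin

definition pb :: "'v table set => ('v inst => 'v => bool) => bool" where
  "pb S P \<longleftrightarrow> (\<lambda>\<G> v. of_bool (P \<G> v)) \<in> pw S"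

lemma pb_congr: "pb S P ==> (\<And>\<G> v. \<G> \<in> insts ==> v \<in> vs \<G> ==> P \<G> v = Q \<G> v) ==> pb S Q"
  unfolding pb_def by (erule pw.congr) simp

lemma pb_eq: "f \<in> pw S ==> g \<in> pw S ==> pb S (\<lambda>\<G> v. f \<G> v = g \<G> v)"
  unfolding pb_def
proof (rule pw.congr)
  assume "f \<in> pw S" "g \<in> pw S"
  then show "(\<lambda>\<G> v. if f \<G> v - g \<G> v > 0 then 0 else if g \<G> v - f \<G> v > 0 then 0 else 1) \<in> pw S"
    by (intro pw.ifp pw.minus pw.const)
qed auto

lemma pb_not: "pb S P ==> pb S (\<lambda>\<G> v. \<not> P \<G> v)"
  unfolding pb_def
proof (rule pw.congr)
  assume "(\<lambda>\<G> v. of_bool (P \<G> v)) \<in> pw S"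
  then show "(\<lambda>\<G> v. 1 - of_bool (P \<G> v)) \<in> pw S" by (intro pw.minus pw.const)
qed auto

lemma pb_and: "pb S P ==> pb S Q ==> pb S (\<lambda>\<G> v. P \<G> v \<and> Q \<G> v)"
  unfolding pb_def
proof (rule pw.congr)
  assume "(\<lambda>\<G> v. of_bool (P \<G> v)) \<in> pw S" "(\<lambda>\<G> v. of_bool (Q \<G> v)) \<in> pw S"
  then show "(\<lambda>\<G> v. if of_bool (P \<G> v) > (0::int) then of_bool (Q \<G> v) else 0) \<in> pw S" by (intro pw.ifp pw.const)
qed auto

lemma pb_const: "pb S (\<lambda>_ _. b)"
  unfolding pb_def by (rule pw.const)

lemma pb_iff: "pb S P ==> pb S (\<lambda>\<G> v. b = P \<G> v)"
  using pb_not by (cases b) auto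

lemma pb_ball: "finite I ==> (\<And>i. i \<in> I ==> pb S (P i)) ==> pb S (\<lambda>\<G> v. \<forall>i\<in>I. P i \<G> v)"
proof (induction I rule: finite_induct)
  case empty then show ?case using pb_const[of S True] by simp
next
  case (insert i I) then show ?case using pb_and[of S "P i" "\<lambda>\<G> v. \<forall>i\<in>I. P i \<G> v"] by simp
qed

lemma pw_load_vfun:
  assumes "t \<in> S" "enc g \<in> pw S" "vfun g"
  shows "(\<lambda>\<G> v. t \<G> (g \<G> v)) \<in> pw S"
proof (rule pw.congr[OF pw.load[OF assms(1,2)]])
  fix \<G> v assume a: "\<G> \<in> insts" "v \<in> vs \<G>"
  show "0 \<le> enc g \<G> v \<and> enc g \<G> v < int (sz \<G>)" using enc_bound vfunD[OF assms(3) a] a by blast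
next
  fix \<G> v assume a: "\<G> \<in> insts" "v \<in> vs \<G>"
  show "t \<G> (vx \<G> (nat (enc g \<G> v))) = t \<G> (g \<G> v)" using insts(6)[OF a(1) vfunD[OF assms(3) a]] by (simp add: enc_def)
qed

lemma pw_compose:
  assumes "enc f \<in> S" "enc g \<in> pw S" "vfun g"
  shows "enc (compose f g) \<in> pw S"
  using pw_load_vfun[OF assms] by (simp add: enc_def compose_def)

lemma vfun_compose: "vfun f ==> vfun g ==> vfun (compose f g)"
  by (simp add: vfun_def compose_def)

lemma pb_eq_vfun:
  assumes "enc f \<in> pw S" "enc g \<in> pw S" "vfun f" "vfun g"
  shows "pb S (\<lambda>\<G> v. f \<G> v = g \<G> v)"
  using pb_eq[OF assms(1,2)]
proof (rule pb_congr)
  fix \<G> v assume a: "\<G> \<in> insts" "v \<in> vs \<G>"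
  show "(enc f \<G> v = enc g \<G> v) = (f \<G> v = g \<G> v)"
    using inj_on_eq_iff[OF insts(8)[OF a(1)] vfunD[OF assms(3) a] vfunD[OF assms(4) a]]
    by (simp add: enc_def)
qed

definition PT :: "'v table set" where "PT = ptab ` psig \<sigma>"

lemma finite_psig: "finite (psig \<sigma>)" using sig by (simp add: functional_signature_def)

text \<open>The qualitative invariant of the construction: density is bounded at all ranks, without
  values. This is what bounded expansion of the expanded class needs, whereas the size of the
  signature needs a number, which \<open>quant\<close> tracks at one rank.\<close>

definition fam :: "'v vfn list => bool" where
  "fam fs \<longleftrightarrow> vid \<in> set fs \<and> bp \<in> set fs \<and> (\<forall>f\<in>set fs. vfun f) \<and> lin (PT \<union> enc ` set fs) \<and>
     (\<forall>r. \<exists>D. \<forall>\<G>\<in>insts. grad_le r D (fgraph fs \<G>))"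

text \<open>The number of functions and their density share the bound X, so that a round is
  described by a single growth function.\<close>

definition quant :: "'v vfn list => nat => nat => bool" where
  "quant fs X R \<longleftrightarrow> length fs \<le> X \<and> (\<forall>\<G>\<in>insts. grad_le R X (fgraph fs \<G>))"

lemma grad_aug:
  assumes \<G>: "\<G> \<in> insts" and fs: "vid \<in> set fs" "\<And>f. f \<in> set fs ==> vfun f"
    and gr: "grad_le (2 * r + 1) D (fgraph fs \<G>)"
    and V: "verts H = vs \<G>"
    and H: "\<And>e. e \<in> edges H ==> \<exists>a\<in>vs \<G>. \<exists>b\<in>vs \<G>. e = {a, b} \<and> near fs \<G> a b"
  shows "grad_le r (augm (length fs) r D) H"
proof -
  have "grad_le r (length (map (\<lambda>f. f \<G>) fs) ^ (4 * r + 4) * D + length (map (\<lambda>f. f \<G>) fs)) H"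
  proof (rule augmentation_sparse[where V = "vs \<G>"])
    show "grad_le (2 * r + 1) D (fun_graph (vs \<G>) (set (map (\<lambda>f. f \<G>) fs)))" using gr by (simp add: fgraph_def)
    show "\<exists>f\<in>set (map (\<lambda>f. f \<G>) fs). \<forall>v\<in>vs \<G>. f v = v"
      using fs(1) by (auto simp: vid_def intro: bexI[of _ vid])
    show "f v \<in> vs \<G>" if "f \<in> set (map (\<lambda>f. f \<G>) fs)" "v \<in> vs \<G>" for f v
      using that vfunD[OF fs(2) \<G>] by auto
    show "edges H \<subseteq> {{f c, w} |f c w. f \<in> set (map (\<lambda>f. f \<G>) fs) \<and> c \<in> vs \<G> \<and> w \<in> vs \<G> \<and>
       (w = c \<or> (\<exists>g\<in>set (map (\<lambda>f. f \<G>) fs). g c = w \<or> g w = c))}"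
    proof
      fix e assume "e \<in> edges H"
      from H[OF this] obtain a b where ab: "a \<in> vs \<G>" "b \<in> vs \<G>" "e = {a, b}" "near fs \<G> a b" by blast
      then obtain f c where "f \<in> set fs" "c \<in> vs \<G>" "f \<G> c = a" "b = c \<or> (\<exists>g\<in>set fs. g \<G> c = b \<or> g \<G> b = c)"
        unfolding near_def by blast
      then have "f \<G> \<in> set (map (\<lambda>f. f \<G>) fs)" "b = c \<or> (\<exists>g\<in>set (map (\<lambda>f. f \<G>) fs). g c = b \<or> g b = c)"
        "c \<in> vs \<G>" "e = {f \<G> c, b}" using ab(3) by auto
      then show "e \<in> {{f c, w} |f c w. f \<in> set (map (\<lambda>f. f \<G>) fs) \<and> c \<in> vs \<G> \<and> w \<in> vs \<G> \<and>
         (w = c \<or> (\<exists>g\<in>set (map (\<lambda>f. f \<G>) fs). g c = w \<or> g w = c))}"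
        using ab(2) by blast
    qed
  qed (use insts(1)[OF \<G>] V in auto)
  then show ?thesis by (simp add: augm_def)
qed

text \<open>Edges are unordered, so it suffices that every new arc joins a \<open>near\<close> pair
  in one of the two orders. Controlling rank R afterwards needs rank \<open>2 * R + 1\<close>
  before.\<close>

lemma fam_aug:
  assumes fs: "fam fs" and fs': "vid \<in> set fs'" "bp \<in> set fs'" "\<And>f. f \<in> set fs' ==> vfun f" "lin (PT \<union> enc ` set fs')"
    and near: "\<And>\<G> f v. \<G> \<in> insts ==> f \<in> set fs' ==> v \<in> vs \<G> ==> f \<G> v = v \<or> near fs \<G> (f \<G> v) v \<or> near fs \<G> v (f \<G> v)"
  shows "fam fs'" "quant fs X (2 * R + 1) ==> length fs' \<le> Y ==> quant fs' (augm X R X + Y) R"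
proof -
  have gr: "grad_le r (augm (length fs) r D) (fgraph fs' \<G>)" if "\<G> \<in> insts" "grad_le (2 * r + 1) D (fgraph fs \<G>)" for \<G> r D
  proof (rule grad_aug[OF that(1) _ _ that(2)])
    fix e assume "e \<in> edges (fgraph fs' \<G>)"
    then obtain f v where fv: "f \<in> set fs'" "v \<in> vs \<G>" "e = {f \<G> v, v}" "f \<G> v \<noteq> v"
      by (auto simp: fgraph_def fun_graph_def)
    have e': "e = {v, f \<G> v}" using fv(3) by (simp add: insert_commute)
    have V: "f \<G> v \<in> vs \<G>" using vfunD[OF fs'(3) that(1)] fv by blast
    from near[OF that(1) fv(1,2)] fv(4) consider "near fs \<G> (f \<G> v) v" | "near fs \<G> v (f \<G> v)" by blast
    then show "\<exists>a\<in>vs \<G>. \<exists>b\<in>vs \<G>. e = {a, b} \<and> near fs \<G> a b"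
      using fv(2,3) e' V by cases blast+
  qed (use fs in \<open>auto simp: fam_def fgraph_def fun_graph_def\<close>)
  then have "\<exists>D. \<forall>\<G>\<in>insts. grad_le r D (fgraph fs' \<G>)" for r
    using fs unfolding fam_def by metis
  then show "fam fs'" using fs' unfolding fam_def by blast
  assume q: "quant fs X (2 * R + 1)" and Y: "length fs' \<le> Y"
  have "grad_le R (augm X R X + Y) (fgraph fs' \<G>)" if \<G>: "\<G> \<in> insts" for \<G>
  proof (rule grad_le_mono[OF gr[OF \<G>] le_refl])
    show "grad_le (2 * R + 1) X (fgraph fs \<G>)" using q \<G> by (simp add: quant_def)
    have "augm (length fs) R X \<le> augm X R X" using q by (intro augm_mono) (auto simp: quant_def)
    then show "augm (length fs) R X \<le> augm X R X + Y" by simp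
  qed
  then show "quant fs' (augm X R X + Y) R" using Y by (simp add: quant_def)
qed

lemma lin_comps:
  assumes "lin (PT \<union> enc ` set fs \<union> S)" "\<And>f. f \<in> set fs ==> vfun f" "enc ` set gs \<subseteq> PT \<union> enc ` set fs \<union> S" "\<And>f. f \<in> set gs ==> vfun f"
  shows "lin (enc ` set (comps fs gs) \<union> (PT \<union> enc ` set fs \<union> S))"
proof (rule lin_pw_set[OF assms(1), where k = 1])
  fix t assume "t \<in> enc ` set (comps fs gs)"
  then obtain f g where fg: "t = enc (compose f g)" "f \<in> set fs" "g \<in> set gs" by (auto simp: set_comps)
  have "enc g \<in> pw (PT \<union> enc ` set fs \<union> S)" using fg(3) assms(3) by (intro pw.tab) auto
  then have "t \<in> pw (PT \<union> enc ` set fs \<union> S)" unfolding fg(1) using fg assms by (intro pw_compose) auto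
  moreover have "vfun (compose f g)" using fg assms by (intro vfun_compose) auto
  ultimately show "t \<in> pw (PT \<union> enc ` set fs \<union> S) \<and> (\<forall>\<G>\<in>insts. \<forall>v\<in>vs \<G>. \<bar>t \<G> v\<bar> \<le> int (1 * sz \<G>))"
    using vfun_bound[of "compose f g"] fg(1) by auto
qed simp

lemma fam_comps:
  assumes "fam fs"
  shows "fam (comps fs fs)" "quant fs X (2 * R + 1) ==> quant (comps fs fs) (augm X R X + X * X) R"
proof -
  have v: "vid \<in> set fs" "bp \<in> set fs" "\<And>f. f \<in> set fs ==> vfun f" using assms by (auto simp: fam_def)
  have 1: "vid \<in> set (comps fs fs)" "bp \<in> set (comps fs fs)" using comps_subset1[OF v(1)] v by blast+
  have 2: "vfun f" if "f \<in> set (comps fs fs)" for f using that v(3) by (auto simp: set_comps vfun_compose)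
  have "lin (PT \<union> enc ` set fs \<union> {})" using assms by (simp add: fam_def)
  then have "lin (enc ` set (comps fs fs) \<union> (PT \<union> enc ` set fs \<union> {}))"
    by (rule lin_comps[OF _ v(3) _ v(3)]) auto
  then have 3: "lin (PT \<union> enc ` set (comps fs fs))"
    by (rule lin_mono) auto
  have 4: "f \<G> v = v \<or> near fs \<G> (f \<G> v) v \<or> near fs \<G> v (f \<G> v)"
    if "\<G> \<in> insts" "f \<in> set (comps fs fs)" "v \<in> vs \<G>" for \<G> f v
  proof -
    obtain g k where gk: "f = compose g k" "g \<in> set fs" "k \<in> set fs" using \<open>f \<in> set (comps fs fs)\<close> by (auto simp: set_comps)
    have "near fs \<G> (f \<G> v) v" unfolding near_def
      using gk v(3) vfunD[OF _ that(1,3)] by (intro bexI[of _ g] bexI[of _ "k \<G> v"]) (auto simp: compose_def)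
    then show ?thesis by simp
  qed
  show "fam (comps fs fs)" by (rule fam_aug(1)[OF assms]) (fact 1 2 3 4)+
  assume q: "quant fs X (2 * R + 1)"
  have l: "length (comps fs fs) \<le> X * X" using q by (auto simp: length_comps quant_def intro: mult_le_mono)
  show "quant (comps fs fs) (augm X R X + X * X) R"
    by (rule fam_aug(2)[OF assms]) (fact 1 2 3 4 q l)+
qed

text \<open>\<open>hub fs Q\<close>: the values at \<open>y\<close> of any nonempty set of functions of the family are determined by one of them,
  through functions in \<open>Q\<close>.\<close>

definition hub :: "'v vfn list => 'v vfn list => bool" where
  "hub fs Q \<longleftrightarrow> (\<forall>\<G>\<in>insts. \<forall>y\<in>vs \<G>. \<forall>A\<subseteq>set fs. A \<noteq> {} --> (\<exists>a\<in>A. \<forall>f\<in>A. \<exists>q\<in>set Q. f \<G> y = q \<G> (a \<G> y)))"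

text \<open>Joining \<open>f \<G> y\<close> to \<open>g \<G> y\<close> for all f, g and y adds only
  near pairs, so this graph has bounded density and can be oriented. For fixed y the values form a
  tournament, up to equality, whose king reaches all of them by at most two out-neighbour functions;
  hence the compositions of two members of \<open>vid # hs\<close>. The number of functions is
  \<open>2 * (2 * augm X 0 X) + 1\<close>: density D gives outdegree \<open>2 * D\<close>, which the
  online algorithm doubles.\<close>

lemma hub_exists:
  assumes fam: "fam fs" and q: "quant fs X 1"
  shows "\<exists>hs. length hs = 4 * augm X 0 X + 1 \<and> lin (enc ` set hs \<union> (PT \<union> enc ` set fs)) \<and> (\<forall>h\<in>set hs. vfun h) \<and>
     (\<forall>\<G>\<in>insts. \<forall>h\<in>set hs. \<forall>v\<in>vs \<G>. h \<G> v = v \<or> near fs \<G> (h \<G> v) v) \<and>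
     hub fs (comps (vid # hs) (vid # hs))"
proof -
  have v: "vid \<in> set fs" "bp \<in> set fs" "\<And>f. f \<in> set fs ==> vfun f" and l: "lin (PT \<union> enc ` set fs)"
    using fam by (auto simp: fam_def)
  let ?P = "List.product fs fs"
  define F where "F = map fst ?P" define G where "G = map snd ?P"
  let ?d = "2 * augm X 0 X"
  have nth: "\<exists>f\<in>set fs. \<exists>g\<in>set fs. F ! c = f \<and> G ! c = g" if "c < length F" for c
  proof -
    have "?P ! c \<in> set ?P" using that by (intro nth_mem) (simp add: F_def)
    then show ?thesis using that by (auto simp: F_def G_def)
  qed
  have nth': "\<exists>c<length F. F ! c = f \<and> G ! c = g" if "f \<in> set fs" "g \<in> set fs" for f g
  proof -
    have "(f, g) \<in> set ?P" using that by simp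
    then obtain c where "c < length ?P" "?P ! c = (f, g)" by (meson in_set_conv_nth)
    then show ?thesis by (intro exI[of _ c]) (auto simp: F_def G_def)
  qed
  have nr: "near fs \<G> (f \<G> y) (g \<G> y)" if "\<G> \<in> insts" "f \<in> set fs" "g \<in> set fs" "y \<in> vs \<G>" for \<G> f g y
    unfolding near_def using that by (intro bexI[of _ f] bexI[of _ y]) auto
  have Or: "\<exists>Or \<subseteq> vs \<G> \<times> vs \<G>. (\<forall>u\<in>vs \<G>. card {w. (u, w) \<in> Or} \<le> ?d) \<and>
      (\<forall>c<length F. \<forall>v\<in>vs \<G>. (F ! c) \<G> v \<noteq> (G ! c) \<G> v -->
        ((F ! c) \<G> v, (G ! c) \<G> v) \<in> Or \<or> ((G ! c) \<G> v, (F ! c) \<G> v) \<in> Or)" if \<G>: "\<G> \<in> insts" for \<G>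
  proof -
    define H where "H = \<lparr>verts = vs \<G>, edges = {{f \<G> y, g \<G> y} | f g y. f \<in> set fs \<and> g \<in> set fs \<and> y \<in> vs \<G>}\<rparr>"
    have gr: "grad_le 0 (augm (length fs) 0 X) H"
    proof (rule grad_aug[OF \<G> v(1,3)])
      show "grad_le (2 * 0 + 1) X (fgraph fs \<G>)" using q \<G> by (simp add: quant_def)
      fix e assume "e \<in> edges H"
      then obtain f g y where "f \<in> set fs" "g \<in> set fs" "y \<in> vs \<G>" "e = {f \<G> y, g \<G> y}" by (auto simp: H_def)
      then show "\<exists>a\<in>vs \<G>. \<exists>b\<in>vs \<G>. e = {a, b} \<and> near fs \<G> a b"
        using nr[OF \<G>] vfunD[OF v(3) \<G>] by blast
    qed (auto simp: H_def)
    have "augm (length fs) 0 X \<le> augm X 0 X" using q by (intro augm_mono) (auto simp: quant_def)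
    then have gr: "grad_le 0 (augm X 0 X) H" using gr grad_le_mono by blast
    obtain Or where Or: "Or \<subseteq> vs \<G> \<times> vs \<G>" "\<forall>u\<in>vs \<G>. card {w. (u, w) \<in> Or} \<le> ?d"
      "\<forall>a\<in>vs \<G>. \<forall>b\<in>vs \<G>. a \<noteq> b --> {a, b} \<in> edges H --> (a, b) \<in> Or \<or> (b, a) \<in> Or"
      using orientation_exists[OF gr, of "vs \<G>"] insts(1)[OF \<G>] by (auto simp: H_def)
    have "((F ! c) \<G> y, (G ! c) \<G> y) \<in> Or \<or> ((G ! c) \<G> y, (F ! c) \<G> y) \<in> Or"
      if c: "c < length F" "y \<in> vs \<G>" "(F ! c) \<G> y \<noteq> (G ! c) \<G> y" for c y
    proof -
      obtain f g where fg: "f \<in> set fs" "g \<in> set fs" "F ! c = f" "G ! c = g" using nth[OF c(1)] by blast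
      have "{f \<G> y, g \<G> y} \<in> edges H" using fg c(2) by (auto simp: H_def)
      then show ?thesis using Or(3) vfunD[OF v(3) \<G> c(2)] fg c(3) by blast
    qed
    then show ?thesis using Or(1,2) by blast
  qed
  have ne: "F \<noteq> []" "length G = length F" using v(1) by (cases fs; auto simp: F_def G_def)+
  have "\<And>f. f \<in> set F \<union> set G ==> vfun f \<and> enc f \<in> PT \<union> enc ` set fs" using v(3) by (auto simp: F_def G_def split: if_splits)
  from lin_orient[OF l ne(2,1) this Or] obtain hs where hs: "length hs = 2 * ?d + 1"
     "lin (enc ` set hs \<union> (PT \<union> enc ` set fs))" "\<forall>h\<in>set hs. vfun h"
     "\<forall>\<G>\<in>insts. \<forall>h\<in>set hs. \<forall>v\<in>vs \<G>. h \<G> v = v \<or>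
        (\<exists>c<length F. \<exists>y\<in>vs \<G>. (F ! c) \<G> y = v \<and> (G ! c) \<G> y = h \<G> v \<or> (G ! c) \<G> y = v \<and> (F ! c) \<G> y = h \<G> v)"
     "\<forall>\<G>\<in>insts. \<forall>c<length F. \<forall>y\<in>vs \<G>. (F ! c) \<G> y \<noteq> (G ! c) \<G> y -->
        (\<exists>h\<in>set hs. h \<G> ((F ! c) \<G> y) = (G ! c) \<G> y \<or> h \<G> ((G ! c) \<G> y) = (F ! c) \<G> y)" by blast
  have near: "h \<G> v = v \<or> near fs \<G> (h \<G> v) v" if a: "\<G> \<in> insts" "h \<in> set hs" "v \<in> vs \<G>" for \<G> h v
  proof (cases "h \<G> v = v")
    case False
    then obtain c y where "c < length F" "y \<in> vs \<G>" "(F ! c) \<G> y = v \<and> (G ! c) \<G> y = h \<G> v \<or> (G ! c) \<G> y = v \<and> (F ! c) \<G> y = h \<G> v"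
      using hs(4) a by blast
    then show ?thesis using nth nr[OF a(1)] by metis
  qed simp
  have "hub fs (comps (vid # hs) (vid # hs))" unfolding hub_def
  proof (intro ballI allI impI)
    fix \<G> y A assume a: "\<G> \<in> insts" "y \<in> vs \<G>" "A \<subseteq> set fs" "A \<noteq> {}"
    let ?E = "\<lambda>f g. g \<G> y = f \<G> y \<or> (\<exists>h\<in>set hs. g \<G> y = h \<G> (f \<G> y))"
    have "\<exists>f\<in>A. \<forall>g\<in>A. g = f \<or> ?E f g \<or> (\<exists>k\<in>A. ?E f k \<and> ?E k g)"
    proof (rule tournament_king)
      show "finite A" using a(3) finite_subset by blast
      fix f g assume "f \<in> A" "g \<in> A"
      then obtain c where "c < length F" "F ! c = f" "G ! c = g" using nth' a(3) by blast
      then show "f = g \<or> ?E f g \<or> ?E g f" using hs(5) a(1,2) by metis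
    qed (rule a(4))
    then obtain f where f: "f \<in> A" "\<And>g. g \<in> A ==> g = f \<or> ?E f g \<or> (\<exists>k\<in>A. ?E f k \<and> ?E k g)" by blast
    have E: "\<exists>h\<in>set (vid # hs). g \<G> y = h \<G> (f \<G> y)" if "?E f g" for f g using that by (auto simp: vid_def)
    have "\<exists>q\<in>set (comps (vid # hs) (vid # hs)). g \<G> y = q \<G> (f \<G> y)" if gA: "g \<in> A" for g
    proof -
      have "\<exists>h\<in>set (vid # hs). \<exists>h'\<in>set (vid # hs). g \<G> y = h \<G> (h' \<G> (f \<G> y))"
      proof -
        consider "g = f" | "?E f g" | "\<exists>k\<in>A. ?E f k \<and> ?E k g" using f(2)[OF gA] by blast
        then show ?thesis
        proof cases
          case 1 then show ?thesis by (auto simp: vid_def)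
        next
          case 2 then show ?thesis by (auto simp: vid_def)
        next
          case 3
          then obtain k where k: "?E f k" "?E k g" by blast
          obtain h' where h': "h' \<in> set (vid # hs)" "k \<G> y = h' \<G> (f \<G> y)" using E[of k f, OF k(1)] ..
          obtain h where h: "h \<in> set (vid # hs)" "g \<G> y = h \<G> (k \<G> y)" using E[of g k, OF k(2)] ..
          show ?thesis by (rule bexI[OF _ h(1)], rule bexI[OF _ h'(1)]) (simp add: h h')
        qed
      qed
      then obtain h h' where "h \<in> set (vid # hs)" "h' \<in> set (vid # hs)" "g \<G> y = compose h h' \<G> (f \<G> y)"
        by (auto simp: compose_def)
      then show ?thesis unfolding set_comps by blast
    qed
    then show "\<exists>a\<in>A. \<forall>f\<in>A. \<exists>q\<in>set (comps (vid # hs) (vid # hs)). f \<G> y = q \<G> (a \<G> y)" using f(1) by blast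
  qed
  then show ?thesis using hs near by (intro exI[of _ hs]) auto
qed

end

section \<open>Elimination of a quantifier\<close>

type_synonym 'v utype = "('v vfn \<times> 'v vfn) set \<times> ('v vfn \<times> nat) set"

text \<open>A type over the functions L, the hub function, and a branch of at most n functions. All
  parts range over finite sets determined by the family, so the witness functions are uniform over
  the class.\<close>

definition wit_index :: "'v vfn set => 'v vfn set => nat set => nat => ('v utype \<times> 'v vfn \<times> 'v vfn list) set" where
  "wit_index L F P n = (Pow (L \<times> L) \<times> Pow (L \<times> P)) \<times> F \<times> {\<beta>. set \<beta> \<subseteq> F \<and> length \<beta> \<le> n}"

lemma card_wit_index:
  assumes "finite L" "finite F" "finite P" "card L \<le> l" "card F \<le> m" "card P \<le> p" "m > 0"
  shows "finite (wit_index L F P n)"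
    "card (wit_index L F P n) \<le> 2 ^ (l * l) * 2 ^ (l * p) * (m * ((n + 1) * m ^ n))"
proof -
  have f: "finite {\<beta>. set \<beta> \<subseteq> F \<and> length \<beta> \<le> n}" using assms(2) by (rule finite_lists_length_le)
  then show "finite (wit_index L F P n)" using assms by (simp add: wit_index_def)
  have "card {\<beta>. set \<beta> \<subseteq> F \<and> length \<beta> \<le> n} = (\<Sum>i\<le>n. card F ^ i)" using assms(2) by (rule card_lists_length_le)
  also have "\<dots> \<le> (\<Sum>i\<le>n. m ^ n)"
  proof (rule sum_mono)
    fix i assume "i \<in> {..n}"
    have "card F ^ i \<le> m ^ i" using assms(5) by (rule power_mono) simp
    also have "\<dots> \<le> m ^ n" using \<open>i \<in> {..n}\<close> assms(7) by (intro power_increasing) auto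
    finally show "card F ^ i \<le> m ^ n" .
  qed
  finally have b: "card {\<beta>. set \<beta> \<subseteq> F \<and> length \<beta> \<le> n} \<le> (n + 1) * m ^ n" by simp
  have "card (wit_index L F P n) = 2 ^ (card L * card L) * 2 ^ (card L * card P) * (card F * card {\<beta>. set \<beta> \<subseteq> F \<and> length \<beta> \<le> n})"
    using assms(1-3) by (simp add: wit_index_def card_cartesian_product card_Pow)
  also have "\<dots> \<le> 2 ^ (l * l) * 2 ^ (l * p) * (m * ((n + 1) * m ^ n))"
    using assms(4-6) b by (intro mult_le_mono power_increasing) auto
  finally show "card (wit_index L F P n) \<le> 2 ^ (l * l) * 2 ^ (l * p) * (m * ((n + 1) * m ^ n))" .
qed

text \<open>The bounds from here on trace one elimination: \<open>hs_size\<close> counts the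
  functions from the orientation, \<open>types_size\<close> those whose equalities make up a type,
  \<open>wit_size\<close> the indices of witnesses; \<open>elim1\<close>, \<open>elim2\<close> and
  \<open>elim_size\<close> bound the family after each of three augmentations. The rank is replaced
  by X, which is assumed to dominate it.\<close>

definition hs_size :: "nat => nat" where "hs_size X = 4 * augm X 0 X + 1"
definition types_size :: "nat => nat" where "types_size X = (hs_size X + 1) * (hs_size X + 1) * X"
definition wit_size :: "nat => nat" where
  "wit_size X = 2 ^ (types_size X * types_size X) * 2 ^ (types_size X * X) * (X * ((X * (X * X) + 1) * X ^ (X * (X * X))))"
definition elim1 :: "nat => nat" where "elim1 X = augm X X X + (X + hs_size X + wit_size X)"
definition elim2 :: "nat => nat" where "elim2 X = augm (elim1 X) X (elim1 X) + elim1 X * elim1 X"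
definition elim_size :: "nat => nat" where "elim_size X = augm (elim2 X) X (elim2 X) + elim2 X * elim2 X"

lemma elem_elim_size: "elem elim_size"
proof -
  have h: "elem hs_size" unfolding hs_size_def augm_def by (intro elem_intros)
  then have t: "elem types_size" unfolding types_size_def by (intro elem_intros)
  then have w: "elem wit_size" unfolding wit_size_def by (intro elem_intros)
  have e1: "elem elim1" unfolding elim1_def augm_def by (intro elem_intros h w)
  have e2: "elem elim2" unfolding elim2_def augm_def by (intro elem_intros e1)
  show ?thesis unfolding elim_size_def augm_def by (intro elem_intros e2)
qed

context structure_class
begin

section \<open>Types over one variable and witness functions\<close>

definition ut :: "'v vfn list => 'v inst => 'v => 'v utype" where
  "ut L \<G> v = ({(f, g). f \<in> set L \<and> g \<in> set L \<and> f \<G> v = g \<G> v},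
     {(f, p). f \<in> set L \<and> p \<in> psig \<sigma> \<and> f \<G> v \<in> pint (fst \<G>) p})"

lemma pb_pred:
  assumes "PT \<subseteq> S" "p \<in> psig \<sigma>" "enc f \<in> pw S" "vfun f"
  shows "pb S (\<lambda>\<G> v. f \<G> v \<in> pint (fst \<G>) p)"
proof -
  have "ptab p \<in> S" using assms(1,2) by (auto simp: PT_def)
  from pw_load_vfun[OF this assms(3,4)] show ?thesis by (simp add: pb_def ptab_def)
qed

lemma pb_ut:
  assumes "PT \<subseteq> S" "enc ` set L \<subseteq> S" "\<And>f. f \<in> set L ==> vfun f"
  shows "pb S (\<lambda>\<G> v. ut L \<G> v = \<tau>)"
proof -
  have t: "enc f \<in> pw S" if "f \<in> set L" for f using that assms(2) by (intro pw.tab) auto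
  have "pb S (\<lambda>\<G> v. (fst \<tau> \<subseteq> set L \<times> set L \<and> snd \<tau> \<subseteq> set L \<times> psig \<sigma>) \<and>
     ((\<forall>x\<in>set L \<times> set L. (x \<in> fst \<tau>) = (fst x \<G> v = snd x \<G> v)) \<and>
      (\<forall>x\<in>set L \<times> psig \<sigma>. (x \<in> snd \<tau>) = (fst x \<G> v \<in> pint (fst \<G>) (snd x)))))"
    using finite_psig assms t
    by (intro pb_and pb_const pb_ball pb_iff pb_eq_vfun pb_pred) auto
  then show ?thesis
    by (rule pb_congr) (cases \<tau>, auto simp: ut_def)
qed

text \<open>Candidates for a witness with hub value z. Each further b of the branch demands that a
  candidate differ at b from the witness of the shorter branch. The element to be replaced does not
  occur here, which makes \<open>wit\<close> a unary function of z.\<close>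

primrec kc :: "'v vfn list => 'v utype => 'v vfn => 'v vfn list => 'v inst => 'v => 'v => bool" where
  "kc L \<tau> a [] \<G> z y \<longleftrightarrow> a \<G> y = z \<and> ut L \<G> y = \<tau>"
| "kc L \<tau> a (b # \<beta>) \<G> z y \<longleftrightarrow> kc L \<tau> a \<beta> \<G> z y \<and> b \<G> y \<noteq> b \<G> (pick \<G> {y \<in> vs \<G>. kc L \<tau> a \<beta> \<G> z y} z)"

definition wit :: "'v vfn list => 'v utype \<times> 'v vfn \<times> 'v vfn list => 'v vfn" where
  "wit L = (\<lambda>(\<tau>, a, \<beta>) \<G> z. pick \<G> {y \<in> vs \<G>. kc L \<tau> a \<beta> \<G> z y} z)"

lemma kc_base: "kc L \<tau> a \<beta> \<G> z y ==> a \<G> y = z \<and> ut L \<G> y = \<tau>"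
  by (induction \<beta>) auto

lemma wit_cases:
  assumes "\<G> \<in> insts" "z \<in> vs \<G>"
  shows "wit L (\<tau>, a, \<beta>) \<G> z = z \<and> (\<forall>y\<in>vs \<G>. \<not> kc L \<tau> a \<beta> \<G> z y) \<or>
    wit L (\<tau>, a, \<beta>) \<G> z \<in> vs \<G> \<and> kc L \<tau> a \<beta> \<G> z (wit L (\<tau>, a, \<beta>) \<G> z)"
proof (cases "{y \<in> vs \<G>. kc L \<tau> a \<beta> \<G> z y} = {}")
  case True
  then have "wit L (\<tau>, a, \<beta>) \<G> z = z" by (simp only: wit_def prod.case True pick_empty)
  moreover have "\<forall>y\<in>vs \<G>. \<not> kc L \<tau> a \<beta> \<G> z y" using True by simp
  ultimately show ?thesis by simp
next
  case False
  have "wit L (\<tau>, a, \<beta>) \<G> z \<in> {y \<in> vs \<G>. kc L \<tau> a \<beta> \<G> z y}"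
    unfolding wit_def prod.case by (rule pick_in[OF assms(1) _ False]) auto
  then show ?thesis by blast
qed

lemma vfun_wit: "vfun (wit L i)"
proof (cases i)
  case (fields \<tau> a \<beta>)
  show ?thesis unfolding vfun_def fields using wit_cases[of _ _ L \<tau> a \<beta>] by metis
qed

text \<open>Candidates are defined relative to z but can be tested at y, because z must be
  \<open>a \<G> y\<close>. A longer branch refers to the table of the witness for the shorter one,
  so S grows along the induction.\<close>

lemma lin_wit1:
  assumes S: "lin S" "PT \<subseteq> S" "enc ` set L \<subseteq> S" "\<And>f. f \<in> set L ==> vfun f"
    and a: "enc a \<in> S" "vfun a" and \<beta>: "\<And>b. b \<in> set \<beta> ==> enc b \<in> S \<and> vfun b"
  shows "\<exists>S'. lin S' \<and> S \<subseteq> S' \<and> enc (wit L (\<tau>, a, \<beta>)) \<in> S'"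
proof -
  have pick: "lin (insert (enc (wit L (\<tau>, a, \<beta>))) S')"
    if "lin S'" "S \<subseteq> S'" "pb S' (\<lambda>\<G> y. kc L \<tau> a \<beta> \<G> (a \<G> y) y)" for \<beta> S'
  proof -
    have "lin (insert (enc (\<lambda>\<G> z. pick \<G> {y \<in> vs \<G>. a \<G> y = z \<and> of_bool (kc L \<tau> a \<beta> \<G> (a \<G> y) y) > (0::int)} z)) S')"
      using that a by (intro lin_pick) (auto simp: pb_def vfun_def intro: pw.tab)
    moreover have "{y \<in> vs \<G>. a \<G> y = z \<and> of_bool (kc L \<tau> a \<beta> \<G> (a \<G> y) y) > (0::int)} = {y \<in> vs \<G>. kc L \<tau> a \<beta> \<G> z y}" for \<G> z
      using kc_base by fastforce
    ultimately show ?thesis by (simp add: wit_def)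
  qed
  have "\<exists>S'. lin S' \<and> S \<subseteq> S' \<and> pb S' (\<lambda>\<G> y. kc L \<tau> a \<beta> \<G> (a \<G> y) y)"
    using \<beta>
  proof (induction \<beta>)
    case Nil
    have "pb S (\<lambda>\<G> v. ut L \<G> v = \<tau>)" using S by (intro pb_ut) auto
    then show ?case using S(1) by auto
  next
    case (Cons b \<beta>)
    then obtain S' where S': "lin S'" "S \<subseteq> S'" "pb S' (\<lambda>\<G> y. kc L \<tau> a \<beta> \<G> (a \<G> y) y)" by auto
    let ?w = "wit L (\<tau>, a, \<beta>)" and ?S = "insert (enc (wit L (\<tau>, a, \<beta>))) S'"
    have l: "lin ?S" by (rule pick[OF S'])
    have b: "enc b \<in> ?S" "vfun b" "enc a \<in> ?S" using Cons.prems[of b] S'(2) a by auto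
    have "enc (compose b (compose ?w a)) \<in> pw ?S"
      by (intro pw_compose vfun_compose vfun_wit b a pw.tab) auto
    moreover have "enc b \<in> pw ?S" using b(1) by (rule pw.tab)
    ultimately have "pb ?S (\<lambda>\<G> y. b \<G> y = compose b (compose ?w a) \<G> y)"
      using b(2) a(2) by (intro pb_eq_vfun vfun_compose vfun_wit)
    moreover have "pb ?S (\<lambda>\<G> y. kc L \<tau> a \<beta> \<G> (a \<G> y) y)" using S'(3) unfolding pb_def by (rule pw_mono) auto
    ultimately have "pb ?S (\<lambda>\<G> y. kc L \<tau> a \<beta> \<G> (a \<G> y) y \<and> \<not> b \<G> y = compose b (compose ?w a) \<G> y)"
      by (intro pb_and pb_not)
    then have "pb ?S (\<lambda>\<G> y. kc L \<tau> a (b # \<beta>) \<G> (a \<G> y) y)" by (simp add: compose_def wit_def)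
    then show ?case using l S'(2) by (intro exI[of _ ?S]) auto
  qed
  then obtain S' where S': "lin S'" "S \<subseteq> S'" "pb S' (\<lambda>\<G> y. kc L \<tau> a \<beta> \<G> (a \<G> y) y)" by blast
  from pick[OF S'] S'(2) show ?thesis by blast
qed

lemma lin_wit:
  assumes S: "lin S" "PT \<subseteq> S" "enc ` set L \<subseteq> S" "\<And>f. f \<in> set L ==> vfun f"
    and F: "enc ` set fs \<subseteq> S" "\<And>f. f \<in> set fs ==> vfun f"
    and I: "finite I" "\<And>\<tau> a \<beta>. (\<tau>, a, \<beta>) \<in> I ==> a \<in> set fs \<and> set \<beta> \<subseteq> set fs"
  shows "lin (enc ` wit L ` I \<union> S)"
proof -
  have "\<exists>S'. lin S' \<and> S \<subseteq> S' \<and> enc ` wit L ` I \<subseteq> S'"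
    using I
  proof (induction I rule: finite_induct)
    case empty then show ?case using S(1) by auto
  next
    case (insert i I)
    then obtain S' where S': "lin S'" "S \<subseteq> S'" "enc ` wit L ` I \<subseteq> S'" by blast
    obtain \<tau> a \<beta> where i: "i = (\<tau>, a, \<beta>)" by (cases i) auto
    have ab: "a \<in> set fs" "set \<beta> \<subseteq> set fs" using insert.prems[of \<tau> a \<beta>] i by auto
    have "\<exists>S''. lin S'' \<and> S' \<subseteq> S'' \<and> enc (wit L (\<tau>, a, \<beta>)) \<in> S''"
    proof (rule lin_wit1[OF S'(1)])
      show "PT \<subseteq> S'" using S(2) S'(2) by (rule order_trans)
      show "enc ` set L \<subseteq> S'" using S(3) S'(2) by (rule order_trans)
      have F': "enc f \<in> S'" if "f \<in> set fs" for f using subsetD[OF F(1) imageI[OF that]] S'(2) by (rule rev_subsetD)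
      show "enc a \<in> S'" "vfun a" using ab(1) F' F(2) by simp_all
      show "enc b \<in> S' \<and> vfun b" if "b \<in> set \<beta>" for b using subsetD[OF ab(2) that] F' F(2) by simp
    qed (rule S(4))
    then obtain S'' where "lin S''" "S' \<subseteq> S''" "enc (wit L i) \<in> S''" using i by blast
    then show ?case using S' by (intro exI[of _ S'']) (simp only: image_insert insert_subset, blast)
  qed
  then show ?thesis using lin_mono by (metis Un_least)
qed

text \<open>Starting from the type of \<open>v\<close> and the value of a hub of those functions that map \<open>v\<close> into \<open>Z\<close>, the next
  branch taken is a function that maps the current witness, but not \<open>v\<close>, into \<open>Z\<close>. Each branch rules out
  a new pair of a function and an element of \<open>Z\<close>.\<close>

lemma kernel:
  assumes \<G>: "\<G> \<in> insts" and v: "v \<in> vs \<G>" and fs: "bp \<in> set fs" "\<And>f. f \<in> set fs ==> vfun f"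
    and hub: "hub fs Q" and vQ: "vid \<in> set Q"
    and Z: "finite Z" "Z \<subseteq> vs \<G>" "bp \<G> v \<in> Z" "card Z \<le> s"
  defines "L \<equiv> comps Q fs"
  shows "\<exists>i\<in>wit_index (set L) (set fs) (psig \<sigma>) (length fs * s). \<exists>z\<in>Z. wit L i \<G> z \<in> vs \<G> \<and> ut L \<G> (wit L i \<G> z) = ut L \<G> v \<and>
     (\<forall>f\<in>set fs. \<forall>z'\<in>Z. f \<G> (wit L i \<G> z) = z' \<longleftrightarrow> f \<G> v = z')"
proof -
  define A where "A = {f \<in> set fs. f \<G> v \<in> Z}"
  have "A \<subseteq> set fs" "A \<noteq> {}" using fs(1) Z(3) by (auto simp: A_def)
  then obtain a where a: "a \<in> A" "\<And>f. f \<in> A ==> \<exists>q\<in>set Q. f \<G> v = q \<G> (a \<G> v)"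
    using hub \<G> v unfolding hub_def by metis
  define z where "z = a \<G> v"
  define \<tau> where "\<tau> = ut L \<G> v"
  have z: "z \<in> Z" "z \<in> vs \<G>" and afs: "a \<in> set fs" using a(1) Z(2) by (auto simp: A_def z_def)
  let ?w = "\<lambda>\<beta>. wit L (\<tau>, a, \<beta>) \<G> z"
  \<comment> \<open>One pair for each step of the branch: the function and its value at the witness
    that was discarded.\<close>
  define prs where "prs = rec_list [] (\<lambda>b \<beta> r. (b, b \<G> (?w \<beta>)) # r)"
  have prs: "prs [] = []" "prs (b # \<beta>) = (b, b \<G> (?w \<beta>)) # prs \<beta>" for b \<beta> by (simp_all add: prs_def)
  have lprs: "length (prs \<beta>) = length \<beta>" for \<beta> by (induction \<beta>) (auto simp: prs)
  have avoid: "kc L \<tau> a \<beta> \<G> z y ==> (b, x) \<in> set (prs \<beta>) ==> b \<G> y \<noteq> x" for \<beta> b x y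
    by (induction \<beta>) (auto simp: prs wit_def)
  define good where "good \<beta> \<longleftrightarrow> set \<beta> \<subseteq> set fs \<and> kc L \<tau> a \<beta> \<G> z v \<and> distinct (prs \<beta>) \<and> set (prs \<beta>) \<subseteq> set fs \<times> Z" for \<beta>
  \<comment> \<open>The pairs are distinct elements of \<open>set fs \<times> Z\<close>, which
    bounds the length of a good branch. Hence extending it must come to an end.\<close>
  have glen: "length \<beta> \<le> length fs * s" if "good \<beta>" for \<beta>
  proof -
    have "length \<beta> = card (set (prs \<beta>))" using that lprs by (simp add: good_def distinct_card)
    also have "\<dots> \<le> card (set fs \<times> Z)" using that Z(1) by (intro card_mono) (auto simp: good_def)
    also have "\<dots> \<le> length fs * s" using Z(4) by (auto simp: card_cartesian_product intro: mult_le_mono card_length)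
    finally show ?thesis .
  qed
  have gw: "?w \<beta> \<in> vs \<G> \<and> kc L \<tau> a \<beta> \<G> z (?w \<beta>)" if "good \<beta>" for \<beta>
    using wit_cases[OF \<G> z(2), of L \<tau> a \<beta>] that v by (auto simp: good_def)
  have ext: "good (b # \<beta>)" if g: "good \<beta>" and b: "b \<in> set fs" "b \<notin> A" "b \<G> (?w \<beta>) \<in> Z" for b \<beta>
  proof -
    have "b \<G> v \<notin> Z" using b by (auto simp: A_def)
    then have "b \<G> v \<noteq> b \<G> (?w \<beta>)" using b(3) by metis
    then have "kc L \<tau> a (b # \<beta>) \<G> z v" using g by (simp add: good_def wit_def)
    \<comment> \<open>The current witness is itself a candidate for the branch and avoids all
      earlier pairs, so the pair that it produces is new.\<close>
    moreover have "(b, b \<G> (?w \<beta>)) \<notin> set (prs \<beta>)" using avoid gw[OF g] by blast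
    ultimately show ?thesis using g b by (auto simp: good_def prs)
  qed
  have "\<exists>\<beta>. good \<beta> \<and> (\<forall>b\<in>set fs - A. b \<G> (?w \<beta>) \<notin> Z)"
  proof (rule ccontr)
    assume n: "\<not> ?thesis"
    have "\<exists>\<beta>. good \<beta> \<and> length \<beta> = k" for k
    proof (induction k)
      case 0
      have "good []" by (simp add: good_def prs z_def \<tau>_def)
      then show ?case by blast
    next
      case (Suc k)
      then obtain \<beta> where \<beta>: "good \<beta>" "length \<beta> = k" by blast
      then obtain b where "b \<in> set fs" "b \<notin> A" "b \<G> (?w \<beta>) \<in> Z" using n by blast
      then have "good (b # \<beta>)" by (rule ext[OF \<beta>(1)])
      then show ?case using \<beta>(2) by (intro exI[of _ "b # \<beta>"]) simp
    qed
    from this[of "Suc (length fs * s)"] glen show False by fastforce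
  qed
  then obtain \<beta> where \<beta>: "good \<beta>" "\<And>b. b \<in> set fs ==> b \<notin> A ==> b \<G> (?w \<beta>) \<notin> Z" by blast
  note w = gw[OF \<beta>(1)]
  have aw: "a \<G> (?w \<beta>) = z" "ut L \<G> (?w \<beta>) = \<tau>" using kc_base[of L \<tau> a \<beta> \<G> z "?w \<beta>"] w by blast+
  \<comment> \<open>Functions mapping v into Z take the same values at the witness, since the type
    expresses them through the hub and the hub values agree. The other functions take values outside
    Z at both elements.\<close>
  have pat: "f \<G> (?w \<beta>) = z' \<longleftrightarrow> f \<G> v = z'" if f: "f \<in> set fs" and z': "z' \<in> Z" for f z'
  proof (cases "f \<in> A")
    case True
    obtain q where q: "q \<in> set Q" "f \<G> v = q \<G> (a \<G> v)" using a(2)[OF True] by blast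
    have fL: "f \<in> set L" using comps_subset2[OF vQ, of fs] f by (auto simp: L_def)
    have qL: "compose q a \<in> set L" using q(1) afs by (auto simp: L_def set_comps)
    have "(f, compose q a) \<in> fst \<tau>" using q(2) fL qL by (simp add: \<tau>_def ut_def compose_def)
    then have "(f, compose q a) \<in> fst (ut L \<G> (?w \<beta>))" by (simp only: aw(2))
    then have "f \<G> (?w \<beta>) = q \<G> (a \<G> (?w \<beta>))" by (simp add: ut_def compose_def)
    then show ?thesis using aw(1) q(2) by (simp add: z_def)
  next
    case False
    then have "f \<G> v \<notin> Z" using f by (simp add: A_def)
    then show ?thesis using \<beta>(2)[OF f False] z' by auto
  qed
  have "(\<tau>, a, \<beta>) \<in> wit_index (set L) (set fs) (psig \<sigma>) (length fs * s)"
    unfolding wit_index_def using afs \<beta>(1) glen[OF \<beta>(1)] by (auto simp: good_def \<tau>_def ut_def)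
  then show ?thesis using z(1) w aw(2) pat by (intro bexI[of _ "(\<tau>, a, \<beta>)"] bexI[of _ z]) (auto simp: \<tau>_def)
qed

lemma quant_mono: "quant fs X R ==> X \<le> Y ==> r \<le> R ==> quant fs Y r"
  unfolding quant_def using grad_le_mono by (meson order_trans)

text \<open>In the application Z consists of the values of the family at the free variables, which
  explains the bound \<open>X * X\<close> on s. The element v is replaced by \<open>w \<G> z\<close>
  with the same type and the same coincidences with Z; as z is some \<open>g \<G> u\<close> for the
  value u of a free variable, \<open>f \<G> (w \<G> z)\<close> is the value of
  \<open>compose f (compose w g)\<close> at u.\<close>

theorem eliminate:
  assumes fam: "fam fs" and q: "quant fs X (8 * R + 7)" and X: "8 * R + 7 \<le> X" "card (psig \<sigma>) \<le> X" and s: "s \<le> X * X"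
  shows "\<exists>fs' W. fam fs' \<and> set fs \<subseteq> set fs' \<and> quant fs' (elim_size X) R \<and> (\<forall>w\<in>W. vfun w) \<and>
     (\<forall>f\<in>set fs. \<forall>g\<in>set fs. \<forall>w\<in>W. compose f (compose w g) \<in> set fs') \<and>
     (\<forall>\<G>\<in>insts. \<forall>v\<in>vs \<G>. \<forall>Z\<subseteq>vs \<G>. bp \<G> v \<in> Z --> card Z \<le> s -->
       (\<exists>w\<in>W. \<exists>z\<in>Z. w \<G> z \<in> vs \<G> \<and> ut fs \<G> (w \<G> z) = ut fs \<G> v \<and>
         (\<forall>f\<in>set fs. \<forall>z'\<in>Z. f \<G> (w \<G> z) = z' \<longleftrightarrow> f \<G> v = z')))"
proof -
  have v: "vid \<in> set fs" "bp \<in> set fs" "\<And>f. f \<in> set fs ==> vfun f" using fam by (auto simp: fam_def)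
  have q1: "quant fs X 1" using q by (rule quant_mono) auto
  obtain hs where hs: "length hs = hs_size X" "lin (enc ` set hs \<union> (PT \<union> enc ` set fs))" "\<And>h. h \<in> set hs ==> vfun h"
     "\<And>\<G> h v. \<G> \<in> insts ==> h \<in> set hs ==> v \<in> vs \<G> ==> h \<G> v = v \<or> near fs \<G> (h \<G> v) v"
     "hub fs (comps (vid # hs) (vid # hs))" using hub_exists[OF fam q1] unfolding hs_size_def by metis
  define Q where "Q = comps (vid # hs) (vid # hs)"
  define L where "L = comps Q fs"
  have vv: "vfun vid" using v by blast
  have vQ: "vid \<in> set Q" using comps_subset1[of "vid # hs" "vid # hs"] by (auto simp: Q_def)
  have Qv: "vfun f" if "f \<in> set Q" for f using that hs(3) vv by (auto simp: Q_def set_comps intro: vfun_compose)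
  have Lv: "vfun f" if "f \<in> set L" for f using that Qv v(3) by (auto simp: L_def set_comps intro: vfun_compose)
  have fsL: "set fs \<subseteq> set L" using comps_subset2[OF vQ] by (simp add: L_def)
  have l1: "lin (PT \<union> enc ` set (vid # hs) \<union> (enc ` set fs))"
    using hs(2) by (rule lin_mono) (use v in auto)
  then have l2: "lin (enc ` set Q \<union> (PT \<union> enc ` set (vid # hs) \<union> (enc ` set fs)))"
    unfolding Q_def by (rule lin_comps) (use hs(3) vv in auto)
  then have "lin (PT \<union> enc ` set Q \<union> (enc ` set (vid # hs) \<union> enc ` set fs))" by (rule lin_mono) auto
  then have l3: "lin (enc ` set L \<union> (PT \<union> enc ` set Q \<union> (enc ` set (vid # hs) \<union> enc ` set fs)))"
    unfolding L_def by (rule lin_comps) (use Qv v in auto)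
  define I where "I = wit_index (set L) (set fs) (psig \<sigma>) (length fs * s)"
  have lenfs: "length fs \<le> X" using q by (simp add: quant_def)
  have "length Q = (hs_size X + 1) * (hs_size X + 1)" using hs(1) by (simp add: Q_def length_comps)
  then have "length L \<le> types_size X" using mult_le_mono2[OF lenfs] by (simp only: L_def length_comps types_size_def)
  then have cL: "card (set L) \<le> types_size X" using card_length order_trans by blast
  have X0: "X > 0" using X(1) by simp
  have cF: "card (set fs) \<le> X" using card_length lenfs order_trans by blast
  have I: "finite I" "card I \<le> 2 ^ (types_size X * types_size X) * 2 ^ (types_size X * X) *
      (X * ((length fs * s + 1) * X ^ (length fs * s)))"
    unfolding I_def using card_wit_index[OF _ _ finite_psig cL cF X(2) X0] by auto
  have ns: "length fs * s \<le> X * (X * X)" using lenfs s by (rule mult_le_mono)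
  have "(length fs * s + 1) * X ^ (length fs * s) \<le> (X * (X * X) + 1) * X ^ (X * (X * X))"
    by (rule mult_le_mono[OF _ power_increasing[OF ns]]) (use ns X0 in auto)
  then have cI: "card I \<le> wit_size X" using I(2) unfolding wit_size_def by (meson le_trans mult_le_mono2)
  have IF: "a \<in> set fs \<and> set \<beta> \<subseteq> set fs" if "(\<tau>, a, \<beta>) \<in> I" for \<tau> a \<beta> using that by (auto simp: I_def wit_index_def)
  have l4: "lin (enc ` wit L ` I \<union> (enc ` set L \<union> (PT \<union> enc ` set Q \<union> (enc ` set (vid # hs) \<union> enc ` set fs))))"
    by (rule lin_wit[OF l3 _ _ Lv _ v(3) I(1) IF]) auto
  obtain ws where ws: "set ws = wit L ` I" "length ws \<le> wit_size X"
  proof -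
    have "\<exists>ws. set ws = wit L ` I \<and> distinct ws" by (intro finite_distinct_list finite_imageI I(1))
    then obtain ws where "set ws = wit L ` I" "distinct ws" by (elim exE conjE)
    then show ?thesis using that[of ws] distinct_card[of ws] card_image_le[OF I(1), of "wit L"] cI by simp
  qed
  define fs1 where "fs1 = fs @ hs @ ws"
  have f1: "vid \<in> set fs1" "bp \<in> set fs1" using v by (auto simp: fs1_def)
  have f2: "vfun f" if "f \<in> set fs1" for f using that v(3) hs(3) vfun_wit ws(1) by (auto simp: fs1_def)
  have f3: "lin (PT \<union> enc ` set fs1)" using l4 by (rule lin_mono) (use ws(1) in \<open>auto simp: fs1_def\<close>)
  have f4: "f \<G> y = y \<or> near fs \<G> (f \<G> y) y \<or> near fs \<G> y (f \<G> y)" if a: "\<G> \<in> insts" "f \<in> set fs1" "y \<in> vs \<G>" for \<G> f y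
  proof -
    consider "f \<in> set fs" | "f \<in> set hs" | "f \<in> wit L ` I" using a(2) ws(1) by (auto simp: fs1_def)
    then show ?thesis
    proof cases
      case 1
      then have "near fs \<G> (f \<G> y) y" unfolding near_def using a(3) by blast
      then show ?thesis by simp
    next
      case 2 then show ?thesis using hs(4)[OF a(1) _ a(3)] by blast
    next
      case 3
      then obtain \<tau> b \<beta> where i: "(\<tau>, b, \<beta>) \<in> I" "f = wit L (\<tau>, b, \<beta>)" by auto
      \<comment> \<open>The hub function b maps a witness back to y, so the new arc reverses an arc
        of the old family.\<close>
      from wit_cases[OF a(1,3), of L \<tau> b \<beta>, folded i(2)] show ?thesis
      proof
        assume k: "f \<G> y \<in> vs \<G> \<and> kc L \<tau> b \<beta> \<G> y (f \<G> y)"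
        then have "b \<G> (f \<G> y) = y" using kc_base by blast
        then have "near fs \<G> y (f \<G> y)" unfolding near_def using k IF[OF i(1)] by blast
        then show ?thesis by simp
      qed simp
    qed
  qed
  have len1: "length fs1 \<le> X + hs_size X + wit_size X" using lenfs hs(1) ws(2) by (simp add: fs1_def)
  \<comment> \<open>The three augmentations are the addition of orientation and witness functions
    and two closures under composition, which suffice for threefold compositions.\<close>
  have "8 * R + 7 = 2 * (4 * R + 3) + 1" by simp
  then have q': "quant fs X (2 * (4 * R + 3) + 1)" using q by metis
  have fam1: "fam fs1" by (rule fam_aug(1)[OF fam]) (fact f1 f2 f3 f4)+
  have "quant fs1 (augm X (4 * R + 3) X + (X + hs_size X + wit_size X)) (4 * R + 3)"
    by (rule fam_aug(2)[OF fam]) (fact f1 f2 f3 f4 q' len1)+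
  then have "quant fs1 (elim1 X) (4 * R + 3)"
    by (rule quant_mono) (use X in \<open>auto simp: elim1_def intro: augm_mono\<close>)
  moreover have "4 * R + 3 = 2 * (2 * R + 1) + 1" by simp
  ultimately have "quant fs1 (elim1 X) (2 * (2 * R + 1) + 1)" by metis
  note fam2 = fam_comps(1)[OF fam1] and q2 = fam_comps(2)[OF fam1 this]
  have "quant (comps fs1 fs1) (elim2 X) (2 * R + 1)"
    using q2 by (rule quant_mono) (use X in \<open>auto simp: elim2_def intro: augm_mono\<close>)
  note fam3 = fam_comps(1)[OF fam2] and q3 = fam_comps(2)[OF fam2 this]
  let ?fs = "comps (comps fs1 fs1) (comps fs1 fs1)"
  have q4: "quant ?fs (elim_size X) R"
    using q3 by (rule quant_mono) (use X in \<open>auto simp: elim_size_def intro: augm_mono\<close>)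
  have sub1: "set fs1 \<subseteq> set (comps fs1 fs1)" by (rule comps_subset1[OF f1(1)])
  have sub2: "set (comps fs1 fs1) \<subseteq> set ?fs" using comps_subset1 sub1 f1(1) by blast
  have c: "compose f (compose w g) \<in> set ?fs" if "f \<in> set fs" "g \<in> set fs" "w \<in> wit L ` I" for f w g
  proof -
    have "f \<in> set (comps fs1 fs1)" using sub1 that(1) by (auto simp: fs1_def)
    moreover have "w \<in> set fs1" "g \<in> set fs1" using that ws(1) by (auto simp: fs1_def)
    then have "compose w g \<in> set (comps fs1 fs1)" by (auto simp: set_comps)
    ultimately show ?thesis unfolding set_comps[of "comps fs1 fs1"] by blast
  qed
  have k: "\<exists>w\<in>wit L ` I. \<exists>z\<in>Z. w \<G> z \<in> vs \<G> \<and> ut fs \<G> (w \<G> z) = ut fs \<G> y \<and>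
         (\<forall>f\<in>set fs. \<forall>z'\<in>Z. f \<G> (w \<G> z) = z' \<longleftrightarrow> f \<G> y = z')"
    if a: "\<G> \<in> insts" "y \<in> vs \<G>" "Z \<subseteq> vs \<G>" "bp \<G> y \<in> Z" "card Z \<le> s" for \<G> y Z
  proof -
    have "finite Z" using finite_subset[OF a(3) insts(1)[OF a(1)]] .
    from kernel[OF a(1,2) v(2,3) hs(5)[folded Q_def] vQ this a(3-5)] obtain i z where
      iz: "i \<in> I" "z \<in> Z" "wit L i \<G> z \<in> vs \<G>" "ut L \<G> (wit L i \<G> z) = ut L \<G> y"
      "\<forall>f\<in>set fs. \<forall>z'\<in>Z. f \<G> (wit L i \<G> z) = z' \<longleftrightarrow> f \<G> y = z'" unfolding L_def I_def by blast
    have "ut fs \<G> x = (fst (ut L \<G> x) \<inter> set fs \<times> set fs, snd (ut L \<G> x) \<inter> set fs \<times> psig \<sigma>)" for x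
      using fsL by (auto simp: ut_def)
    then have "ut fs \<G> (wit L i \<G> z) = ut fs \<G> y" using iz(4) by simp
    then show ?thesis using iz by blast
  qed
  show ?thesis
    by (rule exI[of _ ?fs], rule exI[of _ "wit L ` I"])
      (use fam3 q4 sub1 sub2 c k vfun_wit in \<open>auto simp: fs1_def\<close>)
qed

end

section \<open>Syntactic measures bounded by Goedel numbers\<close>

lemma radius_Suc: "radius (Suc k) = 8 * radius k + 7" by (simp add: radius_def)

lemma radius_mono: "j \<le> k ==> radius j \<le> radius k"
  by (induction rule: dec_induct) (auto simp: radius_Suc)

primrec quantifiers :: "form => nat" where
  "quantifiers (Eq s t) = 0"
| "quantifiers (Pred p t) = 0"
| "quantifiers (Neg \<phi>) = quantifiers \<phi>"
| "quantifiers (And \<phi> \<psi>) = quantifiers \<phi> + quantifiers \<psi>"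
| "quantifiers (Ex x \<phi>) = Suc (quantifiers \<phi>)"

primrec terms :: "form => trm set" where
  "terms (Eq s t) = {s, t}"
| "terms (Pred p t) = {t}"
| "terms (Neg \<phi>) = terms \<phi>"
| "terms (And \<phi> \<psi>) = terms \<phi> \<union> terms \<psi>"
| "terms (Ex x \<phi>) = terms \<phi>"

primrec depth :: "trm => nat" where
  "depth (Var x) = 0"
| "depth (App f t) = Suc (depth t)"

lemma add_le_prod_encode: "a + b \<le> prod_encode (a, b)"
proof -
  have "n \<le> triangle n" for n by (induction n) auto
  from this[of "a + b"] show ?thesis by (simp add: prod_encode_def)
qed

lemma quantifiers_le_code: "quantifiers \<phi> \<le> form_code \<phi>"
proof (induction \<phi>)
  case (Neg \<phi>) then show ?case using le_prod_encode_2[of "form_code \<phi>" 2] by simp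
next
  case (And \<phi> \<psi>)
  from add_le_prod_encode[of "form_code \<phi>" "form_code \<psi>"] And show ?case
    using le_prod_encode_2[of "prod_encode (form_code \<phi>, form_code \<psi>)" 3] by simp
next
  case (Ex x \<phi>)
  from add_le_prod_encode[of 4 "prod_encode (x, form_code \<phi>)"] Ex show ?case
    using le_prod_encode_2[of "form_code \<phi>" x] by simp
qed auto

lemma depth_le_code: "depth t \<le> trm_code t"
proof (induction t)
  case (App f t)
  from add_le_prod_encode[of 1 "prod_encode (f, trm_code t)"] App show ?case
    using le_prod_encode_2[of "trm_code t" f] by simp
qed auto

lemma terms_le_code: "t \<in> terms \<phi> ==> trm_code t \<le> form_code \<phi>"
proof (induction \<phi>)
  case (Eq s r)
  have "trm_code s \<le> form_code (Eq s r)" "trm_code r \<le> form_code (Eq s r)"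
    using le_prod_encode_1[of "trm_code s" "trm_code r"] le_prod_encode_2[of "trm_code r" "trm_code s"]
      le_prod_encode_2[of "prod_encode (trm_code s, trm_code r)" 0] by simp_all
  then show ?case using Eq by auto
next
  case (Pred p t)
  then show ?case using le_prod_encode_2 order_trans by (metis form_code.simps(2) singletonD terms.simps(2))
next
  case (Neg \<phi>) then show ?case using le_prod_encode_2[of "form_code \<phi>" 2] by simp
next
  case (And \<phi> \<psi>)
  have "form_code \<phi> \<le> form_code (And \<phi> \<psi>)" "form_code \<psi> \<le> form_code (And \<phi> \<psi>)"
    using le_prod_encode_1[of "form_code \<phi>" "form_code \<psi>"] le_prod_encode_2[of "form_code \<psi>" "form_code \<phi>"]
      le_prod_encode_2[of "prod_encode (form_code \<phi>, form_code \<psi>)" 3] by simp_all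
  then show ?case using And by fastforce
next
  case (Ex x \<phi>)
  then show ?case using le_prod_encode_2[of "form_code \<phi>" x]
      le_prod_encode_2[of "prod_encode (x, form_code \<phi>)" 4] by simp
qed

section \<open>Truth determined by atomic patterns\<close>

context structure_class
begin

definition same :: "'v vfn list => nat set => 'v inst => (nat => 'v) => 'v inst => (nat => 'v) => bool" where
  "same fs X \<G> \<beta> \<G>' \<beta>' \<longleftrightarrow>
    (\<forall>x\<in>X. \<forall>y\<in>X. \<forall>f\<in>set fs. \<forall>g\<in>set fs. (f \<G> (\<beta> x) = g \<G> (\<beta> y)) = (f \<G>' (\<beta>' x) = g \<G>' (\<beta>' y))) \<and>
    (\<forall>x\<in>X. \<forall>f\<in>set fs. \<forall>p\<in>psig \<sigma>. (f \<G> (\<beta> x) \<in> pint (fst \<G>) p) = (f \<G>' (\<beta>' x) \<in> pint (fst \<G>') p))"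

lemma same_sym: "same fs X \<G> \<beta> \<G>' \<beta>' ==> same fs X \<G>' \<beta>' \<G> \<beta>"
  unfolding same_def by blast

lemma same_trans: "same fs X \<G> \<beta> \<G>' \<beta>' ==> same fs X \<G>' \<beta>' \<kappa> \<gamma> ==> same fs X \<G> \<beta> \<kappa> \<gamma>"
  unfolding same_def by simp

lemma same_eq:
  "same fs X \<G> \<beta> \<G>' \<beta>' ==> x \<in> X ==> y \<in> X ==> f \<in> set fs ==> g \<in> set fs ==>
    (f \<G> (\<beta> x) = g \<G> (\<beta> y)) = (f \<G>' (\<beta>' x) = g \<G>' (\<beta>' y))"
  unfolding same_def by blast

lemma same_pred:
  "same fs X \<G> \<beta> \<G>' \<beta>' ==> x \<in> X ==> f \<in> set fs ==> p \<in> psig \<sigma> ==>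
    (f \<G> (\<beta> x) \<in> pint (fst \<G>) p) = (f \<G>' (\<beta>' x) \<in> pint (fst \<G>') p)"
  unfolding same_def by blast

text \<open>Substitution of terms: if each value under \<gamma> and \<gamma>' is given by one and
  the same function and variable under \<beta> and \<beta>', atoms about the former become atoms
  about the latter.\<close>

lemma same_subst:
  assumes s: "same fs' X' \<G> \<beta> \<G>' \<beta>'"
    and r: "\<And>x f. x \<in> X ==> f \<in> set fs ==>
      \<exists>y\<in>X'. \<exists>g\<in>set fs'. f \<G> (\<gamma> x) = g \<G> (\<beta> y) \<and> f \<G>' (\<gamma>' x) = g \<G>' (\<beta>' y)"
  shows "same fs X \<G> \<gamma> \<G>' \<gamma>'"
proof -
  obtain h k where hk: "\<And>x f. x \<in> X ==> f \<in> set fs ==> h x f \<in> X' \<and> k x f \<in> set fs' \<and>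
      f \<G> (\<gamma> x) = k x f \<G> (\<beta> (h x f)) \<and> f \<G>' (\<gamma>' x) = k x f \<G>' (\<beta>' (h x f))"
    using r by metis
  show ?thesis unfolding same_def
  proof (intro conjI ballI)
    fix x y f g assume "x \<in> X" "y \<in> X" "f \<in> set fs" "g \<in> set fs"
    then show "(f \<G> (\<gamma> x) = g \<G> (\<gamma> y)) = (f \<G>' (\<gamma>' x) = g \<G>' (\<gamma>' y))"
      using hk[of x f] hk[of y g] same_eq[OF s, of "h x f" "h y g" "k x f" "k y g"] by simp
  next
    fix x f p assume "x \<in> X" "f \<in> set fs" "p \<in> psig \<sigma>"
    then show "(f \<G> (\<gamma> x) \<in> pint (fst \<G>) p) = (f \<G>' (\<gamma>' x) \<in> pint (fst \<G>') p)"
      using hk[of x f] same_pred[OF s, of "h x f" "k x f" p] by simp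
  qed
qed

lemma same_mono: "same fs' X' \<G> \<beta> \<G>' \<beta>' ==> set fs \<subseteq> set fs' ==> X \<subseteq> X' ==> same fs X \<G> \<beta> \<G>' \<beta>'"
  by (erule same_subst) blast

text \<open>Semantic substitute for equivalence to a quantifier-free formula. No formula is
  constructed, and uniformity over the class is built in, because the two assignments may live in
  different structures.\<close>

definition qf :: "'v vfn list => nat set => ('v inst => (nat => 'v) => bool) => bool" where
  "qf fs X P \<longleftrightarrow> (\<forall>\<G>\<in>insts. \<forall>\<G>'\<in>insts. \<forall>\<beta> \<beta>'. \<beta> ` X \<subseteq> vs \<G> --> \<beta>' ` X \<subseteq> vs \<G>' -->
     same fs X \<G> \<beta> \<G>' \<beta>' --> P \<G> \<beta> = P \<G>' \<beta>')"

lemma qf_mono: "qf fs X P ==> set fs \<subseteq> set fs' ==> qf fs' X P"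
proof -
  assume "qf fs X P" "set fs \<subseteq> set fs'"
  moreover have "same fs X \<G> \<beta> \<G>' \<beta>'" if "same fs' X \<G> \<beta> \<G>' \<beta>'" for \<G> \<G>' \<beta> \<beta>'
    using that calculation(2) by (rule same_mono) simp
  ultimately show "qf fs' X P" unfolding qf_def by simp
qed

definition rterm :: "'v vfn list => trm => bool" where
  "rterm fs t \<longleftrightarrow> (\<exists>f\<in>set fs. \<forall>\<G>\<in>insts. \<forall>\<beta>. \<beta> (trm_var t) \<in> vs \<G> --> trm_val (fst \<G>) \<beta> t = f \<G> (\<beta> (trm_var t)))"

lemma rterm_mono: "rterm fs t ==> set fs \<subseteq> set fs' ==> rterm fs' t"
  unfolding rterm_def by blast

lemma qf_Eq:
  assumes "rterm fs s" "rterm fs t" "trm_var s \<in> X" "trm_var t \<in> X"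
  shows "qf fs X (\<lambda>\<G> \<beta>. sat (fst \<G>) \<beta> (Eq s t))"
proof -
  obtain f where f: "f \<in> set fs" "\<And>\<G> \<beta>. \<G> \<in> insts ==> \<beta> (trm_var s) \<in> vs \<G> ==> trm_val (fst \<G>) \<beta> s = f \<G> (\<beta> (trm_var s))"
    using assms(1) unfolding rterm_def by blast
  obtain g where g: "g \<in> set fs" "\<And>\<G> \<beta>. \<G> \<in> insts ==> \<beta> (trm_var t) \<in> vs \<G> ==> trm_val (fst \<G>) \<beta> t = g \<G> (\<beta> (trm_var t))"
    using assms(2) unfolding rterm_def by blast
  have "sat (fst \<G>) \<beta> (Eq s t) \<longleftrightarrow> f \<G> (\<beta> (trm_var s)) = g \<G> (\<beta> (trm_var t))" if "\<G> \<in> insts" "\<beta> ` X \<subseteq> vs \<G>" for \<G> \<beta>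
    using f(2)[OF that(1), of \<beta>] g(2)[OF that(1), of \<beta>] subsetD[OF that(2) imageI[OF assms(3)]]
      subsetD[OF that(2) imageI[OF assms(4)]] by simp
  then show ?thesis unfolding qf_def using same_eq[OF _ assms(3,4) f(1) g(1)] by simp
qed

lemma qf_Pred:
  assumes "rterm fs t" "trm_var t \<in> X" "p \<in> psig \<sigma>"
  shows "qf fs X (\<lambda>\<G> \<beta>. sat (fst \<G>) \<beta> (Pred p t))"
proof -
  obtain g where g: "g \<in> set fs" "\<And>\<G> \<beta>. \<G> \<in> insts ==> \<beta> (trm_var t) \<in> vs \<G> ==> trm_val (fst \<G>) \<beta> t = g \<G> (\<beta> (trm_var t))"
    using assms(1) unfolding rterm_def by blast
  have "sat (fst \<G>) \<beta> (Pred p t) \<longleftrightarrow> g \<G> (\<beta> (trm_var t)) \<in> pint (fst \<G>) p" if "\<G> \<in> insts" "\<beta> ` X \<subseteq> vs \<G>" for \<G> \<beta>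
    using g(2)[OF that(1), of \<beta>] that(2) assms(2) by auto
  then show ?thesis unfolding qf_def using same_pred[OF _ assms(2) g(1) assms(3)] by simp
qed

text \<open>The element v is exchanged for some u of the same structure that satisfies the same
  atoms over \<open>fs\<close> and is the value of a function of the larger family. The same
  composition of functions, evaluated in the other structure, yields the required element
  there.\<close>

lemma eliminate_transfer:
  assumes sub: "set fs \<subseteq> set fs'" and fsv: "\<And>f. f \<in> set fs ==> vfun f" and W: "\<And>w. w \<in> W ==> vfun w"
    and comp: "\<And>f g w. f \<in> set fs ==> g \<in> set fs ==> w \<in> W ==> compose f (compose w g) \<in> set fs'"
    and ker: "\<And>\<G> v Z. \<G> \<in> insts ==> v \<in> vs \<G> ==> Z \<subseteq> vs \<G> ==> bp \<G> v \<in> Z ==> card Z \<le> card X * length fs ==>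
       \<exists>w\<in>W. \<exists>z\<in>Z. w \<G> z \<in> vs \<G> \<and> ut fs \<G> (w \<G> z) = ut fs \<G> v \<and> (\<forall>f\<in>set fs. \<forall>z'\<in>Z. f \<G> (w \<G> z) = z' \<longleftrightarrow> f \<G> v = z')"
    and bp: "bp \<in> set fs" and X: "finite X" "x0 \<in> X"
    and P: "qf fs (insert y X) P"
    and s: "same fs' X \<G> \<beta> \<G>' \<beta>'" and \<G>: "\<G> \<in> insts" "\<G>' \<in> insts" "\<beta> ` X \<subseteq> vs \<G>" "\<beta>' ` X \<subseteq> vs \<G>'"
    and v: "v \<in> vs \<G>" "P \<G> (\<beta>(y := v))"
  shows "\<exists>v\<in>vs \<G>'. P \<G>' (\<beta>'(y := v))"
proof -
  define Z where "Z = (\<lambda>(x, f). f \<G> (\<beta> x)) ` (X \<times> set fs)"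
  have Zin: "f \<G> (\<beta> x) \<in> Z" if "x \<in> X" "f \<in> set fs" for f x using that by (force simp: Z_def)
  have "f \<G> (\<beta> x) \<in> vs \<G>" if "x \<in> X" "f \<in> set fs" for f x
    using \<G>(3) that(1) by (intro vfunD[OF fsv[OF that(2)] \<G>(1)]) blast
  then have Zv: "Z \<subseteq> vs \<G>" by (auto simp: Z_def)
  have "bp \<G> v = bp \<G> (\<beta> x0)" by (simp add: bp_def)
  then have Zb: "bp \<G> v \<in> Z" using Zin[OF X(2) bp] by simp
  have "card Z \<le> card (X \<times> set fs)" unfolding Z_def using X(1) by (intro card_image_le) simp
  also have "\<dots> \<le> card X * length fs" by (simp add: card_cartesian_product card_length)
  finally have Zc: "card Z \<le> card X * length fs" .
  from ker[OF \<G>(1) v(1) Zv Zb Zc] obtain w z where w: "w \<in> W" "z \<in> Z" "w \<G> z \<in> vs \<G>" "ut fs \<G> (w \<G> z) = ut fs \<G> v"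
    "\<And>f z'. f \<in> set fs ==> z' \<in> Z ==> f \<G> (w \<G> z) = z' \<longleftrightarrow> f \<G> v = z'" by blast
  from w(2) obtain x g where xg: "x \<in> X" "g \<in> set fs" "z = g \<G> (\<beta> x)" by (auto simp: Z_def)
  define u where "u = w \<G> z"
  define u' where "u' = w \<G>' (g \<G>' (\<beta>' x))"
  have u': "u' \<in> vs \<G>'" unfolding u'_def
    by (intro vfunD[OF W[OF w(1)] \<G>(2)] vfunD[OF fsv[OF xg(2)] \<G>(2)]) (use \<G>(4) xg(1) in blast)
  have ut: "(f \<G> u = g \<G> u) = (f \<G> v = g \<G> v)" if "f \<in> set fs" "g \<in> set fs" for f g
    using arg_cong[OF w(4), of "\<lambda>p. (f, g) \<in> fst p"] that by (simp add: ut_def u_def)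
  have utp: "(f \<G> u \<in> pint (fst \<G>) p) = (f \<G> v \<in> pint (fst \<G>) p)" if "f \<in> set fs" "p \<in> psig \<sigma>" for f p
    using arg_cong[OF w(4), of "\<lambda>q. (f, p) \<in> snd q"] that by (simp add: ut_def u_def)
  have pat: "(f \<G> u = h \<G> (\<beta> a)) = (f \<G> v = h \<G> (\<beta> a))" if "f \<in> set fs" "h \<in> set fs" "a \<in> X" for f h a
    using w(5)[OF that(1) Zin[OF that(3,2)]] by (simp add: u_def)
  have pat': "(h \<G> (\<beta> a) = f \<G> u) = (h \<G> (\<beta> a) = f \<G> v)" if "f \<in> set fs" "h \<in> set fs" "a \<in> X" for f h a
    using pat[OF that] by (simp add: eq_commute)
  have "same fs (insert y X) \<G> (\<beta>(y := v)) \<G> (\<beta>(y := u))"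
    unfolding same_def
  proof (intro conjI ballI)
    fix a b f h assume "a \<in> insert y X" "b \<in> insert y X" "f \<in> set fs" "h \<in> set fs"
    then show "(f \<G> ((\<beta>(y := v)) a) = h \<G> ((\<beta>(y := v)) b)) = (f \<G> ((\<beta>(y := u)) a) = h \<G> ((\<beta>(y := u)) b))"
      using ut[of f h] pat[of f h b] pat'[of h f a] by (cases "a = y"; cases "b = y") auto
  next
    fix a f p assume "a \<in> insert y X" "f \<in> set fs" "p \<in> psig \<sigma>"
    then show "(f \<G> ((\<beta>(y := v)) a) \<in> pint (fst \<G>) p) = (f \<G> ((\<beta>(y := u)) a) \<in> pint (fst \<G>) p)"
      using utp[of f p] by (cases "a = y") auto
  qed
  moreover have "same fs (insert y X) \<G> (\<beta>(y := u)) \<G>' (\<beta>'(y := u'))"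
  proof (rule same_subst[OF s])
    fix a f assume a: "a \<in> insert y X" "f \<in> set fs"
    show "\<exists>b\<in>X. \<exists>h\<in>set fs'. f \<G> ((\<beta>(y := u)) a) = h \<G> (\<beta> b) \<and> f \<G>' ((\<beta>'(y := u')) a) = h \<G>' (\<beta>' b)"
    proof (cases "a = y")
      case True
      then show ?thesis using comp[OF a(2) xg(2) w(1)] xg(1,3)
        by (intro bexI[of _ x] bexI[of _ "compose f (compose w g)"]) (auto simp: compose_def u_def u'_def)
    next
      case False
      then show ?thesis using a sub by (intro bexI[of _ a] bexI[of _ f]) auto
    qed
  qed
  ultimately have "same fs (insert y X) \<G> (\<beta>(y := v)) \<G>' (\<beta>'(y := u'))" by (rule same_trans)
  moreover have "(\<beta>(y := v)) ` insert y X \<subseteq> vs \<G>" using \<G>(3) v(1) by auto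
  moreover have "(\<beta>'(y := u')) ` insert y X \<subseteq> vs \<G>'" using \<G>(4) u' by auto
  ultimately have "P \<G>' (\<beta>'(y := u'))" using P \<G>(1,2) v(2) unfolding qf_def by metis
  then show ?thesis using u' by blast
qed

text \<open>The second conjunct starts from the family made for the first, so ranks and tower
  heights add up over all quantifiers of the formula; j is the budget of rounds left afterwards. The
  bound on \<open>card X + quantifiers \<phi>\<close> survives the step that moves a bound variable
  into X.\<close>

lemma quantifier_elimination:
  assumes c: "\<And>X. elim_size X \<le> tower c X"
  shows "fam fs ==> quant fs Y (radius (j + quantifiers \<phi>)) ==> radius (j + quantifiers \<phi>) \<le> Y ==> card (psig \<sigma>) \<le> Y ==>
     has_signature \<sigma> \<phi> ==> (\<forall>t\<in>terms \<phi>. rterm fs t) ==> finite X ==> X \<noteq> {} ==> free_vars \<phi> \<subseteq> X ==>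
     card X + quantifiers \<phi> \<le> Y ==>
     \<exists>fs'. fam fs' \<and> set fs \<subseteq> set fs' \<and> quant fs' (tower (c * quantifiers \<phi>) Y) (radius j) \<and>
       qf fs' X (\<lambda>\<G> \<beta>. sat (fst \<G>) \<beta> \<phi>)"
proof (induction \<phi> arbitrary: fs Y j X)
  case (Eq s t)
  then have "qf fs X (\<lambda>\<G> \<beta>. sat (fst \<G>) \<beta> (Eq s t))" by (intro qf_Eq) auto
  then show ?case using Eq.prems by (intro exI[of _ fs]) (simp add: tower_0)
next
  case (Pred p t)
  then have "qf fs X (\<lambda>\<G> \<beta>. sat (fst \<G>) \<beta> (Pred p t))" by (intro qf_Pred) auto
  then show ?case using Pred.prems by (intro exI[of _ fs]) (simp add: tower_0)
next
  case (Neg \<phi>)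
  from Neg.IH[of fs Y j X] Neg.prems obtain fs' where "fam fs'" "set fs \<subseteq> set fs'"
    "quant fs' (tower (c * quantifiers \<phi>) Y) (radius j)" "qf fs' X (\<lambda>\<G> \<beta>. sat (fst \<G>) \<beta> \<phi>)" by auto
  then show ?case by (intro exI[of _ fs']) (simp add: qf_def)
next
  case (And \<phi> \<psi>)
  have "\<exists>fs1. fam fs1 \<and> set fs \<subseteq> set fs1 \<and> quant fs1 (tower (c * quantifiers \<phi>) Y) (radius (j + quantifiers \<psi>)) \<and>
       qf fs1 X (\<lambda>\<G> \<beta>. sat (fst \<G>) \<beta> \<phi>)"
    by (rule And.IH(1)) (use And.prems in \<open>auto simp: ac_simps\<close>)
  then obtain fs1 where f1: "fam fs1" "set fs \<subseteq> set fs1" "quant fs1 (tower (c * quantifiers \<phi>) Y) (radius (j + quantifiers \<psi>))"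
      "qf fs1 X (\<lambda>\<G> \<beta>. sat (fst \<G>) \<beta> \<phi>)" by blast
  let ?Y = "tower (c * quantifiers \<phi>) Y"
  have Y: "Y \<le> ?Y" by (rule tower_ge)
  have rt: "\<forall>t\<in>terms \<psi>. rterm fs1 t" using And.prems(6) rterm_mono[OF _ f1(2)] by simp
  have r: "radius (j + quantifiers \<psi>) \<le> ?Y"
    using radius_mono[of "j + quantifiers \<psi>" "j + quantifiers (And \<phi> \<psi>)"] And.prems(3) Y by simp
  have "\<exists>fs2. fam fs2 \<and> set fs1 \<subseteq> set fs2 \<and> quant fs2 (tower (c * quantifiers \<psi>) ?Y) (radius j) \<and>
       qf fs2 X (\<lambda>\<G> \<beta>. sat (fst \<G>) \<beta> \<psi>)"
    by (rule And.IH(2)[OF f1(1,3) r _ _ rt]) (use And.prems Y in auto)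
  then obtain fs2 where f2: "fam fs2" "set fs1 \<subseteq> set fs2" "quant fs2 (tower (c * quantifiers \<psi>) ?Y) (radius j)"
      "qf fs2 X (\<lambda>\<G> \<beta>. sat (fst \<G>) \<beta> \<psi>)" by blast
  have "qf fs2 X (\<lambda>\<G> \<beta>. sat (fst \<G>) \<beta> \<phi>)" using qf_mono[OF f1(4) f2(2)] .
  then have q: "qf fs2 X (\<lambda>\<G> \<beta>. sat (fst \<G>) \<beta> (And \<phi> \<psi>))" using f2(4) unfolding qf_def by simp
  have "tower (c * quantifiers \<psi>) ?Y = tower (c * quantifiers (And \<phi> \<psi>)) Y"
    by (simp add: tower_add[symmetric] algebra_simps)
  then show ?case using f1(2) f2 q by (intro exI[of _ fs2]) auto
next
  case (Ex y \<phi>)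
  have "\<exists>fs1. fam fs1 \<and> set fs \<subseteq> set fs1 \<and> quant fs1 (tower (c * quantifiers \<phi>) Y) (radius (Suc j)) \<and>
       qf fs1 (insert y X) (\<lambda>\<G> \<beta>. sat (fst \<G>) \<beta> \<phi>)"
  proof (rule Ex.IH)
    show "card (insert y X) + quantifiers \<phi> \<le> Y" using Ex.prems(10) card_insert_le_m1[of "Suc (card X)" X y] by simp
  qed (use Ex.prems in auto)
  then obtain fs1 where f1: "fam fs1" "set fs \<subseteq> set fs1" "quant fs1 (tower (c * quantifiers \<phi>) Y) (radius (Suc j))"
       "qf fs1 (insert y X) (\<lambda>\<G> \<beta>. sat (fst \<G>) \<beta> \<phi>)" by blast
  let ?Y = "tower (c * quantifiers \<phi>) Y"
  have Y: "Y \<le> ?Y" by (rule tower_ge)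
  have e1: "quant fs1 ?Y (8 * radius j + 7)" using f1(3) by (simp add: radius_Suc)
  have e2: "8 * radius j + 7 \<le> ?Y" using radius_mono[of "Suc j" "j + quantifiers (Ex y \<phi>)"] Ex.prems(3) Y by (simp add: radius_Suc)
  have e3: "card (psig \<sigma>) \<le> ?Y" using Ex.prems(4) Y by simp
  have e4: "card X * length fs1 \<le> ?Y * ?Y" using Ex.prems(10) Y f1(3) by (intro mult_le_mono) (auto simp: quant_def)
  from eliminate[OF f1(1) e1 e2 e3 e4] obtain fs' W where f: "fam fs'" "set fs1 \<subseteq> set fs'" "quant fs' (elim_size ?Y) (radius j)"
    and W': "\<forall>w\<in>W. vfun w" "\<forall>f\<in>set fs1. \<forall>g\<in>set fs1. \<forall>w\<in>W. compose f (compose w g) \<in> set fs'"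
     "\<forall>\<G>\<in>insts. \<forall>v\<in>vs \<G>. \<forall>Z\<subseteq>vs \<G>. bp \<G> v \<in> Z --> card Z \<le> card X * length fs1 -->
       (\<exists>w\<in>W. \<exists>z\<in>Z. w \<G> z \<in> vs \<G> \<and> ut fs1 \<G> (w \<G> z) = ut fs1 \<G> v \<and>
         (\<forall>f\<in>set fs1. \<forall>z'\<in>Z. f \<G> (w \<G> z) = z' \<longleftrightarrow> f \<G> v = z'))"
    by (elim exE conjE)
  note W = bspec[OF W'(1)] W'(2)[rule_format] W'(3)[rule_format]
  have fv: "\<And>f. f \<in> set fs1 ==> vfun f" and b: "bp \<in> set fs1" using f1(1) by (auto simp: fam_def)
  obtain x0 where x0: "x0 \<in> X" using Ex.prems(8) by blast
  have tr: "\<exists>v\<in>vs \<G>'. sat (fst \<G>') (\<beta>'(y := v)) \<phi>"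
    if "same fs' X \<G> \<beta> \<G>' \<beta>'" "\<G> \<in> insts" "\<G>' \<in> insts" "\<beta> ` X \<subseteq> vs \<G>" "\<beta>' ` X \<subseteq> vs \<G>'" "v \<in> vs \<G>" "sat (fst \<G>) (\<beta>(y := v)) \<phi>"
    for \<G> \<G>' \<beta> \<beta>' v
    by (rule eliminate_transfer[where P = "\<lambda>\<G> \<beta>. sat (fst \<G>) \<beta> \<phi>", OF f(2) _ _ _ _ b Ex.prems(7) x0 f1(4) that])
      (fact fv W)+
  have q: "qf fs' X (\<lambda>\<G> \<beta>. sat (fst \<G>) \<beta> (Ex y \<phi>))"
    unfolding qf_def
  proof (intro ballI allI impI)
    fix \<G> \<G>' \<beta> \<beta>' assume a: "\<G> \<in> insts" "\<G>' \<in> insts" "\<beta> ` X \<subseteq> vs \<G>" "\<beta>' ` X \<subseteq> vs \<G>'" "same fs' X \<G> \<beta> \<G>' \<beta>'"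
    show "sat (fst \<G>) \<beta> (Ex y \<phi>) = sat (fst \<G>') \<beta>' (Ex y \<phi>)"
      using tr[OF a(5) a(1-4)] tr[OF same_sym[OF a(5)] a(2,1,4,3)] by auto
  qed
  have "elim_size ?Y \<le> tower (c * quantifiers (Ex y \<phi>)) Y"
    using c[of ?Y] by (simp add: tower_add)
  from quant_mono[OF f(3) this le_refl] show ?case using f(1,2) f1(2) q by (intro exI[of _ fs']) auto
qed

section \<open>The initial family, and its closure containing all terms of bounded depth\<close>

fun closure :: "nat => 'v vfn list => 'v vfn list" where
  "closure 0 fs = fs"
| "closure (Suc m) fs = comps (closure m fs) (closure m fs)"

definition comp_size :: "nat => nat" where "comp_size X = augm X X X + X * X"

lemma elem_comp_size: "elem comp_size"
  unfolding comp_size_def augm_def by (intro elem_intros)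

lemma closure_quant:
  assumes c: "\<And>X. comp_size X \<le> tower c X"
  shows "fam fs ==> quant fs Y (radius (j + m)) ==> radius (j + m) \<le> Y ==>
    fam (closure m fs) \<and> set fs \<subseteq> set (closure m fs) \<and> quant (closure m fs) (tower (c * m) Y) (radius j)"
proof (induction m arbitrary: j)
  case 0 then show ?case by (simp add: tower_0)
next
  case (Suc m)
  from Suc.IH[of "Suc j"] Suc.prems have IH: "fam (closure m fs)" "set fs \<subseteq> set (closure m fs)"
    "quant (closure m fs) (tower (c * m) Y) (radius (Suc j))" by auto
  let ?Y = "tower (c * m) Y"
  have "quant (closure m fs) ?Y (2 * radius j + 1)" using IH(3) by (rule quant_mono) (auto simp: radius_Suc)
  from fam_comps(2)[OF IH(1) this] have q: "quant (closure (Suc m) fs) (augm ?Y (radius j) ?Y + ?Y * ?Y) (radius j)" by simp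
  have "radius j \<le> Y" using Suc.prems(3) radius_mono[of j "j + Suc m"] by simp
  then have "radius j \<le> ?Y" using tower_ge[of Y "c * m"] by simp
  then have "augm ?Y (radius j) ?Y + ?Y * ?Y \<le> comp_size ?Y" by (simp add: comp_size_def augm_mono)
  also have "\<dots> \<le> tower (c * Suc m) Y" using c[of ?Y] by (simp add: tower_add)
  finally have "quant (closure (Suc m) fs) (tower (c * Suc m) Y) (radius j)" using quant_mono[OF q] by blast
  moreover have "set (closure m fs) \<subseteq> set (closure (Suc m) fs)"
    using comps_subset1[of "closure m fs"] IH(1) by (simp add: fam_def)
  ultimately show ?case using fam_comps(1)[OF IH(1)] IH(2) by auto
qed

definition basic :: "'v vfn list" where
  "basic = map (\<lambda>f \<G>. fint (fst \<G>) f) (sorted_list_of_set (fsig \<sigma>)) @ [vid, bp]"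

lemma fsig_props: "finite (fsig \<sigma>)" "f_id \<in> fsig \<sigma>"
  using sig by (auto simp: functional_signature_def)

lemma set_basic: "set basic = (\<lambda>f \<G>. fint (fst \<G>) f) ` fsig \<sigma> \<union> {vid, bp}"
  using fsig_props by (simp add: basic_def)

lemma inst_Fun: "\<G> \<in> insts ==> fst \<G> \<in> Fun \<sigma>"
  using cls unfolding insts_def by auto

lemma vfun_basic: "f \<in> set basic ==> vfun f"
  using inst_Fun insts(3,5) by (auto simp: set_basic vfun_def Fun_def vid_def bp_def)

lemma fint_near: "f \<in> fsig \<sigma> ==> (\<lambda>\<G>. fint (fst \<G>) f) \<in> set basic" by (auto simp: set_basic)

text \<open>The initial memory consists of the tables of \<sigma>, so the empty program computes
  them; only the identity and \<open>bp\<close> are added.\<close>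

lemma lin_basic: "lin (PT \<union> enc ` set basic)"
proof -
  define ts :: "'v table list" where "ts = map (\<lambda>f. enc (\<lambda>\<G>. fint (fst \<G>) f)) (sorted_list_of_set (fsig \<sigma>)) @ map ptab (sorted_list_of_set (psig \<sigma>))"
  have st: "map (\<lambda>t. t \<G>) ts = struc_tables \<sigma> (ix \<G>) (fst \<G>)" for \<G>
    by (simp add: ts_def struc_tables_def enc_def ptab_def fun_eq_iff)
  have "rep \<G> ts (start \<G>)" if "\<G> \<in> insts" for \<G>
    unfolding rep_def agree_def
  proof (intro conjI allI impI)
    have len: "length (struc_tables \<sigma> (ix \<G>) (fst \<G>)) = length ts" unfolding st[symmetric] by simp
    fix j i assume a: "j < length ts" "i < sz \<G>"
    have "j * sz \<G> + i < length ts * sz \<G>"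
      using mult_le_mono1[of "Suc j" "length ts" "sz \<G>"] a by simp
    then show "start \<G> (j * sz \<G> + i) = (ts ! j) \<G> (vx \<G> i)"
      using a unfolding start_def tables_def len by (simp add: st[symmetric])
  next
    have len: "length (struc_tables \<sigma> (ix \<G>) (fst \<G>)) = length ts" unfolding st[symmetric] by simp
    fix a assume "length ts * sz \<G> \<le> a"
    then show "start \<G> a = 0" unfolding start_def tables_def len by simp
  qed
  then have "Comp ts" unfolding Comp_def by (intro exI[of _ "[]"]) (simp add: exec_prog_def)
  then have "lin (set ts)" unfolding lin_def by blast
  then have "lin ({enc vid, enc bp} \<union> set ts)"
  proof (rule lin_pw_set[where k = 1])
    fix f :: "'v table" assume f: "f \<in> {enc vid, enc bp}"
    have "enc vid \<in> pw (set ts)" using pw.index by (simp add: enc_def vid_def)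
    moreover have "enc bp \<in> pw (set ts)" using insts(3,7) by (intro pw.congr[OF pw.const[of 0]]) (simp add: enc_def bp_def)
    ultimately show "f \<in> pw (set ts) \<and> (\<forall>\<G>\<in>insts. \<forall>v\<in>vs \<G>. \<bar>f \<G> v\<bar> \<le> int (1 * sz \<G>))"
      using f vfun_bound[of vid] vfun_bound[of bp] vfun_basic by (auto simp: set_basic)
  qed simp
  then show ?thesis
    by (rule lin_mono) (use fsig_props finite_psig in \<open>auto simp: ts_def PT_def set_basic\<close>)
qed

text \<open>The arcs of \<open>bp\<close> form a star at the vertex of index 0, hence the additional
  1.\<close>

lemma grad_basic:
  assumes "\<G> \<in> insts" "grad_le r D (underlying \<sigma> (fst \<G>))"
  shows "grad_le r (D + 1) (fgraph basic \<G>)"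
proof (rule grad_le_apex[OF assms(2), where z = "vx \<G> 0"])
  show "edges (fgraph basic \<G>) \<subseteq> edges (underlying \<sigma> (fst \<G>)) \<union> {{vx \<G> 0, v} |v. v \<in> verts (underlying \<sigma> (fst \<G>))}"
  proof
    fix e assume "e \<in> edges (fgraph basic \<G>)"
    then obtain f v where fv: "f \<in> set basic" "v \<in> vs \<G>" "e = {f \<G> v, v}" "f \<G> v \<noteq> v"
      by (auto simp: fgraph_def fun_graph_def)
    from fv(1) consider k where "k \<in> fsig \<sigma>" "f = (\<lambda>\<G>. fint (fst \<G>) k)" | "f = vid" | "f = bp" unfolding set_basic by blast
    then show "e \<in> edges (underlying \<sigma> (fst \<G>)) \<union> {{vx \<G> 0, v} |v. v \<in> verts (underlying \<sigma> (fst \<G>))}"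
    proof cases
      case 1
      have "(f \<G> v, v) \<in> arcs \<sigma> (fst \<G>)" using 1 fv(2) vfunD[OF vfun_basic[OF fv(1)] assms(1) fv(2)] by (auto simp: arcs_def)
      then have "e \<in> edges (underlying \<sigma> (fst \<G>))" unfolding underlying_def ugraph.simps using fv(3,4) by blast
      then show ?thesis by simp
    next
      case 2 then show ?thesis using fv(4) by (simp add: vid_def)
    next
      case 3
      then have "e = {vx \<G> 0, v}" "v \<in> verts (underlying \<sigma> (fst \<G>))" using fv(2,3) by (simp_all add: bp_def underlying_def)
      then show ?thesis by blast
    qed
  qed
qed (use insts(1)[OF assms(1)] in \<open>auto simp: underlying_def fgraph_def fun_graph_def\<close>)

lemma fam_basic:
  assumes "expansion_bound g (underlying \<sigma> ` \<C>)"
  shows "fam basic" "quant basic (g r + length basic + 1) r"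
proof -
  have gr: "grad_le r (g r + 1) (fgraph basic \<G>)" if "\<G> \<in> insts" for r \<G>
  proof (rule grad_basic[OF that])
    have "fst \<G> \<in> \<C>" using that by (auto simp: insts_def)
    then show "grad_le r (g r) (underlying \<sigma> (fst \<G>))" using assms unfolding expansion_bound_def grad_le_def by blast
  qed
  then show "fam basic" unfolding fam_def using vfun_basic lin_basic set_basic by blast
  have "grad_le r (g r + length basic + 1) (fgraph basic \<G>)" if "\<G> \<in> insts" for \<G>
    by (rule grad_le_mono[OF gr[OF that] le_refl]) simp
  then   show "quant basic (g r + length basic + 1) r" unfolding quant_def by simp
qed

lemma rterm_closure:
  assumes "fam basic" "trm_funs t \<subseteq> fsig \<sigma>"
  shows "depth t \<le> m ==> rterm (closure m basic) t"
  using assms(2)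
proof (induction t arbitrary: m)
  case (Var x)
  have "vid \<in> set (closure m basic)"
    by (induction m) (use comps_subset1 in \<open>auto simp: set_basic\<close>)
  then show ?case unfolding rterm_def by (intro bexI[of _ vid]) (auto simp: vid_def)
next
  case (App k t)
  then obtain l where m: "m = Suc l" "depth t \<le> l" by (cases m) auto
  have v: "vid \<in> set (closure i basic)" for i by (induction i) (use comps_subset1 in \<open>auto simp: set_basic\<close>)
  then have "set (closure i basic) \<subseteq> set (closure (Suc i) basic)" for i unfolding closure.simps by (rule comps_subset1)
  then have "set (closure 0 basic) \<subseteq> set (closure l basic)" by (induction l) blast+
  then have k: "(\<lambda>\<G>. fint (fst \<G>) k) \<in> set (closure l basic)" using App.prems(2) fint_near by auto
  from App.IH[OF m(2)] App.prems(2) obtain f where f: "f \<in> set (closure l basic)"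
    "\<And>\<G> \<beta>. \<G> \<in> insts ==> \<beta> (trm_var t) \<in> vs \<G> ==> trm_val (fst \<G>) \<beta> t = f \<G> (\<beta> (trm_var t))"
    unfolding rterm_def by auto
  have "compose (\<lambda>\<G>. fint (fst \<G>) k) f \<in> set (closure m basic)" using k f(1) unfolding m(1) closure.simps set_comps by blast
  then show ?case unfolding rterm_def
    by (intro bexI[of _ "compose (\<lambda>\<G>. fint (fst \<G>) k) f"]) (auto simp: f(2) compose_def)
qed

lemma terms_funs: "has_signature \<sigma> \<phi> ==> t \<in> terms \<phi> ==> trm_funs t \<subseteq> fsig \<sigma>"
  by (induction \<phi>) auto

end

section \<open>Counting\<close>

text \<open>Induction on T avoids the explicit alternating sum: b itself is expanded over the sets
  without t, the difference \<open>b (insert t E) - b E\<close> supplies the coefficients of the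
  sets with t.\<close>

lemma moebius:
  fixes b :: "'a set => int"
  assumes "finite T"
  shows "\<exists>k. \<forall>E\<subseteq>T. b E = (\<Sum>F\<in>Pow T. k F * of_bool (F \<subseteq> E))"
  using assms
proof (induction T arbitrary: b rule: finite_induct)
  case empty
  show ?case by (intro exI[of _ b]) simp
next
  case (insert t T)
  obtain k where k: "\<And>E. E \<subseteq> T ==> b E = (\<Sum>F\<in>Pow T. k F * of_bool (F \<subseteq> E))" using insert.IH[of b] by blast
  obtain l where l: "\<And>E. E \<subseteq> T ==> b (insert t E) - b E = (\<Sum>F\<in>Pow T. l F * of_bool (F \<subseteq> E))"
    using insert.IH[of "\<lambda>E. b (insert t E) - b E"] by blast
  define m where "m F = (if t \<in> F then l (F - {t}) else k F)" for F
  have inj: "inj_on (insert t) (Pow T)" using insert.hyps(2) by (auto intro!: inj_onI)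
  have "(\<Sum>F\<in>Pow (insert t T). m F * of_bool (F \<subseteq> E)) =
      (\<Sum>F\<in>Pow T. m F * of_bool (F \<subseteq> E)) + (\<Sum>F\<in>insert t ` Pow T. m F * of_bool (F \<subseteq> E))" for E
    unfolding Pow_insert using insert.hyps by (intro sum.union_disjoint) auto
  moreover have "(\<Sum>F\<in>insert t ` Pow T. m F * of_bool (F \<subseteq> E)) =
      (\<Sum>F\<in>Pow T. m (insert t F) * of_bool (insert t F \<subseteq> E))" for E
    by (simp add: sum.reindex[OF inj])
  moreover have "(\<Sum>F\<in>Pow T. m (insert t F) * of_bool (insert t F \<subseteq> E)) =
      (\<Sum>F\<in>Pow T. l F * of_bool (insert t F \<subseteq> E))" for E
  proof (rule sum.cong[OF refl])
    fix F assume "F \<in> Pow T"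
    then have "insert t F - {t} = F" using insert.hyps(2) by blast
    then show "m (insert t F) * of_bool (insert t F \<subseteq> E) = l F * of_bool (insert t F \<subseteq> E)" by (simp add: m_def)
  qed
  moreover have "(\<Sum>F\<in>Pow T. m F * of_bool (F \<subseteq> E)) = (\<Sum>F\<in>Pow T. k F * of_bool (F \<subseteq> E))" for E
  proof (rule sum.cong[OF refl])
    fix F assume "F \<in> Pow T"
    then have "t \<notin> F" using insert.hyps(2) by blast
    then show "m F * of_bool (F \<subseteq> E) = k F * of_bool (F \<subseteq> E)" by (simp add: m_def)
  qed
  ultimately have S: "(\<Sum>F\<in>Pow (insert t T). m F * of_bool (F \<subseteq> E)) =
      (\<Sum>F\<in>Pow T. k F * of_bool (F \<subseteq> E)) + (\<Sum>F\<in>Pow T. l F * of_bool (insert t F \<subseteq> E))" for E by simp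
  have "b E = (\<Sum>F\<in>Pow (insert t T). m F * of_bool (F \<subseteq> E))" if E: "E \<subseteq> insert t T" for E
  proof (cases "t \<in> E")
    case False
    then have "E \<subseteq> T" using E by blast
    moreover have "(\<Sum>F\<in>Pow T. l F * of_bool (insert t F \<subseteq> E)) = 0" using False by simp
    ultimately show ?thesis using k[of E] S[of E] by simp
  next
    case True
    define D where "D = E - {t}"
    have D: "D \<subseteq> T" "E = insert t D" "t \<notin> D" using E True by (auto simp: D_def)
    have 1: "(\<Sum>F\<in>Pow T. k F * of_bool (F \<subseteq> E)) = b D"
      unfolding k[OF D(1)]
    proof (rule sum.cong[OF refl])
      fix F assume "F \<in> Pow T"
      then have "F \<subseteq> E \<longleftrightarrow> F \<subseteq> D" using insert.hyps(2) unfolding D(2) by blast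
      then show "k F * of_bool (F \<subseteq> E) = k F * of_bool (F \<subseteq> D)" by simp
    qed
    have 2: "(\<Sum>F\<in>Pow T. l F * of_bool (insert t F \<subseteq> E)) = b (insert t D) - b D"
      unfolding l[OF D(1)]
    proof (rule sum.cong[OF refl])
      fix F assume "F \<in> Pow T"
      then have "insert t F \<subseteq> E \<longleftrightarrow> F \<subseteq> D" using insert.hyps(2) unfolding D(2) by blast
      then show "l F * of_bool (insert t F \<subseteq> E) = l F * of_bool (F \<subseteq> D)" by simp
    qed
    show ?thesis unfolding S 1 2 D(2)[symmetric] by simp
  qed
  then show ?case by blast
qed

context structure_class
begin

definition links :: "'v vfn list => nat set => 'v inst => (nat => 'v) => 'v => ('v vfn \<times> nat \<times> 'v vfn) set" where
  "links fs X \<G> \<beta> v = {(f, x, h). f \<in> set fs \<and> x \<in> X \<and> h \<in> set fs \<and> f \<G> v = h \<G> (\<beta> x)}"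

text \<open>The only counts that are tabulated. They fix a type and the value of one function, so a
  single histogram yields them.\<close>

definition cnt :: "'v vfn list => 'v utype => 'v vfn => 'v table" where
  "cnt L \<tau> a = (\<lambda>\<G> z. int (card {v \<in> vs \<G>. a \<G> v = z \<and> ut L \<G> v = \<tau>}))"

lemma lin_cnt:
  assumes S: "lin S" "PT \<subseteq> S" "enc ` set L \<subseteq> S" "\<And>f. f \<in> set L ==> vfun f"
    and a: "enc a \<in> S" "vfun a"
  shows "\<exists>S'. lin S' \<and> S \<subseteq> S' \<and> cnt L \<tau> a \<in> pw S'"
proof -
  let ?t = "\<lambda>\<G> z. int (card {y \<in> vs \<G>. enc a \<G> y = int (ix \<G> z) \<and> of_bool (ut L \<G> y = \<tau>) > (0::int)})"
  have p: "(\<lambda>\<G> v. of_bool (ut L \<G> v = \<tau>)) \<in> pw S" using pb_ut[OF S(2-4)] unfolding pb_def by simp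
  have l: "lin (insert ?t S)"
    by (rule lin_count[OF S(1) pw.tab[OF a(1)] p]) (rule enc_bound[where f = a, OF _ vfunD[OF a(2)]])
  have "cnt L \<tau> a \<in> pw (insert ?t S)"
  proof (rule pw.congr[OF pw.tab])
    show "?t \<in> insert ?t S" by simp
    fix \<G> z assume \<G>: "\<G> \<in> insts" "z \<in> vs \<G>"
    have "enc a \<G> y = int (ix \<G> z) \<longleftrightarrow> a \<G> y = z" if "y \<in> vs \<G>" for y
      using inj_on_eq_iff[OF insts(8)[OF \<G>(1)] vfunD[OF a(2) \<G>(1) that] \<G>(2)] by (simp add: enc_def)
    then have "{y \<in> vs \<G>. enc a \<G> y = int (ix \<G> z) \<and> of_bool (ut L \<G> y = \<tau>) > (0::int)} =
      {v \<in> vs \<G>. a \<G> v = z \<and> ut L \<G> v = \<tau>}" by auto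
    then show "?t \<G> z = cnt L \<tau> a \<G> z" by (simp add: cnt_def)
  qed
  then show ?thesis using l by blast
qed

lemma lin_cnts:
  assumes S: "lin S" "PT \<subseteq> S" "enc ` set L \<subseteq> S" "\<And>f. f \<in> set L ==> vfun f"
    and I: "finite I" "\<And>\<tau> a. (\<tau>, a) \<in> I ==> enc a \<in> S \<and> vfun a"
  shows "\<exists>S'. lin S' \<and> S \<subseteq> S' \<and> (\<forall>(\<tau>, a)\<in>I. cnt L \<tau> a \<in> pw S')"
  using I
proof (induction I rule: finite_induct)
  case empty then show ?case using S(1) by auto
next
  case (insert i I)
  obtain S' where S': "lin S'" "S \<subseteq> S'" "\<And>\<tau> a. (\<tau>, a) \<in> I ==> cnt L \<tau> a \<in> pw S'" using insert by blast
  obtain \<tau> a where i: "i = (\<tau>, a)" by (cases i)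
  have a: "enc a \<in> S'" "vfun a" using insert.prems[of \<tau> a] i S'(2) by auto
  have "PT \<subseteq> S'" using S(2) S'(2) by (rule order_trans)
  moreover have "enc ` set L \<subseteq> S'" using S(3) S'(2) by (rule order_trans)
  ultimately obtain S'' where S'': "lin S''" "S' \<subseteq> S''" "cnt L \<tau> a \<in> pw S''"
    using lin_cnt[where \<tau> = \<tau>, OF S'(1) _ _ S(4) a] by blast
  have "cnt L \<tau>' a' \<in> pw S''" if m: "(\<tau>', a') \<in> insert i I" for \<tau>' a'
  proof (cases "(\<tau>', a') \<in> I")
    case True show ?thesis by (rule pw_mono[OF S'(3)[OF True] S''(2)])
  next
    case False then show ?thesis using m i S''(3) by simp
  qed
  moreover have "S \<subseteq> S''" using S'(2) S''(2) by (rule order_trans)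
  ultimately show ?case using S''(1) by (intro exI[of _ S'']) auto
qed

text \<open>A hub of the functions occurring in \<open>E\<close>, read off \<open>\<tau>\<close>, reduces the conditions \<open>f v = h (\<beta> x)\<close> to one of them.\<close>

lemma count_links:
  assumes fs: "bp \<in> set fs" "\<And>f. f \<in> set fs ==> vfun f"
    and hub: "hub fs Q" and vQ: "vid \<in> set Q" and L: "L = comps Q fs" "set L \<subseteq> set fs'"
    and X: "x0 \<in> X" and E: "finite E" "E \<subseteq> set fs \<times> X \<times> set fs"
  shows "\<exists>x a F C. x \<in> X \<and> a \<in> set fs \<and> F \<in> set fs \<and> qf fs' X C \<and>
    (\<forall>\<G>\<in>insts. \<forall>\<beta>. \<beta> ` X \<subseteq> vs \<G> -->
      int (card {v \<in> vs \<G>. ut L \<G> v = \<tau> \<and> E \<subseteq> links fs X \<G> \<beta> v}) = (if C \<G> \<beta> then cnt L \<tau> a \<G> (F \<G> (\<beta> x)) else 0))"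
proof -
  \<comment> \<open>Adding \<open>bp\<close> keeps A nonempty when E is empty; its constant value is
    available at any variable.\<close>
  define A where "A = insert bp (fst ` E)"
  have A: "A \<subseteq> set fs" using fs(1) E(2) by (auto simp: A_def)
  have fsL: "set fs \<subseteq> set L" unfolding L(1) by (rule comps_subset2[OF vQ])
  have LI: "compose q f \<in> set L" if "q \<in> set Q" "f \<in> set fs" for q f using that unfolding L(1) set_comps by blast
  show ?thesis
  \<comment> \<open>Whether some member of A determines all others through Q can be read off \<tau>.
    If none does, the hub property shows that no element has the type \<tau>, and the count is
    0.\<close>
  proof (cases "\<exists>a\<in>A. \<forall>f\<in>A. \<exists>q\<in>set Q. (f, compose q a) \<in> fst \<tau>")
    case False
    have "{v \<in> vs \<G>. ut L \<G> v = \<tau> \<and> E \<subseteq> links fs X \<G> \<beta> v} = {}" if \<G>: "\<G> \<in> insts" for \<G> \<beta>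
    proof (rule ccontr)
      assume "\<not> ?thesis"
      then obtain v where v: "v \<in> vs \<G>" "ut L \<G> v = \<tau>" by blast
      have "A \<noteq> {}" by (simp add: A_def)
      then obtain a where a: "a \<in> A" "\<And>f. f \<in> A ==> \<exists>q\<in>set Q. f \<G> v = q \<G> (a \<G> v)"
        using hub \<G> v(1) A unfolding hub_def by metis
      have "\<exists>q\<in>set Q. (f, compose q a) \<in> fst \<tau>" if "f \<in> A" for f
      proof -
        obtain q where q: "q \<in> set Q" "f \<G> v = q \<G> (a \<G> v)" using a(2)[OF \<open>f \<in> A\<close>] by blast
        have "f \<in> set L" "compose q a \<in> set L" using \<open>f \<in> A\<close> a(1) A fsL LI[OF q(1)] by auto
        then have "(f, compose q a) \<in> fst (ut L \<G> v)" using q(2) by (simp add: ut_def compose_def)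
        then show ?thesis using q(1) v(2) by blast
      qed
      then show False using False a(1) by blast
    qed
    then have card0: "int (card {v \<in> vs \<G>. ut L \<G> v = \<tau> \<and> E \<subseteq> links fs X \<G> \<beta> v}) = 0" if "\<G> \<in> insts" for \<G> \<beta>
      using that by (simp only: card.empty of_nat_0)
    show ?thesis
    proof (rule exI[of _ x0], rule exI[of _ bp], rule exI[of _ bp], rule exI[of _ "\<lambda>_ _. False"], intro conjI ballI allI impI)
      fix \<G> \<beta> assume "\<G> \<in> insts"
      then show "int (card {v \<in> vs \<G>. ut L \<G> v = \<tau> \<and> E \<subseteq> links fs X \<G> \<beta> v}) =
          (if False then cnt L \<tau> bp \<G> (bp \<G> (\<beta> x0)) else 0)" unfolding if_False by (rule card0)
    qed (use X fs(1) in \<open>simp_all add: qf_def\<close>)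
  next
    case True
    then obtain a where a: "a \<in> A" "\<And>f. f \<in> A ==> \<exists>q\<in>set Q. (f, compose q a) \<in> fst \<tau>" by blast
    then obtain q where q: "\<And>f. f \<in> A ==> q f \<in> set Q \<and> (f, compose (q f) a) \<in> fst \<tau>" by metis
    have afs: "a \<in> set fs" using a(1) A by blast
    have "\<exists>x F. x \<in> X \<and> F \<in> set fs \<and> (\<forall>\<G> \<beta> v. E \<subseteq> links fs X \<G> \<beta> v --> a \<G> v = F \<G> (\<beta> x))"
    proof (cases "a = bp")
      case True
      then show ?thesis using X fs(1) by (intro exI[of _ x0] exI[of _ bp]) (simp add: bp_def)
    next
      case False
      then obtain x F where xF: "(a, x, F) \<in> E" using a(1) by (force simp: A_def)
      then have "x \<in> X" "F \<in> set fs" using E(2) by auto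
      moreover have "a \<G> v = F \<G> (\<beta> x)" if "E \<subseteq> links fs X \<G> \<beta> v" for \<G> \<beta> v
        using subsetD[OF that xF] by (simp add: links_def)
      ultimately show ?thesis by blast
    qed
    then obtain x F where xF: "x \<in> X" "F \<in> set fs" "\<And>\<G> \<beta> v. E \<subseteq> links fs X \<G> \<beta> v ==> a \<G> v = F \<G> (\<beta> x)" by blast
    \<comment> \<open>What remains of the links once \<open>a \<G> v = F \<G> (\<beta> x)\<close> is
      imposed: a condition on \<beta> alone, which moreover depends only on its atomic
      pattern.\<close>
    define C where "C \<G> \<beta> \<longleftrightarrow> (\<forall>(f, x', h)\<in>E. q f \<G> (F \<G> (\<beta> x)) = h \<G> (\<beta> x'))" for \<G> \<beta>
    have qf: "qf fs' X C"
      unfolding qf_def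
    proof (intro ballI allI impI)
      fix \<G> \<G>' \<beta> \<beta>' assume s: "same fs' X \<G> \<beta> \<G>' \<beta>'"
      have "(q f \<G> (F \<G> (\<beta> x)) = h \<G> (\<beta> x')) = (q f \<G>' (F \<G>' (\<beta>' x)) = h \<G>' (\<beta>' x'))" if e: "(f, x', h) \<in> E" for f x' h
      proof -
        have "f \<in> A" using e by (force simp: A_def)
        then have "compose (q f) F \<in> set fs'" using LI q xF(2) L(2) by blast
        moreover have "h \<in> set fs'" "x' \<in> X" using e E(2) fsL L(2) by blast+
        ultimately show ?thesis using same_eq[OF s xF(1), of x' "compose (q f) F" h] by (simp add: compose_def)
      qed
      then show "C \<G> \<beta> = C \<G>' \<beta>'" unfolding C_def by (intro ball_cong refl) auto
    qed
    have eq: "int (card {v \<in> vs \<G>. ut L \<G> v = \<tau> \<and> E \<subseteq> links fs X \<G> \<beta> v}) = (if C \<G> \<beta> then cnt L \<tau> a \<G> (F \<G> (\<beta> x)) else 0)"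
      if \<G>: "\<G> \<in> insts" for \<G> \<beta>
    proof -
      have qv: "f \<G> v = q f \<G> (a \<G> v)" if "f \<in> A" "ut L \<G> v = \<tau>" for f v
      proof -
        have "(f, compose (q f) a) \<in> fst (ut L \<G> v)" using q[OF that(1)] unfolding that(2) by blast
        then show ?thesis by (simp add: ut_def compose_def)
      qed
      have "E \<subseteq> links fs X \<G> \<beta> v \<longleftrightarrow> a \<G> v = F \<G> (\<beta> x) \<and> C \<G> \<beta>" if ut: "ut L \<G> v = \<tau>" for v
      proof
        assume e: "E \<subseteq> links fs X \<G> \<beta> v"
        have z: "a \<G> v = F \<G> (\<beta> x)" by (rule xF(3)[OF e])
        have "q f \<G> (F \<G> (\<beta> x)) = h \<G> (\<beta> x')" if m: "(f, x', h) \<in> E" for f x' h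
        proof -
          have "f \<in> A" using m by (force simp: A_def)
          then have "f \<G> v = q f \<G> (F \<G> (\<beta> x))" using qv[OF _ ut] z by simp
          then show ?thesis using subsetD[OF e m] by (simp add: links_def)
        qed
        then show "a \<G> v = F \<G> (\<beta> x) \<and> C \<G> \<beta>" using z unfolding C_def by blast
      next
        assume z: "a \<G> v = F \<G> (\<beta> x) \<and> C \<G> \<beta>"
        have "(f, x', h) \<in> links fs X \<G> \<beta> v" if m: "(f, x', h) \<in> E" for f x' h
        proof -
          have "f \<in> A" using m by (force simp: A_def)
          then have "f \<G> v = q f \<G> (F \<G> (\<beta> x))" using qv[OF _ ut] z by simp
          moreover have "q f \<G> (F \<G> (\<beta> x)) = h \<G> (\<beta> x')" using z m unfolding C_def by blast
          ultimately show ?thesis using m E(2) by (auto simp: links_def)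
        qed
        then show "E \<subseteq> links fs X \<G> \<beta> v" by (simp add: subset_iff)
      qed
      then have "{v \<in> vs \<G>. ut L \<G> v = \<tau> \<and> E \<subseteq> links fs X \<G> \<beta> v} =
        {v \<in> vs \<G>. C \<G> \<beta> \<and> a \<G> v = F \<G> (\<beta> x) \<and> ut L \<G> v = \<tau>}" by auto
      then show ?thesis by (simp add: cnt_def)
    qed
    show ?thesis
      by (rule exI[of _ x], rule exI[of _ a], rule exI[of _ F], rule exI[of _ C]) (use xF(1,2) afs qf eq in simp)
  qed
qed

lemma pw_smult: "f \<in> pw S ==> (\<lambda>\<G> v. k * f \<G> v) \<in> pw S" for k :: int
proof (induction k rule: int_induct[of _ 0])
  case base then show ?case using pw.const[of 0] by simp
next
  case (step1 i)
  then have "(\<lambda>\<G> v. i * f \<G> v + f \<G> v) \<in> pw S" by (intro pw.plus) auto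
  then show ?case by (simp add: algebra_simps)
next
  case (step2 i)
  then have "(\<lambda>\<G> v. i * f \<G> v - f \<G> v) \<in> pw S" by (intro pw.minus) auto
  then show ?case by (simp add: algebra_simps)
qed

lemma pw_sum: "finite I ==> (\<And>i. i \<in> I ==> f i \<in> pw S) ==> (\<lambda>\<G> v. \<Sum>i\<in>I. f i \<G> v) \<in> pw S"
proof (induction I rule: finite_induct)
  case empty then show ?case using pw.const[of 0] by simp
next
  case (insert i I)
  have "(\<lambda>\<G> v. f i \<G> v + (\<Sum>i\<in>I. f i \<G> v)) \<in> pw S" using insert by (intro pw.plus) auto
  then show ?case using insert.hyps by simp
qed

text \<open>Atoms that involve the new element are settled by its type if they concern it alone, and
  by its links if they compare it with a variable.\<close>

lemma same_extend:
  assumes s: "same fs X \<G> \<beta> \<G>' \<beta>'" and "y \<notin> X" and fsL: "set fs \<subseteq> set L"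
    and u: "ut L \<G> v = ut L \<G>' v'" and l: "links fs X \<G> \<beta> v = links fs X \<G>' \<beta>' v'"
  shows "same fs (insert y X) \<G> (\<beta>(y := v)) \<G>' (\<beta>'(y := v'))"
proof -
  have ut: "(f \<G> v = g \<G> v) = (f \<G>' v' = g \<G>' v')" if "f \<in> set fs" "g \<in> set fs" for f g
  proof -
    have "f \<in> set L" "g \<in> set L" using that fsL by auto
    then show ?thesis using arg_cong[OF u, of "\<lambda>p. (f, g) \<in> fst p"] by (simp add: ut_def)
  qed
  have utp: "(f \<G> v \<in> pint (fst \<G>) p) = (f \<G>' v' \<in> pint (fst \<G>') p)" if "f \<in> set fs" "p \<in> psig \<sigma>" for f p
  proof -
    have "f \<in> set L" using that fsL by auto
    then show ?thesis using arg_cong[OF u, of "\<lambda>q. (f, p) \<in> snd q"] that(2) by (simp add: ut_def)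
  qed
  have pat: "(f \<G> v = h \<G> (\<beta> a)) = (f \<G>' v' = h \<G>' (\<beta>' a))" if "f \<in> set fs" "h \<in> set fs" "a \<in> X" for f h a
    using arg_cong[OF l, of "\<lambda>q. (f, a, h) \<in> q"] that by (simp add: links_def)
  have pat': "(h \<G> (\<beta> a) = f \<G> v) = (h \<G>' (\<beta>' a) = f \<G>' v')" if "f \<in> set fs" "h \<in> set fs" "a \<in> X" for f h a
    using pat[OF that] by (simp add: eq_commute)
  show ?thesis
    unfolding same_def
  proof (intro conjI ballI)
    fix a b f h assume "a \<in> insert y X" "b \<in> insert y X" "f \<in> set fs" "h \<in> set fs"
    then show "(f \<G> ((\<beta>(y := v)) a) = h \<G> ((\<beta>(y := v)) b)) = (f \<G>' ((\<beta>'(y := v')) a) = h \<G>' ((\<beta>'(y := v')) b))"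
      using ut[of f h] pat[of f h b] pat'[of h f a] same_eq[OF s, of a b f h] by (cases "a = y"; cases "b = y") auto
  next
    fix a f p assume "a \<in> insert y X" "f \<in> set fs" "p \<in> psig \<sigma>"
    then show "(f \<G> ((\<beta>(y := v)) a) \<in> pint (fst \<G>) p) = (f \<G>' ((\<beta>'(y := v')) a) \<in> pint (fst \<G>') p)"
      using utp[of f p] same_pred[OF s, of a f p] by (cases "a = y") auto
  qed
qed

text \<open>The construction of \<open>eliminate\<close> without the witnesses; the same growth
  bound serves.\<close>

lemma hub_family:
  assumes fam: "fam fs" and q: "quant fs Y (8 * R + 7)" and Y: "8 * R + 7 \<le> Y"
  shows "\<exists>fs' Q. fam fs' \<and> set fs \<subseteq> set fs' \<and> quant fs' (elim_size Y) R \<and> hub fs Q \<and> vid \<in> set Q \<and>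
    set (comps Q fs) \<subseteq> set fs'"
proof -
  have v: "vid \<in> set fs" "bp \<in> set fs" "\<And>f. f \<in> set fs ==> vfun f" using fam by (auto simp: fam_def)
  have q1: "quant fs Y 1" using q by (rule quant_mono) auto
  obtain hs where hs: "length hs = hs_size Y" "lin (enc ` set hs \<union> (PT \<union> enc ` set fs))" "\<And>h. h \<in> set hs ==> vfun h"
     "\<And>\<G> h v. \<G> \<in> insts ==> h \<in> set hs ==> v \<in> vs \<G> ==> h \<G> v = v \<or> near fs \<G> (h \<G> v) v"
     "hub fs (comps (vid # hs) (vid # hs))" using hub_exists[OF fam q1] unfolding hs_size_def by metis
  define fs1 where "fs1 = fs @ hs"
  have f1: "vid \<in> set fs1" "bp \<in> set fs1" using v by (auto simp: fs1_def)
  have f2: "vfun f" if "f \<in> set fs1" for f using that v(3) hs(3) by (auto simp: fs1_def)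
  have f3: "lin (PT \<union> enc ` set fs1)" using hs(2) by (rule lin_mono) (auto simp: fs1_def)
  have f4: "f \<G> y = y \<or> near fs \<G> (f \<G> y) y \<or> near fs \<G> y (f \<G> y)" if a: "\<G> \<in> insts" "f \<in> set fs1" "y \<in> vs \<G>" for \<G> f y
  proof -
    consider "f \<in> set fs" | "f \<in> set hs" using a(2) by (auto simp: fs1_def)
    then show ?thesis
    proof cases
      case 1
      then have "near fs \<G> (f \<G> y) y" unfolding near_def using a(3) by blast
      then show ?thesis by simp
    next
      case 2 then show ?thesis using hs(4)[OF a(1) _ a(3)] by blast
    qed
  qed
  have len1: "length fs1 \<le> Y + hs_size Y + wit_size Y" using q hs(1) by (simp add: fs1_def quant_def)
  have "8 * R + 7 = 2 * (4 * R + 3) + 1" by simp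
  then have q': "quant fs Y (2 * (4 * R + 3) + 1)" using q by metis
  have fam1: "fam fs1" by (rule fam_aug(1)[OF fam]) (fact f1 f2 f3 f4)+
  have "quant fs1 (augm Y (4 * R + 3) Y + (Y + hs_size Y + wit_size Y)) (4 * R + 3)"
    by (rule fam_aug(2)[OF fam]) (fact f1 f2 f3 f4 q' len1)+
  then have "quant fs1 (elim1 Y) (4 * R + 3)"
    by (rule quant_mono) (use Y in \<open>auto simp: elim1_def intro: augm_mono\<close>)
  moreover have "4 * R + 3 = 2 * (2 * R + 1) + 1" by simp
  ultimately have "quant fs1 (elim1 Y) (2 * (2 * R + 1) + 1)" by metis
  note fam2 = fam_comps(1)[OF fam1] and q2 = fam_comps(2)[OF fam1 this]
  have "quant (comps fs1 fs1) (elim2 Y) (2 * R + 1)"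
    using q2 by (rule quant_mono) (use Y in \<open>auto simp: elim2_def intro: augm_mono\<close>)
  note fam3 = fam_comps(1)[OF fam2] and q3 = fam_comps(2)[OF fam2 this]
  let ?fs = "comps (comps fs1 fs1) (comps fs1 fs1)" and ?Q = "comps (vid # hs) (vid # hs)"
  have q4: "quant ?fs (elim_size Y) R"
    using q3 by (rule quant_mono) (use Y in \<open>auto simp: elim_size_def intro: augm_mono\<close>)
  have sub1: "set fs1 \<subseteq> set (comps fs1 fs1)" by (rule comps_subset1[OF f1(1)])
  have sub2: "set (comps fs1 fs1) \<subseteq> set ?fs" using comps_subset1 sub1 f1(1) by blast
  have "set (vid # hs) \<subseteq> set fs1" using f1(1) by (auto simp: fs1_def)
  then have Q: "set ?Q \<subseteq> set (comps fs1 fs1)" unfolding set_comps by blast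
  have "set fs \<subseteq> set (comps fs1 fs1)" using sub1 by (auto simp: fs1_def)
  then have "set (comps ?Q fs) \<subseteq> set ?fs" using Q unfolding set_comps[of ?Q] set_comps[of "comps fs1 fs1"] by blast
  moreover have "vid \<in> set ?Q" using comps_subset1[of "vid # hs" "vid # hs"] by auto
  moreover have "set fs \<subseteq> set ?fs" using sub1 sub2 by (auto simp: fs1_def)
  ultimately show ?thesis using fam3 q4 hs(5) by blast
qed

text \<open>The pair \<kappa>, \<gamma> represents an atomic pattern over the new family. For
  assignments with this pattern, P at v depends only on the type and the links of v. Expanding this
  dependence leaves the counts of \<open>count_links\<close>, whose side conditions are decided by
  the pattern. Each count is a function of one variable, and grouping by that variable yields the
  coefficients.\<close>

theorem counting:
  assumes fam: "fam fs" and q: "quant fs Y (8 * R + 7)" and Y: "8 * R + 7 \<le> Y"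
    and P: "qf fs (insert y X) P" and X: "finite X" "x0 \<in> X" "y \<notin> X"
  shows "\<exists>fs' S. fam fs' \<and> set fs \<subseteq> set fs' \<and> quant fs' (elim_size Y) R \<and> lin S \<and> PT \<union> enc ` set fs' \<subseteq> S \<and>
    (\<forall>\<kappa>\<in>insts. \<forall>\<gamma>. \<gamma> ` X \<subseteq> vs \<kappa> --> (\<exists>c k. (\<forall>x\<in>X. c x \<in> pw S) \<and>
      (\<forall>x\<in>X. \<forall>\<G>\<in>insts. \<forall>v\<in>vs \<G>. \<bar>c x \<G> v\<bar> \<le> int (k * sz \<G>)) \<and>
      (\<forall>\<G>\<in>insts. \<forall>\<beta>. \<beta> ` X \<subseteq> vs \<G> --> same fs' X \<kappa> \<gamma> \<G> \<beta> -->
        int (card {v \<in> vs \<G>. P \<G> (\<beta>(y := v))}) = (\<Sum>x\<in>X. c x \<G> (\<beta> x)))))"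
proof -
  obtain fs' Q where f': "fam fs'" "set fs \<subseteq> set fs'" "quant fs' (elim_size Y) R" "hub fs Q" "vid \<in> set Q"
    "set (comps Q fs) \<subseteq> set fs'" using hub_family[OF fam q Y] by blast
  define L where "L = comps Q fs"
  have Lf: "set L \<subseteq> set fs'" using f'(6) by (simp add: L_def)
  have v: "bp \<in> set fs" "\<And>f. f \<in> set fs ==> vfun f" using fam by (auto simp: fam_def)
  have v': "\<And>f. f \<in> set fs' ==> vfun f" and l': "lin (PT \<union> enc ` set fs')" using f'(1) by (auto simp: fam_def)
  have fsL: "set fs \<subseteq> set L" unfolding L_def by (rule comps_subset2[OF f'(5)])
  define TY where "TY = Pow (set L \<times> set L) \<times> Pow (set L \<times> psig \<sigma>)"
  define T where "T = set fs \<times> X \<times> set fs"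
  have fin: "finite TY" "finite T" using finite_psig X(1) by (auto simp: TY_def T_def)
  have "\<exists>S. lin S \<and> PT \<union> enc ` set fs' \<subseteq> S \<and> (\<forall>(\<tau>, a)\<in>TY \<times> set fs. cnt L \<tau> a \<in> pw S)"
  proof (rule lin_cnts[OF l'])
    show "enc ` set L \<subseteq> PT \<union> enc ` set fs'" using Lf by blast
    show "vfun f" if "f \<in> set L" for f using that Lf v' by blast
    show "enc a \<in> PT \<union> enc ` set fs' \<and> vfun a" if "(\<tau>, a) \<in> TY \<times> set fs" for \<tau> a using that f'(2) v' by blast
  qed (use fin in auto)
  then obtain S where S: "lin S" "PT \<union> enc ` set fs' \<subseteq> S" "\<forall>(\<tau>, a)\<in>TY \<times> set fs. cnt L \<tau> a \<in> pw S" by (elim exE conjE)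
  have S3: "cnt L \<tau> a \<in> pw S" if "\<tau> \<in> TY" "a \<in> set fs" for \<tau> a using bspec[OF S(3), of "(\<tau>, a)"] that by simp
  define R where "R j x a F C \<longleftrightarrow> x \<in> X \<and> a \<in> set fs \<and> F \<in> set fs \<and> qf fs' X C \<and>
    (\<forall>\<G>\<in>insts. \<forall>\<beta>. \<beta> ` X \<subseteq> vs \<G> --> int (card {v \<in> vs \<G>. ut L \<G> v = fst j \<and> snd j \<subseteq> links fs X \<G> \<beta> v}) =
      (if C \<G> \<beta> then cnt L (fst j) a \<G> (F \<G> (\<beta> x)) else 0))" for j x a F C
  have "\<exists>x a F C. R j x a F C" if "j \<in> TY \<times> Pow T" for j
  proof -
    have E: "snd j \<subseteq> set fs \<times> X \<times> set fs" "finite (snd j)" using that fin(2) finite_subset by (auto simp: T_def)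
    show ?thesis unfolding R_def by (rule count_links[OF v f'(4,5) L_def Lf X(2) E(2,1)])
  qed
  then obtain xj aj Fj Cj where jR: "\<And>j. j \<in> TY \<times> Pow T ==> R j (xj j) (aj j) (Fj j) (Cj j)" by metis
  note j = jR[unfolded R_def]
  define t where "t j = (\<lambda>\<G> v. cnt L (fst j) (aj j) \<G> (Fj j \<G> v))" for j
  have t0: "0 \<le> t j \<G> v \<and> t j \<G> v \<le> int (sz \<G>)" if "\<G> \<in> insts" for j \<G> v
    unfolding t_def cnt_def using insts(1)[OF that] by (auto intro: card_mono)
  \<comment> \<open>The counts become tables because they are loaded at \<open>Fj j \<G> v\<close>,
    and only tables can be loaded.\<close>
  define S' where "S' = S \<union> (\<lambda>(\<tau>, a). cnt L \<tau> a) ` (TY \<times> set fs)"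
  have "lin ((\<lambda>(\<tau>, a). cnt L \<tau> a) ` (TY \<times> set fs) \<union> S)"
  proof (rule lin_pw_set[OF S(1), where k = 1])
    fix f assume "f \<in> (\<lambda>(\<tau>, a). cnt L \<tau> a) ` (TY \<times> set fs)"
    then obtain \<tau> a where f: "f = cnt L \<tau> a" "\<tau> \<in> TY" "a \<in> set fs" by auto
    have "card {v \<in> vs \<G>. a \<G> v = z \<and> ut L \<G> v = \<tau>} \<le> sz \<G>" if "\<G> \<in> insts" for \<G> z
      using insts(1)[OF that] by (intro card_mono) auto
    then show "f \<in> pw S \<and> (\<forall>\<G>\<in>insts. \<forall>v\<in>vs \<G>. \<bar>f \<G> v\<bar> \<le> int (1 * sz \<G>))"
      using S3[OF f(2,3)] by (simp add: f(1)) (simp add: cnt_def)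
  qed (use fin in simp)
  then have S'1: "lin S'" unfolding S'_def by (simp add: Un_commute)
  have S'2: "PT \<union> enc ` set fs' \<subseteq> S'" using S(2) by (auto simp: S'_def)
  have tpw: "t j \<in> pw S'" if "j \<in> TY \<times> Pow T" for j
    unfolding t_def
  proof (rule pw_load_vfun)
    have m: "fst j \<in> TY" "aj j \<in> set fs" "Fj j \<in> set fs" using j[OF that] that by auto
    then show "cnt L (fst j) (aj j) \<in> S'" unfolding S'_def by force
    show "enc (Fj j) \<in> pw S'" using m(3) f'(2) S'2 by (intro pw.tab) blast
    show "vfun (Fj j)" by (rule v(2)[OF m(3)])
  qed
  have main: "\<exists>c k. (\<forall>x\<in>X. c x \<in> pw S') \<and>
      (\<forall>x\<in>X. \<forall>\<G>\<in>insts. \<forall>v\<in>vs \<G>. \<bar>c x \<G> v\<bar> \<le> int (k * sz \<G>)) \<and>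
      (\<forall>\<G>\<in>insts. \<forall>\<beta>. \<beta> ` X \<subseteq> vs \<G> --> same fs' X \<kappa> \<gamma> \<G> \<beta> -->
        int (card {v \<in> vs \<G>. P \<G> (\<beta>(y := v))}) = (\<Sum>x\<in>X. c x \<G> (\<beta> x)))"
    if \<kappa>: "\<kappa> \<in> insts" "\<gamma> ` X \<subseteq> vs \<kappa>" for \<kappa> \<gamma>
  proof -
    \<comment> \<open>P expressed through type and links for the fixed pattern; this is well defined
      because \<open>qf\<close> does not separate elements that agree in both.\<close>
    define B where "B \<tau> E \<longleftrightarrow> (\<exists>\<G>\<in>insts. \<exists>\<beta>. \<exists>v\<in>vs \<G>. \<beta> ` X \<subseteq> vs \<G> \<and> same fs' X \<kappa> \<gamma> \<G> \<beta> \<and> ut L \<G> v = \<tau> \<and>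
      links fs X \<G> \<beta> v = E \<and> P \<G> (\<beta>(y := v)))" for \<tau> E
    have B: "P \<G> (\<beta>(y := v)) \<longleftrightarrow> B (ut L \<G> v) (links fs X \<G> \<beta> v)"
      if a: "\<G> \<in> insts" "\<beta> ` X \<subseteq> vs \<G>" "same fs' X \<kappa> \<gamma> \<G> \<beta>" "v \<in> vs \<G>" for \<G> \<beta> v
    proof
      assume "P \<G> (\<beta>(y := v))" then show "B (ut L \<G> v) (links fs X \<G> \<beta> v)" unfolding B_def using a by blast
    next
      assume "B (ut L \<G> v) (links fs X \<G> \<beta> v)"
      then obtain \<G>' \<beta>' v' where b: "\<G>' \<in> insts" "v' \<in> vs \<G>'" "\<beta>' ` X \<subseteq> vs \<G>'" "same fs' X \<kappa> \<gamma> \<G>' \<beta>'"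
        "ut L \<G>' v' = ut L \<G> v" "links fs X \<G>' \<beta>' v' = links fs X \<G> \<beta> v" "P \<G>' (\<beta>'(y := v'))" unfolding B_def by blast
      have "same fs' X \<G>' \<beta>' \<G> \<beta>" using same_trans[OF same_sym[OF b(4)] a(3)] .
      then have "same fs X \<G>' \<beta>' \<G> \<beta>" by (rule same_mono[OF _ f'(2)]) simp
      from same_extend[OF this X(3) fsL b(5,6)] have s: "same fs (insert y X) \<G>' (\<beta>'(y := v')) \<G> (\<beta>(y := v))" .
      have "(\<beta>'(y := v')) ` insert y X \<subseteq> vs \<G>'" "(\<beta>(y := v)) ` insert y X \<subseteq> vs \<G>" using a b by auto
      then have "P \<G>' (\<beta>'(y := v')) = P \<G> (\<beta>(y := v))" using P b(1) a(1) s unfolding qf_def by blast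
      then show "P \<G> (\<beta>(y := v))" using b(7) by simp
    qed
    have "\<forall>\<tau>. \<exists>k. \<forall>E\<subseteq>T. of_bool (B \<tau> E) = (\<Sum>F\<in>Pow T. k F * of_bool (F \<subseteq> E) :: int)"
    proof
      show "\<exists>k. \<forall>E\<subseteq>T. of_bool (B \<tau> E) = (\<Sum>F\<in>Pow T. k F * of_bool (F \<subseteq> E) :: int)" for \<tau>
        by (rule moebius[OF fin(2)])
    qed
    from choice[OF this] obtain co where "\<forall>\<tau>. \<forall>E\<subseteq>T. of_bool (B \<tau> E) = (\<Sum>F\<in>Pow T. co \<tau> F * of_bool (F \<subseteq> E) :: int)" ..
    note co = this[rule_format]
    \<comment> \<open>The side condition is constant on the pattern, so it is evaluated at the
      representative and becomes part of a constant weight.\<close>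
    define w where "w j = (if Cj j \<kappa> \<gamma> then co (fst j) (snd j) else 0)" for j
    define c where "c x = (\<lambda>\<G> v. \<Sum>j\<in>{j \<in> TY \<times> Pow T. xj j = x}. w j * t j \<G> v)" for x
    define k where "k = nat (\<Sum>j\<in>TY \<times> Pow T. \<bar>w j\<bar>)"
    have finJ: "finite (TY \<times> Pow T)" using fin by simp
    have c1: "c x \<in> pw S'" for x unfolding c_def using finJ tpw by (intro pw_sum pw_smult) auto
    have c2: "\<bar>c x \<G> v\<bar> \<le> int (k * sz \<G>)" if "\<G> \<in> insts" for x \<G> v
    proof -
      have "\<bar>c x \<G> v\<bar> \<le> (\<Sum>j\<in>{j \<in> TY \<times> Pow T. xj j = x}. \<bar>w j * t j \<G> v\<bar>)" unfolding c_def by (rule sum_abs)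
      also have "\<dots> \<le> (\<Sum>j\<in>TY \<times> Pow T. \<bar>w j * t j \<G> v\<bar>)" using finJ by (intro sum_mono2) auto
      also have "\<dots> \<le> (\<Sum>j\<in>TY \<times> Pow T. \<bar>w j\<bar> * int (sz \<G>))"
        using t0[OF that] by (intro sum_mono) (simp add: abs_mult mult_left_mono)
      also have "\<dots> = int (k * sz \<G>)" by (simp add: k_def sum_distrib_right sum_nonneg)
      finally show ?thesis .
    qed
    have c3: "int (card {v \<in> vs \<G>. P \<G> (\<beta>(y := v))}) = (\<Sum>x\<in>X. c x \<G> (\<beta> x))"
      if a: "\<G> \<in> insts" "\<beta> ` X \<subseteq> vs \<G>" "same fs' X \<kappa> \<gamma> \<G> \<beta>" for \<G> \<beta>
    proof -
      have fv: "finite (vs \<G>)" by (rule insts(1)[OF a(1)])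
      have "int (card {v \<in> vs \<G>. P \<G> (\<beta>(y := v))}) = (\<Sum>v\<in>vs \<G>. of_bool (P \<G> (\<beta>(y := v))))"
        using fv by (simp add: Int_def)
      also have "\<dots> = (\<Sum>v\<in>vs \<G>. \<Sum>\<tau>\<in>TY. of_bool (ut L \<G> v = \<tau>) * (\<Sum>F\<in>Pow T. co \<tau> F * of_bool (F \<subseteq> links fs X \<G> \<beta> v)))"
      proof (rule sum.cong[OF refl])
        fix v assume v: "v \<in> vs \<G>"
        have "ut L \<G> v \<in> TY" by (auto simp: TY_def ut_def)
        then have "(\<Sum>\<tau>\<in>TY. of_bool (ut L \<G> v = \<tau>) * (\<Sum>F\<in>Pow T. co \<tau> F * of_bool (F \<subseteq> links fs X \<G> \<beta> v))) =
          (\<Sum>F\<in>Pow T. co (ut L \<G> v) F * of_bool (F \<subseteq> links fs X \<G> \<beta> v))"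
          using fin(1) by (simp add: of_bool_def if_distrib[of "\<lambda>b. b * _"] cong: if_cong)
        also have "\<dots> = of_bool (B (ut L \<G> v) (links fs X \<G> \<beta> v))" by (rule co[symmetric]) (auto simp: links_def T_def)
        also have "\<dots> = of_bool (P \<G> (\<beta>(y := v)))" using B[OF a v] by simp
        finally show "of_bool (P \<G> (\<beta>(y := v))) = (\<Sum>\<tau>\<in>TY. of_bool (ut L \<G> v = \<tau>) * (\<Sum>F\<in>Pow T. co \<tau> F * of_bool (F \<subseteq> links fs X \<G> \<beta> v)))" ..
      qed
      also have "\<dots> = (\<Sum>v\<in>vs \<G>. \<Sum>j\<in>TY \<times> Pow T. co (fst j) (snd j) * of_bool (ut L \<G> v = fst j \<and> snd j \<subseteq> links fs X \<G> \<beta> v))"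
        by (simp add: sum.cartesian_product sum_distrib_left case_prod_beta of_bool_conj ac_simps)
      also have "\<dots> = (\<Sum>j\<in>TY \<times> Pow T. \<Sum>v\<in>vs \<G>. co (fst j) (snd j) * of_bool (ut L \<G> v = fst j \<and> snd j \<subseteq> links fs X \<G> \<beta> v))"
        by (rule sum.swap)
      also have "\<dots> = (\<Sum>j\<in>TY \<times> Pow T. co (fst j) (snd j) * int (card {v \<in> vs \<G>. ut L \<G> v = fst j \<and> snd j \<subseteq> links fs X \<G> \<beta> v}))"
        using fv by (simp add: sum_distrib_left[symmetric] Int_def)
      also have "\<dots> = (\<Sum>j\<in>TY \<times> Pow T. w j * t j \<G> (\<beta> (xj j)))"
      proof (rule sum.cong[OF refl])
        fix i assume i: "i \<in> TY \<times> Pow T"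
        have "Cj i \<kappa> \<gamma> = Cj i \<G> \<beta>" using j[OF i] \<kappa> a unfolding qf_def by blast
        moreover have "int (card {v \<in> vs \<G>. ut L \<G> v = fst i \<and> snd i \<subseteq> links fs X \<G> \<beta> v}) =
          (if Cj i \<G> \<beta> then t i \<G> (\<beta> (xj i)) else 0)" using j[OF i] a unfolding t_def by blast
        ultimately show "co (fst i) (snd i) * int (card {v \<in> vs \<G>. ut L \<G> v = fst i \<and> snd i \<subseteq> links fs X \<G> \<beta> v}) =
          w i * t i \<G> (\<beta> (xj i))" by (simp add: w_def)
      qed
      also have "\<dots> = (\<Sum>x\<in>X. \<Sum>i\<in>{i \<in> TY \<times> Pow T. xj i = x}. w i * t i \<G> (\<beta> (xj i)))"
        using j by (intro sum.group[symmetric] finJ X(1)) auto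
      also have "\<dots> = (\<Sum>x\<in>X. c x \<G> (\<beta> x))" unfolding c_def by (intro sum.cong refl) auto
      finally show ?thesis .
    qed
    show ?thesis by (rule exI[of _ c], rule exI[of _ k]) (use c1 c2 c3 in blast)
  qed
  show ?thesis by (rule exI[of _ fs'], rule exI[of _ S'], intro conjI ballI allI impI) (fact f'(1-3) S'1 S'2 main)+
qed

end

section \<open>Clauses and the expanded structures\<close>

lemma copy_table:
  assumes "j < s"
  shows "exec_phase n (1, [(j, Ctr, Ld s Ctr, k)]) M =
    (\<lambda>a. if a \<in> {j * n..<j * n + n} then clamp (k * n) (M (s * n + (a - j * n))) else M a)"
proof -
  have fold: "fold (\<lambda>i x. if i = z then g i else x) (rev [0..<m]) x = (if z < m then g z else x)"
    for g and z m :: nat and x :: int by (induction m arbitrary: x) (auto simp: less_Suc_eq)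
  have "exec_phase n (1, [(j, Ctr, Ld s Ctr, k)]) M =
    (\<lambda>a. if a \<in> {j * n..<j * n + n}
      then fold (\<lambda>i x. if i = a - j * n then clamp (k * n) (M (s * n + i)) else x) (rev [0..<n]) (M a) else M a)"
  proof (rule fold_pass[where F = "\<lambda>i. i" and G = "\<lambda>i x. M (s * n + i)"])
    fix M' i assume a: "\<forall>a. a \<notin> {j * n..<j * n + n} --> M' a = M a" "i < n"
    have "(j + 1) * n \<le> s * n" using assms by (intro mult_le_mono1) simp
    then have "M' (s * n + i) = M (s * n + i)" using a(1) by simp
    moreover have "nat (int (s * n) + int i) = s * n + i" by linarith
    ultimately show "eval n (int i) M' Ctr = int i \<and> i < n \<and> eval n (int i) M' (Ld s Ctr) = M (s * n + i)"
      using a(2) by (simp only: eval.simps simp_thms)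
  qed
  also have "\<dots> = (\<lambda>a. if a \<in> {j * n..<j * n + n} then clamp (k * n) (M (s * n + (a - j * n))) else M a)"
  proof
    fix a
    show "(if a \<in> {j * n..<j * n + n}
      then fold (\<lambda>i x. if i = a - j * n then clamp (k * n) (M (s * n + i)) else x) (rev [0..<n]) (M a) else M a) =
      (if a \<in> {j * n..<j * n + n} then clamp (k * n) (M (s * n + (a - j * n))) else M a)"
      unfolding fold by auto
  qed
  finally show ?thesis .
qed

text \<open>The output has to stand at the beginning of memory. Copying in increasing order is safe:
  when table \<open>J + j\<close> is read, only tables below j have been overwritten.\<close>

lemma copy_tables:
  assumes "J > 0"
  shows "exec_prog n (map (\<lambda>j. (1, [(j, Ctr, Ld (J + j) Ctr, k)])) [0..<L]) M =
    (\<lambda>a. if a < L * n then clamp (k * n) (M (J * n + a)) else M a)"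
proof (induction L)
  case 0 then show ?case by (simp add: exec_prog_def)
next
  case (Suc L)
  let ?M = "\<lambda>a. if a < L * n then clamp (k * n) (M (J * n + a)) else M a"
  have "exec_prog n (map (\<lambda>j. (1, [(j, Ctr, Ld (J + j) Ctr, k)])) [0..<Suc L]) M =
    exec_phase n (1, [(L, Ctr, Ld (J + L) Ctr, k)]) ?M"
    unfolding Suc[symmetric] by (simp add: exec_prog_def del: exec_phase.simps)
  also have "\<dots> = (\<lambda>a. if a \<in> {L * n..<L * n + n} then clamp (k * n) (?M ((J + L) * n + (a - L * n))) else ?M a)"
    by (rule copy_table) (use assms in simp)
  also have "\<dots> = (\<lambda>a. if a < Suc L * n then clamp (k * n) (M (J * n + a)) else M a)"
  proof
    fix a
    have e: "(J + L) * n + (a - L * n) = J * n + a" if "L * n \<le> a" using that by (simp add: add_mult_distrib)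
    have l: "\<not> J * n + a < L * n" if "L * n \<le> a" using that by simp
    show "(if a \<in> {L * n..<L * n + n} then clamp (k * n) (?M ((J + L) * n + (a - L * n))) else ?M a) =
      (if a < Suc L * n then clamp (k * n) (M (J * n + a)) else M a)"
    proof (cases "L * n \<le> a")
      case True then show ?thesis unfolding e[OF True] using l[OF True] by (simp add: add.commute)
    next
      case False then show ?thesis by simp
    qed
  qed
  finally show ?case .
qed

lemma set_ext: "set (ext A \<Omega>) = And A ` set \<Omega> \<union> And (Neg A) ` set \<Omega>"
proof -
  have "set (fold (\<lambda>c acc. And A c # And (Neg A) c # acc) \<Omega> acc) = And A ` set \<Omega> \<union> And (Neg A) ` set \<Omega> \<union> set acc" for acc
    by (induction \<Omega> arbitrary: acc) auto
  then show ?thesis by (simp add: ext_def)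
qed

lemma distinct_ext: "distinct \<Omega> ==> distinct (ext A \<Omega>)"
proof -
  have ne: "A \<noteq> Neg A" by (induction A) auto
  have "distinct (fold (\<lambda>c acc. And A c # And (Neg A) c # acc) \<Omega> acc)"
    if "distinct \<Omega>" "distinct acc" "\<forall>c\<in>set \<Omega>. And A c \<notin> set acc \<and> And (Neg A) c \<notin> set acc" for acc
    using that
  proof (induction \<Omega> arbitrary: acc)
    case (Cons c \<Omega>)
    have "distinct (fold (\<lambda>c acc. And A c # And (Neg A) c # acc) \<Omega> (And A c # And (Neg A) c # acc))"
    proof (rule Cons.IH)
      show "distinct \<Omega>" "distinct (And A c # And (Neg A) c # acc)" using Cons.prems ne by auto
      show "\<forall>d\<in>set \<Omega>. And A d \<notin> set (And A c # And (Neg A) c # acc) \<and> And (Neg A) d \<notin> set (And A c # And (Neg A) c # acc)"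
      proof
        fix d assume d: "d \<in> set \<Omega>"
        then have "d \<noteq> c" using Cons.prems(1) by auto
        then show "And A d \<notin> set (And A c # And (Neg A) c # acc) \<and> And (Neg A) d \<notin> set (And A c # And (Neg A) c # acc)"
          using Cons.prems(3) d by simp
      qed
    qed
    then show ?case by simp
  qed simp
  then show "distinct \<Omega> ==> distinct (ext A \<Omega>)" by (simp add: ext_def)
qed

lemma fold_ext_invariant:
  assumes "\<And>c. c \<in> set \<Omega> ==> I c" "\<And>A c. A \<in> set As ==> I c ==> I (And A c) \<and> I (And (Neg A) c)"
  shows "\<omega> \<in> set (fold ext As \<Omega>) ==> I \<omega>"
  using assms(2)
proof (induction As arbitrary: \<omega> rule: rev_induct)
  case (snoc A As) then show ?case by (auto simp: set_ext)
qed (use assms(1) in simp)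

lemma fold_ext_unique:
  "\<exists>!\<omega>. \<omega> \<in> set \<Omega> \<and> sat G \<beta> \<omega> ==> \<exists>!\<omega>. \<omega> \<in> set (fold ext As \<Omega>) \<and> sat G \<beta> \<omega>"
proof (induction As rule: rev_induct)
  case (snoc A As)
  then obtain c where c: "c \<in> set (fold ext As \<Omega>)" "sat G \<beta> c"
    "\<And>d. d \<in> set (fold ext As \<Omega>) ==> sat G \<beta> d ==> d = c" by blast
  let ?\<omega> = "And (if sat G \<beta> A then A else Neg A) c"
  show ?case
  proof (rule ex1I[of _ ?\<omega>])
    show "?\<omega> \<in> set (fold ext (As @ [A]) \<Omega>) \<and> sat G \<beta> ?\<omega>" using c(1,2) by (auto simp: set_ext)
    fix \<omega> assume "\<omega> \<in> set (fold ext (As @ [A]) \<Omega>) \<and> sat G \<beta> \<omega>"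
    then obtain d where d: "d \<in> set (fold ext As \<Omega>)" "sat G \<beta> d" "\<omega> = And A d \<and> sat G \<beta> A \<or> \<omega> = And (Neg A) d \<and> \<not> sat G \<beta> A"
      by (auto simp: set_ext)
    then show "\<omega> = ?\<omega>" using c(3)[OF d(1,2)] by auto
  qed
qed simp

text \<open>Each atom occurs in the clause with one of the two signs, so two assignments satisfying
  the clause agree on it.\<close>

lemma fold_ext_complete:
  "\<omega> \<in> set (fold ext As \<Omega>) ==> sat G \<beta> \<omega> ==> sat G' \<beta>' \<omega> ==> A \<in> set As ==> sat G \<beta> A = sat G' \<beta>' A"
proof (induction As arbitrary: \<omega> rule: rev_induct)
  case (snoc B As)
  then obtain c where c: "c \<in> set (fold ext As \<Omega>)" "\<omega> = And B c \<or> \<omega> = And (Neg B) c" by (auto simp: set_ext)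
  then have s: "sat G \<beta> c" "sat G' \<beta>' c" "sat G \<beta> B = sat G' \<beta>' B" using snoc.prems(2,3) by auto
  show ?case using snoc.IH[OF c(1) s(1,2)] s(3) snoc.prems(4) by auto
qed simp

lemma in_atoms: "A \<in> set (atoms N xs) \<longleftrightarrow> (\<exists>x\<in>set xs. \<exists>i\<in>{0..<N}. A = pred_atom x i) \<or>
    (\<exists>x\<in>set xs. \<exists>x'\<in>set xs. \<exists>i\<in>{0..<N}. A = eq_atom x x' i)"
  by (simp add: atoms_def image_iff)

lemma clauses_props:
  assumes "xs \<noteq> []" "N > 0"
  shows "distinct (clauses N xs)"
    "\<omega> \<in> set (clauses N xs) ==> conjunctive_clause \<omega> \<and> has_signature \<lparr>fsig = {0..<N}, psig = {0..<N}\<rparr> \<omega> \<and> free_vars \<omega> \<subseteq> set xs"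
    "\<exists>!\<omega>. \<omega> \<in> set (clauses N xs) \<and> sat G \<beta> \<omega>"
proof -
  let ?\<rho> = "\<lparr>fsig = {0..<N}, psig = {0..<N}\<rparr>"
  have "distinct (fold ext As \<Omega>)" if "distinct \<Omega>" for As \<Omega>
    using that by (induction As arbitrary: \<Omega>) (auto intro: distinct_ext)
  then show "distinct (clauses N xs)" by (simp add: clauses_def)
  have sel: "pfst i < N" "psnd i < N" if "i < N" for i
    using le_prod_encode_1[of "pfst i" "psnd i"] le_prod_encode_2[of "psnd i" "pfst i"] that by simp_all
  have at: "literal A \<and> literal (Neg A) \<and> has_signature ?\<rho> A \<and> free_vars A \<subseteq> set xs" if A: "A \<in> set (atoms N xs)" for A
  proof -
    consider x i where "A = pred_atom x i" "x \<in> set xs" "i \<in> {0..<N}"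
      | x x' i where "A = eq_atom x x' i" "x \<in> set xs" "x' \<in> set xs" "i \<in> {0..<N}" using A unfolding in_atoms by blast
    then show ?thesis by cases (simp_all add: pred_atom_def eq_atom_def literal.intros sel)
  qed
  show "\<omega> \<in> set (clauses N xs) ==> conjunctive_clause \<omega> \<and> has_signature ?\<rho> \<omega> \<and> free_vars \<omega> \<subseteq> set xs"
    unfolding clauses_def
  proof (erule fold_ext_invariant[rotated 2])
    fix c assume "c \<in> set [Eq (Var (hd xs)) (Var (hd xs))]"
    then show "conjunctive_clause c \<and> has_signature ?\<rho> c \<and> free_vars c \<subseteq> set xs"
      using assms(1) by (auto intro: literal.intros conjunctive_clause.intros)
  next
    fix A c assume "A \<in> set (atoms N xs)" "conjunctive_clause c \<and> has_signature ?\<rho> c \<and> free_vars c \<subseteq> set xs"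
    then show "(conjunctive_clause (And A c) \<and> has_signature ?\<rho> (And A c) \<and> free_vars (And A c) \<subseteq> set xs) \<and>
       conjunctive_clause (And (Neg A) c) \<and> has_signature ?\<rho> (And (Neg A) c) \<and> free_vars (And (Neg A) c) \<subseteq> set xs"
      using at by (auto intro: conjunctive_clause.intros)
  qed
  show "\<exists>!\<omega>. \<omega> \<in> set (clauses N xs) \<and> sat G \<beta> \<omega>"
    unfolding clauses_def by (rule fold_ext_unique) auto
qed

lemma prod_encode_mono: "a \<le> c ==> b \<le> d ==> prod_encode (a, b) \<le> prod_encode (c, d)"
proof -
  have "triangle m \<le> triangle n" if "m \<le> n" for m n using that by (induction rule: dec_induct) auto
  then show "a \<le> c ==> b \<le> d ==> prod_encode (a, b) \<le> prod_encode (c, d)"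
    by (simp add: prod_encode_def add_mono)
qed

lemma elem_encode: "elem (\<lambda>Z. prod_encode (b + Z, b + Z) + 1)"
proof (rule elem_mono)
  show "elem (\<lambda>Z. (b + Z + (b + Z)) * (b + Z + (b + Z) + 1) + (b + Z) + 1)" by (intro elem_intros)
  fix Z
  have "triangle n \<le> n * (n + 1)" for n by (simp add: triangle_def)
  then show "prod_encode (b + Z, b + Z) + 1 \<le> (b + Z + (b + Z)) * (b + Z + (b + Z) + 1) + (b + Z) + 1"
    unfolding prod_encode_def by simp
qed

section \<open>Output of the tables, and the size of the final family\<close>

context structure_class
begin

lemma lin_output:
  assumes "lin S" and os: "\<And>t. t \<in> set os ==> t \<in> pw S \<and> (\<forall>\<G>\<in>insts. \<forall>v\<in>vs \<G>. \<bar>t \<G> v\<bar> \<le> int (k * sz \<G>))"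
  shows "\<exists>P c. \<forall>\<G>\<in>insts. computes_tables P (c * sz \<G>) (c * sz \<G>) (vs \<G>) (ix \<G>)
    (struc_tables \<sigma> (ix \<G>) (fst \<G>)) (map (\<lambda>t. t \<G>) os)"
proof -
  obtain ts0 where ts0: "Comp ts0" "S \<subseteq> set ts0" using assms(1) unfolding lin_def by blast
  \<comment> \<open>The extra zero table guarantees a positive distance between the output tables
    and their copies, even if \<open>ts0\<close> is empty.\<close>
  define ts where "ts = ts0 @ [\<lambda>_ _. 0]"
  have "Comp ts" unfolding ts_def by (rule Comp_pw[OF ts0 pw.const, of _ 0]) simp
  moreover have Sts: "S \<subseteq> set ts" using ts0(2) by (auto simp: ts_def)
  ultimately have "Comp (ts @ os)" using os
  proof (induction os rule: rev_induct)
    case (snoc t us)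
    have "S \<subseteq> set (ts @ us)" using Sts by auto
    moreover have "Comp (ts @ us)" using snoc by simp
    ultimately have "Comp ((ts @ us) @ [t])"
      using snoc.prems(3)[of t] by (intro Comp_pw[of _ S t k]) auto
    then show ?case by simp
  qed simp
  then obtain ps where ps: "\<And>\<G>. \<G> \<in> insts ==> rep \<G> (ts @ os) (exec_prog (sz \<G>) ps (start \<G>))"
    unfolding Comp_def by blast
  let ?J = "length ts" and ?L = "length os"
  define cp :: "phase list" where "cp = map (\<lambda>j. (1, [(j, Ctr, Ld (?J + j) Ctr, k)])) [0..<?L]"
  have J: "?J > 0" by (simp add: ts_def)
  have res: "exec_prog (sz \<G>) (ps @ cp) (start \<G>) a = tables (vs \<G>) (ix \<G>) (map (\<lambda>t. t \<G>) os) a"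
    if \<G>: "\<G> \<in> insts" and a: "a < ?L * sz \<G>" for \<G> a
  proof -
    let ?n = "sz \<G>" and ?M = "exec_prog (sz \<G>) ps (start \<G>)"
    have n: "?n > 0" by (rule insts(3)[OF \<G>])
    define j i where "j = a div ?n" and "i = a mod ?n"
    have ji: "j < ?L" "i < ?n" "a = j * ?n + i" using a n by (auto simp: j_def i_def less_mult_imp_div_less)
    have "exec_prog ?n (ps @ cp) (start \<G>) a = exec_prog ?n cp ?M a" by (simp add: exec_prog_def)
    also have "\<dots> = clamp (k * ?n) (?M (?J * ?n + a))" unfolding cp_def copy_tables[OF J] using a by simp
    also have "?J * ?n + a = (?J + j) * ?n + i" using ji(3) by (simp add: add_mult_distrib)
    also have "?M \<dots> = ((ts @ os) ! (?J + j)) \<G> (vx \<G> i)"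
      using ps[OF \<G>] ji(1,2) unfolding rep_def agree_def by auto
    also have "\<dots> = (os ! j) \<G> (vx \<G> i)" by simp
    also have "clamp (k * ?n) \<dots> = (os ! j) \<G> (vx \<G> i)"
      using os[OF nth_mem[OF ji(1)]] \<G> insts(5)[OF \<G> ji(2)] by (simp add: clamp_def)
    also have "\<dots> = tables (vs \<G>) (ix \<G>) (map (\<lambda>t. t \<G>) os) a"
      using a ji(1) by (simp add: tables_def j_def i_def)
    finally show ?thesis .
  qed
  have st: "\<bar>start \<G> a\<bar> \<le> int (sz \<G>)" if \<G>: "\<G> \<in> insts" for \<G> a
  proof (cases "a < length (struc_tables \<sigma> (ix \<G>) (fst \<G>)) * sz \<G>")
    case True
    have t: "\<bar>t v\<bar> \<le> int (sz \<G>)" if m: "t \<in> set (struc_tables \<sigma> (ix \<G>) (fst \<G>))" and v: "v \<in> vs \<G>" for t v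
    proof -
      consider f where "f \<in> fsig \<sigma>" "t = (\<lambda>v. int (ix \<G> (fint (fst \<G>) f v)))" | p where "t = (\<lambda>v. of_bool (v \<in> pint (fst \<G>) p))"
        using m fsig_props(1) finite_psig unfolding struc_tables_def by auto
      then show ?thesis
      proof cases
        case 1
        have "fint (fst \<G>) f v \<in> vs \<G>" using inst_Fun[OF \<G>] 1(1) v unfolding Fun_def by blast
        then show ?thesis using insts(4)[OF \<G>] 1(2) by (simp add: less_imp_le)
      next
        case 2 then show ?thesis using insts(3)[OF \<G>] by simp
      qed
    qed
    have "a mod sz \<G> < sz \<G>" using insts(3)[OF \<G>] by simp
    then have "vx \<G> (a mod sz \<G>) \<in> vs \<G>" by (rule insts(5)[OF \<G>])
    then show ?thesis using True t[OF nth_mem[OF less_mult_imp_div_less[OF True]]] by (simp add: start_def tables_def)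
  next
    case False then show ?thesis by (simp add: start_def tables_def)
  qed
  obtain P c where Pc: "\<And>n M. 1 \<le> n ==> \<forall>a. \<bar>M a\<bar> \<le> int n ==>
     (\<exists>t R. t \<le> c * n \<and> run (\<lambda>_. 0) P t (0, (\<lambda>_. 0)(0 := int n), M) = (length P, R, exec_prog n (ps @ cp) M) \<and>
       (\<forall>k\<le>t. bdd (c * n) (snd (run (\<lambda>_. 0) P k (0, (\<lambda>_. 0)(0 := int n), M)))))"
    using linear_program[of "ps @ cp"] by blast
  have "computes_tables P (c * sz \<G>) (c * sz \<G>) (vs \<G>) (ix \<G>) (struc_tables \<sigma> (ix \<G>) (fst \<G>)) (map (\<lambda>t. t \<G>) os)"
    if \<G>: "\<G> \<in> insts" for \<G>
  proof -
    have n: "1 \<le> sz \<G>" using insts(3)[OF \<G>] by simp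
    obtain t R where t: "t \<le> c * sz \<G>"
      "run (\<lambda>_. 0) P t (0, (\<lambda>_. 0)(0 := int (sz \<G>)), start \<G>) = (length P, R, exec_prog (sz \<G>) (ps @ cp) (start \<G>))"
      "\<And>k. k \<le> t ==> bdd (c * sz \<G>) (snd (run (\<lambda>_. 0) P k (0, (\<lambda>_. 0)(0 := int (sz \<G>)), start \<G>)))"
      using Pc[OF n, of "start \<G>"] st[OF \<G>] by blast
    show ?thesis
      unfolding computes_tables_def Let_def start_def[symmetric]
    proof (rule exI[of _ t], intro conjI allI impI)
      show "t \<le> c * sz \<G>" by (rule t(1))
      show "halted P (run (\<lambda>_. 0) P t (0, (\<lambda>_. 0)(0 := int (sz \<G>)), start \<G>))" unfolding t(2) by (simp add: halted_def)
      fix s assume "s \<le> t"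
      from t(3)[OF this] show "case run (\<lambda>_. 0) P s (0, (\<lambda>_. 0)(0 := int (sz \<G>)), start \<G>) of
          (pc, R, M) => \<forall>a. \<bar>R a\<bar> \<le> int (c * sz \<G>) \<and> \<bar>M a\<bar> \<le> int (c * sz \<G>)"
        by (auto simp: bdd_def split: prod.splits)
    next
      fix a assume "a < length (map (\<lambda>t. t \<G>) os) * sz \<G>"
      then show "snd (snd (run (\<lambda>_. 0) P t (0, (\<lambda>_. 0)(0 := int (sz \<G>)), start \<G>))) a =
          tables (vs \<G>) (ix \<G>) (map (\<lambda>t. t \<G>) os) a" unfolding t(2) using res[OF \<G>] by simp
    qed
  qed
  then show ?thesis by blast
qed

definition counts :: "'v vfn list => 'v table set => form => nat => nat set => bool" where
  "counts fs S \<phi> y X \<longleftrightarrow> (\<forall>\<kappa>\<in>insts. \<forall>\<gamma>. \<gamma> ` X \<subseteq> vs \<kappa> --> (\<exists>c k. (\<forall>x\<in>X. c x \<in> pw S) \<and>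
      (\<forall>x\<in>X. \<forall>\<G>\<in>insts. \<forall>v\<in>vs \<G>. \<bar>c x \<G> v\<bar> \<le> int (k * sz \<G>)) \<and>
      (\<forall>\<G>\<in>insts. \<forall>\<beta>. \<beta> ` X \<subseteq> vs \<G> --> same fs X \<kappa> \<gamma> \<G> \<beta> -->
        int (card {v \<in> vs \<G>. sat (fst \<G>) (\<beta>(y := v)) \<phi>}) = (\<Sum>x\<in>X. c x \<G> (\<beta> x)))))"

text \<open>The size of the family must be bounded by one computable function of the query, with a
  constant a that does not depend on the query. The members will be named by the numbers from b on,
  and atoms are indexed by codes of pairs of symbols, so the bound has to exceed the code of a pair
  with both entries \<open>b + length fs\<close>.\<close>

theorem family_exists:
  assumes g: "expansion_bound g (underlying \<sigma> ` \<C>)"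
  shows "\<exists>a. \<forall>\<phi> y xs. has_signature \<sigma> \<phi> --> xs \<noteq> [] --> distinct (y # xs) --> free_vars \<phi> \<subseteq> set (y # xs) -->
    (\<exists>fs S. fam fs \<and> set basic \<subseteq> set fs \<and> prod_encode (b + length fs, b + length fs) < sig_bound g a (query_code \<phi> y xs) \<and>
      lin S \<and> PT \<union> enc ` set fs \<subseteq> S \<and> counts fs S \<phi> y (set xs))"
proof -
  obtain c1 where c1: "\<And>X. elim_size X \<le> tower c1 X" using elem_elim_size unfolding elem_def by blast
  obtain c2 where c2: "\<And>X. comp_size X \<le> tower c2 X" using elem_comp_size unfolding elem_def by blast
  obtain c3 where c3: "\<And>X. prod_encode (b + X, b + X) + 1 \<le> tower c3 X" using elem_encode unfolding elem_def by blast
  \<comment> \<open>The tower heights for elimination, composition and pairing, and the sizes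
    belonging to \<sigma>; the 3 makes \<open>a * (m + 1)\<close> exceed the number of
    rounds.\<close>
  define a where "a = c1 + c2 + c3 + card (psig \<sigma>) + length (basic :: 'v vfn list) + 3"
  show ?thesis
  proof (rule exI[of _ a], intro allI impI)
    fix \<phi> y xs assume \<phi>: "has_signature \<sigma> \<phi>" "xs \<noteq> []" "distinct (y # xs)" "free_vars \<phi> \<subseteq> set (y # xs)"
    define m where "m = query_code \<phi> y xs"
    define n d where "n = quantifiers \<phi>" and "d = form_code \<phi>"
    define k where "k = a * (m + 1)"
    define X0 where "X0 = radius k + g (radius k) + m + a"
    have dm: "d + list_encode (y # xs) \<le> m" unfolding m_def query_code_def d_def by (rule add_le_prod_encode)
    have nd: "n \<le> d" unfolding n_def d_def by (rule quantifiers_le_code)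
    have lm: "d + (length xs + 1) \<le> m" using dm length_le_list_encode[of "y # xs"] by simp
    have "3 * (m + 1) \<le> k" unfolding k_def by (rule mult_le_mono1) (simp add: a_def)
    then have k: "1 + n + d \<le> k" using nd lm by simp
    have X0: "radius k \<le> X0" "m \<le> X0" "a \<le> X0" by (simp_all add: X0_def)
    \<comment> \<open>The rank is budgeted for d rounds of composition, n eliminations and the final
      round for counting.\<close>
    have q0: "quant basic X0 (radius (1 + n + d))"
    proof (rule quant_mono[OF fam_basic(2)[OF g, of "radius k"]])
      show "g (radius k) + length (basic :: 'v vfn list) + 1 \<le> X0" by (simp add: X0_def a_def)
      show "radius (1 + n + d) \<le> radius k" using k by (rule radius_mono)
    qed
    have r0: "radius (1 + n + d) \<le> X0" using radius_mono[OF k] X0(1) by simp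
    define fs1 where "fs1 = closure d (basic :: 'v vfn list)"
    define Y1 where "Y1 = tower (c2 * d) X0"
    from closure_quant[OF c2 fam_basic(1)[OF g] q0 r0]
    have f1: "fam fs1" "set basic \<subseteq> set fs1" "quant fs1 Y1 (radius (1 + n))" by (auto simp: fs1_def Y1_def)
    have Y1: "X0 \<le> Y1" unfolding Y1_def by (rule tower_ge)
    have rt: "\<forall>t\<in>terms \<phi>. rterm fs1 t"
    proof
      fix t assume t: "t \<in> terms \<phi>"
      have "depth t \<le> d" using depth_le_code[of t] terms_le_code[OF t] by (simp add: d_def)
      then show "rterm fs1 t" unfolding fs1_def by (rule rterm_closure[OF fam_basic(1)[OF g] terms_funs[OF \<phi>(1) t]])
    qed
    have "\<exists>fs2. fam fs2 \<and> set fs1 \<subseteq> set fs2 \<and> quant fs2 (tower (c1 * quantifiers \<phi>) Y1) (radius 1) \<and>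
       qf fs2 (insert y (set xs)) (\<lambda>\<G> \<beta>. sat (fst \<G>) \<beta> \<phi>)"
    proof (rule quantifier_elimination[OF c1 f1(1) _ _ _ \<phi>(1) rt])
      show "quant fs1 Y1 (radius (1 + quantifiers \<phi>))" using f1(3) by (simp add: n_def)
      have "radius (1 + n) \<le> radius (1 + n + d)" by (rule radius_mono) simp
      then show "radius (1 + quantifiers \<phi>) \<le> Y1" using r0 Y1 by (simp add: n_def)
      show "card (psig \<sigma>) \<le> Y1" using X0(3) Y1 by (simp add: a_def)
      show "free_vars \<phi> \<subseteq> insert y (set xs)" using \<phi>(4) by simp
      have "card (insert y (set xs)) \<le> length xs + 1" using card_length[of "y # xs"] by simp
      then show "card (insert y (set xs)) + quantifiers \<phi> \<le> Y1" using nd lm X0(2) Y1 by (simp add: n_def)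
    qed auto
    then obtain fs2 where f2: "fam fs2" "set fs1 \<subseteq> set fs2" "quant fs2 (tower (c1 * n) Y1) (radius 1)"
       "qf fs2 (insert y (set xs)) (\<lambda>\<G> \<beta>. sat (fst \<G>) \<beta> \<phi>)" unfolding n_def by blast
    define Y2 where "Y2 = tower (c1 * n) Y1"
    have Y2: "Y1 \<le> Y2" unfolding Y2_def by (rule tower_ge)
    have q2: "quant fs2 Y2 (8 * 0 + 7)" using f2(3) by (simp add: Y2_def radius_def)
    have "radius 1 \<le> radius (1 + n + d)" by (rule radius_mono) simp
    then have Y27: "8 * 0 + 7 \<le> Y2" using r0 Y1 Y2 by (simp add: radius_def)
    obtain x0 where x0: "x0 \<in> set xs" using \<phi>(2) by (cases xs) auto
    have y: "y \<notin> set xs" using \<phi>(3) by simp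
    have "\<exists>fs S. fam fs \<and> set fs2 \<subseteq> set fs \<and> quant fs (elim_size Y2) 0 \<and> lin S \<and> PT \<union> enc ` set fs \<subseteq> S \<and> counts fs S \<phi> y (set xs)"
      unfolding counts_def by (rule counting[where P = "\<lambda>\<G> \<beta>. sat (fst \<G>) \<beta> \<phi>", OF f2(1) q2 Y27 f2(4) finite_set x0 y])
    then obtain fs S where f: "fam fs" "set fs2 \<subseteq> set fs" "quant fs (elim_size Y2) 0"
      "lin S" "PT \<union> enc ` set fs \<subseteq> S" "counts fs S \<phi> y (set xs)" by (elim exE conjE)
    have "length fs \<le> elim_size Y2" using f(3) by (simp add: quant_def)
    also have "\<dots> \<le> tower c1 Y2" by (rule c1)
    finally have len: "length fs \<le> tower c1 Y2" .
    have "prod_encode (b + length fs, b + length fs) + 1 \<le> tower c3 (length fs)" by (rule c3)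
    also have "\<dots> \<le> tower c3 (tower c1 Y2)" using len by (rule tower_mono)
    also have "\<dots> = tower (c3 + (c1 + (c1 * n + c2 * d))) X0" by (simp add: Y2_def Y1_def tower_add)
    also have "\<dots> \<le> tower k X0"
    proof (rule tower_mono1)
      have "n \<le> m" "d \<le> m" using nd lm by auto
      then have "c3 + (c1 + (c1 * n + c2 * d)) \<le> c3 + (c1 + (c1 * m + c2 * m))" by (intro add_mono mult_le_mono le_refl)
      also have "\<dots> \<le> (c1 + c2 + c3) * (m + 1)" by (simp add: algebra_simps)
      also have "\<dots> \<le> k" unfolding k_def by (rule mult_le_mono1) (simp add: a_def)
      finally show "c3 + (c1 + (c1 * n + c2 * d)) \<le> k" .
    qed
    also have "\<dots> = sig_bound g a m" by (simp add: sig_bound_def k_def X0_def)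
    finally have "prod_encode (b + length fs, b + length fs) < sig_bound g a (query_code \<phi> y xs)" by (simp add: m_def)
    moreover have "set basic \<subseteq> set fs" using f1(2) f2(2) f(2) by blast
    ultimately show "\<exists>fs S. fam fs \<and> set basic \<subseteq> set fs \<and> prod_encode (b + length fs, b + length fs) < sig_bound g a (query_code \<phi> y xs) \<and>
      lin S \<and> PT \<union> enc ` set fs \<subseteq> S \<and> counts fs S \<phi> y (set xs)" using f by blast
  qed
qed

end

section \<open>The expanded structures and the coefficients of a clause\<close>

context structure_class
begin

text \<open>The signature \<rho> is computed from a bound alone and hence contains all numbers below
  N, whatever the family is. Numbers of \<sigma> keep their meaning, those from b on name the
  family, and all others become the identity, which adds no edge.\<close>

definition symbol :: "nat => 'v vfn list => nat => 'v vfn" where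
  "symbol b fs i = (if i \<in> fsig \<sigma> then (\<lambda>\<G>. fint (fst \<G>) i) else if b \<le> i \<and> i < b + length fs then fs ! (i - b) else vid)"

definition expand :: "nat => 'v vfn list => 'v inst => 'v struc" where
  "expand b fs \<G> = \<lparr>univ = vs \<G>, fint = (\<lambda>i. symbol b fs i \<G>), pint = (\<lambda>p. if p \<in> psig \<sigma> then pint (fst \<G>) p else {})\<rparr>"

lemma symbol_in:
  assumes "set basic \<subseteq> set fs"
  shows "symbol b fs i \<in> set fs"
proof -
  consider "i \<in> fsig \<sigma>" | "i \<notin> fsig \<sigma>" "b \<le> i" "i < b + length fs" | "i \<notin> fsig \<sigma>" "\<not> (b \<le> i \<and> i < b + length fs)" by blast
  then show ?thesis
  proof cases
    case 1 then show ?thesis using subsetD[OF assms fint_near] by (simp add: symbol_def)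
  next
    case 2
    then have "i - b < length fs" by simp
    then show ?thesis using 2 by (simp add: symbol_def)
  next
    case 3
    have "vid \<in> set fs" using assms by (auto simp: set_basic)
    then show ?thesis unfolding symbol_def if_not_P[OF 3(1)] if_not_P[OF 3(2)] .
  qed
qed

lemma symbol_nth:
  assumes "\<forall>i\<in>fsig \<sigma>. i < b" "j < length fs"
  shows "symbol b fs (b + j) = fs ! j"
  using assms by (auto simp: symbol_def)

lemma expand_Fun:
  assumes "fam fs" "set basic \<subseteq> set fs" "\<G> \<in> insts"
  shows "expand b fs \<G> \<in> Fun \<rho>"
proof -
  have v: "vfun (symbol b fs i)" for i using assms(1) symbol_in[OF assms(2)] by (simp add: fam_def)
  have "fint (fst \<G>) f_id v = v" if "v \<in> vs \<G>" for v using inst_Fun[OF assms(3)] that by (simp add: Fun_def)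
  moreover have "pint (fst \<G>) p \<subseteq> vs \<G>" if "p \<in> psig \<sigma>" for p using inst_Fun[OF assms(3)] that by (simp add: Fun_def)
  ultimately show ?thesis
    using insts(1,2)[OF assms(3)] vfunD[OF v assms(3)] fsig_props(2)
    by (simp add: Fun_def expand_def) (simp add: symbol_def)
qed

lemma expand_sparse:
  assumes "fam fs" "set basic \<subseteq> set fs"
  shows "bounded_expansion (underlying \<rho> ` expand b fs ` insts)"
proof -
  obtain D where D: "\<And>r \<G>. \<G> \<in> insts ==> grad_le r (D r) (fgraph fs \<G>)"
    using assms(1) unfolding fam_def by metis
  have "grad_le r (D r) (underlying \<rho> (expand b fs \<G>))" if \<G>: "\<G> \<in> insts" for r \<G>
  proof (rule grad_le_subgraph[OF D[OF \<G>]])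
    show "edges (underlying \<rho> (expand b fs \<G>)) \<subseteq> edges (fgraph fs \<G>)"
    proof
      fix e assume "e \<in> edges (underlying \<rho> (expand b fs \<G>))"
      then obtain v i where e: "e = {symbol b fs i \<G> v, v}" "v \<in> vs \<G>" "symbol b fs i \<G> v \<noteq> v"
        by (auto simp: underlying_def arcs_def expand_def)
      have "(symbol b fs i) \<G> \<in> (\<lambda>f. f \<G>) ` set fs" using symbol_in[OF assms(2)] by (rule imageI)
      then show "e \<in> edges (fgraph fs \<G>)" unfolding fgraph_def fun_graph_def ugraph.simps using e by blast
    qed
  qed (simp add: underlying_def expand_def fgraph_def fun_graph_def)
  then have "expansion_bound D (underlying \<rho> ` expand b fs ` insts)"
    unfolding expansion_bound_def grad_le_def by blast
  then show ?thesis unfolding bounded_expansion_def by blast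
qed

text \<open>All pairs of symbols naming the family have codes below N, so their atoms are among
  those whose signs the clause fixes.\<close>

lemma clause_same:
  assumes b: "\<forall>i\<in>fsig \<sigma>. i < b" "\<forall>p\<in>psig \<sigma>. p < b" and N: "prod_encode (b + length fs, b + length fs) < N"
    and \<omega>: "\<omega> \<in> set (clauses N xs)" "sat (expand b fs \<kappa>) \<gamma> \<omega>" "sat (expand b fs \<G>) \<beta> \<omega>"
  shows "same fs (set xs) \<kappa> \<gamma> \<G> \<beta>"
proof -
  have at: "sat (expand b fs \<kappa>) \<gamma> A = sat (expand b fs \<G>) \<beta> A" if "A \<in> set (atoms N xs)" for A
    using fold_ext_complete[OF \<omega>(1)[unfolded clauses_def] \<omega>(2,3) that] .
  have N': "prod_encode (i, j) \<in> {0..<N}" if "i \<le> b + length fs" "j \<le> b + length fs" for i j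
    using prod_encode_mono[OF that] N by simp
  show ?thesis
    unfolding same_def
  proof (intro conjI ballI)
    fix x y f h assume a: "x \<in> set xs" "y \<in> set xs" "f \<in> set fs" "h \<in> set fs"
    obtain i where i: "i < length fs" "fs ! i = f" using a(3) by (auto simp: in_set_conv_nth)
    obtain j where j: "j < length fs" "fs ! j = h" using a(4) by (auto simp: in_set_conv_nth)
    have "prod_encode (b + i, b + j) \<in> {0..<N}" using i(1) j(1) by (intro N') auto
    then have "eq_atom x y (prod_encode (b + i, b + j)) \<in> set (atoms N xs)" using a unfolding in_atoms by blast
    from at[OF this] show "(f \<kappa> (\<gamma> x) = h \<kappa> (\<gamma> y)) = (f \<G> (\<beta> x) = h \<G> (\<beta> y))"
      using symbol_nth[OF b(1) i(1)] symbol_nth[OF b(1) j(1)] i(2) j(2) by (simp add: eq_atom_def expand_def)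
  next
    fix x f p assume a: "x \<in> set xs" "f \<in> set fs" "p \<in> psig \<sigma>"
    obtain i where i: "i < length fs" "fs ! i = f" using a(2) by (auto simp: in_set_conv_nth)
    have "p < b" using b(2) a(3) by blast
    then have "prod_encode (p, b + i) \<in> {0..<N}" using i(1) by (intro N') auto
    then have "pred_atom x (prod_encode (p, b + i)) \<in> set (atoms N xs)" using a unfolding in_atoms by blast
    from at[OF this] show "(f \<kappa> (\<gamma> x) \<in> pint (fst \<kappa>) p) = (f \<G> (\<beta> x) \<in> pint (fst \<G>) p)"
      using symbol_nth[OF b(1) i(1)] i(2) a(3) by (simp add: pred_atom_def expand_def)
  qed
qed

lemma computes_tables_mono:
  assumes "computes_tables P T W V e ins outs" "T \<le> T'" "W \<le> W'"
  shows "computes_tables P T' W' V e ins outs"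
proof -
  let ?c = "\<lambda>t. run (\<lambda>_. 0) P t (0, (\<lambda>_. 0)(0 := int (card V)), tables V e ins)"
  obtain t where t: "t \<le> T" "halted P (?c t)"
    "\<And>s. s \<le> t ==> (case ?c s of (pc, R, M) => \<forall>a. \<bar>R a\<bar> \<le> int W \<and> \<bar>M a\<bar> \<le> int W)"
    "\<forall>a<length outs * card V. snd (snd (?c t)) a = tables V e outs a"
    using assms(1) unfolding computes_tables_def Let_def by blast
  have "case ?c s of (pc, R, M) => \<forall>a. \<bar>R a\<bar> \<le> int W' \<and> \<bar>M a\<bar> \<le> int W'" if "s \<le> t" for s
  proof -
    obtain pc R M where c: "?c s = (pc, R, M)" by (cases "?c s")
    have "\<forall>a. \<bar>R a\<bar> \<le> int W \<and> \<bar>M a\<bar> \<le> int W" using t(3)[OF that] unfolding c by simp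
    moreover have "int W \<le> int W'" using assms(3) by simp
    ultimately have "\<forall>a. \<bar>R a\<bar> \<le> int W' \<and> \<bar>M a\<bar> \<le> int W'" using order_trans by blast
    then show ?thesis unfolding c by simp
  qed
  then show ?thesis unfolding computes_tables_def Let_def using t(1,2,4) assms(2) by (intro exI[of _ t]) auto
qed

text \<open>A clause satisfied somewhere in the class is represented by one such instance, whose
  pattern supplies the coefficients; a clause satisfied nowhere gets zeros. The sum of the
  individual bounds serves all clauses at once.\<close>

lemma clause_coefficients:
  assumes c: "counts fs S \<phi> y (set xs)"
    and same: "\<And>\<omega> \<kappa> \<gamma> \<G> \<beta>. \<omega> \<in> \<Omega> ==> sat (expand b fs \<kappa>) \<gamma> \<omega> ==> sat (expand b fs \<G>) \<beta> \<omega> ==> same fs (set xs) \<kappa> \<gamma> \<G> \<beta>"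
    and fin: "finite \<Omega>"
  shows "\<exists>c k. \<forall>\<omega>\<in>\<Omega>. (\<forall>x\<in>set xs. c \<omega> x \<in> pw S) \<and>
      (\<forall>x\<in>set xs. \<forall>\<G>\<in>insts. \<forall>v\<in>vs \<G>. \<bar>c \<omega> x \<G> v\<bar> \<le> int (k * sz \<G>)) \<and>
      (\<forall>\<G>\<in>insts. \<forall>\<beta>. \<beta> ` set xs \<subseteq> vs \<G> --> sat (expand b fs \<G>) \<beta> \<omega> -->
        int (card {v \<in> vs \<G>. sat (fst \<G>) (\<beta>(y := v)) \<phi>}) = (\<Sum>x\<in>set xs. c \<omega> x \<G> (\<beta> x)))"
proof -
  define good where "good \<omega> c k \<longleftrightarrow> (\<forall>x\<in>set xs. c x \<in> pw S) \<and>
      (\<forall>x\<in>set xs. \<forall>\<G>\<in>insts. \<forall>v\<in>vs \<G>. \<bar>c x \<G> v\<bar> \<le> int (k * sz \<G>)) \<and>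
      (\<forall>\<G>\<in>insts. \<forall>\<beta>. \<beta> ` set xs \<subseteq> vs \<G> --> sat (expand b fs \<G>) \<beta> \<omega> -->
        int (card {v \<in> vs \<G>. sat (fst \<G>) (\<beta>(y := v)) \<phi>}) = (\<Sum>x\<in>set xs. c x \<G> (\<beta> x)))" for \<omega> c k
  have "\<exists>c k. good \<omega> c k" if \<omega>: "\<omega> \<in> \<Omega>" for \<omega>
  proof (cases "\<exists>\<kappa>\<in>insts. \<exists>\<gamma>. \<gamma> ` set xs \<subseteq> vs \<kappa> \<and> sat (expand b fs \<kappa>) \<gamma> \<omega>")
    case True
    then obtain \<kappa> \<gamma> where k: "\<kappa> \<in> insts" "\<gamma> ` set xs \<subseteq> vs \<kappa>" "sat (expand b fs \<kappa>) \<gamma> \<omega>" by blast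
    from bspec[OF c[unfolded counts_def] k(1), THEN spec, THEN mp, OF k(2)] obtain c k where "\<forall>x\<in>set xs. c x \<in> pw S"
      "\<forall>x\<in>set xs. \<forall>\<G>\<in>insts. \<forall>v\<in>vs \<G>. \<bar>c x \<G> v\<bar> \<le> int (k * sz \<G>)"
      "\<forall>\<G>\<in>insts. \<forall>\<beta>. \<beta> ` set xs \<subseteq> vs \<G> --> same fs (set xs) \<kappa> \<gamma> \<G> \<beta> -->
        int (card {v \<in> vs \<G>. sat (fst \<G>) (\<beta>(y := v)) \<phi>}) = (\<Sum>x\<in>set xs. c x \<G> (\<beta> x))"
      by (elim exE conjE)
    then have "good \<omega> c k" unfolding good_def using same[OF \<omega> k(3)] by simp
    then show ?thesis by blast
  next
    case False
    then have "good \<omega> (\<lambda>_ _ _. 0) 0" unfolding good_def using pw.const[of 0] by simp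
    then show ?thesis by blast
  qed
  then obtain c k where ck: "\<And>\<omega>. \<omega> \<in> \<Omega> ==> good \<omega> (c \<omega>) (k \<omega>)" by metis
  let ?K = "\<Sum>\<omega>\<in>\<Omega>. k \<omega>"
  have "good \<omega> (c \<omega>) ?K" if \<omega>: "\<omega> \<in> \<Omega>" for \<omega>
  proof -
    have "k \<omega> \<le> ?K" using \<omega> fin by (intro member_le_sum) auto
    then have "int (k \<omega> * sz \<G>) \<le> int (?K * sz \<G>)" for \<G> :: "'v inst" by (simp add: mult_le_mono1 del: of_nat_mult)
    then show ?thesis using ck[OF \<omega>] order_trans unfolding good_def by blast
  qed
  then show ?thesis unfolding good_def by blast
qed

end

theorem theorem34:
  fixes \<sigma> :: signature
    and \<C> :: "'v struc set"
    and g :: "nat \<Rightarrow> nat"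
  assumes "functional_signature \<sigma>"
    and "\<C> \<subseteq> Fun \<sigma>"
    and "bounded_expansion (underlying \<sigma> ` \<C>)"
    and "expansion_bound g (underlying \<sigma> ` \<C>)"
  shows "\<exists>Q. \<forall>\<phi> y xs.
    has_signature \<sigma> \<phi> \<and> xs \<noteq> [] \<and> distinct (y # xs) \<and> free_vars \<phi> \<subseteq> set (y # xs) \<longrightarrow>
    (\<exists>\<rho> \<Omega>.
      computes g Q (query_code \<phi> y xs) (clauses_code \<rho> \<Omega>) \<and>
      functional_signature \<rho> \<and> sub_signature \<sigma> \<rho> \<and> distinct \<Omega> \<and>
      (\<forall>\<omega>\<in>set \<Omega>. conjunctive_clause \<omega> \<and> has_signature \<rho> \<omega> \<and> free_vars \<omega> \<subseteq> set xs) \<and>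
      (\<exists>\<C>' :: 'v struc set.
        \<C>' \<subseteq> Fun \<rho> \<and> bounded_expansion (underlying \<rho> ` \<C>') \<and>
        (\<exists>P K. \<forall>G\<in>\<C>. \<forall>e. bij_betw e (univ G) {..<card (univ G)} \<longrightarrow>
          (\<exists>G' (c :: form \<Rightarrow> nat \<Rightarrow> 'v \<Rightarrow> int).
            G' \<in> \<C>' \<and> expansion_of \<sigma> G G' \<and>
            computes_tables P (K * struc_size \<sigma> G) (K * struc_size \<sigma> G ^ K) (univ G) e
              (struc_tables \<sigma> e G)
              (struc_tables \<rho> e G' @ concat (map (\<lambda>\<omega>. map (c \<omega>) [0..<length xs]) \<Omega>)) \<and>
            (\<forall>\<omega>\<in>set \<Omega>. \<forall>i<length xs. \<forall>v\<in>univ G. \<bar>c \<omega> i v\<bar> \<le> int (K * card (univ G))) \<and>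
            (\<forall>us. length us = length xs \<and> set us \<subseteq> univ G \<longrightarrow>
              (\<exists>!\<omega>. \<omega> \<in> set \<Omega> \<and> sat G' (assign xs us) \<omega>) \<and>
              (\<forall>\<omega>\<in>set \<Omega>. sat G' (assign xs us) \<omega> \<longrightarrow>
                int (count G \<phi> y xs us) = (\<Sum>i<length xs. c \<omega> i (us ! i))))))))"
proof -
  let "\<exists>Q. \<forall>\<phi> y xs. ?H \<phi> y xs --> ?R Q \<phi> y xs" = ?thesis
  interpret structure_class \<sigma> \<C> using assms(1,2) by unfold_locales
  \<comment> \<open>Since b exceeds every symbol of \<sigma>, names from b on cannot clash with old
    ones.\<close>
  define b where "b = Suc (\<Sum>(fsig \<sigma> \<union> psig \<sigma>))"
  have "finite (fsig \<sigma> \<union> psig \<sigma>)" using fsig_props(1) finite_psig by simp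
  then have "i \<le> \<Sum>(fsig \<sigma> \<union> psig \<sigma>)" if "i \<in> fsig \<sigma> \<union> psig \<sigma>" for i using member_le_sum[OF that, of "\<lambda>i. i"] by simp
  then have b: "\<forall>i\<in>fsig \<sigma>. i < b" "\<forall>p\<in>psig \<sigma>. p < b" unfolding b_def by (simp_all add: le_imp_less_Suc)
  obtain a where a: "\<And>\<phi> y xs. has_signature \<sigma> \<phi> ==> xs \<noteq> [] ==> distinct (y # xs) ==> free_vars \<phi> \<subseteq> set (y # xs) ==>
    (\<exists>fs S. fam fs \<and> set basic \<subseteq> set fs \<and> prod_encode (b + length fs, b + length fs) < sig_bound g a (query_code \<phi> y xs) \<and>
      lin S \<and> PT \<union> enc ` set fs \<subseteq> S \<and> counts fs S \<phi> y (set xs))"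
    using family_exists[OF assms(4), of b] by blast
  obtain Q where Q: "\<And>\<phi> y xs. xs \<noteq> [] ==> (let N = sig_bound g a (query_code \<phi> y xs) in
     computes g Q (query_code \<phi> y xs) (clauses_code \<lparr>fsig = {0..<N}, psig = {0..<N}\<rparr> (clauses N xs)))"
    using clauses_computable[of g a] by blast
  show ?thesis
  proof (rule exI[of _ Q], intro allI impI, elim conjE)
    fix \<phi> y and xs :: "nat list"
    assume \<phi>: "has_signature \<sigma> \<phi>" "xs \<noteq> []" "distinct (y # xs)" "free_vars \<phi> \<subseteq> set (y # xs)"
    define N where "N = sig_bound g a (query_code \<phi> y xs)"
    define \<rho> where "\<rho> = \<lparr>fsig = {0..<N}, psig = {0..<N}\<rparr>"
    define \<Omega> where "\<Omega> = clauses N xs"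
    obtain fs S where fs: "fam fs" "set basic \<subseteq> set fs" "prod_encode (b + length fs, b + length fs) < N"
      "lin S" "PT \<union> enc ` set fs \<subseteq> S" "counts fs S \<phi> y (set xs)" using a[OF \<phi>] unfolding N_def by blast
    have comp: "computes g Q (query_code \<phi> y xs) (clauses_code \<rho> \<Omega>)"
      using Q[OF \<phi>(2), of \<phi> y] by (simp add: Let_def N_def \<rho>_def \<Omega>_def)
    have bN: "b \<le> N" using le_prod_encode_1[of "b + length fs" "b + length fs"] fs(3) by simp
    have N0: "N > 0" using fs(3) by simp
    have sigs: "functional_signature \<rho>" "sub_signature \<sigma> \<rho>"
      using N0 bN b unfolding functional_signature_def sub_signature_def \<rho>_def f_id_def by fastforce+
    note cl = clauses_props[OF \<phi>(2) N0]
    have same: "same fs (set xs) \<kappa> \<gamma> \<G> \<beta>"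
      if "\<omega> \<in> set \<Omega>" "sat (expand b fs \<kappa>) \<gamma> \<omega>" "sat (expand b fs \<G>) \<beta> \<omega>" for \<omega> \<kappa> \<gamma> \<G> \<beta>
      using clause_same[OF b fs(3) that[unfolded \<Omega>_def]] .
    have "\<exists>c k. \<forall>\<omega>\<in>set \<Omega>. (\<forall>x\<in>set xs. c \<omega> x \<in> pw S) \<and>
      (\<forall>x\<in>set xs. \<forall>\<G>\<in>insts. \<forall>v\<in>vs \<G>. \<bar>c \<omega> x \<G> v\<bar> \<le> int (k * sz \<G>)) \<and>
      (\<forall>\<G>\<in>insts. \<forall>\<beta>. \<beta> ` set xs \<subseteq> vs \<G> --> sat (expand b fs \<G>) \<beta> \<omega> -->
        int (card {v \<in> vs \<G>. sat (fst \<G>) (\<beta>(y := v)) \<phi>}) = (\<Sum>x\<in>set xs. c \<omega> x \<G> (\<beta> x)))"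
      by (rule clause_coefficients[OF fs(6) same]) (assumption | rule finite_set)+
    then obtain c k where ck: "\<And>\<omega> x. \<omega> \<in> set \<Omega> ==> x \<in> set xs ==> c \<omega> x \<in> pw S"
      "\<And>\<omega> x \<G> v. \<omega> \<in> set \<Omega> ==> x \<in> set xs ==> \<G> \<in> insts ==> v \<in> vs \<G> ==> \<bar>c \<omega> x \<G> v\<bar> \<le> int (k * sz \<G>)"
      "\<And>\<omega> \<G> \<beta>. \<omega> \<in> set \<Omega> ==> \<G> \<in> insts ==> \<beta> ` set xs \<subseteq> vs \<G> ==> sat (expand b fs \<G>) \<beta> \<omega> ==>
        int (card {v \<in> vs \<G>. sat (fst \<G>) (\<beta>(y := v)) \<phi>}) = (\<Sum>x\<in>set xs. c \<omega> x \<G> (\<beta> x))"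
      by (elim exE) (erule meta_mp[rotated], blast)
    define pt where "pt p = (\<lambda>\<G> v. of_bool (v \<in> pint (expand b fs \<G>) p) :: int)" for p
    \<comment> \<open>The order in which \<open>struc_tables\<close> lists the symbols of \<rho>,
      followed by the coefficients.\<close>
    define os :: "'v table list" where "os = map (\<lambda>i. enc (symbol b fs i)) [0..<N] @ map pt [0..<N] @
      concat (map (\<lambda>\<omega>. map (\<lambda>i. c \<omega> (xs ! i)) [0..<length xs]) \<Omega>)"
    have vf: "vfun f" if "f \<in> set fs" for f using fs(1) that by (simp add: fam_def)
    have os: "t \<in> pw S \<and> (\<forall>\<G>\<in>insts. \<forall>v\<in>vs \<G>. \<bar>t \<G> v\<bar> \<le> int (Suc k * sz \<G>))" if "t \<in> set os" for t
    proof -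
      consider i where "t = enc (symbol b fs i)" | p where "t = pt p" | \<omega> i where "\<omega> \<in> set \<Omega>" "i < length xs" "t = c \<omega> (xs ! i)"
        using \<open>t \<in> set os\<close> unfolding os_def by auto
      then show ?thesis
      proof cases
        case 1
        have s: "symbol b fs i \<in> set fs" by (rule symbol_in[OF fs(2)])
        then have "t \<in> pw S" using fs(5) unfolding 1 by (intro pw.tab) blast
        moreover have "\<bar>t \<G> v\<bar> \<le> int (Suc k * sz \<G>)" if "\<G> \<in> insts" "v \<in> vs \<G>" for \<G> v
        proof -
          have "int (1 * sz \<G>) \<le> int (Suc k * sz \<G>)" unfolding of_nat_le_iff by (rule mult_le_mono1) simp
          with vfun_bound[OF vf[OF s] that] show ?thesis unfolding 1 by (rule order_trans)
        qed
        ultimately show ?thesis by blast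
      next
        case 2
        have "t \<in> pw S"
        proof (cases "p \<in> psig \<sigma>")
          case True
          then have "ptab p \<in> pw S" using fs(5) unfolding PT_def by (intro pw.tab) blast
          then show ?thesis using True unfolding 2 pt_def by (simp add: expand_def ptab_def)
        next
          case False then show ?thesis using pw.const[of 0] unfolding 2 pt_def by (simp add: expand_def)
        qed
        moreover have "\<bar>t \<G> v\<bar> \<le> int (Suc k * sz \<G>)" if "\<G> \<in> insts" for \<G> v
        proof -
          have "1 \<le> Suc k * sz \<G>" using insts(3)[OF that] by simp
          then have "1 \<le> int (Suc k * sz \<G>)" by linarith
          moreover have "\<bar>t \<G> v\<bar> \<le> 1" unfolding 2 pt_def by simp
          ultimately show ?thesis by linarith
        qed
        ultimately show ?thesis by blast
      next
        case 3
        have x: "xs ! i \<in> set xs" using 3(2) by simp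
        have "\<bar>t \<G> v\<bar> \<le> int (Suc k * sz \<G>)" if "\<G> \<in> insts" "v \<in> vs \<G>" for \<G> v
          using ck(2)[OF 3(1) x that] unfolding 3(3) by simp
        then show ?thesis using ck(1)[OF 3(1) x] 3(3) by simp
      qed
    qed
    from lin_output[OF fs(4) os] obtain P c0 where P: "\<And>\<G>. \<G> \<in> insts ==>
      computes_tables P (c0 * sz \<G>) (c0 * sz \<G>) (vs \<G>) (ix \<G>) (struc_tables \<sigma> (ix \<G>) (fst \<G>)) (map (\<lambda>t. t \<G>) os)" by blast
    \<comment> \<open>K is at once the factor of the time bound, factor and exponent of the word
      bound, and factor of the bound on coefficients; the successor makes the exponent
      positive.\<close>
    define K where "K = Suc (c0 + k)"
    let ?C = "expand b fs ` insts"
    have main: "\<exists>G' (c :: form => nat => 'v => int).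
            G' \<in> ?C \<and> expansion_of \<sigma> G G' \<and>
            computes_tables P (K * struc_size \<sigma> G) (K * struc_size \<sigma> G ^ K) (univ G) e
              (struc_tables \<sigma> e G)
              (struc_tables \<rho> e G' @ concat (map (\<lambda>\<omega>. map (c \<omega>) [0..<length xs]) \<Omega>)) \<and>
            (\<forall>\<omega>\<in>set \<Omega>. \<forall>i<length xs. \<forall>v\<in>univ G. \<bar>c \<omega> i v\<bar> \<le> int (K * card (univ G))) \<and>
            (\<forall>us. length us = length xs \<and> set us \<subseteq> univ G -->
              (\<exists>!\<omega>. \<omega> \<in> set \<Omega> \<and> sat G' (assign xs us) \<omega>) \<and>
              (\<forall>\<omega>\<in>set \<Omega>. sat G' (assign xs us) \<omega> -->
                int (count G \<phi> y xs us) = (\<Sum>i<length xs. c \<omega> i (us ! i))))"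
      (is "?out P K G e") if G: "G \<in> \<C>" "bij_betw e (univ G) {..<card (univ G)}" for G e
    proof -
      define \<G> where "\<G> = (G, e)"
      have \<G>: "\<G> \<in> insts" using G by (simp add: \<G>_def insts_def)
      have sim: "fst \<G> = G" "snd \<G> = e" by (simp_all add: \<G>_def)
      define c' where "c' = (\<lambda>\<omega> i. c \<omega> (xs ! i) \<G>)"
      have n: "card (univ G) > 0" using insts(3)[OF \<G>] by (simp add: sim)
      have "sig_size \<sigma> > 0" using fsig_props by (auto simp: sig_size_def card_gt_0_iff)
      then have sn: "card (univ G) \<le> struc_size \<sigma> G" by (simp add: struc_size_def)
      have K: "c0 * card (univ G) \<le> K * struc_size \<sigma> G" unfolding K_def using sn by (intro mult_le_mono) auto
      have "struc_size \<sigma> G ^ 1 \<le> struc_size \<sigma> G ^ K" using n sn by (intro power_increasing) (auto simp: K_def)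
      then have "card (univ G) \<le> struc_size \<sigma> G ^ K" using sn by simp
      then have K': "c0 * card (univ G) \<le> K * struc_size \<sigma> G ^ K" by (intro mult_le_mono) (simp add: K_def)
      have out: "map (\<lambda>t. t \<G>) os = struc_tables \<rho> e (expand b fs \<G>) @ concat (map (\<lambda>\<omega>. map (c' \<omega>) [0..<length xs]) \<Omega>)"
      proof -
        have "struc_tables \<rho> e (expand b fs \<G>) = map (\<lambda>i. enc (symbol b fs i) \<G>) [0..<N] @ map (\<lambda>p. pt p \<G>) [0..<N]"
          by (simp add: struc_tables_def \<rho>_def enc_def pt_def sim fun_eq_iff) (simp add: expand_def)
        moreover have "map (\<lambda>t. t \<G>) (concat (map (\<lambda>\<omega>. map (\<lambda>i. c \<omega> (xs ! i)) [0..<length xs]) \<Omega>)) =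
            concat (map (\<lambda>\<omega>. map (c' \<omega>) [0..<length xs]) \<Omega>)"
          by (simp add: map_concat o_def c'_def)
        ultimately show ?thesis unfolding os_def by (simp add: o_def)
      qed
      have "computes_tables P (c0 * card (univ G)) (c0 * card (univ G)) (univ G) e (struc_tables \<sigma> e G)
        (struc_tables \<rho> e (expand b fs \<G>) @ concat (map (\<lambda>\<omega>. map (c' \<omega>) [0..<length xs]) \<Omega>))"
        using P[OF \<G>] unfolding out unfolding sim .
      then have t: "computes_tables P (K * struc_size \<sigma> G) (K * struc_size \<sigma> G ^ K) (univ G) e (struc_tables \<sigma> e G)
        (struc_tables \<rho> e (expand b fs \<G>) @ concat (map (\<lambda>\<omega>. map (c' \<omega>) [0..<length xs]) \<Omega>))"
        using K K' by (rule computes_tables_mono)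
      have ex: "expansion_of \<sigma> G (expand b fs \<G>)"
        by (simp add: expansion_of_def expand_def symbol_def sim)
      have bd: "\<bar>c' \<omega> i v\<bar> \<le> int (K * card (univ G))" if "\<omega> \<in> set \<Omega>" "i < length xs" "v \<in> univ G" for \<omega> i v
      proof -
        have "\<bar>c' \<omega> i v\<bar> \<le> int (k * card (univ G))" using ck(2)[OF that(1) nth_mem[OF that(2)] \<G>, of v] that(3) by (simp add: c'_def sim)
        moreover have "k * card (univ G) \<le> K * card (univ G)" by (intro mult_le_mono1) (simp add: K_def)
        then have "int (k * card (univ G)) \<le> int (K * card (univ G))" by (simp only: of_nat_le_iff)
        ultimately show ?thesis by (rule order_trans)
      qed
      have cnt: "int (count G \<phi> y xs us) = (\<Sum>i<length xs. c' \<omega> i (us ! i))"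
        if us: "length us = length xs" "set us \<subseteq> univ G" and \<omega>: "\<omega> \<in> set \<Omega>" "sat (expand b fs \<G>) (assign xs us) \<omega>" for us \<omega>
      proof -
        have nth: "assign xs us (xs ! i) = us ! i" if "i < length xs" for i
          using that us(1) \<phi>(3) by (simp add: assign_def map_of_zip_nth)
        have im: "assign xs us ` set xs \<subseteq> vs \<G>"
        proof
          fix v assume "v \<in> assign xs us ` set xs"
          then obtain i where "i < length xs" "v = assign xs us (xs ! i)" by (auto simp: in_set_conv_nth)
          then have "v = us ! i" "i < length us" using nth us(1) by auto
          then show "v \<in> vs \<G>" using us(2) nth_mem by (auto simp: sim)
        qed
        have "assign (y # xs) (v # us) = (assign xs us)(y := v)" for v
          by (simp add: assign_def fun_eq_iff)
        then have "int (count G \<phi> y xs us) = int (card {v \<in> vs \<G>. sat (fst \<G>) ((assign xs us)(y := v)) \<phi>})"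
          by (simp add: count_def sim)
        also have "\<dots> = (\<Sum>x\<in>set xs. c \<omega> x \<G> (assign xs us x))" by (rule ck(3)[OF \<omega>(1) \<G> im \<omega>(2)])
        also have "\<dots> = (\<Sum>i<length xs. c \<omega> (xs ! i) \<G> (assign xs us (xs ! i)))"
          by (rule sum.reindex_bij_betw[symmetric]) (use \<phi>(3) in \<open>auto intro: bij_betw_nth\<close>)
        also have "\<dots> = (\<Sum>i<length xs. c' \<omega> i (us ! i))" unfolding c'_def using nth by (intro sum.cong) auto
        finally show ?thesis .
      qed
      show ?thesis
      proof (rule exI[of _ "expand b fs \<G>"], rule exI[of _ c'], intro conjI ballI allI impI)
        show "expand b fs \<G> \<in> ?C" using \<G> by (rule imageI)
        show "\<exists>!\<omega>. \<omega> \<in> set \<Omega> \<and> sat (expand b fs \<G>) (assign xs us) \<omega>" for us unfolding \<Omega>_def by (rule cl(3))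
        show "\<bar>c' \<omega> i v\<bar> \<le> int (K * card (univ G))" if "\<omega> \<in> set \<Omega>" "i < length xs" "v \<in> univ G" for \<omega> i v
          using that by (rule bd)
        show "int (count G \<phi> y xs us) = (\<Sum>i<length xs. c' \<omega> i (us ! i))"
          if "length us = length xs \<and> set us \<subseteq> univ G" "\<omega> \<in> set \<Omega>" "sat (expand b fs \<G>) (assign xs us) \<omega>" for us \<omega>
          using that(1) by (intro cnt[OF _ _ that(2,3)]) auto
      qed (fact ex t)+
    qed
    have C: "?C \<subseteq> Fun \<rho>" using expand_Fun[OF fs(1,2)] by blast
    have B: "bounded_expansion (underlying \<rho> ` ?C)" by (rule expand_sparse[OF fs(1,2)])
    have cls: "\<forall>\<omega>\<in>set \<Omega>. conjunctive_clause \<omega> \<and> has_signature \<rho> \<omega> \<and> free_vars \<omega> \<subseteq> set xs"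
      using cl(2) unfolding \<Omega>_def \<rho>_def by blast
    have dist: "distinct \<Omega>" unfolding \<Omega>_def by (rule cl(1))
    have "\<exists>P K. \<forall>G\<in>\<C>. \<forall>e. bij_betw e (univ G) {..<card (univ G)} --> ?out P K G e"
      by (rule exI[of _ P], rule exI[of _ K], intro ballI allI impI) (rule main)
    then show "?R Q \<phi> y xs"
      by (intro exI[of _ \<rho>] exI[of _ \<Omega>] conjI comp sigs dist cls exI[of _ ?C] C B)
  qed
qed

end
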